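(* Let $X_1,\dots,X_n$ be a piecewise locally stationary process with $E[X_j]=0$ and $\|X_j\|_2<\infty$ for all $j$, with local autocovariances $\gamma(t,h)$ and local spectral density $f(t,\lambda)$ as in the context. Let $\lambda=\lambda_n$ be a sequence of frequencies. Let $K$ be an even, continuously differentiable probability density function with support $[-1,1]$, and let $$I_n(\lambda)=\frac1{2\pi n}\Big|\sum_{j=1}^nX_j\exp(ij\lambda)\Big|^2,\qquad \tilde f_n(\lambda)=\int_{-m}^m\frac1mK\Big(\frac um\Big)I_n\Big(\lambda+\frac{2\pi u}n\Big)\,du .$$ Assume that for some $p\ge1$, $\gamma(t,h)$ is $\mathcal C^p$ in $t$ on $(d_k,d_{k+1}]$ for every $h$ and $k=0,\dots,r$; that $\delta_X(k,4)=O(\rho^k)$ for some $\rho\in[0,1)$; that $\|G_k(t,\mathcal F_0)-G_k(s,\mathcal F_0)\|_4\le C|t-s|$ for all $t,s\in[d_k,d_{k+1}]$, $k=0,\dots,r$, for some $C<\infty$; that $\inf_{t\in[0,1]}f(t,\lambda)>0$; and that $m=m_n\to\infty$ with $m/(n^{p/[4(p+2)]}(\log n)^2)\to0$. (i) If $0<\lambda_*\le\lambda\le\lambda^*<\pi$ for some constants $\lambda_*,\lambda^*$, then $$\sqrt m\,\big(\tilde f_n(\lambda)-E\tilde f_n(\lambda)\big)\Rightarrow N\Big(0,\int_{-1}^1[K(t)]^2\,dt\int_0^1f^2(t,\lambda)\,dt\Big).$$ (ii) If $\lambda=0$ or $\lambda=\pi$, then $$\sqrt m\,\big(\tilde f_n(\lambda)-E\tilde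 f_n(\lambda)\big)\Rightarrow N\Big(0,2\int_{-1}^1[K(t)]^2\,dt\int_0^1f^2(t,\lambda)\,dt\Big).$$
   Context: Notation: $t_k=k/n$; $\|Y\|_p=(E|Y|^p)^{1/p}$; $i=\sqrt{-1}$; $\Rightarrow$ denotes weak convergence as $n\to\infty$. Piecewise locally stationary model: there are an integer $r\ge0$ and nonrandom points $0=d_0<d_1<\dots<d_r<d_{r+1}=1$ such that $$X_k=\sum_{j=0}^rG_j(t_k,\mathcal F_k)\mathbf 1\{d_j<t_k\le d_{j+1}\},\qquad k=1,\dots,n,$$ where $\mathcal F_k=(\dots,\varepsilon_{k-1},\varepsilon_k)$, $(\varepsilon_k)_{k\in\mathbb Z}$ are i.i.d. random variables and $G_j$ are measurable real functions of $(t,\mathcal F)$, $t\in(d_j,d_{j+1}]$, understood to be defined also at $t=d_j$ when closed intervals are used. Dependence measures: $\delta_X(k,p)=\max_{0\le l\le r}\sup_{t\in(d_l,d_{l+1}]}\|G_l(t,\mathcal F_0)-G_l(t,\mathcal F_{0,-k})\|_p$, where $\mathcal F_{0,-k}$ is $\mathcal F_0$ with $\varepsilon_{-k}$ replaced by $\varepsilon'_{-k}$, and $(\varepsilon'_j)$ is an independent i.i.d. copy of $(\varepsilon_j)$. Local spectral density: $\zeta(t)=k$ if $d_k<t\le d_{k+1}$ and $\zeta(0)=0$; $\gamma(t,k)=\operatorname{Cov}[G_{\zeta(t)}(t,\mathcal F_0),G_{\zeta(t)}(t,\mathcal F_k)]$; $f(t,\lambda)=\frac1{2\pi}\sum_{k=-\infty}^\infty\gamma(t,k)\cos(k\lambda)$.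 *)

theory Defs
  imports "HOL-Probability.Probability"
begin

text \<open>
  The norm is extended-real valued, so that a bound on it includes the existence of the
  \<open>p\<close>-th absolute moment.
\<close>

definition Lnorm :: "'a measure \<Rightarrow> real \<Rightarrow> ('a \<Rightarrow> real) \<Rightarrow> ennreal" where
  "Lnorm M p Y =
     (let I = (\<integral>\<^sup>+ \<omega>. ennreal (\<bar>Y \<omega>\<bar> powr p) \<partial>M)
      in if I = \<infinity> then \<infinity> else ennreal (enn2real I powr (1 / p)))"

definition Cov :: "'a measure \<Rightarrow> ('a \<Rightarrow> real) \<Rightarrow> ('a \<Rightarrow> real) \<Rightarrow> real" where
  "Cov M Y Z =
     (\<integral>\<omega>. (Y \<omega> - (\<integral>\<omega>'. Y \<omega>' \<partial>M)) * (Z \<omega> - (\<integral>\<omega>'. Z \<omega>' \<partial>M)) \<partial>M)"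

text \<open>
  The past \<open>(\<dots>, \<epsilon>\<^sub>k\<^sub>-\<^sub>1, \<epsilon>\<^sub>k)\<close> is a sequence indexed by the lag: entry \<open>i\<close> is \<open>\<epsilon>\<^sub>k\<^sub>-\<^sub>i\<close>. Hence replacing
  the innovation at time \<open>-k\<close> in the past at time \<open>0\<close> updates entry \<open>k\<close>.
\<close>

definition past :: "(int \<Rightarrow> 'a \<Rightarrow> real) \<Rightarrow> int \<Rightarrow> 'a \<Rightarrow> nat \<Rightarrow> real" where
  "past \<epsilon> k \<omega> = (\<lambda>i. \<epsilon> (k - int i) \<omega>)"

definition coupled_past ::
    "(int \<Rightarrow> 'a \<Rightarrow> real) \<Rightarrow> (int \<Rightarrow> 'a \<Rightarrow> real) \<Rightarrow> nat \<Rightarrow> 'a \<Rightarrow> nat \<Rightarrow> real" where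
  "coupled_past \<epsilon> \<epsilon>' k \<omega> = (past \<epsilon> 0 \<omega>)(k := \<epsilon>' (- int k) \<omega>)"

text \<open>
  The innovations \<open>\<epsilon>\<close> and their independent copy \<open>\<epsilon>'\<close> together form one i.i.d. family, indexed by
  two copies of the integers. Each \<open>G\<^sub>j\<close> is jointly measurable on \<open>[d\<^sub>j, d\<^sub>j\<^sub>+\<^sub>1]\<close>.
\<close>

locale piecewise_stationary_model = prob_space M
  for M :: "'a measure" +
  fixes \<epsilon> \<epsilon>' :: "int \<Rightarrow> 'a \<Rightarrow> real"
    and r :: nat
    and d :: "nat \<Rightarrow> real"
    and G :: "nat \<Rightarrow> real \<Rightarrow> (nat \<Rightarrow> real) \<Rightarrow> real"
  assumes indep: "indep_vars (\<lambda>_. borel) (case_sum \<epsilon> \<epsilon>') UNIV"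
    and ident: "\<And>k. distr M borel (\<epsilon> k) = distr M borel (\<epsilon> 0)"
    and ident_copy: "\<And>k. distr M borel (\<epsilon>' k) = distr M borel (\<epsilon> 0)"
    and d_0: "d 0 = 0"
    and d_end: "d (Suc r) = 1"
    and d_less: "\<And>j. j \<le> r \<Longrightarrow> d j < d (Suc j)"
    and G_measurable: "\<And>j. j \<le> r \<Longrightarrow>
          (\<lambda>(t, x). G j t x) \<in> borel_measurable
            (restrict_space borel {d j..d (Suc j)} \<Otimes>\<^sub>M (\<Pi>\<^sub>M i\<in>UNIV. borel))"

definition pls_process ::
    "(int \<Rightarrow> 'a \<Rightarrow> real) \<Rightarrow> nat \<Rightarrow> (nat \<Rightarrow> real) \<Rightarrow> (nat \<Rightarrow> real \<Rightarrow> (nat \<Rightarrow> real) \<Rightarrow> real)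
      \<Rightarrow> nat \<Rightarrow> nat \<Rightarrow> 'a \<Rightarrow> real" where
  "pls_process \<epsilon> r d G n k \<omega> =
     (\<Sum>j\<le>r. G j (real k / real n) (past \<epsilon> (int k) \<omega>)
              * indicator {d j<..d (Suc j)} (real k / real n))"

definition dep_measure ::
    "'a measure \<Rightarrow> (int \<Rightarrow> 'a \<Rightarrow> real) \<Rightarrow> (int \<Rightarrow> 'a \<Rightarrow> real) \<Rightarrow> nat \<Rightarrow> (nat \<Rightarrow> real)
      \<Rightarrow> (nat \<Rightarrow> real \<Rightarrow> (nat \<Rightarrow> real) \<Rightarrow> real) \<Rightarrow> nat \<Rightarrow> real \<Rightarrow> ennreal" where
  "dep_measure M \<epsilon> \<epsilon>' r d G k p =
     (MAX l\<in>{..r}. SUP t\<in>{d l<..d (Suc l)}.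
        Lnorm M p (\<lambda>\<omega>. G l t (past \<epsilon> 0 \<omega>) - G l t (coupled_past \<epsilon> \<epsilon>' k \<omega>)))"

definition segment :: "nat \<Rightarrow> (nat \<Rightarrow> real) \<Rightarrow> real \<Rightarrow> nat" where
  "segment r d t = (if t = 0 then 0 else (THE k. k \<le> r \<and> d k < t \<and> t \<le> d (Suc k)))"

definition local_acov ::
    "'a measure \<Rightarrow> (int \<Rightarrow> 'a \<Rightarrow> real) \<Rightarrow> nat \<Rightarrow> (nat \<Rightarrow> real)
      \<Rightarrow> (nat \<Rightarrow> real \<Rightarrow> (nat \<Rightarrow> real) \<Rightarrow> real) \<Rightarrow> real \<Rightarrow> int \<Rightarrow> real" where
  "local_acov M \<epsilon> r d G t h =
     Cov M (\<lambda>\<omega>. G (segment r d t) t (past \<epsilon> 0 \<omega>)) (\<lambda>\<omega>. G (segment r d t) t (past \<epsilon> h \<omega>))"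

definition local_spectral_density ::
    "'a measure \<Rightarrow> (int \<Rightarrow> 'a \<Rightarrow> real) \<Rightarrow> nat \<Rightarrow> (nat \<Rightarrow> real)
      \<Rightarrow> (nat \<Rightarrow> real \<Rightarrow> (nat \<Rightarrow> real) \<Rightarrow> real) \<Rightarrow> real \<Rightarrow> real \<Rightarrow> real" where
  "local_spectral_density M \<epsilon> r d G t \<theta> =
     1 / (2 * pi) * (\<Sum>\<^sub>\<infinity>h\<in>UNIV. local_acov M \<epsilon> r d G t h * cos (real_of_int h * \<theta>))"

text \<open>One-sided derivatives are used at the endpoints that belong to \<open>S\<close>.\<close>

definition Ck_on :: "nat \<Rightarrow> real set \<Rightarrow> (real \<Rightarrow> real) \<Rightarrow> bool" where
  "Ck_on p S g \<longleftrightarrow>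
     (\<exists>D. (\<forall>t\<in>S. D 0 t = g t)
        \<and> (\<forall>i<p. \<forall>t\<in>S. (D i has_real_derivative D (Suc i) t) (at t within S))
        \<and> continuous_on S (D p))"

definition periodogram :: "(nat \<Rightarrow> nat \<Rightarrow> 'a \<Rightarrow> real) \<Rightarrow> nat \<Rightarrow> real \<Rightarrow> 'a \<Rightarrow> real" where
  "periodogram X n \<theta> \<omega> =
     1 / (2 * pi * real n)
       * (cmod (\<Sum>j=1..n. complex_of_real (X n j \<omega>) * exp (\<i> * complex_of_real (real j * \<theta>))))\<^sup>2"

definition smoothed_periodogram ::
    "(nat \<Rightarrow> nat \<Rightarrow> 'a \<Rightarrow> real) \<Rightarrow> (real \<Rightarrow> real) \<Rightarrow> nat \<Rightarrow> real \<Rightarrow> real \<Rightarrow> 'a \<Rightarrow> real" where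
  "smoothed_periodogram X K n m \<theta> \<omega> =
     (LBINT u:{-m..m}. 1 / m * K (u / m) * periodogram X n (\<theta> + 2 * pi * u / real n) \<omega>)"

definition normal_law :: "real \<Rightarrow> real \<Rightarrow> real measure" where
  "normal_law \<mu> v = density lborel (normal_density \<mu> (sqrt v))"

text \<open>
  Weak approximation of a sequence of laws by a sequence of laws that may itself vary with \<open>n\<close>:
  integrals of bounded continuous test functions differ by \<open>o(1)\<close>. It gives a meaning to
  \<open>\<mu>\<^sub>n \<Rightarrow> \<nu>\<^sub>n\<close> when the limit law depends on \<open>n\<close>, and it is ordinary weak convergence when \<open>\<nu>\<^sub>n\<close> is
  constant.
\<close>

definition weakly_merging :: "(nat \<Rightarrow> real measure) \<Rightarrow> (nat \<Rightarrow> real measure) \<Rightarrow> bool" where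
  "weakly_merging \<mu> \<nu> \<longleftrightarrow>
     (\<forall>g :: real \<Rightarrow> real. continuous_on UNIV g \<and> bounded (range g) \<longrightarrow>
        (\<lambda>n. (\<integral>x. g x \<partial>\<mu> n) - (\<integral>x. g x \<partial>\<nu> n)) \<longlonglongrightarrow> 0)"

lemma weakly_merging_const_iff:
  assumes "\<And>n. real_distribution (\<mu> n)" and "real_distribution N"
  shows "weakly_merging \<mu> (\<lambda>_. N) \<longleftrightarrow> weak_conv_m \<mu> N"
proof
  assume merge: "weakly_merging \<mu> (\<lambda>_. N)"
  show "weak_conv_m \<mu> N"
  proof (rule integral_bdd_continuous_conv_imp_weak_conv[OF assms])
    fix f :: "real \<Rightarrow> real"
    assume cont: "\<And>x. isCont f x" and bdd: "\<And>x. \<bar>f x\<bar> \<le> 1"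
    have "continuous_on UNIV f"
      using cont by (simp add: continuous_on_eq_continuous_at)
    moreover have "bounded (range f)"
      using bdd by (auto simp: bounded_iff)
    ultimately have "(\<lambda>n. (\<integral>x. f x \<partial>\<mu> n) - (\<integral>x. f x \<partial>N)) \<longlonglongrightarrow> 0"
      using merge by (simp add: weakly_merging_def)
    then show "(\<lambda>n. integral\<^sup>L (\<mu> n) f) \<longlonglongrightarrow> integral\<^sup>L N f"
      by (rule LIM_zero_cancel)
  qed
next
  assume conv: "weak_conv_m \<mu> N"
  show "weakly_merging \<mu> (\<lambda>_. N)"
    unfolding weakly_merging_def
  proof (intro allI impI)
    fix g :: "real \<Rightarrow> real"
    assume g: "continuous_on UNIV g \<and> bounded (range g)"
    then obtain B where B: "\<And>x. norm (g x) \<le> B"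
      by (auto simp: bounded_iff)
    have cont: "\<And>x. isCont g x"
      using g by (simp add: continuous_on_eq_continuous_at)
    have "(\<lambda>n. integral\<^sup>L (\<mu> n) g) \<longlonglongrightarrow> integral\<^sup>L N g"
      by (rule weak_conv_imp_integral_bdd_continuous_conv[OF assms conv cont B])
    then show "(\<lambda>n. (\<integral>x. g x \<partial>\<mu> n) - (\<integral>x. g x \<partial>N)) \<longlonglongrightarrow> 0"
      by (rule LIM_zero)
  qed
qed

end

theory Submission
  imports Defs "HOL-Real_Asymp.Real_Asymp"
begin

text \<open>
  After the substitution \<open>u = m v\<close> the normalised estimate \<open>sqrt m (F - E F)\<close> is a centred quadratic form
  \<open>sum a(j,k) (X\<^sub>j X\<^sub>k - E X\<^sub>j X\<^sub>k)\<close> with \<open>a(j,k) = s Khat(\<delta> (j-k)) cos((j-k) \<theta>)\<close>, where \<open>Khat\<close> is the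
  Fourier transform of the kernel, \<open>s = sqrt m/(2 pi n)\<close> and \<open>\<delta> = 2 pi m/n\<close>. The Hilbert-Schmidt norm of
  the matrix \<open>a\<close> stays of order one while its operator norm is of order \<open>1/sqrt m\<close>; such forms are
  asymptotically normal, and the proof makes this quantitative through the characteristic function.

  Replacing \<open>X\<^sub>j\<close> by its conditional expectation given the last \<open>L\<close> innovations costs \<open>O(\<rho> ^ L)\<close> in fourth
  mean, because the coupling coefficients decay geometrically. The new array is \<open>L\<close>-dependent, and the
  coefficients within distance \<open>5 L\<close> of the diagonal carry a negligible variance. For the remaining
  form \<open>T\<close> a leave-out argument in the manner of Stein (\<open>leave_out_step\<close>, \<open>stein_identity\<close>) shows that
  the characteristic function almost satisfies \<open>\<phi>'(s) = -2 \<tau> s \<phi>(s)\<close>, where \<open>\<tau>\<close> is the trace of the square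
  of coefficient matrix times covariance matrix; hence \<open>\<phi>(s)\<close> is close to \<open>exp(-\<tau> s ^ 2)\<close>
  (\<open>characteristic_function_bound\<close>).

  To evaluate \<open>\<tau>\<close>, note that the covariance matrix acts locally on oscillations of frequency \<open>\<theta>\<close> as
  multiplication by \<open>2 pi f(t,\<theta>)\<close> (\<open>symbol_calculus\<close>). So \<open>\<tau>\<close> is close to a Riemann sum for the integral of
  \<open>f(t,\<theta>) ^ 2\<close> times \<open>n sum (s Khat(\<delta> l) cos(l \<theta>)) ^ 2\<close>, which by Plancherel tends to a multiple of the
  integral of \<open>K ^ 2\<close>. The factor \<open>cos ^ 2\<close> averages to one half at interior frequencies and equals one at
  \<open>0\<close> and \<open>pi\<close>: this is the factor two between the two cases. Since the variance may vary with \<open>n\<close>, Levy's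
  theorem is applied along subsequences.
\<close>

section \<open>Functions of disjoint blocks of independent noise\<close>


text \<open>Blocks of innovations with disjoint index sets are independent; all factorisations of moments below rest on this.\<close>

locale indep_noise = prob_space M
 for M :: "'a measure" +
 fixes \<epsilon> :: "int => 'a => real"
 assumes indep_noise: "indep_vars (\<lambda>_. borel) \<epsilon> UNIV"
begin

definition noise_field :: "int set => 'a measure" where
 "noise_field I = vimage_algebra (space M) (\<lambda>om. \<lambda>i\<in>I. \<epsilon> i om) (PiM I (\<lambda>_. borel))"

lemma noise_measurable [measurable]: "\<epsilon> i \<in> borel_measurable M"
 using indep_noise by (auto simp: indep_vars_def)

lemma space_noise_field [simp]: "space (noise_field I) = space M"
 by (simp add: noise_field_def)

lemma sets_noise_field:
 "sets (noise_field I) =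
  {(\<lambda>om. \<lambda>i\<in>I. \<epsilon> i om) -` A \<inter> space M | A. A \<in> sets (PiM I (\<lambda>_. borel))}"
 unfolding noise_field_def by (rule sets_vimage_algebra2) (auto simp: space_PiM)

lemma measurable_noise_field_component:
 assumes "i \<in> I"
 shows "\<epsilon> i \<in> borel_measurable (noise_field I)"
proof -
 have "(\<lambda>x. x i) \<circ> (\<lambda>om. \<lambda>i\<in>I. \<epsilon> i om) \<in> borel_measurable (noise_field I)"
  unfolding noise_field_def
  by (rule measurable_comp[OF measurable_vimage_algebra1])
   (use assms in \<open>auto simp: space_PiM intro: measurable_component_singleton\<close>)
 also have "(\<lambda>x. x i) \<circ> (\<lambda>om. \<lambda>i\<in>I. \<epsilon> i om) = \<epsilon> i"
  using assms by auto
 finally show ?thesis .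
qed

lemma noise_field_mono:
 assumes "I \<subseteq> J"
 shows "sets (noise_field I) \<subseteq> sets (noise_field J)"
proof -
 have "(\<lambda>om. \<lambda>i\<in>I. \<epsilon> i om) \<in> measurable (noise_field J) (PiM I (\<lambda>_. borel))"
  using assms by (intro measurable_restrict measurable_noise_field_component) auto
 then show ?thesis
  by (auto simp: sets_noise_field[of I] dest: measurable_sets)
qed

lemma measurable_noise_field_mono:
 "f \<in> measurable (noise_field I) N ==> I \<subseteq> J ==> f \<in> measurable (noise_field J) N"
 using noise_field_mono[of I J] by (auto simp: measurable_def)

lemma noise_field_subset_events: "sets (noise_field I) \<subseteq> sets M"
proof -
 have "(\<lambda>om. \<lambda>i\<in>I. \<epsilon> i om) \<in> measurable M (PiM I (\<lambda>_. borel))"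
  by measurable
 then show ?thesis
  by (auto simp: sets_noise_field dest: measurable_sets)
qed

lemma measurable_noise_fieldD:
 "f \<in> measurable (noise_field I) N ==> f \<in> measurable M N"
 using noise_field_subset_events[of I] by (auto simp: measurable_def)

lemma indep_var_noise_field:
 assumes f: "f \<in> borel_measurable (noise_field I)"
  and g: "g \<in> borel_measurable (noise_field J)"
  and "I \<inter> J = {}"
 shows "indep_var borel f borel g"
proof -
 let ?P = "\<lambda>I om. \<lambda>i\<in>I. \<epsilon> i om"
 have ind: "indep_var (PiM I (\<lambda>_. borel)) (?P I) (PiM J (\<lambda>_. borel)) (?P J)"
  using indep_noise assms(3) by (intro indep_var_restrict) auto
 have fi: "sigma_sets (space M) {f -` A \<inter> space M | A. A \<in> sets borel}
   \<subseteq> sigma_sets (space M) {?P I -` A \<inter> space M | A. A \<in> sets (PiM I (\<lambda>_. borel))}"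
  if "f \<in> borel_measurable (noise_field I)" for f :: "'a => 'b" and I
  using measurable_sets[OF that] by (intro sigma_sets_mono) (auto simp: sets_noise_field)
 show ?thesis
  using ind measurable_noise_fieldD[OF f] measurable_noise_fieldD[OF g] fi[OF f] fi[OF g]
  unfolding indep_var_eq indep_sets2_eq by blast
qed

lemma
 fixes f g :: "'a => 'b :: {real_normed_field, banach, second_countable_topology}"
 assumes "f \<in> borel_measurable (noise_field I)" "g \<in> borel_measurable (noise_field J)"
  and "I \<inter> J = {}" "integrable M f" "integrable M g"
 shows expectation_mult_disjoint:
   "expectation (\<lambda>om. f om * g om) = expectation f * expectation g"
  and integrable_mult_disjoint: "integrable M (\<lambda>om. f om * g om)"
 using indep_var_noise_field[OF assms(1-3)] assms(4,5)
 by (auto intro: indep_var_lebesgue_integral indep_var_integrable)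

end

section \<open>Quadratic forms in dependent arrays\<close>


text \<open>Jensen for the fourth power.\<close>

lemma power4_sum_le:
 fixes y :: "'b => real"
 shows "(\<Sum>q\<in>Q. y q) ^ 4 \<le> real (card Q) ^ 3*(\<Sum>q\<in>Q. y q ^ 4)"
proof -
 have sq: "(\<Sum>q\<in>Q. z q)^2 \<le> real (card Q)*(\<Sum>q\<in>Q. (z q)^2)" for z :: "'b => real"
  using Cauchy_Schwarz_ineq_sum[of "\<lambda>_. 1" z Q] by simp
 have "(\<Sum>q\<in>Q. y q) ^ 4 = ((\<Sum>q\<in>Q. y q)^2)^2"
  by simp
 also have "... \<le> (real (card Q)*(\<Sum>q\<in>Q. (y q)^2))^2"
  using sq by (intro power_mono) auto
 also have "... = real (card Q) ^ 2*(\<Sum>q\<in>Q. (y q)^2)^2"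
  by (simp add: power_mult_distrib)
 also have "... \<le> real (card Q) ^ 2*(real (card Q)*(\<Sum>q\<in>Q. ((y q)^2)^2))"
  by (intro mult_left_mono sq) auto
 also have "... = real (card Q) ^ 3*(\<Sum>q\<in>Q. y q ^ 4)"
  by (simp add: power2_eq_square power3_eq_cube power4_eq_xxxx mult.assoc)
 finally show ?thesis .
qed

lemma abs_mult4_le:
 fixes a b c d :: real
 shows "\<bar>a * b * c * d\<bar> \<le> (a^4+b^4+c^4+d^4)/4"
proof -
 have "\<bar>x * y\<bar> \<le> (x^2+y^2)/2" for x y :: real
  using sum_squares_ge_zero[of "\<bar>x\<bar> - \<bar>y\<bar>" 0]
  by (simp add: abs_mult power2_eq_square algebra_simps)
 note amgm = this
 have "\<bar>a * b * c * d\<bar> = \<bar>(a * b)*(c * d)\<bar>" by (simp add: mult.assoc)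
 also have "... \<le> ((a * b)^2+(c * d)^2)/2" by (rule amgm)
 also have "(a * b)^2 \<le> (a^4+b^4)/2"
  using amgm[of "a^2" "b^2"] by (simp add: power_mult_distrib)
 also have "(c * d)^2 \<le> (c^4+d^4)/2"
  using amgm[of "c^2" "d^2"] by (simp add: power_mult_distrib)
 finally show ?thesis by (simp add: field_simps)
qed

lemma abs_power_le_1_power4:
 fixes x :: real
 assumes "k \<le> 4"
 shows "\<bar>x\<bar> ^ k \<le> 1+x ^ 4"
proof (cases "\<bar>x\<bar> \<le> 1")
 case True
 then have "\<bar>x\<bar> ^ k \<le> 1" by (simp add: power_le_one)
 then show ?thesis by (smt (verit) zero_le_power_eq_numeral even_numeral)
next
 case False
 then have "\<bar>x\<bar> ^ k \<le> \<bar>x\<bar> ^ 4" using assms by (intro power_increasing) auto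
 then show ?thesis by simp
qed

context prob_space
begin

lemma integrable_power_le4:
 fixes f :: "'a => real"
 assumes [measurable]: "f \<in> borel_measurable M" and "integrable M (\<lambda>om. f om ^ 4)" "k \<le> 4"
 shows "integrable M (\<lambda>om. f om ^ k)"
proof (rule Bochner_Integration.integrable_bound)
 show "integrable M (\<lambda>om. 1+f om ^ 4)" using assms by simp
 show "AE om in M. norm (f om ^ k) \<le> norm (1+f om ^ 4)"
  using abs_power_le_1_power4[OF assms(3)] by (auto simp: power_abs)
qed measurable

lemma integrable_mult4:
 fixes a b c d :: "'a => real"
 assumes [measurable]: "a \<in> borel_measurable M" "b \<in> borel_measurable M"
   "c \<in> borel_measurable M" "d \<in> borel_measurable M"
  and "integrable M (\<lambda>om. a om ^ 4)" "integrable M (\<lambda>om. b om ^ 4)"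
   "integrable M (\<lambda>om. c om ^ 4)" "integrable M (\<lambda>om. d om ^ 4)"
 shows "integrable M (\<lambda>om. a om * b om * c om * d om)"
proof (rule Bochner_Integration.integrable_bound)
 show "integrable M (\<lambda>om. (a om^4+b om^4+c om^4+d om^4)/4)" using assms by simp
 show "AE om in M. norm (a om * b om * c om * d om) \<le> norm ((a om^4+b om^4+c om^4+d om^4)/4)"
  using abs_mult4_le by (intro AE_I2) (smt (verit) real_norm_def)
qed measurable

lemma integrable_mult_le4:
 fixes a b c :: "'a => real"
 assumes m: "a \<in> borel_measurable M" "b \<in> borel_measurable M" "c \<in> borel_measurable M"
  and i: "integrable M (\<lambda>om. a om ^ 4)" "integrable M (\<lambda>om. b om ^ 4)" "integrable M (\<lambda>om. c om ^ 4)"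
 shows "integrable M (\<lambda>om. a om * b om * c om)" and "integrable M (\<lambda>om. a om * b om)"
  and "integrable M a"
 using integrable_mult4[of a b c "\<lambda>_. 1"] integrable_mult4[of a b "\<lambda>_. 1" "\<lambda>_. 1"]
  integrable_mult4[of a "\<lambda>_. 1" "\<lambda>_. 1" "\<lambda>_. 1"] assms by simp_all

lemma abs_expectation_square_le:
 fixes f :: "'a => real"
 assumes [measurable]: "f \<in> borel_measurable M" and i: "integrable M (\<lambda>om. (f om)^2)"
 shows "integrable M f" and "(expectation (\<lambda>om. \<bar>f om\<bar>))^2 \<le> expectation (\<lambda>om. (f om)^2)"
proof -
 show "integrable M f"
  using i by (rule square_integrable_imp_integrable[rotated]) measurable
 then have "variance (\<lambda>om. \<bar>f om\<bar>) = expectation (\<lambda>om. \<bar>f om\<bar>\<^sup>2) - (expectation (\<lambda>om. \<bar>f om\<bar>))\<^sup>2"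
  using i by (intro variance_eq) auto
 moreover have "0 \<le> variance (\<lambda>om. \<bar>f om\<bar>)"
  by (intro Bochner_Integration.integral_nonneg) auto
 ultimately show "(expectation (\<lambda>om. \<bar>f om\<bar>))^2 \<le> expectation (\<lambda>om. (f om)^2)" by simp
qed

end

text \<open>The entry at time \<open>j\<close> is a function of the innovations at times \<open>j - L, ..., j\<close>. The index set is a set of integers so that windows may be written without truncated subtraction.\<close>

locale dependent_array = indep_noise M \<epsilon>
 for M :: "'a measure" and \<epsilon> +
 fixes X :: "int => 'a => real" and I :: "int set" and L :: int and D S :: real
 assumes finite_I: "finite I"
  and L_nonneg: "0 \<le> L"
  and X_window: "\<And>j. j \<in> I ==> X j \<in> borel_measurable (noise_field {j - L..j})"
  and X_mean: "\<And>j. j \<in> I ==> expectation (X j) = 0"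
  and X_power4: "\<And>j. j \<in> I ==> integrable M (\<lambda>om. X j om ^ 4)"
  and X_moment4: "\<And>j. j \<in> I ==> expectation (\<lambda>om. X j om ^ 4) \<le> D"
  and D_ge_1: "1 \<le> D"
  and row_sum: "\<And>i. i \<in> I ==> (\<Sum>j\<in>I. \<bar>expectation (\<lambda>om. X i om*X j om)\<bar>) \<le> S"
  and S_pos: "0 < S"
begin

lemma S_nonneg: "0 \<le> S"
 using S_pos by simp

definition field :: "int set => 'a measure" where
 "field J = noise_field (\<Union>j\<in>J. {j - L..j})"

definition \<sigma> :: "int => int => real" where
 "\<sigma> i j = expectation (\<lambda>om. X i om*X j om)"

lemma X_field: "j \<in> I ==> j \<in> J ==> X j \<in> borel_measurable (field J)"
 unfolding field_def by (rule measurable_noise_field_mono[OF X_window]) auto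

lemma X_measurable [measurable]: "j \<in> I ==> X j \<in> borel_measurable M"
 using X_window measurable_noise_fieldD by blast

lemma measurable_fieldD: "f \<in> measurable (field J) N ==> f \<in> measurable M N"
 unfolding field_def by (rule measurable_noise_fieldD)

lemma measurable_field_mono:
 "f \<in> measurable (field J) N ==> J \<subseteq> K ==> f \<in> measurable (field K) N"
 unfolding field_def by (rule measurable_noise_field_mono) auto

lemma
 fixes f g :: "'a => 'b :: {real_normed_field, banach, second_countable_topology}"
 assumes "f \<in> borel_measurable (field J)" "g \<in> borel_measurable (field K)"
  and far: "\<And>j k. j \<in> J ==> k \<in> K ==> L < \<bar>j - k\<bar>"
  and "integrable M f" "integrable M g"
 shows expectation_mult_far:
   "expectation (\<lambda>om. f om * g om) = expectation f * expectation g"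
  and integrable_mult_far: "integrable M (\<lambda>om. f om * g om)"
proof -
 have "(\<Union>j\<in>J. {j - L..j}) \<inter> (\<Union>j\<in>K. {j - L..j}) = {}"
  using far by (fastforce simp: abs_if split: if_splits)
 note * = assms(1,2)[unfolded field_def] this assms(4,5)
 show "expectation (\<lambda>om. f om * g om) = expectation f * expectation g"
  by (rule expectation_mult_disjoint) (fact *)+
 show "integrable M (\<lambda>om. f om * g om)"
  by (rule integrable_mult_disjoint) (fact *)+
qed

lemma
 assumes "i \<in> I"
 shows X_integrable: "integrable M (X i)"
  and X_abs_integrable: "integrable M (\<lambda>om. \<bar>X i om\<bar>)"
  and X_square_integrable: "integrable M (\<lambda>om. (X i om)^2)"
  and X_abs_le: "expectation (\<lambda>om. \<bar>X i om\<bar>) \<le> D"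
  and X_square_le: "expectation (\<lambda>om. (X i om)^2) \<le> D"
proof -
 note i = X_power4[OF assms]
 show 1: "integrable M (X i)" and 2: "integrable M (\<lambda>om. (X i om)^2)"
  using integrable_power_le4[OF _ i, of 1] integrable_power_le4[OF _ i, of 2] assms by simp_all
 then show 3: "integrable M (\<lambda>om. \<bar>X i om\<bar>)" by simp
 have "expectation (\<lambda>om. (X i om)^2) \<le> expectation (\<lambda>om. (1 + X i om ^ 4)/2)"
 proof (intro integral_mono 2)
  show "(X i om)^2 \<le> (1 + X i om ^ 4)/2" for om
   using sum_squares_ge_zero[of "(X i om)^2 - 1" 0]
   by (simp add: power2_eq_square power4_eq_xxxx algebra_simps)
 qed (use i in simp)
 also have "... \<le> D"
  using X_moment4[OF assms] D_ge_1 i by (simp add: prob_space)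
 finally show 4: "expectation (\<lambda>om. (X i om)^2) \<le> D" .
 have "expectation (\<lambda>om. \<bar>X i om\<bar>) \<le> expectation (\<lambda>om. (1+(X i om)^2)/2)"
 proof (intro integral_mono 3)
  show "\<bar>X i om\<bar> \<le> (1+(X i om)^2)/2" for om
   using sum_squares_ge_zero[of "\<bar>X i om\<bar> - 1" 0]
   by (simp add: power2_eq_square algebra_simps)
 qed (use 2 in simp)
 also have "... \<le> D"
  using 4 D_ge_1 2 by (simp add: prob_space)
 finally show "expectation (\<lambda>om. \<bar>X i om\<bar>) \<le> D" .
qed

lemma XX_integrable:
 assumes "i \<in> I" "j \<in> I"
 shows "integrable M (\<lambda>om. X i om*X j om)"
 using integrable_mult_le4(2)[of "X i" "X j" "X j"] assms X_power4 by auto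

lemma XXXX_integrable:
 assumes "i \<in> I" "j \<in> I" "k \<in> I" "l \<in> I"
 shows "integrable M (\<lambda>om. X i om*X j om*X k om*X l om)"
 using integrable_mult4[of "X i" "X j" "X k" "X l"] assms X_power4 by auto

lemma XX_square_le:
 assumes "i \<in> I" "j \<in> I"
 shows "expectation (\<lambda>om. (X i om*X j om)^2) \<le> D"
proof -
 have "expectation (\<lambda>om. (X i om*X j om)^2) \<le> expectation (\<lambda>om. (X i om^4 + X j om^4)/2)"
 proof (intro integral_mono)
  show "integrable M (\<lambda>om. (X i om*X j om)^2)"
   using XXXX_integrable[of i j i j] assms by (simp add: power2_eq_square mult.assoc)
  show "(X i om*X j om)^2 \<le> (X i om^4 + X j om^4)/2" for om
   using abs_mult4_le[of "X i om" "X i om" "X j om" "X j om"]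
   by (simp add: power2_eq_square power4_eq_xxxx algebra_simps)
 qed (use assms X_power4 in simp)
 also have "... \<le> D"
  using X_moment4[OF assms(1)] X_moment4[OF assms(2)] assms X_power4 by simp
 finally show ?thesis .
qed

lemma abs_X_X2:
 assumes "i \<in> I" "j \<in> I"
 shows "integrable M (\<lambda>om. \<bar>X i om\<bar>*(X j om)^2)" and "expectation (\<lambda>om. \<bar>X i om\<bar>*(X j om)^2) \<le> D"
proof -
 have "integrable M (\<lambda>om. \<bar>X i om*X j om*X j om\<bar>)"
  using integrable_mult_le4(1)[of "X i" "X j" "X j"] assms X_power4 by auto
 then show i: "integrable M (\<lambda>om. \<bar>X i om\<bar>*(X j om)^2)"
  by (simp add: abs_mult power2_eq_square mult.assoc)
 have "expectation (\<lambda>om. \<bar>X i om\<bar>*(X j om)^2) \<le> expectation (\<lambda>om. ((X i om)^2 + X j om^4)/2)"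
 proof (intro integral_mono i)
  show "\<bar>X i om\<bar>*(X j om)^2 \<le> ((X i om)^2 + X j om^4)/2" for om
   using sum_squares_ge_zero[of "\<bar>X i om\<bar> - (X j om)\<^sup>2" 0]
   by (simp add: power2_eq_square power4_eq_xxxx algebra_simps)
 qed (use assms X_power4 X_square_integrable in simp)
 also have "... \<le> D"
  using X_moment4[OF assms(2)] X_square_le[OF assms(1)] assms X_power4 X_square_integrable by simp
 finally show "expectation (\<lambda>om. \<bar>X i om\<bar>*(X j om)^2) \<le> D" .
qed

lemma \<sigma>_sym: "\<sigma> i j = \<sigma> j i"
 by (simp add: \<sigma>_def mult.commute)

lemma \<sigma>_far:
 assumes "i \<in> I" "j \<in> I" "L < \<bar>i - j\<bar>"
 shows "\<sigma> i j = 0"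
 unfolding \<sigma>_def
 using expectation_mult_far[of "X i" "{i}" "X j" "{j}"] assms X_field X_integrable X_mean by simp

lemma row_sum_\<sigma>: "i \<in> I ==> (\<Sum>j\<in>I. \<bar>\<sigma> i j\<bar>) \<le> S"
 using row_sum by (simp add: \<sigma>_def)

text \<open>Schur test: bounded absolute row sums bound the bilinear form.\<close>

lemma schur_bound:
 assumes "J \<subseteq> I" "K \<subseteq> I"
 shows "(\<Sum>i\<in>J. \<Sum>j\<in>K. \<bar>\<sigma> i j\<bar>*\<bar>x i\<bar>*\<bar>y j\<bar>) \<le> S*((\<Sum>i\<in>J. (x i)^2)+(\<Sum>j\<in>K. (y j)^2))/2"
proof -
 have fin: "finite J" "finite K" using assms finite_I finite_subset by auto
 have row: "(\<Sum>j\<in>K. \<bar>\<sigma> i j\<bar>) \<le> S" if "i \<in> I" "K \<subseteq> I" for i K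
 proof -
  have "(\<Sum>j\<in>K. \<bar>\<sigma> i j\<bar>) \<le> (\<Sum>j\<in>I. \<bar>\<sigma> i j\<bar>)"
   using that finite_I by (intro sum_mono2) auto
  then show ?thesis using row_sum_\<sigma>[OF that(1)] by simp
 qed
 have "(\<Sum>i\<in>J. \<Sum>j\<in>K. \<bar>\<sigma> i j\<bar>*\<bar>x i\<bar>*\<bar>y j\<bar>)
   \<le> (\<Sum>i\<in>J. \<Sum>j\<in>K. (x i)^2/2*\<bar>\<sigma> i j\<bar>+(y j)^2/2*\<bar>\<sigma> j i\<bar>)"
 proof (intro sum_mono)
  fix i j
  have "\<bar>x i\<bar>*\<bar>y j\<bar> \<le> (x i)^2/2+(y j)^2/2"
   using sum_squares_ge_zero[of "\<bar>x i\<bar> - \<bar>y j\<bar>" 0] by (simp add: power2_eq_square algebra_simps)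
  then have "\<bar>\<sigma> i j\<bar>*(\<bar>x i\<bar>*\<bar>y j\<bar>) \<le> \<bar>\<sigma> i j\<bar>*((x i)^2/2+(y j)^2/2)"
   by (intro mult_left_mono) auto
  then show "\<bar>\<sigma> i j\<bar>*\<bar>x i\<bar>*\<bar>y j\<bar> \<le> (x i)^2/2*\<bar>\<sigma> i j\<bar>+(y j)^2/2*\<bar>\<sigma> j i\<bar>"
   by (simp add: \<sigma>_sym[of j i] algebra_simps)
 qed
 also have "... = (\<Sum>i\<in>J. (x i)^2/2*(\<Sum>j\<in>K. \<bar>\<sigma> i j\<bar>))+(\<Sum>j\<in>K. (y j)^2/2*(\<Sum>i\<in>J. \<bar>\<sigma> j i\<bar>))"
  by (simp add: sum.distrib sum_distrib_left sum.swap[of _ J K])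
 also have "... \<le> (\<Sum>i\<in>J. (x i)^2/2*S)+(\<Sum>j\<in>K. (y j)^2/2*S)"
  using assms row by (intro add_mono sum_mono mult_left_mono) auto
 also have "... = S*((\<Sum>i\<in>J. (x i)^2)+(\<Sum>j\<in>K. (y j)^2))/2"
  by (simp add: sum_distrib_left sum_divide_distrib[symmetric] algebra_simps add_divide_distrib)
 finally show ?thesis .
qed

text \<open>Each factor is close to at most one factor of the other pair, so the moment factorises along one of the two Gaussian pairings and the other pairing contributes zero.\<close>

lemma expectation_four_far:
 assumes I: "k \<in> I" "k' \<in> I" "l \<in> I" "l' \<in> I"
  and far: "5*L < \<bar>k - k'\<bar>" "5*L < \<bar>l - l'\<bar>"
 shows "expectation (\<lambda>om. (X k om*X k' om)*(X l om*X l' om)) = \<sigma> k l*\<sigma> k' l'+\<sigma> k l'*\<sigma> k' l"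
proof -
 have two: "expectation (\<lambda>om. (X a om*X b om)*(X c om*X d om)) = \<sigma> a b*\<sigma> c d"
  if I: "a \<in> I" "b \<in> I" "c \<in> I" "d \<in> I"
   and far: "L < \<bar>a - c\<bar>" "L < \<bar>a - d\<bar>" "L < \<bar>b - c\<bar>" "L < \<bar>b - d\<bar>" for a b c d
  unfolding \<sigma>_def
 proof (rule expectation_mult_far[of "\<lambda>om. X a om*X b om" "{a, b}" "\<lambda>om. X c om*X d om" "{c, d}"])
  show "L < \<bar>j - k\<bar>" if "j \<in> {a, b}" "k \<in> {c, d}" for j k
   using that far by (elim insertE emptyE) simp_all
 qed (use I in \<open>auto intro!: borel_measurable_times X_field XX_integrable\<close>)
 consider "\<bar>k - l\<bar> \<le> L" | "\<bar>k - l'\<bar> \<le> L" | "L < \<bar>k - l\<bar>" "L < \<bar>k - l'\<bar>" by linarith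
 then show ?thesis
 proof cases
  case 1
  have far': "L < \<bar>k - l'\<bar>" "L < \<bar>k - k'\<bar>" "L < \<bar>l - k'\<bar>" "L < \<bar>l - l'\<bar>"
   using far 1 L_nonneg by linarith+
  have "expectation (\<lambda>om. (X k om*X l om)*(X k' om*X l' om)) = \<sigma> k l*\<sigma> k' l'"
   by (rule two) (fact I far')+
  then show ?thesis using \<sigma>_far[OF I(1,4) far'(1)] by (simp add: algebra_simps)
 next
  case 2
  have far': "L < \<bar>k - l\<bar>" "L < \<bar>k - k'\<bar>" "L < \<bar>l' - k'\<bar>" "L < \<bar>l' - l\<bar>"
   using far 2 L_nonneg by linarith+
  have "expectation (\<lambda>om. (X k om*X l' om)*(X k' om*X l om)) = \<sigma> k l'*\<sigma> k' l"
   by (rule two) (fact I far')+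
  then show ?thesis using \<sigma>_far[OF I(1,3) far'(1)] by (simp add: algebra_simps)
 next
  case 3
  have far': "L < \<bar>k - k'\<bar>" using far L_nonneg by linarith
  have "expectation (\<lambda>om. X k om*(X k' om*X l om*X l' om)) = expectation (X k) * expectation (\<lambda>om. X k' om*X l om*X l' om)"
  proof (rule expectation_mult_far[of "X k" "{k}" "\<lambda>om. X k' om*X l om*X l' om" "{k', l, l'}"])
   show "integrable M (\<lambda>om. X k' om*X l om*X l' om)"
    using I X_power4 by (intro integrable_mult_le4(1)) auto
   show "L < \<bar>i - j\<bar>" if "i \<in> {k}" "j \<in> {k', l, l'}" for i j
    using that 3 far' by (elim insertE emptyE) simp_all
  qed (use I in \<open>auto intro!: borel_measurable_times X_field X_integrable\<close>)
  then show ?thesis using X_mean[OF I(1)] \<sigma>_far[OF I(1,3) 3(1)] \<sigma>_far[OF I(1,4) 3(2)]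
   by (simp add: algebra_simps)
 qed
qed

text \<open>Away from the diagonal only the two Gaussian pairings contribute, and the Schur test sums them.\<close>

lemma far_form_square:
 assumes "P \<subseteq> {(k, k'). k \<in> I \<and> k' \<in> I \<and> 5*L < \<bar>k - k'\<bar>}"
 shows "integrable M (\<lambda>om. (\<Sum>(k, k')\<in>P. b k k'*(X k om*X k' om))^2)"
  and "expectation (\<lambda>om. (\<Sum>(k, k')\<in>P. b k k'*(X k om*X k' om))^2)
   \<le> 2*S^2*(\<Sum>k\<in>I. \<Sum>k'\<in>I. (b k k')^2)"
proof -
 let ?Z = "\<lambda>p om. X (fst p) om*X (snd p) om" and ?b = "\<lambda>p. b (fst p) (snd p)"
 have P: "P \<subseteq> I \<times> I" using assms by auto
 then have PI: "fst p \<in> I" "snd p \<in> I" if "p \<in> P" for p using that by auto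
 have PF: "5*L < \<bar>fst p - snd p\<bar>" if "p \<in> P" for p using that assms by auto
 have finP: "finite P" using P finite_I by (meson finite_SigmaI finite_subset)
 have sq: "(\<Sum>(k, k')\<in>P. b k k'*(X k om*X k' om))^2
   = (\<Sum>p\<in>P. \<Sum>q\<in>P. ?b p*?b q*(?Z p om*?Z q om))" for om
  unfolding power2_eq_square sum_product by (intro sum.cong) (auto simp: algebra_simps case_prod_beta)
 have int: "integrable M (\<lambda>om. ?Z p om*?Z q om)" if "p \<in> P" "q \<in> P" for p q
  using XXXX_integrable[of "fst p" "snd p" "fst q" "snd q"] PI[OF that(1)] PI[OF that(2)] by (simp add: mult.assoc)
 show "integrable M (\<lambda>om. (\<Sum>(k, k')\<in>P. b k k'*(X k om*X k' om))^2)"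
  unfolding sq using int by (intro Bochner_Integration.integrable_sum integrable_mult_right) auto
 have "expectation (\<lambda>om. (\<Sum>(k, k')\<in>P. b k k'*(X k om*X k' om))^2)
  = (\<Sum>p\<in>P. \<Sum>q\<in>P. ?b p*?b q * expectation (\<lambda>om. ?Z p om*?Z q om))"
  unfolding sq using int by (simp add: Bochner_Integration.integral_sum)
 also have "... \<le> (\<Sum>p\<in>P. \<Sum>q\<in>P. ((?b p)^2/2+(?b q)^2/2) *
   (\<bar>\<sigma> (fst p) (fst q)\<bar>*\<bar>\<sigma> (snd p) (snd q)\<bar>+\<bar>\<sigma> (fst p) (snd q)\<bar>*\<bar>\<sigma> (snd p) (fst q)\<bar>))"
 proof (intro sum_mono)
  fix p q assume pq: "p \<in> P" "q \<in> P"
  have E: "expectation (\<lambda>om. ?Z p om*?Z q om) = \<sigma> (fst p) (fst q)*\<sigma> (snd p) (snd q)+\<sigma> (fst p) (snd q)*\<sigma> (snd p) (fst q)"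
   using expectation_four_far[of "fst p" "snd p" "fst q" "snd q"] PI PF pq by blast
  have "\<bar>?b p*?b q\<bar> \<le> (?b p)^2/2+(?b q)^2/2"
   using sum_squares_ge_zero[of "\<bar>?b p\<bar> - \<bar>?b q\<bar>" 0]
   by (simp add: abs_mult power2_eq_square algebra_simps)
  then have "\<bar>?b p*?b q * expectation (\<lambda>om. ?Z p om*?Z q om)\<bar> \<le> ((?b p)^2/2+(?b q)^2/2) *
   (\<bar>\<sigma> (fst p) (fst q)\<bar>*\<bar>\<sigma> (snd p) (snd q)\<bar>+\<bar>\<sigma> (fst p) (snd q)\<bar>*\<bar>\<sigma> (snd p) (fst q)\<bar>)"
   unfolding E abs_mult[of "?b p*?b q"]
   by (intro mult_mono) (auto intro!: order_trans[OF abs_triangle_ineq] simp: abs_mult)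
  then show "?b p*?b q * expectation (\<lambda>om. ?Z p om*?Z q om) \<le> ((?b p)^2/2+(?b q)^2/2) *
   (\<bar>\<sigma> (fst p) (fst q)\<bar>*\<bar>\<sigma> (snd p) (snd q)\<bar>+\<bar>\<sigma> (fst p) (snd q)\<bar>*\<bar>\<sigma> (snd p) (fst q)\<bar>)"
   by linarith
 qed
 also have "... = (\<Sum>p\<in>P. (?b p)^2*(\<Sum>q\<in>P. \<bar>\<sigma> (fst p) (fst q)\<bar>*\<bar>\<sigma> (snd p) (snd q)\<bar>+\<bar>\<sigma> (fst p) (snd q)\<bar>*\<bar>\<sigma> (snd p) (fst q)\<bar>))"
 proof -
  define G where "G p q = \<bar>\<sigma> (fst p) (fst q)\<bar>*\<bar>\<sigma> (snd p) (snd q)\<bar>+\<bar>\<sigma> (fst p) (snd q)\<bar>*\<bar>\<sigma> (snd p) (fst q)\<bar>" for p q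
  have G: "G p q = G q p" for p q
   unfolding G_def by (simp add: \<sigma>_sym mult.commute)
  have "(\<Sum>p\<in>P. \<Sum>q\<in>P. ((?b p)^2/2+(?b q)^2/2)*G p q)
   = (\<Sum>p\<in>P. \<Sum>q\<in>P. (?b p)^2/2*G p q)+(\<Sum>p\<in>P. \<Sum>q\<in>P. (?b q)^2/2*G p q)"
   by (simp add: distrib_right sum.distrib)
  also have "(\<Sum>p\<in>P. \<Sum>q\<in>P. (?b q)^2/2*G p q) = (\<Sum>p\<in>P. \<Sum>q\<in>P. (?b p)^2/2*G p q)"
   by (subst sum.swap) (simp add: G[of _ _])
  finally show ?thesis
   by (simp add: G_def sum_distrib_left flip: sum.distrib)
 qed
 also have "... \<le> (\<Sum>p\<in>P. (?b p)^2*(2*S^2))"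
 proof (intro sum_mono mult_left_mono)
  fix p assume p: "p \<in> P"
  then have pI: "fst p \<in> I" "snd p \<in> I" using P by auto
  have "(\<Sum>q\<in>P. \<bar>\<sigma> (fst p) (fst q)\<bar>*\<bar>\<sigma> (snd p) (snd q)\<bar>+\<bar>\<sigma> (fst p) (snd q)\<bar>*\<bar>\<sigma> (snd p) (fst q)\<bar>)
   \<le> (\<Sum>q\<in>I \<times> I. \<bar>\<sigma> (fst p) (fst q)\<bar>*\<bar>\<sigma> (snd p) (snd q)\<bar>+\<bar>\<sigma> (fst p) (snd q)\<bar>*\<bar>\<sigma> (snd p) (fst q)\<bar>)"
   using P finite_I by (intro sum_mono2) auto
  also have "... = 2*((\<Sum>j\<in>I. \<bar>\<sigma> (fst p) j\<bar>)*(\<Sum>j\<in>I. \<bar>\<sigma> (snd p) j\<bar>))"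
   unfolding sum.distrib sum.cartesian_product' sum_product
   using sum.swap[of "\<lambda>i j. \<bar>\<sigma> (fst p) j\<bar>*\<bar>\<sigma> (snd p) i\<bar>" I I] by simp
  also have "... \<le> 2*(S*S)"
   using pI row_sum_\<sigma> S_nonneg by (intro mult_left_mono mult_mono sum_nonneg) auto
  finally show "(\<Sum>q\<in>P. \<bar>\<sigma> (fst p) (fst q)\<bar>*\<bar>\<sigma> (snd p) (snd q)\<bar>+\<bar>\<sigma> (fst p) (snd q)\<bar>*\<bar>\<sigma> (snd p) (fst q)\<bar>) \<le> 2*S^2"
   by (simp add: power2_eq_square)
 qed auto
 also have "... = 2*S^2*(\<Sum>p\<in>P. (?b p)^2)"
  by (simp add: sum_distrib_left mult.commute)
 also have "... \<le> 2*S^2*(\<Sum>p\<in>I\<times>I. (?b p)^2)"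
  using P finite_I by (intro mult_left_mono sum_mono2) auto
 also have "... = 2*S^2*(\<Sum>k\<in>I. \<Sum>k'\<in>I. (b k k')^2)"
  by (simp add: sum.cartesian_product case_prod_beta')
 finally show "expectation (\<lambda>om. (\<Sum>(k, k')\<in>P. b k k'*(X k om*X k' om))^2)
   \<le> 2*S^2*(\<Sum>k\<in>I. \<Sum>k'\<in>I. (b k k')^2)" .
qed

end

context dependent_array
begin

lemma lin_comb_integrable4:
 assumes "J \<subseteq> I"
 shows "integrable M (\<lambda>om. (\<Sum>k\<in>J. c k*X k om) ^ 4)"
proof (rule Bochner_Integration.integrable_bound)
 show "integrable M (\<lambda>om. real (card J) ^ 3*(\<Sum>k\<in>J. c k ^ 4*X k om ^ 4))"
  using assms X_power4 by (intro integrable_mult_right Bochner_Integration.integrable_sum) auto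
 show "(\<lambda>om. (\<Sum>k\<in>J. c k*X k om) ^ 4) \<in> borel_measurable M"
  using assms by (intro borel_measurable_power borel_measurable_sum borel_measurable_times) auto
 show "AE om in M. norm ((\<Sum>k\<in>J. c k*X k om) ^ 4) \<le> norm (real (card J) ^ 3*(\<Sum>k\<in>J. c k ^ 4*X k om ^ 4))"
 proof (intro AE_I2)
  fix om
  have "(\<Sum>k\<in>J. c k*X k om) ^ 4 \<le> real (card J) ^ 3*(\<Sum>k\<in>J. c k ^ 4*X k om ^ 4)"
   using power4_sum_le[of "\<lambda>k. c k*X k om" J] by (simp add: power_mult_distrib)
  then show "norm ((\<Sum>k\<in>J. c k*X k om) ^ 4) \<le> norm (real (card J) ^ 3*(\<Sum>k\<in>J. c k ^ 4*X k om ^ 4))"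
   by (simp add: sum_nonneg)
 qed
qed

lemma lin_comb_measurable_field:
 assumes "J \<subseteq> I"
 shows "(\<lambda>om. \<Sum>k\<in>J. c k*X k om) \<in> borel_measurable (field J)"
 using assms by (intro borel_measurable_sum borel_measurable_times borel_measurable_const X_field) auto

lemma lin_comb_square_expand:
 assumes "J \<subseteq> I"
 shows "expectation (\<lambda>om. (\<Sum>k\<in>J. c k*X k om)^2) = (\<Sum>i\<in>J. \<Sum>j\<in>J. c i * c j*\<sigma> i j)"
proof -
 have "(\<Sum>k\<in>J. c k*X k om)^2 = (\<Sum>i\<in>J. \<Sum>j\<in>J. c i * c j*(X i om*X j om))" for om
  unfolding power2_eq_square sum_product by (intro sum.cong) (auto simp: algebra_simps)
 moreover have "integrable M (\<lambda>om. X i om*X j om)" if "i \<in> J" "j \<in> J" for i j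
  using that assms XX_integrable by auto
 ultimately show ?thesis
  by (simp add: \<sigma>_def Bochner_Integration.integral_sum)
qed

lemma lin_comb_square_le:
 assumes "J \<subseteq> I"
 shows "expectation (\<lambda>om. (\<Sum>k\<in>J. c k*X k om)^2) \<le> S*(\<Sum>k\<in>J. (c k)^2)"
proof -
 have "(\<Sum>i\<in>J. \<Sum>j\<in>J. c i * c j*\<sigma> i j) \<le> (\<Sum>i\<in>J. \<Sum>j\<in>J. \<bar>\<sigma> i j\<bar>*\<bar>c i\<bar>*\<bar>c j\<bar>)"
  by (intro sum_mono) (metis abs_ge_self abs_mult mult.assoc mult.commute)
 also have "... \<le> S*(\<Sum>k\<in>J. (c k)^2)"
  using schur_bound[OF assms assms, of c c] by simp
 finally show ?thesis by (simp add: lin_comb_square_expand[OF assms])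
qed

text \<open>Summands further apart than the dependence range are independent; odd moments then drop out and the fourth moment is of the order of the squared sum of squares.\<close>

lemma lin_comb_spaced_moment4:
 assumes "finite J" "J \<subseteq> I" and spaced: "\<And>j k. j \<in> J ==> k \<in> J ==> j \<noteq> k ==> L < \<bar>j - k\<bar>"
 shows "expectation (\<lambda>om. (\<Sum>k\<in>J. c k*X k om) ^ 4) \<le> 3*D^2*(\<Sum>k\<in>J. (c k)^2)^2
  \<and> expectation (\<lambda>om. (\<Sum>k\<in>J. c k*X k om)^2) \<le> D*(\<Sum>k\<in>J. (c k)^2)"
 using assms
proof (induction J rule: finite_induct)
 case empty
 then show ?case by simp
next
 case (insert a J)
 define s where "s = (\<lambda>om. \<Sum>k\<in>J. c k*X k om)"
 define y where "y = (\<lambda>om. c a*X a om)"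
 define v where "v = (\<Sum>k\<in>J. (c k)^2)"
 have J: "J \<subseteq> I" and a: "a \<in> I" using insert.prems by auto
 have IH: "expectation (\<lambda>om. s om ^ 4) \<le> 3*D^2 * v^2" "expectation (\<lambda>om. (s om)^2) \<le> D * v"
  using insert.IH insert.prems unfolding s_def v_def by auto
 have v: "0 \<le> v" unfolding v_def by (simp add: sum_nonneg)
 have sF: "s \<in> borel_measurable (field J)" unfolding s_def by (rule lin_comb_measurable_field[OF J])
 have yF: "y \<in> borel_measurable (field {a})"
  unfolding y_def using X_field[OF a] by (intro borel_measurable_times) auto
 note sM = measurable_fieldD[OF sF] and yM = measurable_fieldD[OF yF]
 have s4: "integrable M (\<lambda>om. s om ^ 4)" unfolding s_def by (rule lin_comb_integrable4[OF J])
 have y4: "integrable M (\<lambda>om. y om ^ 4)"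
  unfolding y_def using X_power4[OF a] by (simp add: power_mult_distrib)
 have far: "L < \<bar>j - k\<bar>" if "j \<in> J" "k \<in> {a}" for j k
  using that insert.prems insert.hyps by auto
 have ind: "expectation (\<lambda>om. s om ^ i * y om ^ j) = expectation (\<lambda>om. s om ^ i) * expectation (\<lambda>om. y om ^ j)"
   "integrable M (\<lambda>om. s om ^ i * y om ^ j)" if "i \<le> 4" "j \<le> 4" for i j
  using sF yF far integrable_power_le4[OF sM s4 that(1)] integrable_power_le4[OF yM y4 that(2)]
  by (auto intro!: expectation_mult_far[of "\<lambda>om. s om ^ i" J "\<lambda>om. y om ^ j" "{a}"]
   integrable_mult_far[of "\<lambda>om. s om ^ i" J "\<lambda>om. y om ^ j" "{a}"])
 have Ey: "expectation y = 0" unfolding y_def using X_mean[OF a] by simp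
 have Es: "expectation s = 0"
  unfolding s_def using J by (simp add: Bochner_Integration.integral_sum X_integrable X_mean subset_eq)
 have Ey2: "expectation (\<lambda>om. (y om)^2) \<le> D*(c a)^2"
  unfolding y_def using mult_left_mono[OF X_square_le[OF a], of "(c a)^2"]
  by (simp add: power_mult_distrib mult.commute)
 have Ey4: "expectation (\<lambda>om. y om ^ 4) \<le> D*(c a) ^ 4"
  unfolding y_def using mult_left_mono[OF X_moment4[OF a], of "c a ^ 4"]
  by (simp add: power_mult_distrib mult.commute)
 have sum: "(\<Sum>k\<in>insert a J. c k*X k om) = s om+y om" for om
  using insert.hyps by (simp add: s_def y_def)
 have sum2: "(\<Sum>k\<in>insert a J. (c k)^2) = v+(c a)^2"
  using insert.hyps by (simp add: v_def)
 have exp4: "(s om+y om) ^ 4 = s om ^ 4 * y om ^ 0+4*(s om ^ 3 * y om ^ 1)+6*(s om ^ 2 * y om ^ 2)+4*(s om ^ 1 * y om ^ 3)+s om ^ 0 * y om ^ 4" for om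
  by (simp add: power4_eq_xxxx power3_eq_cube power2_eq_square algebra_simps)
 have exp2: "(s om+y om) ^ 2 = s om ^ 2 * y om ^ 0+2*(s om ^ 1 * y om ^ 1)+s om ^ 0 * y om ^ 2" for om
  by (simp add: power2_eq_square algebra_simps)
 have "expectation (\<lambda>om. (s om+y om) ^ 4)
  = expectation (\<lambda>om. s om ^ 4)+6*(expectation (\<lambda>om. s om ^ 2) * expectation (\<lambda>om. y om ^ 2))+expectation (\<lambda>om. y om ^ 4)"
  unfolding exp4 using ind[of 3 1] ind[of 2 2] ind[of 1 3] s4 y4 Ey Es by (simp add: prob_space)
 also have "... \<le> 3*D^2 * v^2+6*((D * v)*(D*(c a)^2)) + D*(c a) ^ 4"
  using IH Ey2 Ey4 D_ge_1 v by (intro add_mono mult_left_mono mult_mono) auto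
 also have "... \<le> 3*D^2 * v^2+6*((D * v)*(D*(c a)^2))+(3*D^2)*(c a) ^ 4"
 proof -
  have "D*1 \<le> D*D" using D_ge_1 by (intro mult_left_mono) auto
  then have "D \<le> 3*D^2" using D_ge_1 unfolding power2_eq_square by linarith
  then show ?thesis by (intro add_left_mono mult_right_mono) auto
 qed
 also have "... = 3*D^2*(v+(c a)^2)^2"
  by (simp add: power4_eq_xxxx power2_eq_square algebra_simps)
 finally have 4: "expectation (\<lambda>om. (s om+y om) ^ 4) \<le> 3*D^2*(v+(c a)^2)^2" .
 have "expectation (\<lambda>om. (s om+y om) ^ 2) = expectation (\<lambda>om. s om ^ 2)+expectation (\<lambda>om. y om ^ 2)"
  unfolding exp2 using ind[of 2 0] ind[of 1 1] ind[of 0 2] Ey Es by (simp add: prob_space)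
 also have "... \<le> D * v + D*(c a)^2" using IH Ey2 by simp
 finally show ?case using 4 unfolding sum sum2 by (simp add: algebra_simps)
qed

text \<open>Splitting the indices into residue classes modulo \<open>L + 1\<close> reduces to spaced sums.\<close>

lemma lin_comb_moment4:
 assumes J: "J \<subseteq> I"
 shows "expectation (\<lambda>om. (\<Sum>k\<in>J. c k*X k om) ^ 4) \<le> 3*D^2*(real_of_int L+1) ^ 4*(\<Sum>k\<in>J. (c k)^2)^2"
proof -
 define v where "v = (\<Sum>k\<in>J. (c k)^2)"
 define R where "R q = {k \<in> J. k mod (L+1) = q}" for q
 define y where "y q om = (\<Sum>k\<in>R q. c k*X k om)" for q om
 have finJ: "finite J" using J finite_I finite_subset by auto
 have R: "R q \<subseteq> I" "finite (R q)" for q using J finJ by (auto simp: R_def)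
 have "k mod (L+1) \<le> L" for k using pos_mod_bound[of "L+1" k] L_nonneg by linarith
 then have group: "(\<Sum>k\<in>J. c k*X k om) = (\<Sum>q\<in>{0..L}. y q om)" for om
  unfolding y_def R_def using L_nonneg finJ by (intro sum.group[symmetric]) auto
 have card: "real (card {0..L}) = real_of_int L+1" using L_nonneg by simp
 have spaced: "L < \<bar>j - k\<bar>" if "j \<in> R q" "k \<in> R q" "j \<noteq> k" for j k q
 proof -
  have "(L+1) dvd (j - k)"
   using that by (simp add: R_def flip: mod_eq_dvd_iff)
  then have "\<bar>L+1\<bar> \<le> \<bar>j - k\<bar>" using that by (intro dvd_imp_le_int) auto
  then show ?thesis using L_nonneg by simp
 qed
 have y_le: "expectation (\<lambda>om. y q om ^ 4) \<le> 3*D^2 * v^2" for q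
 proof -
  have "expectation (\<lambda>om. y q om ^ 4) \<le> 3*D^2*(\<Sum>k\<in>R q. (c k)^2)^2"
   unfolding y_def using lin_comb_spaced_moment4[of "R q" c] R spaced by blast
  also have "... \<le> 3*D^2 * v^2"
   unfolding v_def using finJ
   by (intro mult_left_mono power_mono sum_mono2 sum_nonneg) (auto simp: R_def)
  finally show ?thesis .
 qed
 have y4: "integrable M (\<lambda>om. y q om ^ 4)" for q
  unfolding y_def by (rule lin_comb_integrable4[OF R(1)])
 have "expectation (\<lambda>om. (\<Sum>k\<in>J. c k*X k om) ^ 4) \<le> expectation (\<lambda>om. (real_of_int L+1) ^ 3*(\<Sum>q\<in>{0..L}. y q om ^ 4))"
 proof (intro integral_mono lin_comb_integrable4[OF J])
  show "(\<Sum>k\<in>J. c k*X k om) ^ 4 \<le> (real_of_int L+1) ^ 3*(\<Sum>q\<in>{0..L}. y q om ^ 4)" for om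
   using power4_sum_le[of "\<lambda>q. y q om" "{0..L}"] unfolding group card .
 qed (use y4 in simp)
 also have "... = (real_of_int L+1) ^ 3*(\<Sum>q\<in>{0..L}. expectation (\<lambda>om. y q om ^ 4))"
  using y4 by (simp add: Bochner_Integration.integral_sum)
 also have "... \<le> (real_of_int L+1) ^ 3*(\<Sum>q\<in>{0..L}. 3*D^2 * v^2)"
  using y_le L_nonneg by (intro mult_left_mono sum_mono) auto
 also have "... = 3*D^2*(real_of_int L+1) ^ 4 * v^2"
  using L_nonneg by (simp add: card power4_eq_xxxx power3_eq_cube algebra_simps)
 finally show ?thesis by (simp add: v_def)
qed

lemma card_near_le:
 assumes "0 \<le> R"
 shows "card {k \<in> I. \<bar>k - j\<bar> \<le> R} \<le> nat (2 * R+1)"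
proof -
 have "card {k \<in> I. \<bar>k - j\<bar> \<le> R} \<le> card {j - R..j + R}"
  by (intro card_mono) auto
 then show ?thesis using assms by simp
qed

text \<open>Row sums of a band are functions of short windows, so distant rows are uncorrelated and each row correlates with few others.\<close>

lemma band_form_square:
 fixes W :: int and b :: "int => int => real"
 assumes W: "0 \<le> W" and b: "\<And>j k. j \<in> I ==> k \<in> I ==> \<bar>b j k\<bar> \<le> \<beta>"
 defines "Q \<equiv> (\<lambda>om. \<Sum>j\<in>I. \<Sum>k\<in>{k \<in> I. \<bar>k - j\<bar> \<le> W}. b j k*(X j om*X k om - \<sigma> j k))"
 shows "integrable M (\<lambda>om. (Q om)^2)"
  and "expectation (\<lambda>om. (Q om)^2) \<le> real (card I)*(4*(W + L)+1)*(2*W+1)^2*\<beta>^2*D"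
proof -
 define N where "N j = {k \<in> I. \<bar>k - j\<bar> \<le> W}" for j
 define c where "c j k om = X j om*X k om - \<sigma> j k" for j k om
 define Z where "Z j om = (\<Sum>k\<in>N j. b j k * c j k om)" for j om
 have N: "N j \<subseteq> I" "finite (N j)" for j using finite_I by (auto simp: N_def)
 have cardN: "real (card (N j)) \<le> 2*W+1" for j
  using card_near_le[OF W, of j] W unfolding N_def by linarith
 have Q: "Q om = (\<Sum>j\<in>I. Z j om)" for om by (simp add: Q_def Z_def N_def c_def)
 have c_meas: "c j k \<in> borel_measurable (field {j, k})" if "j \<in> I" "k \<in> I" for j k
  unfolding c_def using that X_field by (intro borel_measurable_diff borel_measurable_times) auto
 have c1: "integrable M (c j k)" and c0: "expectation (c j k) = 0" if "j \<in> I" "k \<in> I" for j k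
  unfolding c_def using XX_integrable[OF that] by (auto simp: prob_space \<sigma>_def)
 have c2: "integrable M (\<lambda>om. (c j k om)^2)" and c2_le: "expectation (\<lambda>om. (c j k om)^2) \<le> D"
  if "j \<in> I" "k \<in> I" for j k
 proof -
  have e: "(c j k om)^2 = (X j om*X k om)^2 - 2*\<sigma> j k*(X j om*X k om)+(\<sigma> j k)^2" for om
   unfolding c_def by (simp add: power2_eq_square algebra_simps)
  have i: "integrable M (\<lambda>om. (X j om*X k om)^2)"
   using XXXX_integrable[of j k j k] that by (simp add: power2_eq_square mult.assoc)
  show "integrable M (\<lambda>om. (c j k om)^2)"
   unfolding e using i XX_integrable[OF that] by simp
  have "expectation (\<lambda>om. (c j k om)^2) = expectation (\<lambda>om. (X j om*X k om)^2) - (\<sigma> j k)\<^sup>2"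
   unfolding e using i XX_integrable[OF that]
   by (simp add: prob_space \<sigma>_def[symmetric] power2_eq_square)
  then show "expectation (\<lambda>om. (c j k om)^2) \<le> D"
   using XX_square_le[OF that] zero_le_power2[of "\<sigma> j k"] by linarith
 qed
 have Z_meas: "Z j \<in> borel_measurable (field (insert j (N j)))" if "j \<in> I" for j
  unfolding Z_def
 proof (intro borel_measurable_sum borel_measurable_times borel_measurable_const)
  fix k assume "k \<in> N j"
  then show "c j k \<in> borel_measurable (field (insert j (N j)))"
   using measurable_field_mono[OF c_meas[of j k]] N that by auto
 qed
 have Z_meas' [measurable]: "Z j \<in> borel_measurable M" if "j \<in> I" for j
  using Z_meas[OF that] measurable_fieldD by blast
 have Zsq_le: "(Z j om)^2 \<le> (2*W+1)*(\<Sum>k\<in>N j. \<beta>^2*(c j k om)^2)" if "j \<in> I" for j om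
 proof -
  have "(Z j om)^2 \<le> real (card (N j))*(\<Sum>k\<in>N j. (b j k * c j k om)^2)"
   using Cauchy_Schwarz_ineq_sum[of "\<lambda>_. 1" "\<lambda>k. b j k * c j k om" "N j"] by (simp add: Z_def)
  also have "... \<le> (2*W+1)*(\<Sum>k\<in>N j. \<beta>^2*(c j k om)^2)"
  proof (intro mult_mono cardN sum_mono sum_nonneg)
   fix k assume "k \<in> N j"
   then have "\<bar>b j k\<bar> \<le> \<beta>" using b that N by auto
   then have "(b j k)^2 \<le> \<beta>^2" by (metis abs_ge_zero order_trans power2_abs power_mono)
   then show "(b j k * c j k om)^2 \<le> \<beta>^2*(c j k om)^2"
    by (simp add: power_mult_distrib mult_right_mono)
  qed (use W in auto)
  finally show ?thesis .
 qed
 have bnd_int: "integrable M (\<lambda>om. (2*W+1)*(\<Sum>k\<in>N j. \<beta>^2*(c j k om)^2))" if "j \<in> I" for j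
  using c2 that N by (intro integrable_mult_right Bochner_Integration.integrable_sum) auto
 have Z2: "integrable M (\<lambda>om. (Z j om)^2)" if "j \<in> I" for j
  by (rule Bochner_Integration.integrable_bound[OF bnd_int[OF that]])
   (use that Zsq_le[OF that] order_trans[OF _ abs_ge_self] in auto)
 define z where "z = (2*W+1)^2*\<beta>^2*D"
 have z: "0 \<le> z" unfolding z_def using D_ge_1 by auto
 have Z2_le: "expectation (\<lambda>om. (Z j om)^2) \<le> z" if "j \<in> I" for j
 proof -
  have "expectation (\<lambda>om. (Z j om)^2) \<le> expectation (\<lambda>om. (2*W+1)*(\<Sum>k\<in>N j. \<beta>^2*(c j k om)^2))"
   using Z2 bnd_int Zsq_le that by (intro integral_mono) auto
  also have "... = (2*W+1)*(\<Sum>k\<in>N j. \<beta>^2 * expectation (\<lambda>om. (c j k om)^2))"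
   using c2 that N by (subst integral_mult_right_zero, subst Bochner_Integration.integral_sum) auto
  also have "... \<le> (2*W+1)*(\<Sum>k\<in>N j. \<beta>^2*D)"
   using c2_le that N W by (intro mult_left_mono sum_mono) auto
  also have "... = (2*W+1)*(real (card (N j))*(\<beta>^2*D))" by simp
  also have "... \<le> (2*W+1)*((2*W+1)*(\<beta>^2*D))"
   using W D_ge_1 cardN by (intro mult_left_mono mult_right_mono) auto
  finally show ?thesis by (simp add: z_def power2_eq_square mult.assoc)
 qed
 have Z1: "integrable M (Z j)" and Z0: "expectation (Z j) = 0" if "j \<in> I" for j
  unfolding Z_def using c1 c0 that N
  by (auto intro!: Bochner_Integration.integrable_sum simp: Bochner_Integration.integral_sum subset_eq)
 have ZZ: "integrable M (\<lambda>om. Z i om*Z j om)" if "i \<in> I" "j \<in> I" for i j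
 proof (rule Bochner_Integration.integrable_bound)
  show "integrable M (\<lambda>om. ((Z i om)^2+(Z j om)^2)/2)" using Z2 that by simp
  show "AE om in M. norm (Z i om*Z j om) \<le> norm (((Z i om)^2+(Z j om)^2)/2)"
  proof (intro AE_I2)
   fix om
   have "0 \<le> (\<bar>Z i om\<bar> - \<bar>Z j om\<bar>)^2" by simp
   then show "norm (Z i om*Z j om) \<le> norm (((Z i om)^2+(Z j om)^2)/2)"
    by (simp add: power2_diff abs_mult)
  qed
 qed (use that in measurable)
 have ZZ_le: "expectation (\<lambda>om. Z i om*Z j om) \<le> (if \<bar>j - i\<bar> \<le> 2*W + L then z else 0)" if ij: "i \<in> I" "j \<in> I" for i j
 proof (cases "\<bar>j - i\<bar> \<le> 2*W + L")
  case True
  have "expectation (\<lambda>om. Z i om*Z j om) \<le> expectation (\<lambda>om. ((Z i om)^2+(Z j om)^2)/2)"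
  proof (intro integral_mono ZZ ij)
   fix om
   have "0 \<le> (Z i om - Z j om)^2" by simp
   then show "Z i om*Z j om \<le> ((Z i om)^2+(Z j om)^2)/2" by (simp add: power2_diff)
  qed (use Z2 ij in simp)
  also have "... \<le> z" using Z2 Z2_le[OF ij(1)] Z2_le[OF ij(2)] ij by simp
  finally show ?thesis using True by simp
 next
  case False
  have "expectation (\<lambda>om. Z i om*Z j om) = expectation (Z i) * expectation (Z j)"
  proof (rule expectation_mult_far[of "Z i" "insert i (N i)" "Z j" "insert j (N j)"])
   fix a b assume "a \<in> insert i (N i)" "b \<in> insert j (N j)"
   then have "\<bar>a - i\<bar> \<le> W" "\<bar>b - j\<bar> \<le> W" using W by (auto simp: N_def)
   then show "L < \<bar>a - b\<bar>" using False by linarith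
  qed (use ij Z_meas Z1 in auto)
  then show ?thesis using Z0 ij False by simp
 qed
 have Qsq: "(Q om)^2 = (\<Sum>i\<in>I. \<Sum>j\<in>I. Z i om*Z j om)" for om
  unfolding Q power2_eq_square sum_product ..
 show "integrable M (\<lambda>om. (Q om)^2)"
  unfolding Qsq using ZZ by (intro Bochner_Integration.integrable_sum) auto
 have "expectation (\<lambda>om. (Q om)^2) = (\<Sum>i\<in>I. \<Sum>j\<in>I. expectation (\<lambda>om. Z i om*Z j om))"
  unfolding Qsq using ZZ by (simp add: Bochner_Integration.integral_sum)
 also have "... \<le> (\<Sum>i\<in>I. \<Sum>j\<in>I. if \<bar>j - i\<bar> \<le> 2*W + L then z else 0)"
  using ZZ_le by (intro sum_mono) auto
 also have "... = (\<Sum>i\<in>I. real (card {j \<in> I. \<bar>j - i\<bar> \<le> 2*W + L}) * z)"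
  using finite_I by (simp add: sum.inter_filter[symmetric])
 also have "... \<le> (\<Sum>i\<in>I. (4*(W + L)+1) * z)"
 proof (intro sum_mono mult_right_mono z)
  fix i
  show "real (card {j \<in> I. \<bar>j - i\<bar> \<le> 2*W + L}) \<le> 4*(W + L)+1"
   using card_near_le[of "2*W + L" i] W L_nonneg
   by (smt (verit) of_int_le_iff of_int_of_nat_eq int_nat_eq nat_int_comparison(3))
 qed
 finally show "expectation (\<lambda>om. (Q om)^2) \<le> real (card I)*(4*(W + L)+1)*(2*W+1)^2*\<beta>^2*D"
  by (simp add: z_def mult.assoc)
qed

end

section \<open>Leave-out expansion of a quadratic form\<close>


lemma norm_iexp_minus_1_le: "cmod (iexp x - 1) \<le> \<bar>x\<bar>"
 using iexp_approx1[of x 0] by simp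

lemma norm_iexp_minus_linear_le: "cmod (iexp x - 1 - \<i> * x) \<le> x^2/2"
 using iexp_approx1[of x 1] by (simp add: diff_diff_eq power2_eq_square)

context prob_space
begin

lemma integrable_of_real_mult_unit:
 fixes f :: "'a => real" and e :: "'a => complex"
 assumes f: "integrable M f" and [measurable]: "e \<in> borel_measurable M" and e: "\<And>om. cmod (e om) \<le> 1"
 shows "integrable M (\<lambda>om. complex_of_real (f om) * e om)"
proof (rule Bochner_Integration.integrable_bound[OF f])
 note [measurable] = borel_measurable_integrable[OF f]
 show "(\<lambda>om. complex_of_real (f om) * e om) \<in> borel_measurable M" by measurable
 show "AE om in M. norm (complex_of_real (f om) * e om) \<le> norm (f om)"
  using e by (auto simp: norm_mult intro!: mult_right_le_one_le)
qed

lemma norm_expectation_le: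
 fixes h :: "'a => complex"
 assumes "integrable M h" "integrable M g" "\<And>om. cmod (h om) \<le> g om"
 shows "cmod (expectation h) \<le> expectation g"
 by (rule order_trans[OF integral_norm_bound integral_mono]) (use assms in auto)

end

text \<open>Coefficients vanish near the diagonal, so the two factors of every product are independent and the form is centred.\<close>

locale far_form = dependent_array +
 fixes a :: "int => int => real" and v :: real
 assumes a_sym: "\<And>j k. a j k = a k j"
  and a_near: "\<And>j k. \<bar>j - k\<bar> \<le> 5*L ==> a j k = 0"
  and v_pos: "0 < v"
  and a_row: "\<And>j. j \<in> I ==> (\<Sum>k\<in>I. (a j k)^2) \<le> v"
begin

definition Y :: "int => 'a => real" where
 "Y j om = (\<Sum>k\<in>I. a j k*X k om)"

definition T :: "'a => real" where
 "T om = (\<Sum>j\<in>I. X j om*Y j om)"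

definition q :: real where
 "q = sqrt v * v * (S+3*D^2*(real_of_int L+1) ^ 4)/2"

lemma q_nonneg: "0 \<le> q"
 unfolding q_def using v_pos S_nonneg by simp

lemma Y_field:
 assumes "{k \<in> I. 5*L < \<bar>k - j\<bar>} \<subseteq> K"
 shows "Y j \<in> borel_measurable (field K)"
proof -
 have "a j k = 0" if "\<not> 5*L < \<bar>k - j\<bar>" for k
  using a_near[of j k] that by (simp add: abs_minus_commute[of j k])
 then have "Y j = (\<lambda>om. \<Sum>k\<in>{k \<in> I. 5*L < \<bar>k - j\<bar>}. a j k*X k om)"
  unfolding Y_def using finite_I by (intro ext sum.mono_neutral_right) auto
 then have "Y j \<in> borel_measurable (field {k \<in> I. 5*L < \<bar>k - j\<bar>})"
  using lin_comb_measurable_field[of "{k \<in> I. 5*L < \<bar>k - j\<bar>}" "a j"] by simp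
 then show ?thesis using assms by (rule measurable_field_mono)
qed

lemma Y_measurable [measurable]: "Y j \<in> borel_measurable M"
 using Y_field[of j UNIV] measurable_fieldD by blast

lemma T_measurable [measurable]: "T \<in> borel_measurable M"
 unfolding T_def by measurable

lemma Y_power4: "integrable M (\<lambda>om. Y j om ^ 4)"
 unfolding Y_def by (rule lin_comb_integrable4) simp

lemma Y_Y2:
 assumes "i \<in> I" "j \<in> I"
 shows "integrable M (\<lambda>om. \<bar>Y i om\<bar>*(Y j om)^2)" and "expectation (\<lambda>om. \<bar>Y i om\<bar>*(Y j om)^2) \<le> q"
proof -
 have "integrable M (\<lambda>om. \<bar>Y i om*Y j om*Y j om\<bar>)"
  by (intro integrable_abs integrable_mult_le4(1) Y_power4) measurable
 then show 1: "integrable M (\<lambda>om. \<bar>Y i om\<bar>*(Y j om)^2)"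
  by (simp add: abs_mult power2_eq_square mult.assoc)
 let ?w = "sqrt v"
 have w: "0 < ?w" "?w*?w = v" using v_pos by auto
 have Y2: "integrable M (\<lambda>om. (Y i om)^2)" by (rule integrable_power_le4[OF _ Y_power4]) auto
 have "expectation (\<lambda>om. \<bar>Y i om\<bar>*(Y j om)^2) \<le> expectation (\<lambda>om. (?w*(Y i om)^2 + Y j om ^ 4/?w)/2)"
 proof (intro integral_mono 1)
  fix om
  have "0 \<le> (?w*\<bar>Y i om\<bar> - (Y j om)\<^sup>2)^2" by simp
  also have "... = ?w*(?w*(Y i om)^2 + Y j om ^ 4/?w - 2*(\<bar>Y i om\<bar>*(Y j om)^2))"
   using w by (simp add: field_simps power2_eq_square power4_eq_xxxx)
  finally show "\<bar>Y i om\<bar>*(Y j om)^2 \<le> (?w*(Y i om)^2 + Y j om ^ 4/?w)/2"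
   using w by (simp add: zero_le_mult_iff)
 qed (use Y2 Y_power4 in simp)
 also have "... = (?w * expectation (\<lambda>om. (Y i om)^2)+expectation (\<lambda>om. Y j om ^ 4)/?w)/2"
  using Y2 Y_power4 by simp
 also have "... \<le> (?w*(S * v)+3*D^2*(real_of_int L+1) ^ 4 * v^2/?w)/2"
 proof -
  have "expectation (\<lambda>om. (Y i om)^2) \<le> S*(\<Sum>k\<in>I. (a i k)^2)"
   unfolding Y_def by (rule lin_comb_square_le) simp
  also have "... \<le> S * v" using a_row[OF assms(1)] S_nonneg by (rule mult_left_mono)
  finally have 2: "expectation (\<lambda>om. (Y i om)^2) \<le> S * v" .
  have "expectation (\<lambda>om. Y j om ^ 4) \<le> 3*D^2*(real_of_int L+1) ^ 4*(\<Sum>k\<in>I. (a j k)^2)^2"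
   unfolding Y_def by (rule lin_comb_moment4) simp
  also have "... \<le> 3*D^2*(real_of_int L+1) ^ 4 * v^2"
   using a_row[OF assms(2)] L_nonneg by (intro mult_left_mono power_mono sum_nonneg) auto
  finally show ?thesis using 2 w
   by (intro divide_right_mono add_mono mult_left_mono) auto
 qed
 also have "... = q"
 proof -
  have "v^2/?w = ?w * v" using w by (simp add: field_simps power2_eq_square)
  then have c: "c * v^2/?w = c*(?w * v)" for c by (metis times_divide_eq_right)
  show ?thesis unfolding q_def c by (simp add: algebra_simps)
 qed
 finally show "expectation (\<lambda>om. \<bar>Y i om\<bar>*(Y j om)^2) \<le> q" .
qed

definition near :: "int => int set" where
 "near j = {i \<in> I. \<bar>i - j\<bar> \<le> 2*L}"

definition T_away :: "int => 'a => real" where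
 "T_away j om = (\<Sum>i\<in>I - near j. \<Sum>k\<in>I - near j. a i k*X i om*X k om)"

definition U :: "int => 'a => real" where
 "U j om = (\<Sum>i\<in>near j. X i om*Y i om)"

lemma near_subset: "near j \<subseteq> I" and finite_near [simp]: "finite (near j)"
 using finite_I by (auto simp: near_def)

lemma card_near: "real (card (near j)) \<le> 4*L+1"
 using card_near_le[of "2*L" j] L_nonneg unfolding near_def by linarith

lemma U_measurable [measurable]: "U j \<in> borel_measurable M"
 unfolding U_def
 by (intro borel_measurable_sum borel_measurable_times X_measurable Y_measurable) (use near_subset in blast)

lemma T_away_field:
 assumes "I - near j \<subseteq> K"
 shows "T_away j \<in> borel_measurable (field K)"
 unfolding T_away_def using assms
 by (intro borel_measurable_sum borel_measurable_times borel_measurable_const X_field) auto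

lemma T_away_measurable [measurable]: "T_away j \<in> borel_measurable M"
 using T_away_field[of j UNIV] measurable_fieldD by blast

lemma T_split: "T om = T_away j om+2*U j om"
proof -
 let ?N = "near j"
 define F where "F i k = a i k*X i om*X k om" for i k
 have split: "(\<Sum>i\<in>I. h i) = (\<Sum>i\<in>?N. h i)+(\<Sum>i\<in>I - ?N. h i)" for h :: "int => real"
  using sum.subset_diff[OF near_subset finite_I, of h j] by simp
 have sym: "F i k = F k i" for i k using a_sym[of i k] by (simp add: F_def)
 have NN: "(\<Sum>i\<in>?N. \<Sum>k\<in>?N. F i k) = 0"
 proof (intro sum.neutral ballI)
  fix i k assume "i \<in> ?N" "k \<in> ?N"
  then have "\<bar>i - k\<bar> \<le> 5*L" using L_nonneg unfolding near_def by auto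
  then show "F i k = 0" using a_near by (simp add: F_def)
 qed
 have U: "U j om = (\<Sum>i\<in>?N. \<Sum>k\<in>I. F i k)"
  unfolding U_def Y_def F_def by (simp add: sum_distrib_left algebra_simps)
 also have "... = (\<Sum>i\<in>?N. \<Sum>k\<in>I - ?N. F i k)"
  using NN by (simp add: split sum.distrib)
 finally have U': "U j om = (\<Sum>i\<in>?N. \<Sum>k\<in>I - ?N. F i k)" .
 have "(\<Sum>i\<in>I - ?N. \<Sum>k\<in>?N. F i k) = (\<Sum>k\<in>?N. \<Sum>i\<in>I - ?N. F i k)" by (rule sum.swap)
 also have "... = U j om" unfolding U' by (intro sum.cong refl sym)
 finally have O: "(\<Sum>i\<in>I - ?N. \<Sum>k\<in>?N. F i k) = U j om" .
 have "T om = (\<Sum>i\<in>I. \<Sum>k\<in>I. F i k)"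
  unfolding T_def Y_def F_def by (simp add: sum_distrib_left algebra_simps)
 also have "... = (\<Sum>i\<in>?N. \<Sum>k\<in>I. F i k)+(\<Sum>i\<in>I - ?N. (\<Sum>k\<in>?N. F i k)+(\<Sum>k\<in>I - ?N. F i k))"
  by (subst split) (simp only: split[of "F _"])
 also have "... = T_away j om+2*U j om"
  unfolding sum.distrib O U[symmetric] by (simp add: T_away_def F_def)
 finally show ?thesis .
qed

lemma field_iexp_measurable:
 assumes [measurable]: "f \<in> borel_measurable (field K)"
 shows "(\<lambda>om. iexp (s * f om)) \<in> borel_measurable (field K)"
 by measurable

lemma away_zero:
 assumes "j \<in> I"
 shows "expectation (\<lambda>om. complex_of_real (X j om*Y j om) * iexp (s*T_away j om)) = 0"
proof -
 let ?K = "{k \<in> I. L < \<bar>k - j\<bar>}"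
 have Yf: "Y j \<in> borel_measurable (field ?K)" using L_nonneg by (intro Y_field) auto
 have Tf: "T_away j \<in> borel_measurable (field ?K)"
  using L_nonneg by (intro T_away_field) (auto simp: near_def)
 have "expectation (\<lambda>om. complex_of_real (X j om)*(complex_of_real (Y j om) * iexp (s*T_away j om)))
   = expectation (\<lambda>om. complex_of_real (X j om)) * expectation (\<lambda>om. complex_of_real (Y j om) * iexp (s*T_away j om))"
 proof (rule expectation_mult_far[of "\<lambda>om. complex_of_real (X j om)" "{j}" "\<lambda>om. complex_of_real (Y j om) * iexp (s*T_away j om)" ?K])
  show "(\<lambda>om. complex_of_real (X j om)) \<in> borel_measurable (field {j})"
   using X_field[OF assms, of "{j}"] by simp
  show "(\<lambda>om. complex_of_real (Y j om) * iexp (s*T_away j om)) \<in> borel_measurable (field ?K)"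
   using Yf field_iexp_measurable[OF Tf] by (intro borel_measurable_times) auto
  show "integrable M (\<lambda>om. complex_of_real (X j om))" using X_integrable[OF assms] by simp
  show "integrable M (\<lambda>om. complex_of_real (Y j om) * iexp (s*T_away j om))"
   using integrable_power_le4[OF Y_measurable Y_power4, of 1 j] by (intro integrable_of_real_mult_unit) auto
 qed (auto simp: abs_minus_commute)
 then show ?thesis using X_mean[OF assms] by (simp add: mult.assoc)
qed

lemma cov_term:
 assumes j: "j \<in> I" and i: "i \<in> near j"
 shows "expectation (\<lambda>om. complex_of_real (X j om*Y j om*X i om*Y i om) * iexp (s*T_away j om))
  = complex_of_real (\<sigma> j i) * expectation (\<lambda>om. complex_of_real (Y j om*Y i om) * iexp (s*T_away j om))"
proof -
 let ?e = "\<lambda>om. iexp (s*T_away j om)"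
 have iI: "i \<in> I" and ij: "\<bar>i - j\<bar> \<le> 2*L" using i by (auto simp: near_def)
 show ?thesis
 proof (cases "\<bar>i - j\<bar> \<le> L")
  case True
  let ?K = "{k \<in> I. 2*L < \<bar>k - j\<bar>}"
  have Yj: "Y j \<in> borel_measurable (field ?K)" using L_nonneg by (intro Y_field) auto
  have Yi: "Y i \<in> borel_measurable (field ?K)"
  proof (rule Y_field, safe)
   fix k assume "5*L < \<bar>k - i\<bar>"
   then show "2*L < \<bar>k - j\<bar>" using True L_nonneg by linarith
  qed
  have Tf: "T_away j \<in> borel_measurable (field ?K)"
   by (intro T_away_field) (auto simp: near_def)
  have "expectation (\<lambda>om. complex_of_real (X j om*X i om)*(complex_of_real (Y j om*Y i om)*?e om))
    = expectation (\<lambda>om. complex_of_real (X j om*X i om)) * expectation (\<lambda>om. complex_of_real (Y j om*Y i om)*?e om)"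
  proof (rule expectation_mult_far[of "\<lambda>om. complex_of_real (X j om*X i om)" "{j, i}" "\<lambda>om. complex_of_real (Y j om*Y i om)*?e om" ?K])
   have [measurable]: "(\<lambda>om. X j om*X i om) \<in> borel_measurable (field {j, i})"
    using X_field j iI by (intro borel_measurable_times) auto
   show "(\<lambda>om. complex_of_real (X j om*X i om)) \<in> borel_measurable (field {j, i})"
    by measurable
   have m [measurable]: "(\<lambda>om. Y j om*Y i om) \<in> borel_measurable (field ?K)"
    using Yj Yi by (intro borel_measurable_times) auto
   note [measurable] = field_iexp_measurable[OF Tf, of s]
   show "(\<lambda>om. complex_of_real (Y j om*Y i om)*?e om) \<in> borel_measurable (field ?K)"
    by measurable
   show "integrable M (\<lambda>om. complex_of_real (X j om*X i om))"
    using XX_integrable[OF j iI] by (rule integrable_of_real)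
   show "integrable M (\<lambda>om. complex_of_real (Y j om*Y i om)*?e om)"
    by (intro integrable_of_real_mult_unit integrable_mult_le4(2)[of _ _ "Y i"] Y_power4) auto
   show "L < \<bar>l - k\<bar>" if "l \<in> {j, i}" "k \<in> ?K" for l k
   proof -
    have "2*L < \<bar>k - j\<bar>" using that by simp
    then have "L < \<bar>j - k\<bar>" "L < \<bar>i - k\<bar>" using True L_nonneg by linarith+
    then show ?thesis using that by auto
   qed
  qed
  also have "expectation (\<lambda>om. complex_of_real (X j om*X i om)) = complex_of_real (\<sigma> j i)"
   unfolding \<sigma>_def by (rule integral_complex_of_real)
  finally show ?thesis by (simp add: mult_ac)
 next
  case False
  let ?K = "{k \<in> I. L < \<bar>k - j\<bar>}"
  have Yj: "Y j \<in> borel_measurable (field ?K)" using L_nonneg by (intro Y_field) auto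
  have Yi: "Y i \<in> borel_measurable (field ?K)"
  proof (rule Y_field, safe)
   fix k assume "5*L < \<bar>k - i\<bar>"
   then show "L < \<bar>k - j\<bar>" using ij L_nonneg by linarith
  qed
  have Xi: "X i \<in> borel_measurable (field ?K)"
   using False iI by (intro X_field) auto
  have Tf: "T_away j \<in> borel_measurable (field ?K)"
   using L_nonneg by (intro T_away_field) (auto simp: near_def)
  have "expectation (\<lambda>om. complex_of_real (X j om)*(complex_of_real (Y j om*X i om*Y i om)*?e om))
    = expectation (\<lambda>om. complex_of_real (X j om)) * expectation (\<lambda>om. complex_of_real (Y j om*X i om*Y i om)*?e om)"
  proof (rule expectation_mult_far[of "\<lambda>om. complex_of_real (X j om)" "{j}" "\<lambda>om. complex_of_real (Y j om*X i om*Y i om)*?e om" ?K])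
   show "(\<lambda>om. complex_of_real (X j om)) \<in> borel_measurable (field {j})"
    using X_field[OF j, of "{j}"] by simp
   have m [measurable]: "(\<lambda>om. Y j om*X i om*Y i om) \<in> borel_measurable (field ?K)"
    using Yj Yi Xi by (intro borel_measurable_times) auto
   note [measurable] = field_iexp_measurable[OF Tf, of s]
   show "(\<lambda>om. complex_of_real (Y j om*X i om*Y i om)*?e om) \<in> borel_measurable (field ?K)"
    by measurable
   show "integrable M (\<lambda>om. complex_of_real (X j om))" using X_integrable[OF j] by simp
   show "integrable M (\<lambda>om. complex_of_real (Y j om*X i om*Y i om)*?e om)"
    using iI X_power4 by (intro integrable_of_real_mult_unit integrable_mult_le4(1) Y_power4) auto
  qed (auto simp: abs_minus_commute)
  then show ?thesis
   using X_mean[OF j] \<sigma>_far[OF j iI] False by (simp add: mult_ac abs_minus_commute)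
 qed
qed

lemma XY_integrable:
 assumes "j \<in> I" "i \<in> I"
 shows "integrable M (\<lambda>om. X j om*Y i om)"
  and "integrable M (\<lambda>om. X j om*Y j om*X i om*Y i om)"
  and "integrable M (\<lambda>om. Y j om*Y i om)"
 using integrable_mult_le4(2)[of "X j" "Y i" "Y i"] integrable_mult4[of "X j" "Y j" "X i" "Y i"]
  integrable_mult_le4(2)[of "Y j" "Y i" "Y i"] assms X_power4 Y_power4 by auto

lemma near_product:
 assumes j: "j \<in> I" and i: "i \<in> near j" "i' \<in> near j" "l \<in> near j" "l' \<in> near j"
 shows "integrable M (\<lambda>om. (\<bar>X i om\<bar>*(X i' om)^2)*(\<bar>Y l om\<bar>*(Y l' om)^2))"
  and "expectation (\<lambda>om. (\<bar>X i om\<bar>*(X i' om)^2)*(\<bar>Y l om\<bar>*(Y l' om)^2)) \<le> D * q"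
  and "integrable M (\<lambda>om. \<bar>X i om\<bar>*(\<bar>Y l om\<bar>*(Y l' om)^2))"
  and "expectation (\<lambda>om. \<bar>X i om\<bar>*(\<bar>Y l om\<bar>*(Y l' om)^2)) \<le> D * q"
proof -
 let ?K = "{k \<in> I. 3*L < \<bar>k - j\<bar>}"
 have I: "i \<in> I" "i' \<in> I" "l \<in> I" "l' \<in> I" using i near_subset by auto
 have YK: "Y l \<in> borel_measurable (field ?K)" if "l \<in> near j" for l
 proof (rule Y_field, safe)
  fix k assume "5*L < \<bar>k - l\<bar>"
  then show "3*L < \<bar>k - j\<bar>" using that L_nonneg unfolding near_def by (simp; linarith)
 qed
 have XK: "X i \<in> borel_measurable (field (near j))" if "i \<in> near j" for i
  using that near_subset by (intro X_field) auto
 have far: "L < \<bar>m - k\<bar>" if "m \<in> near j" "k \<in> ?K" for m k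
  using that unfolding near_def by (simp; linarith)
 have fx: "(\<lambda>om. \<bar>X i om\<bar>*(X i' om)^2) \<in> borel_measurable (field (near j))" "(\<lambda>om. \<bar>X i om\<bar>) \<in> borel_measurable (field (near j))"
  using XK i by auto
 have fy: "(\<lambda>om. \<bar>Y l om\<bar>*(Y l' om)^2) \<in> borel_measurable (field ?K)"
  using YK i by auto
 note iY = Y_Y2(1)[OF I(3,4)] and iX = abs_X_X2(1)[OF I(1,2)] X_abs_integrable[OF I(1)]
 show "integrable M (\<lambda>om. (\<bar>X i om\<bar>*(X i' om)^2)*(\<bar>Y l om\<bar>*(Y l' om)^2))"
  by (rule integrable_mult_far[OF fx(1) fy far iX(1) iY])
 show "integrable M (\<lambda>om. \<bar>X i om\<bar>*(\<bar>Y l om\<bar>*(Y l' om)^2))"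
  by (rule integrable_mult_far[OF fx(2) fy far iX(2) iY])
 have "expectation (\<lambda>om. (\<bar>X i om\<bar>*(X i' om)^2)*(\<bar>Y l om\<bar>*(Y l' om)^2))
   = expectation (\<lambda>om. \<bar>X i om\<bar>*(X i' om)^2) * expectation (\<lambda>om. \<bar>Y l om\<bar>*(Y l' om)^2)"
  by (rule expectation_mult_far[OF fx(1) fy far iX(1) iY])
 also have "... \<le> D * q"
  using abs_X_X2(2)[OF I(1,2)] Y_Y2(2)[OF I(3,4)] D_ge_1 by (intro mult_mono) auto
 finally show "expectation (\<lambda>om. (\<bar>X i om\<bar>*(X i' om)^2)*(\<bar>Y l om\<bar>*(Y l' om)^2)) \<le> D * q" .
 have "expectation (\<lambda>om. \<bar>X i om\<bar>*(\<bar>Y l om\<bar>*(Y l' om)^2))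
   = expectation (\<lambda>om. \<bar>X i om\<bar>) * expectation (\<lambda>om. \<bar>Y l om\<bar>*(Y l' om)^2)"
  by (rule expectation_mult_far[OF fx(2) fy far iX(2) iY])
 also have "... \<le> D * q"
  using X_abs_le[OF I(1)] Y_Y2(2)[OF I(3,4)] D_ge_1 by (intro mult_mono) auto
 finally show "expectation (\<lambda>om. \<bar>X i om\<bar>*(\<bar>Y l om\<bar>*(Y l' om)^2)) \<le> D * q" .
qed

lemma remainder_moment:
 assumes j: "j \<in> I"
 shows "integrable M (\<lambda>om. \<bar>X j om*Y j om\<bar>*(U j om)^2)"
  and "expectation (\<lambda>om. \<bar>X j om*Y j om\<bar>*(U j om)^2) \<le> (4*L+1)^2*(D * q)"
proof -
 define g where "g = (\<lambda>om. real (card (near j))*(\<Sum>i\<in>near j. (\<bar>X j om\<bar>*(X i om)^2)*(\<bar>Y j om\<bar>*(Y i om)^2)))"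
 have jj: "j \<in> near j" using j L_nonneg by (simp add: near_def)
 have g: "integrable M g"
  unfolding g_def using near_product(1)[OF j jj _ jj]
  by (intro integrable_mult_right Bochner_Integration.integrable_sum) auto
 have le: "\<bar>X j om*Y j om\<bar>*(U j om)^2 \<le> g om" for om
 proof -
  have "(U j om)^2 \<le> real (card (near j))*(\<Sum>i\<in>near j. (X i om*Y i om)^2)"
   using Cauchy_Schwarz_ineq_sum[of "\<lambda>_. 1" "\<lambda>i. X i om*Y i om" "near j"] by (simp add: U_def)
  then have "\<bar>X j om*Y j om\<bar>*(U j om)^2 \<le> \<bar>X j om*Y j om\<bar>*(real (card (near j))*(\<Sum>i\<in>near j. (X i om*Y i om)^2))"
   by (intro mult_left_mono) auto
  also have "... = g om"
   unfolding g_def by (simp add: sum_distrib_left abs_mult power_mult_distrib mult_ac)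
  finally show ?thesis .
 qed
 show i: "integrable M (\<lambda>om. \<bar>X j om*Y j om\<bar>*(U j om)^2)"
 proof (rule Bochner_Integration.integrable_bound[OF g])
  show "AE om in M. norm (\<bar>X j om*Y j om\<bar>*(U j om)^2) \<le> norm (g om)"
   using order_trans[OF le abs_ge_self] by (intro AE_I2) (simp add: abs_mult)
 qed (use j in measurable)
 have "expectation (\<lambda>om. \<bar>X j om*Y j om\<bar>*(U j om)^2) \<le> expectation g"
  using i g le by (intro integral_mono) auto
 also have "... = real (card (near j))*(\<Sum>i\<in>near j. expectation (\<lambda>om. (\<bar>X j om\<bar>*(X i om)^2)*(\<bar>Y j om\<bar>*(Y i om)^2)))"
  unfolding g_def using near_product(1)[OF j jj _ jj]
  by (subst integral_mult_right_zero, subst Bochner_Integration.integral_sum) auto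
 also have "... \<le> real (card (near j))*(\<Sum>i\<in>near j. D * q)"
  using near_product(2)[OF j jj _ jj] by (intro mult_left_mono sum_mono) auto
 also have "... = (real (card (near j)))^2*(D * q)" by (simp add: power2_eq_square)
 also have "... \<le> (4*L+1)^2*(D * q)"
  using card_near[of j] D_ge_1 q_nonneg L_nonneg by (intro mult_right_mono power_mono) auto
 finally show "expectation (\<lambda>om. \<bar>X j om*Y j om\<bar>*(U j om)^2) \<le> (4*L+1)^2*(D * q)" by simp
qed

lemma replacement_moment:
 assumes j: "j \<in> I" and i: "i \<in> near j"
 shows "integrable M (\<lambda>om. \<bar>Y j om*Y i om\<bar>*\<bar>U j om\<bar>)"
  and "expectation (\<lambda>om. \<bar>Y j om*Y i om\<bar>*\<bar>U j om\<bar>) \<le> (4*L+1)*(D * q)"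
proof -
 define h where "h l om = (\<bar>X l om\<bar>*(\<bar>Y j om\<bar>*(Y i om)^2)+\<bar>X l om\<bar>*(\<bar>Y j om\<bar>*(Y l om)^2))/2" for l om
 define g where "g = (\<lambda>om. \<Sum>l\<in>near j. h l om)"
 have jj: "j \<in> near j" using j L_nonneg by (simp add: near_def)
 have h: "integrable M (h l)" and h_le: "expectation (h l) \<le> D * q" if "l \<in> near j" for l
  unfolding h_def using near_product(3,4)[OF j that i jj i] near_product(3,4)[OF j that i jj that] by auto
 have g: "integrable M g"
  unfolding g_def using h by (intro Bochner_Integration.integrable_sum) auto
 have le: "\<bar>Y j om*Y i om\<bar>*\<bar>U j om\<bar> \<le> g om" for om
 proof -
  have "\<bar>Y j om*Y i om\<bar>*\<bar>U j om\<bar> \<le> \<bar>Y j om*Y i om\<bar>*(\<Sum>l\<in>near j. \<bar>X l om*Y l om\<bar>)"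
   unfolding U_def by (intro mult_left_mono sum_abs) auto
  also have "... = (\<Sum>l\<in>near j. \<bar>X l om\<bar>*(\<bar>Y j om\<bar>*(\<bar>Y i om\<bar>*\<bar>Y l om\<bar>)))"
   by (simp add: sum_distrib_left abs_mult mult_ac)
  also have "... \<le> (\<Sum>l\<in>near j. \<bar>X l om\<bar>*(\<bar>Y j om\<bar>*(((Y i om)^2+(Y l om)^2)/2)))"
  proof (intro sum_mono mult_left_mono)
   fix l
   have "0 \<le> (\<bar>Y i om\<bar> - \<bar>Y l om\<bar>)^2" by simp
   then show "\<bar>Y i om\<bar>*\<bar>Y l om\<bar> \<le> ((Y i om)^2+(Y l om)^2)/2" by (simp add: power2_diff)
  qed auto
  also have "... = g om" unfolding g_def h_def by (simp add: algebra_simps add_divide_distrib)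
  finally show ?thesis .
 qed
 show ii: "integrable M (\<lambda>om. \<bar>Y j om*Y i om\<bar>*\<bar>U j om\<bar>)"
 proof (rule Bochner_Integration.integrable_bound[OF g])
  show "AE om in M. norm (\<bar>Y j om*Y i om\<bar>*\<bar>U j om\<bar>) \<le> norm (g om)"
   using order_trans[OF le abs_ge_self] by (intro AE_I2) (simp add: abs_mult)
 qed measurable
 have "expectation (\<lambda>om. \<bar>Y j om*Y i om\<bar>*\<bar>U j om\<bar>) \<le> expectation g"
  using ii g le by (intro integral_mono) auto
 also have "... = (\<Sum>l\<in>near j. expectation (h l))"
  unfolding g_def using h by (subst Bochner_Integration.integral_sum) auto
 also have "... \<le> (\<Sum>l\<in>near j. D * q)" using h_le by (intro sum_mono) auto
 also have "... = real (card (near j))*(D * q)" by simp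
 also have "... \<le> (4*L+1)*(D * q)"
  using card_near[of j] D_ge_1 q_nonneg by (intro mult_right_mono) auto
 finally show "expectation (\<lambda>om. \<bar>Y j om*Y i om\<bar>*\<bar>U j om\<bar>) \<le> (4*L+1)*(D * q)" by simp
qed

text \<open>\<open>T_away\<close> and \<open>Y j\<close> minus its nearby part do not see the innovations of \<open>X j\<close>. Expanding \<open>iexp (s T)\<close> around \<open>iexp (s T_away)\<close> leaves, by centring, only the first-order term.\<close>

lemma leave_out_step:
 assumes j: "j \<in> I"
 shows "cmod (expectation (\<lambda>om. complex_of_real (X j om*Y j om) * iexp (s*T om))
   - 2*\<i> * s*(\<Sum>i\<in>I. complex_of_real (\<sigma> j i) * expectation (\<lambda>om. complex_of_real (Y j om*Y i om) * iexp (s*T om))))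
  \<le> s^2*((4*L+1)^2*(D * q)*(2+4*S))"
proof -
 define e where "e om = iexp (s*T om)" for om
 define e' where "e' om = iexp (s*T_away j om)" for om
 define c where "c om = iexp (2 * s*U j om)" for om
 let ?xy = "\<lambda>om. complex_of_real (X j om*Y j om)"
 let ?yy = "\<lambda>i om. complex_of_real (Y j om*Y i om)"
 have e: "e om = e' om * c om" for om
  unfolding T_split[of om j] e_def e'_def c_def by (simp add: algebra_simps flip: exp_add)
 have [simp]: "cmod (e om) = 1" "cmod (e' om) = 1" for om
  unfolding e_def e'_def by simp_all
 have [measurable]: "e \<in> borel_measurable M" "e' \<in> borel_measurable M"
  unfolding e_def e'_def by measurable
 have Ixy: "integrable M (\<lambda>om. ?xy om * e om)" "integrable M (\<lambda>om. ?xy om * e' om)"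
  by (rule integrable_of_real_mult_unit[OF XY_integrable(1)[OF j j]]; simp)+
 have Iyy: "integrable M (\<lambda>om. ?yy i om * e om)" "integrable M (\<lambda>om. ?yy i om * e' om)" if "i \<in> I" for i
  by (rule integrable_of_real_mult_unit[OF XY_integrable(3)[OF j that]]; simp)+
 have Ixyxy: "integrable M (\<lambda>om. complex_of_real (X j om*Y j om*X i om*Y i om) * e' om)" if "i \<in> I" for i
  by (rule integrable_of_real_mult_unit[OF XY_integrable(2)[OF j that]]; simp)
 have xyU: "?xy om*U j om * e' om = (\<Sum>i\<in>near j. complex_of_real (X j om*Y j om*X i om*Y i om) * e' om)" for om
  unfolding U_def by (simp add: sum_distrib_left sum_distrib_right mult_ac)
 have IxyU: "integrable M (\<lambda>om. ?xy om*U j om * e' om)"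
  unfolding xyU using Ixyxy near_subset by (intro Bochner_Integration.integrable_sum) auto
 have ExyU: "expectation (\<lambda>om. ?xy om*U j om * e' om) = (\<Sum>i\<in>near j. complex_of_real (\<sigma> j i) * expectation (\<lambda>om. ?yy i om * e' om))"
  unfolding xyU using Ixyxy near_subset[of j] cov_term[OF j, of _ s, folded e'_def]
  by (subst Bochner_Integration.integral_sum) auto
 have first: "cmod (expectation (\<lambda>om. ?xy om * e om) - 2*\<i> * s * expectation (\<lambda>om. ?xy om*U j om * e' om))
   \<le> 2 * s^2*((4*L+1)^2*(D * q))"
 proof -
  let ?h = "\<lambda>om. ?xy om * e om - ?xy om * e' om - 2*\<i> * s*(?xy om*U j om * e' om)"
  have eq: "expectation (\<lambda>om. ?xy om * e om) - 2*\<i> * s * expectation (\<lambda>om. ?xy om*U j om * e' om) = expectation ?h"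
   using Ixy IxyU away_zero[OF j, of s, folded e'_def] by simp
  have "cmod (expectation ?h) \<le> expectation (\<lambda>om. 2 * s^2*(\<bar>X j om*Y j om\<bar>*(U j om)^2))"
  proof (rule norm_expectation_le)
   show "integrable M ?h" using Ixy IxyU by simp
   show "integrable M (\<lambda>om. 2 * s^2*(\<bar>X j om*Y j om\<bar>*(U j om)^2))" using remainder_moment(1)[OF j] by simp
   fix om
   have "?h om = ?xy om * e' om*(c om - 1 - \<i>*(2 * s*U j om))"
    unfolding e by (simp add: algebra_simps)
   then have "cmod (?h om) = \<bar>X j om*Y j om\<bar> * cmod (c om - 1 - \<i>*(2 * s*U j om))"
    by (simp add: norm_mult abs_mult)
   also have "... \<le> \<bar>X j om*Y j om\<bar>*((2 * s*U j om)^2/2)"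
    using norm_iexp_minus_linear_le[of "2 * s*U j om"] unfolding c_def by (intro mult_left_mono) auto
   also have "... = 2 * s^2*(\<bar>X j om*Y j om\<bar>*(U j om)^2)"
    by (simp add: power_mult_distrib)
   finally show "cmod (?h om) \<le> 2 * s^2*(\<bar>X j om*Y j om\<bar>*(U j om)^2)" .
  qed
  also have "... \<le> 2 * s^2*((4*L+1)^2*(D * q))"
   using remainder_moment(2)[OF j] unfolding integral_mult_right_zero by (rule mult_left_mono) simp
  finally show ?thesis unfolding eq .
 qed
 have second: "cmod (expectation (\<lambda>om. ?yy i om * e' om) - expectation (\<lambda>om. ?yy i om * e om)) \<le> 2*\<bar>s\<bar>*((4*L+1)*(D * q))"
  if i: "i \<in> near j" for i
 proof -
  have iI: "i \<in> I" using i near_subset by auto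
  have eq: "expectation (\<lambda>om. ?yy i om * e' om) - expectation (\<lambda>om. ?yy i om * e om) = expectation (\<lambda>om. ?yy i om * e' om - ?yy i om * e om)"
   using Iyy[OF iI] by simp
  have "cmod (expectation (\<lambda>om. ?yy i om * e' om - ?yy i om * e om)) \<le> expectation (\<lambda>om. 2*\<bar>s\<bar>*(\<bar>Y j om*Y i om\<bar>*\<bar>U j om\<bar>))"
  proof (rule norm_expectation_le)
   show "integrable M (\<lambda>om. ?yy i om * e' om - ?yy i om * e om)" using Iyy[OF iI] by simp
   show "integrable M (\<lambda>om. 2*\<bar>s\<bar>*(\<bar>Y j om*Y i om\<bar>*\<bar>U j om\<bar>))" using replacement_moment(1)[OF j i] by simp
   fix om
   have "?yy i om * e' om - ?yy i om * e om = - (?yy i om * e' om*(c om - 1))"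
    unfolding e by (simp add: algebra_simps)
   then have "cmod (?yy i om * e' om - ?yy i om * e om) = \<bar>Y j om*Y i om\<bar> * cmod (c om - 1)"
    by (simp only: norm_minus_cancel) (simp add: norm_mult abs_mult)
   also have "... \<le> \<bar>Y j om*Y i om\<bar>*\<bar>2 * s*U j om\<bar>"
    using norm_iexp_minus_1_le[of "2 * s*U j om"] unfolding c_def by (intro mult_left_mono) auto
   also have "... = 2*\<bar>s\<bar>*(\<bar>Y j om*Y i om\<bar>*\<bar>U j om\<bar>)" by (simp add: abs_mult)
   finally show "cmod (?yy i om * e' om - ?yy i om * e om) \<le> 2*\<bar>s\<bar>*(\<bar>Y j om*Y i om\<bar>*\<bar>U j om\<bar>)" .
  qed
  also have "... \<le> 2*\<bar>s\<bar>*((4*L+1)*(D * q))"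
   using replacement_moment(2)[OF j i] unfolding integral_mult_right_zero by (rule mult_left_mono) simp
  finally show ?thesis unfolding eq .
 qed
 have restrict: "(\<Sum>i\<in>I. complex_of_real (\<sigma> j i) * expectation (\<lambda>om. ?yy i om * e om))
   = (\<Sum>i\<in>near j. complex_of_real (\<sigma> j i) * expectation (\<lambda>om. ?yy i om * e om))"
 proof (intro sum.mono_neutral_right finite_I near_subset ballI)
  fix i assume "i \<in> I - near j"
  then have "\<sigma> j i = 0" using L_nonneg by (intro \<sigma>_far j) (auto simp: near_def)
  then show "complex_of_real (\<sigma> j i) * expectation (\<lambda>om. ?yy i om * e om) = 0" by simp
 qed
 have third: "cmod (\<Sum>i\<in>near j. complex_of_real (\<sigma> j i)*(expectation (\<lambda>om. ?yy i om * e' om) - expectation (\<lambda>om. ?yy i om * e om)))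
   \<le> S*(2*\<bar>s\<bar>*((4*L+1)*(D * q)))"
 proof -
  have Dq: "0 \<le> 2*\<bar>s\<bar>*((4*L+1)*(D * q))" using L_nonneg D_ge_1 q_nonneg by auto
  have "cmod (\<Sum>i\<in>near j. complex_of_real (\<sigma> j i)*(expectation (\<lambda>om. ?yy i om * e' om) - expectation (\<lambda>om. ?yy i om * e om)))
   \<le> (\<Sum>i\<in>near j. \<bar>\<sigma> j i\<bar>*(2*\<bar>s\<bar>*((4*L+1)*(D * q))))"
   using second by (intro order_trans[OF norm_sum] sum_mono) (auto simp: norm_mult intro!: mult_left_mono)
  also have "... \<le> (\<Sum>i\<in>I. \<bar>\<sigma> j i\<bar>*(2*\<bar>s\<bar>*((4*L+1)*(D * q))))"
   by (intro sum_mono2 finite_I near_subset mult_nonneg_nonneg[OF abs_ge_zero Dq])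
  also have "... \<le> S*(2*\<bar>s\<bar>*((4*L+1)*(D * q)))"
   unfolding sum_distrib_right[symmetric] using row_sum_\<sigma>[OF j] Dq by (intro mult_right_mono) auto
  finally show ?thesis .
 qed
 have dist: "(\<Sum>i\<in>near j. complex_of_real (\<sigma> j i)*(expectation (\<lambda>om. ?yy i om * e' om) - expectation (\<lambda>om. ?yy i om * e om)))
  = expectation (\<lambda>om. ?xy om*U j om * e' om) - (\<Sum>i\<in>I. complex_of_real (\<sigma> j i) * expectation (\<lambda>om. ?yy i om * e om))"
  unfolding restrict ExyU by (simp add: right_diff_distrib sum_subtractf)
 define A0 where "A0 = expectation (\<lambda>om. ?xy om * e om)"
 define A1 where "A1 = expectation (\<lambda>om. ?xy om*U j om * e' om)"
 define A2 where "A2 = (\<Sum>i\<in>I. complex_of_real (\<sigma> j i) * expectation (\<lambda>om. ?yy i om * e om))"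
 define w where "w = D * q"
 define R where "R = real_of_int (4*L+1)"
 have w: "0 \<le> w" using D_ge_1 q_nonneg by (simp add: w_def)
 have R: "1 \<le> R" using L_nonneg by (simp add: R_def)
 have first': "cmod (A0 - 2*\<i> * s*A1) \<le> 2 * s^2*(R^2 * w)"
  using first unfolding A0_def A1_def R_def w_def by simp
 have third': "cmod (A1 - A2) \<le> S*(2*\<bar>s\<bar>*(R * w))"
  using third unfolding dist A1_def A2_def R_def w_def by simp
 have "cmod (A0 - 2*\<i> * s*A2) \<le> cmod (A0 - 2*\<i> * s*A1)+cmod (2*\<i> * s*(A1 - A2))"
  by (rule order_trans[OF _ norm_triangle_ineq]) (simp add: algebra_simps)
 also have "cmod (2*\<i> * s*(A1 - A2)) = 2*\<bar>s\<bar> * cmod (A1 - A2)" by (simp add: norm_mult)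
 also have "cmod (A0 - 2*\<i> * s*A1)+2*\<bar>s\<bar> * cmod (A1 - A2)
   \<le> 2 * s^2*(R^2 * w)+2*\<bar>s\<bar>*(S*(2*\<bar>s\<bar>*(R * w)))"
  using first' third' by (intro add_mono mult_left_mono) auto
 also have "2*\<bar>s\<bar>*(S*(2*\<bar>s\<bar>*(R * w))) = 4 * s^2*S*(R*1 * w)"
  by (simp add: power2_eq_square)
 also have "2 * s^2*(R^2 * w)+4 * s^2*S*(R*1 * w) \<le> 2 * s^2*(R^2 * w)+4 * s^2*S*(R * R * w)"
  using R S_nonneg w by (intro add_left_mono mult_left_mono mult_right_mono) auto
 also have "... = s^2*(R^2 * w*(2+4*S))"
  by (simp add: algebra_simps power2_eq_square)
 finally show ?thesis unfolding A0_def A2_def R_def w_def e_def by simp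
qed

end

section \<open>Characteristic function of a quadratic form\<close>


text \<open>Multiplication by \<open>exp (\<tau> s ^ 2)\<close> turns the approximate equation into a bound on a derivative.\<close>

lemma near_gaussian_ode:
 fixes \<phi> \<phi>' :: "real => complex"
 assumes deriv: "\<And>u. (\<phi> has_vector_derivative \<phi>' u) (at u)" and "\<phi> 0 = 1"
  and near: "\<And>u. \<bar>u\<bar> \<le> \<bar>s\<bar> ==> cmod (\<phi>' u+complex_of_real (2*\<tau> * u)*\<phi> u) \<le> \<eta>"
 shows "cmod (\<phi> s - complex_of_real (exp (- \<tau> * s^2))) \<le> \<bar>s\<bar>*\<eta> * exp (2*\<bar>\<tau>\<bar> * s^2)"
proof -
 define \<psi> where "\<psi> u = exp (\<tau> * u^2) *\<^sub>R \<phi> u" for u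
 define \<psi>' where "\<psi>' u = exp (\<tau> * u^2) *\<^sub>R (\<phi>' u+complex_of_real (2*\<tau> * u)*\<phi> u)" for u
 have \<eta>: "0 \<le> \<eta>" by (rule order_trans[OF norm_ge_zero near[of s]]) simp
 have "(\<psi> has_vector_derivative \<psi>' u) (at u)" for u
 proof -
  have "((\<lambda>u. exp (\<tau> * u^2)) has_real_derivative exp (\<tau> * u^2)*(2*\<tau> * u)) (at u)"
   by (auto intro!: derivative_eq_intros)
  then have "(\<psi> has_vector_derivative (exp (\<tau> * u^2) *\<^sub>R \<phi>' u+(exp (\<tau> * u^2)*(2*\<tau> * u)) *\<^sub>R \<phi> u)) (at u)"
   unfolding \<psi>_def using deriv by (rule has_vector_derivative_scaleR)
  then show ?thesis by (simp add: \<psi>'_def scaleR_conv_of_real algebra_simps)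
 qed
 note vec = this
 have d: "(\<psi> has_derivative (\<lambda>h. h *\<^sub>R \<psi>' u)) (at u within {-\<bar>s\<bar>..\<bar>s\<bar>})" for u
  using vec[of u] unfolding has_vector_derivative_def by (rule has_derivative_at_withinI)
 have "norm (\<psi> s - \<psi> 0) \<le> (\<eta> * exp (\<bar>\<tau>\<bar> * s^2)) * norm (s - 0)"
 proof (rule differentiable_bound[of "{-\<bar>s\<bar>..\<bar>s\<bar>}"])
  fix u assume "u \<in> {-\<bar>s\<bar>..\<bar>s\<bar>}"
  then have u: "\<bar>u\<bar> \<le> \<bar>s\<bar>" by auto
  have "\<tau> * u^2 \<le> \<bar>\<tau>\<bar> * s^2"
   using u by (intro mult_mono) (auto simp: abs_le_square_iff)
  then have "cmod (\<psi>' u) \<le> exp (\<bar>\<tau>\<bar> * s^2)*\<eta>"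
   unfolding \<psi>'_def using near[OF u] by (simp add: mult_mono)
  then show "onorm (\<lambda>h. h *\<^sub>R \<psi>' u) \<le> \<eta> * exp (\<bar>\<tau>\<bar> * s^2)"
   using \<eta> by (intro onorm_bound) (simp_all add: mult.commute mult_left_mono)
 qed (use d in auto)
 then have le: "cmod (\<psi> s - 1) \<le> \<eta> * exp (\<bar>\<tau>\<bar> * s^2)*\<bar>s\<bar>"
  using assms(2) by (simp add: \<psi>_def)
 have "\<phi> s - complex_of_real (exp (- \<tau> * s^2)) = exp (- \<tau> * s^2) *\<^sub>R (\<psi> s - 1)"
 proof -
  have "complex_of_real (exp (- \<tau> * s^2)) * complex_of_real (exp (\<tau> * s^2)) = 1"
   by (simp flip: of_real_mult exp_add)
  then show ?thesis
   unfolding \<psi>_def scaleR_conv_of_real right_diff_distrib mult.assoc[symmetric] by simp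
 qed
 then have "cmod (\<phi> s - complex_of_real (exp (- \<tau> * s^2))) = exp (- \<tau> * s^2) * cmod (\<psi> s - 1)"
  by simp
 also have "... \<le> exp (\<bar>\<tau>\<bar> * s^2)*(\<eta> * exp (\<bar>\<tau>\<bar> * s^2)*\<bar>s\<bar>)"
 proof (intro mult_mono le)
  have "- \<tau> * s^2 \<le> \<bar>\<tau>\<bar> * s^2" by (intro mult_right_mono) auto
  then show "exp (- \<tau> * s^2) \<le> exp (\<bar>\<tau>\<bar> * s^2)" by simp
 qed auto
 also have "... = \<bar>s\<bar>*\<eta> * exp (2*\<bar>\<tau>\<bar> * s^2)"
  by (simp add: mult_ac flip: exp_add)
 finally show ?thesis .
qed

lemma (in prob_space) characteristic_derivative:
 fixes T :: "'a => real"
 assumes [measurable]: "T \<in> borel_measurable M" and T2: "integrable M (\<lambda>om. (T om)^2)"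
 shows "((\<lambda>s. expectation (\<lambda>om. iexp (s*T om))) has_vector_derivative
   \<i> * expectation (\<lambda>om. complex_of_real (T om) * iexp (s*T om))) (at s)"
proof -
 let ?\<phi> = "\<lambda>s. expectation (\<lambda>om. iexp (s*T om))"
 define e where "e s om = iexp (s*T om)" for s om
 define d where "d s = \<i> * expectation (\<lambda>om. complex_of_real (T om) * e s om)" for s
 define c where "c = expectation (\<lambda>om. (T om)^2)/2"
 have [measurable]: "e s \<in> borel_measurable M" for s unfolding e_def by measurable
 have n[simp]: "cmod (e s om) = 1" for s om by (simp add: e_def)
 have c: "0 \<le> c" unfolding c_def by simp
 have T1: "integrable M T" by (rule abs_expectation_square_le(1)[OF _ T2]) measurable
 have Ie: "integrable M (e s)" for s
  by (rule Bochner_Integration.integrable_bound[of M "\<lambda>_. 1 :: real"]) auto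
 have ITe: "integrable M (\<lambda>om. complex_of_real (T om) * e s om)" for s
  by (rule integrable_of_real_mult_unit[OF T1]; simp)
 have taylor: "cmod (?\<phi> (s+h) - ?\<phi> s - h *\<^sub>R d s) \<le> c * h^2" for h
 proof -
  let ?r = "\<lambda>om. e (s+h) om - e s om - h *\<^sub>R (\<i>*(complex_of_real (T om) * e s om))"
  have eq: "?\<phi> (s+h) - ?\<phi> s - h *\<^sub>R d s = expectation ?r"
   unfolding d_def e_def[symmetric] using Ie ITe by simp
  have "cmod (expectation ?r) \<le> expectation (\<lambda>om. (T om)^2/2 * h^2)"
  proof (rule norm_expectation_le)
   show "integrable M ?r" using Ie ITe by simp
   show "integrable M (\<lambda>om. (T om)^2/2 * h^2)" using T2 by simp
   fix om
   have "?r om = e s om*(iexp (h*T om) - 1 - \<i>*(h*T om))"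
    unfolding e_def by (simp add: algebra_simps scaleR_conv_of_real flip: exp_add)
   then have "cmod (?r om) = cmod (iexp (h*T om) - 1 - \<i>*(h*T om))"
    by (simp only: norm_mult n mult_1)
   also have "... \<le> (h*T om)^2/2" by (rule norm_iexp_minus_linear_le)
   finally show "cmod (?r om) \<le> (T om)^2/2 * h^2" by (simp add: power_mult_distrib mult.commute)
  qed
  also have "... = c * h^2" using T2 by (simp add: c_def)
  finally show ?thesis unfolding eq .
 qed
 have "(?\<phi> has_derivative (\<lambda>h. h *\<^sub>R d s)) (at s)"
 proof (rule has_derivativeI_sandwich[of 1])
  show "bounded_linear (\<lambda>h. h *\<^sub>R d s)" by (rule bounded_linear_scaleR_left)
  fix y :: real assume "y \<noteq> s"
  show "norm ((?\<phi> y - ?\<phi> s) - (y - s) *\<^sub>R d s)/norm (y - s) \<le> c*\<bar>y - s\<bar>"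
   using taylor[of "y - s"] \<open>y \<noteq> s\<close> by (simp add: divide_le_eq power2_eq_square mult.assoc)
 next
  show "((\<lambda>y. c*\<bar>y - s\<bar>) \<longlongrightarrow> 0) (at s)"
   by (auto intro!: tendsto_eq_intros)
 qed simp
 then show ?thesis by (simp add: has_vector_derivative_def d_def e_def)
qed

context dependent_array
begin

lemma covariance_operator_bound:
 "(\<Sum>j\<in>I. (\<Sum>i\<in>I. \<sigma> j i * x i)^2) \<le> S^2*(\<Sum>i\<in>I. (x i)^2)"
proof -
 define c where "c j = (\<Sum>i\<in>I. \<sigma> j i * x i)" for j
 define C where "C = (\<Sum>j\<in>I. (c j)^2)"
 have "C/S = (\<Sum>j\<in>I. \<Sum>i\<in>I. \<sigma> j i*(c j/S) * x i)"
  unfolding C_def c_def by (simp add: power2_eq_square sum_divide_distrib sum_distrib_left mult_ac)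
 also have "... \<le> (\<Sum>j\<in>I. \<Sum>i\<in>I. \<bar>\<sigma> j i\<bar>*\<bar>c j/S\<bar>*\<bar>x i\<bar>)"
 proof (intro sum_mono)
  fix j i
  show "\<sigma> j i*(c j/S) * x i \<le> \<bar>\<sigma> j i\<bar>*\<bar>c j/S\<bar>*\<bar>x i\<bar>"
   using abs_ge_self[of "\<sigma> j i*(c j/S) * x i"] by (simp add: abs_mult)
 qed
 also have "... \<le> S*((\<Sum>j\<in>I. (c j/S)^2)+(\<Sum>i\<in>I. (x i)^2))/2"
  by (rule schur_bound) auto
 also have "(\<Sum>j\<in>I. (c j/S)^2) = C/S^2"
  unfolding C_def by (simp add: power_divide sum_divide_distrib)
 finally have "C/S \<le> S*(C/S^2+(\<Sum>i\<in>I. (x i)^2))/2" .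
 then have "C \<le> S^2*(\<Sum>i\<in>I. (x i)^2)"
  using S_pos by (simp add: field_simps power2_eq_square)
 then show ?thesis by (simp add: C_def c_def)
qed

text \<open>The band near the diagonal is controlled by the size of the coefficients, the rest by their Hilbert-Schmidt norm.\<close>

lemma centered_form_abs_le:
 assumes b: "\<And>j k. j \<in> I ==> k \<in> I ==> \<bar>b j k\<bar> \<le> \<beta>"
  and hs: "(\<Sum>j\<in>I. \<Sum>k\<in>I. (b j k)^2) \<le> h"
 shows "integrable M (\<lambda>om. \<Sum>j\<in>I. \<Sum>k\<in>I. b j k*(X j om*X k om - \<sigma> j k))"
  and "expectation (\<lambda>om. \<bar>\<Sum>j\<in>I. \<Sum>k\<in>I. b j k*(X j om*X k om - \<sigma> j k)\<bar>)
   \<le> sqrt (real (card I)*(24*L+1)*(10*L+1)^2*\<beta>^2*D)+sqrt (2*S^2 * h)"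
proof -
 let ?P = "{(k, k'). k \<in> I \<and> k' \<in> I \<and> 5*L < \<bar>k - k'\<bar>}"
 define B where "B om = (\<Sum>j\<in>I. \<Sum>k\<in>{k \<in> I. \<bar>k - j\<bar> \<le> 5*L}. b j k*(X j om*X k om - \<sigma> j k))" for om
 define F where "F om = (\<Sum>(k, k')\<in>?P. b k k'*(X k om*X k' om))" for om
 have split: "(\<Sum>j\<in>I. \<Sum>k\<in>I. b j k*(X j om*X k om - \<sigma> j k)) = B om + F om" for om
 proof -
  have "F om = (\<Sum>(j, k)\<in>Sigma I (\<lambda>j. {k \<in> I. 5*L < \<bar>k - j\<bar>}). b j k*(X j om*X k om))"
   unfolding F_def by (intro sum.cong) (auto simp: abs_minus_commute)
  also have "... = (\<Sum>j\<in>I. \<Sum>k\<in>{k \<in> I. 5*L < \<bar>k - j\<bar>}. b j k*(X j om*X k om))"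
   using finite_I by (subst sum.Sigma) auto
  also have "... = (\<Sum>j\<in>I. \<Sum>k\<in>{k \<in> I. 5*L < \<bar>k - j\<bar>}. b j k*(X j om*X k om - \<sigma> j k))"
  proof (intro sum.cong refl)
   fix j k assume "j \<in> I" "k \<in> {k \<in> I. 5*L < \<bar>k - j\<bar>}"
   then have "\<sigma> j k = 0" using L_nonneg by (intro \<sigma>_far) auto
   then show "b j k*(X j om*X k om) = b j k*(X j om*X k om - \<sigma> j k)" by simp
  qed
  finally have F: "F om = (\<Sum>j\<in>I. \<Sum>k\<in>{k \<in> I. 5*L < \<bar>k - j\<bar>}. b j k*(X j om*X k om - \<sigma> j k))" .
  have I: "I = {k \<in> I. \<bar>k - j\<bar> \<le> 5*L} \<union> {k \<in> I. 5*L < \<bar>k - j\<bar>}" for j by auto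
  have "(\<Sum>k\<in>I. g k) = (\<Sum>k\<in>{k \<in> I. \<bar>k - j\<bar> \<le> 5*L}. g k)+(\<Sum>k\<in>{k \<in> I. 5*L < \<bar>k - j\<bar>}. g k)"
   for g :: "int => real" and j
   using finite_I by (subst I[of j], intro sum.union_disjoint) auto
  then show ?thesis unfolding B_def F sum.distrib[symmetric] by (intro sum.cong) auto
 qed
 have L5: "0 \<le> 5*L" using L_nonneg by simp
 have B2: "integrable M (\<lambda>om. (B om)^2)"
   "expectation (\<lambda>om. (B om)^2) \<le> real (card I)*(24*L+1)*(10*L+1)^2*\<beta>^2*D"
  unfolding B_def using band_form_square[OF L5 b] by simp_all
 have F2: "integrable M (\<lambda>om. (F om)^2)" "expectation (\<lambda>om. (F om)^2) \<le> 2*S^2 * h"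
  unfolding F_def using far_form_square[of ?P b] mult_left_mono[OF hs, of "2*S^2"] by auto
 have [measurable]: "B \<in> borel_measurable M"
  unfolding B_def by (intro borel_measurable_sum borel_measurable_times borel_measurable_diff X_measurable borel_measurable_const) auto
 have [measurable]: "F \<in> borel_measurable M"
  unfolding F_def case_prod_beta by (intro borel_measurable_sum borel_measurable_times X_measurable borel_measurable_const) auto
 note B = abs_expectation_square_le[OF _ B2(1)] and F = abs_expectation_square_le[OF _ F2(1)]
 show "integrable M (\<lambda>om. \<Sum>j\<in>I. \<Sum>k\<in>I. b j k*(X j om*X k om - \<sigma> j k))"
  unfolding split using B(1) F(1) by simp
 have "expectation (\<lambda>om. \<bar>B om + F om\<bar>) \<le> expectation (\<lambda>om. \<bar>B om\<bar>+\<bar>F om\<bar>)"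
  using B(1) F(1) by (intro integral_mono) auto
 also have "... = expectation (\<lambda>om. \<bar>B om\<bar>)+expectation (\<lambda>om. \<bar>F om\<bar>)"
  using B(1) F(1) by simp
 also have "... \<le> sqrt (real (card I)*(24*L+1)*(10*L+1)^2*\<beta>^2*D)+sqrt (2*S^2 * h)"
  using B(2) F(2) B2(2) F2(2) by (intro add_mono real_le_rsqrt) auto
 finally show "expectation (\<lambda>om. \<bar>\<Sum>j\<in>I. \<Sum>k\<in>I. b j k*(X j om*X k om - \<sigma> j k)\<bar>)
   \<le> sqrt (real (card I)*(24*L+1)*(10*L+1)^2*\<beta>^2*D)+sqrt (2*S^2 * h)"
  unfolding split .
qed

end

context far_form
begin

definition \<tau> :: real where
 "\<tau> = (\<Sum>j\<in>I. \<Sum>i\<in>I. \<sigma> j i*(\<Sum>k\<in>I. \<Sum>l\<in>I. a j k * a i l*\<sigma> k l))"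

definition V :: "'a => real" where
 "V om = (\<Sum>j\<in>I. \<Sum>i\<in>I. \<sigma> j i*(Y j om*Y i om))"

definition B :: "int => int => real" where
 "B k l = (\<Sum>j\<in>I. \<Sum>i\<in>I. \<sigma> j i * a j k * a i l)"

lemma V_centered: "V om - \<tau> = (\<Sum>k\<in>I. \<Sum>l\<in>I. B k l*(X k om*X l om - \<sigma> k l))"
proof -
 have swap: "(\<Sum>j\<in>I. \<Sum>i\<in>I. \<Sum>k\<in>I. \<Sum>l\<in>I. g j i k l) = (\<Sum>k\<in>I. \<Sum>l\<in>I. \<Sum>j\<in>I. \<Sum>i\<in>I. g j i k l)"
  for g :: "int => int => int => int => real"
 proof -
  have "(\<Sum>j\<in>I. \<Sum>i\<in>I. \<Sum>k\<in>I. \<Sum>l\<in>I. g j i k l) = (\<Sum>j\<in>I. \<Sum>k\<in>I. \<Sum>i\<in>I. \<Sum>l\<in>I. g j i k l)"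
   by (intro sum.cong refl sum.swap)
  also have "... = (\<Sum>k\<in>I. \<Sum>j\<in>I. \<Sum>l\<in>I. \<Sum>i\<in>I. g j i k l)"
   by (subst sum.swap) (intro sum.cong refl sum.swap)
  also have "... = (\<Sum>k\<in>I. \<Sum>l\<in>I. \<Sum>j\<in>I. \<Sum>i\<in>I. g j i k l)"
   by (intro sum.cong refl sum.swap)
  finally show ?thesis .
 qed
 have YY: "Y j om*Y i om = (\<Sum>k\<in>I. \<Sum>l\<in>I. a j k*X k om*(a i l*X l om))" for i j
  unfolding Y_def by (rule sum_product)
 have "V om = (\<Sum>j\<in>I. \<Sum>i\<in>I. \<Sum>k\<in>I. \<Sum>l\<in>I. \<sigma> j i*(a j k*X k om*(a i l*X l om)))"
  unfolding V_def YY by (simp only: sum_distrib_left)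
 also have "... = (\<Sum>j\<in>I. \<Sum>i\<in>I. \<Sum>k\<in>I. \<Sum>l\<in>I. \<sigma> j i * a j k * a i l*(X k om*X l om))"
  by (simp only: mult_ac)
 also have "... = (\<Sum>k\<in>I. \<Sum>l\<in>I. B k l*(X k om*X l om))"
  unfolding B_def sum_distrib_right by (rule swap)
 finally have V: "V om = (\<Sum>k\<in>I. \<Sum>l\<in>I. B k l*(X k om*X l om))" .
 have "\<tau> = (\<Sum>j\<in>I. \<Sum>i\<in>I. \<Sum>k\<in>I. \<Sum>l\<in>I. \<sigma> j i*(a j k * a i l*\<sigma> k l))"
  unfolding \<tau>_def by (simp only: sum_distrib_left)
 also have "... = (\<Sum>j\<in>I. \<Sum>i\<in>I. \<Sum>k\<in>I. \<Sum>l\<in>I. \<sigma> j i * a j k * a i l*\<sigma> k l)"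
  by (simp only: mult.assoc)
 also have "... = (\<Sum>k\<in>I. \<Sum>l\<in>I. B k l*\<sigma> k l)"
  unfolding B_def sum_distrib_right by (rule swap)
 finally have "\<tau> = (\<Sum>k\<in>I. \<Sum>l\<in>I. B k l*\<sigma> k l)" .
 with V show ?thesis by (simp only: right_diff_distrib sum_subtractf)
qed

lemma B_le:
 assumes "k \<in> I" "l \<in> I"
 shows "\<bar>B k l\<bar> \<le> S * v"
proof -
 have "\<bar>B k l\<bar> \<le> (\<Sum>j\<in>I. \<Sum>i\<in>I. \<bar>\<sigma> j i\<bar>*\<bar>a j k\<bar>*\<bar>a i l\<bar>)"
  unfolding B_def by (intro order_trans[OF sum_abs] sum_mono) (simp add: abs_mult)
 also have "... \<le> S*((\<Sum>j\<in>I. (a j k)^2)+(\<Sum>i\<in>I. (a i l)^2))/2"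
  by (rule schur_bound) auto
 also have "... \<le> S*(v+v)/2"
  using a_row[OF assms(1)] a_row[OF assms(2)] S_nonneg
  by (intro divide_right_mono mult_left_mono add_mono) (auto simp: a_sym[of _ k] a_sym[of _ l])
 finally show ?thesis by simp
qed

lemma B_hs:
 assumes op: "\<And>x. (\<Sum>j\<in>I. (\<Sum>k\<in>I. a j k * x k)^2) \<le> \<kappa>*(\<Sum>k\<in>I. (x k)^2)" and "0 \<le> \<kappa>"
 shows "(\<Sum>k\<in>I. \<Sum>l\<in>I. (B k l)^2) \<le> \<kappa>*(S^2*(real (card I) * v))"
proof -
 have "(\<Sum>k\<in>I. (B k l)^2) \<le> \<kappa>*(S^2*(\<Sum>i\<in>I. (a i l)^2))" for l
 proof -
  have "B k l = (\<Sum>j\<in>I. a k j*(\<Sum>i\<in>I. \<sigma> j i * a i l))" for k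
   unfolding B_def by (simp add: sum_distrib_left mult_ac a_sym[of k])
  then have "(\<Sum>k\<in>I. (B k l)^2) \<le> \<kappa>*(\<Sum>j\<in>I. (\<Sum>i\<in>I. \<sigma> j i * a i l)^2)"
   using op[of "\<lambda>j. \<Sum>i\<in>I. \<sigma> j i * a i l"] by simp
  also have "... \<le> \<kappa>*(S^2*(\<Sum>i\<in>I. (a i l)^2))"
   using assms(2) by (intro mult_left_mono covariance_operator_bound)
  finally show ?thesis .
 qed
 then have "(\<Sum>l\<in>I. \<Sum>k\<in>I. (B k l)^2) \<le> (\<Sum>l\<in>I. \<kappa>*(S^2*(\<Sum>i\<in>I. (a l i)^2)))"
  by (intro sum_mono) (simp add: a_sym)
 also have "... \<le> (\<Sum>l\<in>I. \<kappa>*(S^2 * v))"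
  using a_row assms(2) by (intro sum_mono mult_left_mono) auto
 finally show ?thesis by (subst sum.swap) (simp add: mult_ac)
qed

text \<open>The weight \<open>V\<close> in the integration by parts is again a quadratic form, and its Hilbert-Schmidt norm is small because the operator norm of the coefficients is.\<close>

lemma V_concentration:
 assumes op: "\<And>x. (\<Sum>j\<in>I. (\<Sum>k\<in>I. a j k * x k)^2) \<le> \<kappa>*(\<Sum>k\<in>I. (x k)^2)" and "0 \<le> \<kappa>"
 shows "integrable M (\<lambda>om. V om - \<tau>)"
  and "expectation (\<lambda>om. \<bar>V om - \<tau>\<bar>)
   \<le> sqrt (real (card I)*(24*L+1)*(10*L+1)^2*(S * v)^2*D)
    + sqrt (2*S^2*(\<kappa>*(S^2*(real (card I) * v))))"
 unfolding V_centered
 using centered_form_abs_le[of B "S * v", OF B_le B_hs[OF assms]] by auto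

lemma T_square_integrable: "integrable M (\<lambda>om. (T om)^2)"
proof -
 have "(T om)^2 = (\<Sum>j\<in>I. \<Sum>i\<in>I. X j om*Y j om*X i om*Y i om)" for om
  unfolding T_def power2_eq_square sum_product by (simp add: mult.assoc)
 then show ?thesis using XY_integrable(2) by simp
qed

definition remainder :: real where
 "remainder = (4 * real_of_int L+1)^2*(D * q)*(2+4*S)"

text \<open>Gaussian integration by parts up to an error, with \<open>V\<close> replaced by its mean \<open>\<tau>\<close>.\<close>

lemma stein_identity:
 assumes V: "integrable M (\<lambda>om. V om - \<tau>)" "expectation (\<lambda>om. \<bar>V om - \<tau>\<bar>) \<le> \<delta>"
 shows "cmod (expectation (\<lambda>om. complex_of_real (T om) * iexp (s*T om))
   - 2*\<i> * s*\<tau> * expectation (\<lambda>om. iexp (s*T om)))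
  \<le> real (card I)*(s^2 * remainder)+2*\<bar>s\<bar>*\<delta>"
proof -
 define e where "e om = iexp (s*T om)" for om
 have [measurable]: "e \<in> borel_measurable M" unfolding e_def by measurable
 have n[simp]: "cmod (e om) = 1" for om by (simp add: e_def)
 have Ie: "integrable M e"
  by (rule Bochner_Integration.integrable_bound[of M "\<lambda>_. 1 :: real"]) auto
 have Ixy: "integrable M (\<lambda>om. complex_of_real (X j om*Y j om) * e om)" if "j \<in> I" for j
  by (rule integrable_of_real_mult_unit[OF XY_integrable(1)[OF that that]]; simp)
 have Iyy: "integrable M (\<lambda>om. complex_of_real (Y j om*Y i om) * e om)" if "j \<in> I" "i \<in> I" for i j
  by (rule integrable_of_real_mult_unit[OF XY_integrable(3)[OF that]]; simp)
 have IV: "integrable M (\<lambda>om. complex_of_real (V om - \<tau>) * e om)"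
  by (rule integrable_of_real_mult_unit[OF V(1)]; simp)
 define A where "A j = expectation (\<lambda>om. complex_of_real (X j om*Y j om) * e om)" for j
 define C where "C j = (\<Sum>i\<in>I. complex_of_real (\<sigma> j i) * expectation (\<lambda>om. complex_of_real (Y j om*Y i om) * e om))" for j
 have T: "complex_of_real (T om) * e om = (\<Sum>j\<in>I. complex_of_real (X j om*Y j om) * e om)" for om
  unfolding T_def by (simp add: sum_distrib_right)
 have ET: "expectation (\<lambda>om. complex_of_real (T om) * e om) = (\<Sum>j\<in>I. A j)"
  unfolding T A_def using Ixy by (subst Bochner_Integration.integral_sum) auto
 have Ve: "complex_of_real (V om) * e om = (\<Sum>j\<in>I. \<Sum>i\<in>I. complex_of_real (\<sigma> j i)*(complex_of_real (Y j om*Y i om) * e om))" for om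
  unfolding V_def by (simp add: sum_distrib_right mult.assoc)
 have EV: "expectation (\<lambda>om. complex_of_real (V om) * e om) = (\<Sum>j\<in>I. C j)"
  unfolding Ve C_def using Iyy by (simp add: Bochner_Integration.integral_sum del: of_real_mult)
 have IVe: "integrable M (\<lambda>om. complex_of_real (V om) * e om)"
  unfolding Ve using Iyy by (intro Bochner_Integration.integrable_sum integrable_mult_right) auto
 have CV: "(\<Sum>j\<in>I. C j) - \<tau> * expectation e = expectation (\<lambda>om. complex_of_real (V om - \<tau>) * e om)"
  unfolding EV[symmetric] using IVe Ie by (simp add: left_diff_distrib)
 have "cmod ((\<Sum>j\<in>I. C j) - \<tau> * expectation e) \<le> expectation (\<lambda>om. \<bar>V om - \<tau>\<bar>)"
  unfolding CV using V(1) by (intro norm_expectation_le IV) (auto simp: norm_mult simp flip: of_real_diff)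
 then have conc: "cmod ((\<Sum>j\<in>I. C j) - \<tau> * expectation e) \<le> \<delta>" using V(2) by linarith
 have step: "cmod (A j - 2*\<i> * s*C j) \<le> s^2 * remainder" if "j \<in> I" for j
  using leave_out_step[OF that, of s] unfolding A_def C_def e_def remainder_def by simp
 have "cmod ((\<Sum>j\<in>I. A j) - 2*\<i> * s*(\<Sum>j\<in>I. C j)) \<le> (\<Sum>j\<in>I. s^2 * remainder)"
  unfolding sum_distrib_left sum_subtractf[symmetric]
  using step by (intro order_trans[OF norm_sum] sum_mono) auto
 then have 1: "cmod ((\<Sum>j\<in>I. A j) - 2*\<i> * s*(\<Sum>j\<in>I. C j)) \<le> real (card I)*(s^2 * remainder)"
  by simp
 have "cmod ((\<Sum>j\<in>I. A j) - 2*\<i> * s*\<tau> * expectation e)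
  \<le> cmod ((\<Sum>j\<in>I. A j) - 2*\<i> * s*(\<Sum>j\<in>I. C j))+cmod (2*\<i> * s*((\<Sum>j\<in>I. C j) - \<tau> * expectation e))"
  by (rule order_trans[OF _ norm_triangle_ineq]) (simp add: algebra_simps)
 also have "cmod (2*\<i> * s*((\<Sum>j\<in>I. C j) - \<tau> * expectation e)) = 2*\<bar>s\<bar> * cmod ((\<Sum>j\<in>I. C j) - \<tau> * expectation e)"
  by (simp add: norm_mult)
 also have "cmod ((\<Sum>j\<in>I. A j) - 2*\<i> * s*(\<Sum>j\<in>I. C j))+2*\<bar>s\<bar> * cmod ((\<Sum>j\<in>I. C j) - \<tau> * expectation e)
  \<le> real (card I)*(s^2 * remainder)+2*\<bar>s\<bar>*\<delta>"
  using 1 conc by (intro add_mono mult_left_mono) auto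
 finally show ?thesis unfolding ET[symmetric] e_def by simp
qed

theorem characteristic_function_bound:
 assumes op: "\<And>x. (\<Sum>j\<in>I. (\<Sum>k\<in>I. a j k * x k)^2) \<le> \<kappa>*(\<Sum>k\<in>I. (x k)^2)" and "0 \<le> \<kappa>"
 shows "cmod (expectation (\<lambda>om. iexp (s*T om)) - complex_of_real (exp (- \<tau> * s^2)))
  \<le> \<bar>s\<bar>*(real (card I)*(s^2 * remainder)+2*\<bar>s\<bar> *
    (sqrt (real (card I)*(24*L+1)*(10*L+1)^2*(S * v)^2*D)
     + sqrt (2*S^2*(\<kappa>*(S^2*(real (card I) * v)))))) * exp (2*\<bar>\<tau>\<bar> * s^2)"
proof (rule near_gaussian_ode)
 let ?d = "sqrt (real (card I)*(24*L+1)*(10*L+1)^2*(S * v)^2*D)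
     + sqrt (2*S^2*(\<kappa>*(S^2*(real (card I) * v))))"
 show "((\<lambda>s. expectation (\<lambda>om. iexp (s*T om))) has_vector_derivative
   \<i> * expectation (\<lambda>om. complex_of_real (T om) * iexp (u*T om))) (at u)" for u
  by (rule characteristic_derivative[OF T_measurable T_square_integrable])
 show "expectation (\<lambda>om. iexp (0*T om)) = 1" by (simp add: prob_space)
 fix u :: real assume u: "\<bar>u\<bar> \<le> \<bar>s\<bar>"
 define A where "A = expectation (\<lambda>om. complex_of_real (T om) * iexp (u*T om))"
 define E where "E = expectation (\<lambda>om. iexp (u*T om))"
 have r0: "0 \<le> remainder" unfolding remainder_def using D_ge_1 q_nonneg S_nonneg by simp
 have d0: "0 \<le> ?d"
  using D_ge_1 L_nonneg assms(2) v_pos by (intro add_nonneg_nonneg real_sqrt_ge_zero) auto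
 have "\<i>*A+complex_of_real (2*\<tau> * u)*E = \<i>*(A - 2*\<i> * u*\<tau>*E)"
  by (simp add: algebra_simps)
 then have "cmod (\<i>*A+complex_of_real (2*\<tau> * u)*E) = cmod (A - 2*\<i> * u*\<tau>*E)"
  by (simp add: norm_mult)
 also have "... \<le> real (card I)*(u^2 * remainder)+2*\<bar>u\<bar>*?d"
  unfolding A_def E_def by (rule stein_identity[OF V_concentration[OF assms]])
 also have "... \<le> real (card I)*(s^2 * remainder)+2*\<bar>s\<bar>*?d"
  using u r0 d0 by (intro add_mono mult_mono mult_left_mono mult_right_mono) (auto simp: abs_le_square_iff)
 finally show "cmod (\<i> * expectation (\<lambda>om. complex_of_real (T om) * iexp (u*T om))
   + complex_of_real (2*\<tau> * u) * expectation (\<lambda>om. iexp (u*T om)))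
  \<le> real (card I)*(s^2 * remainder)+2*\<bar>s\<bar>*?d"
  unfolding A_def E_def .
qed

end

section \<open>Averaging out the remote past\<close>


lemma weighted_power4_sum_le:
 fixes u w :: "'b => real"
 assumes w: "\<And>i. i \<in> S ==> 0 < w i"
 shows "(\<Sum>i\<in>S. u i) ^ 4 \<le> (\<Sum>i\<in>S. w i) ^ 3*(\<Sum>i\<in>S. u i ^ 4/w i ^ 3)"
proof -
 let ?W = "\<Sum>i\<in>S. w i"
 have W: "0 \<le> ?W" using w by (intro sum_nonneg) (auto intro: less_imp_le)
 have cs: "(\<Sum>i\<in>S. z i)^2 \<le> ?W*(\<Sum>i\<in>S. (z i)^2/w i)" for z :: "'b => real"
 proof -
  have "(\<Sum>i\<in>S. z i) = (\<Sum>i\<in>S. sqrt (w i)*(z i/sqrt (w i)))"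
   using w by (intro sum.cong) (auto simp: less_imp_neq[symmetric])
  also have "...^2 \<le> (\<Sum>i\<in>S. (sqrt (w i))^2)*(\<Sum>i\<in>S. (z i/sqrt (w i))^2)"
   by (rule Cauchy_Schwarz_ineq_sum)
  also have "(\<Sum>i\<in>S. (sqrt (w i))^2) = ?W"
   using w by (intro sum.cong) (auto simp: less_imp_le)
  also have "(\<Sum>i\<in>S. (z i/sqrt (w i))^2) = (\<Sum>i\<in>S. (z i)^2/w i)"
   using w by (intro sum.cong) (auto simp: less_imp_le power_divide)
  finally show ?thesis .
 qed
 have "(\<Sum>i\<in>S. u i) ^ 4 = ((\<Sum>i\<in>S. u i)^2)^2" by simp
 also have "... \<le> (?W*(\<Sum>i\<in>S. (u i)^2/w i))^2"
  by (intro power_mono cs) auto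
 also have "... = ?W^2*(\<Sum>i\<in>S. (u i)^2/w i)^2" by (simp add: power_mult_distrib)
 also have "... \<le> ?W^2*(?W*(\<Sum>i\<in>S. ((u i)^2/w i)^2/w i))"
  by (intro mult_left_mono cs) auto
 also have "(\<Sum>i\<in>S. ((u i)^2/w i)^2/w i) = (\<Sum>i\<in>S. u i ^ 4/w i ^ 3)"
  by (intro sum.cong) (auto simp: power_divide power2_eq_square power3_eq_cube power4_eq_xxxx)
 also have "?W^2*(?W*(\<Sum>i\<in>S. u i ^ 4/w i ^ 3)) = ?W ^ 3*(\<Sum>i\<in>S. u i ^ 4/w i ^ 3)"
  by (simp add: power2_eq_square power3_eq_cube mult.assoc)
 finally show ?thesis .
qed

lemma (in prob_space) nn_jensen_power4:
 fixes D :: "'a => real"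
 assumes D: "integrable M D"
 shows "ennreal (expectation D ^ 4) \<le> (\<integral>\<^sup>+ y. ennreal (D y ^ 4) \<partial>M)"
proof (cases "(\<integral>\<^sup>+ y. ennreal (D y ^ 4) \<partial>M) = \<infinity>")
 case True
 then show ?thesis by simp
next
 case False
 note [measurable] = borel_measurable_integrable[OF D]
 have D4: "integrable M (\<lambda>y. D y ^ 4)"
  using False by (intro integrableI_nonneg) (auto simp: top.not_eq_extremum)
 have D2: "integrable M (\<lambda>y. (D y)^2)" by (rule integrable_power_le4[OF _ D4]) auto
 have 1: "(expectation D)^2 \<le> expectation (\<lambda>y. (D y)^2)"
 proof -
  have "\<bar>expectation D\<bar> \<le> expectation (\<lambda>y. \<bar>D y\<bar>)" by (rule integral_abs_bound)
  then have "\<bar>expectation D\<bar>\<^sup>2 \<le> (expectation (\<lambda>y. \<bar>D y\<bar>))^2" by (intro power_mono) auto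
  then show ?thesis using abs_expectation_square_le(2)[OF _ D2] by simp
 qed
 have 2: "(expectation (\<lambda>y. (D y)^2))^2 \<le> expectation (\<lambda>y. D y ^ 4)"
  using abs_expectation_square_le(2)[of "\<lambda>y. (D y)^2"] D4 by simp
 have "expectation D ^ 4 = ((expectation D)^2)^2" by simp
 also have "... \<le> (expectation (\<lambda>y. (D y)^2))^2" using 1 by (intro power_mono) auto
 also note 2
 finally have "ennreal (expectation D ^ 4) \<le> ennreal (expectation (\<lambda>y. D y ^ 4))" by (rule ennreal_leI)
 also have "... = (\<integral>\<^sup>+ y. ennreal (D y ^ 4) \<partial>M)"
  using D4 by (intro nn_integral_eq_integral[symmetric]) auto
 finally show ?thesis .
qed

text \<open>The law of the past is a countable product. Replacing all entries from lag \<open>k\<close> on by an independent copy and integrating them out gives the conditional expectation without conditioning.\<close>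

locale iid_past =
 fixes \<nu> :: "real measure"
 assumes prob_\<nu>: "prob_space \<nu>" and sets_\<nu> [measurable_cong]: "sets \<nu> = sets borel"
begin

definition P :: "(nat => real) measure" where
 "P = (\<Pi>\<^sub>M i\<in>UNIV. \<nu>)"

sublocale \<nu>: prob_space \<nu> by (rule prob_\<nu>)

sublocale seq: product_prob_space "\<lambda>_. \<nu>" "UNIV :: nat set" ..

sublocale P: prob_space P unfolding P_def by (rule seq.prob_space_axioms)

sublocale PP: pair_prob_space P P ..

lemma space_\<nu> [simp]: "space \<nu> = UNIV"
 using sets_eq_imp_space_eq[OF sets_\<nu>] by simp

lemma space_P [simp]: "space P = UNIV"
 by (simp add: P_def space_PiM PiE_UNIV_domain)

lemma prob_UNIV [simp]: "measure P UNIV = 1"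
 using P.prob_space by simp

lemma sets_P: "sets P = sets (\<Pi>\<^sub>M i\<in>UNIV. borel)"
 unfolding P_def by (intro sets_PiM_cong) (simp_all add: sets_\<nu>)

lemma component_measurable [measurable]: "(\<lambda>x. x i) \<in> borel_measurable P"
 using measurable_component_singleton[of i UNIV "\<lambda>_. \<nu>"] unfolding P_def
 by (simp add: measurable_cong_sets[OF refl sets_\<nu>])

lemma measurable_P_I:
 assumes "\<And>i. (\<lambda>x. f x i) \<in> borel_measurable N"
 shows "f \<in> measurable N P"
proof -
 have "(\<lambda>x. \<lambda>i\<in>UNIV. f x i) \<in> measurable N (\<Pi>\<^sub>M i\<in>UNIV. \<nu>)"
  using assms by (intro measurable_restrict) (simp add: measurable_cong_sets[OF refl sets_\<nu>])
 then show ?thesis by (simp add: P_def restrict_UNIV)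
qed

definition mix :: "nat => (nat => real) => (nat => real) => nat => real" where
 "mix k x y = (\<lambda>i. if i < k then x i else y i)"

lemma measurable_mix [measurable]: "(\<lambda>p. mix k (fst p) (snd p)) \<in> measurable (P \<Otimes>\<^sub>M P) P"
 unfolding mix_def by (rule measurable_P_I) (measurable)

lemma measurable_mix2 [measurable]: "mix k x \<in> measurable P P"
 unfolding mix_def by (rule measurable_P_I) measurable

lemma measurable_upd [measurable]: "(\<lambda>p. (snd p)(k := fst p)) \<in> measurable (\<nu> \<Otimes>\<^sub>M P) P"
 by (rule measurable_P_I) (auto simp: fun_upd_def)

lemma mix_law: "distr (P \<Otimes>\<^sub>M P) P (\<lambda>p. mix k (fst p) (snd p)) = P"
 unfolding P_def
proof (rule seq.PiM_eq)
 fix J :: "nat set" and F :: "nat => real set"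
 assume J: "finite J" "J \<subseteq> UNIV" and F: "\<And>j. j \<in> J ==> F j \<in> sets \<nu>"
 let ?emb = "\<lambda>J. prod_emb UNIV (\<lambda>_. \<nu>) J (\<Pi>\<^sub>E j\<in>J. F j)"
 have sets: "?emb J \<in> sets P" if "finite J" "\<And>j. j \<in> J ==> F j \<in> sets \<nu>" for J
  unfolding P_def using that by (intro sets_PiM_I) auto
 have vim: "(\<lambda>p. mix k (fst p) (snd p)) -` ?emb J \<inter> space (P \<Otimes>\<^sub>M P) = ?emb (J \<inter> {..<k}) \<times> ?emb (J - {..<k})"
 proof (rule set_eqI)
  fix p :: "(nat => real) \<times> (nat => real)"
  obtain a b where p: "p = (a, b)" by (cases p)
  have "p \<in> (\<lambda>p. mix k (fst p) (snd p)) -` ?emb J \<inter> space (P \<Otimes>\<^sub>M P) \<longleftrightarrow> (\<forall>i\<in>J. mix k a b i \<in> F i)"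
   by (auto simp: p prod_emb_def space_pair_measure PiE_iff extensional_def)
  also have "... \<longleftrightarrow> (\<forall>i\<in>J \<inter> {..<k}. a i \<in> F i) \<and> (\<forall>i\<in>J - {..<k}. b i \<in> F i)"
   unfolding mix_def by (auto split: if_splits)
  also have "... \<longleftrightarrow> p \<in> ?emb (J \<inter> {..<k}) \<times> ?emb (J - {..<k})"
   by (auto simp: p prod_emb_def PiE_iff extensional_def)
  finally show "p \<in> (\<lambda>p. mix k (fst p) (snd p)) -` ?emb J \<inter> space (P \<Otimes>\<^sub>M P)
    \<longleftrightarrow> p \<in> ?emb (J \<inter> {..<k}) \<times> ?emb (J - {..<k})" .
 qed
 have "emeasure (distr (P \<Otimes>\<^sub>M P) P (\<lambda>p. mix k (fst p) (snd p))) (?emb J)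
   = emeasure (P \<Otimes>\<^sub>M P) (?emb (J \<inter> {..<k}) \<times> ?emb (J - {..<k}))"
  using sets[OF J(1) F] by (simp add: emeasure_distr vim)
 also have "... = emeasure P (?emb (J \<inter> {..<k})) * emeasure P (?emb (J - {..<k}))"
  using J F by (intro P.emeasure_pair_measure_Times sets) auto
 also have "... = (\<Prod>j\<in>J \<inter> {..<k}. emeasure \<nu> (F j))*(\<Prod>j\<in>J - {..<k}. emeasure \<nu> (F j))"
  unfolding P_def using J F by (subst (1 2) seq.emeasure_PiM_emb) auto
 also have "... = (\<Prod>j\<in>J. emeasure \<nu> (F j))"
  using J(1) by (subst prod.Int_Diff[of J _ "{..<k}"]) auto
 finally show "emeasure (distr (Pi\<^sub>M UNIV (\<lambda>i. \<nu>) \<Otimes>\<^sub>M Pi\<^sub>M UNIV (\<lambda>i. \<nu>)) (Pi\<^sub>M UNIV (\<lambda>i. \<nu>)) (\<lambda>p. mix k (fst p) (snd p))) (?emb J)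
  = (\<Prod>j\<in>J. emeasure \<nu> (F j))" unfolding P_def .
qed simp

lemma upd_law: "distr (\<nu> \<Otimes>\<^sub>M P) P (\<lambda>p. (snd p)(k := fst p)) = P"
 using distr_pair_PiM_eq_PiM[of UNIV "\<lambda>_. \<nu>" k] prob_\<nu>
 by (simp add: P_def case_prod_beta')

lemma nn_integral_mix:
 assumes [measurable]: "f \<in> borel_measurable P"
 shows "(\<integral>\<^sup>+ x. \<integral>\<^sup>+ y. f (mix k x y) \<partial>P \<partial>P) = (\<integral>\<^sup>+ x. f x \<partial>P)"
proof -
 have "(\<integral>\<^sup>+ x. f x \<partial>P) = (\<integral>\<^sup>+ x. f x \<partial>distr (P \<Otimes>\<^sub>M P) P (\<lambda>p. mix k (fst p) (snd p)))"
  by (simp add: mix_law)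
 also have "... = (\<integral>\<^sup>+ p. f (mix k (fst p) (snd p)) \<partial>(P \<Otimes>\<^sub>M P))"
  by (rule nn_integral_distr) measurable
 also have "... = (\<integral>\<^sup>+ x. \<integral>\<^sup>+ y. f (mix k x y) \<partial>P \<partial>P)"
  by (subst P.nn_integral_fst[symmetric]) auto
 finally show ?thesis by simp
qed

lemma nn_integral_upd:
 assumes [measurable]: "f \<in> borel_measurable P"
 shows "(\<integral>\<^sup>+ z. \<integral>\<^sup>+ y. f (y(k := z)) \<partial>P \<partial>\<nu>) = (\<integral>\<^sup>+ x. f x \<partial>P)"
proof -
 have "(\<integral>\<^sup>+ x. f x \<partial>P) = (\<integral>\<^sup>+ x. f x \<partial>distr (\<nu> \<Otimes>\<^sub>M P) P (\<lambda>p. (snd p)(k := fst p)))"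
  by (simp add: upd_law)
 also have "... = (\<integral>\<^sup>+ p. f ((snd p)(k := fst p)) \<partial>(\<nu> \<Otimes>\<^sub>M P))"
  by (rule nn_integral_distr) measurable
 also have "... = (\<integral>\<^sup>+ z. \<integral>\<^sup>+ y. f (y(k := z)) \<partial>P \<partial>\<nu>)"
  by (subst P.nn_integral_fst[symmetric]) auto
 finally show ?thesis by simp
qed

lemma integrable_mix:
 fixes H :: "(nat => real) => real"
 assumes H: "integrable P H"
 shows "integrable (P \<Otimes>\<^sub>M P) (\<lambda>p. H (mix k (fst p) (snd p)))"
  and "(\<integral>p. H (mix k (fst p) (snd p)) \<partial>(P \<Otimes>\<^sub>M P)) = (\<integral>x. H x \<partial>P)"
proof -
 note [measurable] = borel_measurable_integrable[OF H]
 have "integrable (distr (P \<Otimes>\<^sub>M P) P (\<lambda>p. mix k (fst p) (snd p))) H" using H by (simp add: mix_law)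
 then show "integrable (P \<Otimes>\<^sub>M P) (\<lambda>p. H (mix k (fst p) (snd p)))"
  by (subst (asm) integrable_distr_eq) auto
 have "(\<integral>x. H x \<partial>P) = (\<integral>x. H x \<partial>distr (P \<Otimes>\<^sub>M P) P (\<lambda>p. mix k (fst p) (snd p)))"
  by (simp add: mix_law)
 also have "... = (\<integral>p. H (mix k (fst p) (snd p)) \<partial>(P \<Otimes>\<^sub>M P))"
  by (rule integral_distr) measurable
 finally show "(\<integral>p. H (mix k (fst p) (snd p)) \<partial>(P \<Otimes>\<^sub>M P)) = (\<integral>x. H x \<partial>P)" by simp
qed

definition trunc :: "nat => ((nat => real) => real) => (nat => real) => real" where
 "trunc k H x = (\<integral>y. H (mix k x y) \<partial>P)"

lemma trunc_cong: "(\<And>i. i < k ==> x i = x' i) ==> trunc k H x = trunc k H x'"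
 unfolding trunc_def mix_def by (intro arg_cong2[where f = "\<lambda>a b. integral\<^sup>L a b"] ext arg_cong[of _ _ H] refl) auto

lemma trunc_0: "trunc 0 H x = (\<integral>y. H y \<partial>P)"
 by (simp add: trunc_def mix_def)

lemma trunc_measurable [measurable]:
 assumes [measurable]: "H \<in> borel_measurable P"
 shows "trunc k H \<in> borel_measurable P"
 unfolding trunc_def by measurable

lemma trunc_integrable:
 assumes H: "integrable P H"
 shows "integrable P (trunc k H)" and "(\<integral>x. trunc k H x \<partial>P) = (\<integral>x. H x \<partial>P)"
  and "AE x in P. integrable P (\<lambda>y. H (mix k x y))"
proof -
 have i: "integrable (P \<Otimes>\<^sub>M P) (\<lambda>(x, y). H (mix k x y))"
  using integrable_mix(1)[OF H] by (simp add: case_prod_beta')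
 show "integrable P (trunc k H)" unfolding trunc_def by (rule PP.integrable_fst[OF i])
 show "AE x in P. integrable P (\<lambda>y. H (mix k x y))" by (rule PP.AE_integrable_fst[OF i])
 show "(\<integral>x. trunc k H x \<partial>P) = (\<integral>x. H x \<partial>P)"
  unfolding trunc_def using PP.integral_fst[OF i] integrable_mix(2)[OF H] by (simp add: case_prod_beta')
qed

text \<open>Passing from \<open>k\<close> to \<open>k + 1\<close> retained lags averages a single replacement, which is what the coupling coefficients measure.\<close>

lemma trunc_step:
 assumes H: "integrable P H"
 shows "(\<integral>\<^sup>+ x. ennreal ((trunc (Suc k) H x - trunc k H x) ^ 4) \<partial>P)
  \<le> (\<integral>\<^sup>+ z. \<integral>\<^sup>+ x. ennreal ((H x - H (x(k := z))) ^ 4) \<partial>P \<partial>\<nu>)"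
proof -
 note [measurable] = borel_measurable_integrable[OF H]
 define \<Phi> where "\<Phi> w z = ennreal ((H w - H (w(k := z))) ^ 4)" for w z
 have [measurable]: "(\<lambda>p. H ((fst p)(k := snd p))) \<in> borel_measurable (P \<Otimes>\<^sub>M \<nu>)"
 proof -
  have "(\<lambda>p. (fst p)(k := snd p)) \<in> measurable (P \<Otimes>\<^sub>M \<nu>) P"
   by (rule measurable_P_I) (auto simp: fun_upd_def)
  then show ?thesis by measurable
 qed
 have \<Phi>[measurable]: "(\<lambda>p. \<Phi> (fst p) (snd p)) \<in> borel_measurable (P \<Otimes>\<^sub>M \<nu>)"
  unfolding \<Phi>_def by measurable
 have mixk: "mix k x y = (mix (Suc k) x y)(k := y k)" for x y
  by (auto simp: mix_def fun_eq_iff)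
 have mixs: "mix (Suc k) x (y(k := z)) = mix (Suc k) x y" for x y z
  by (auto simp: mix_def fun_eq_iff)
 have "AE x in P. ennreal ((trunc (Suc k) H x - trunc k H x) ^ 4) \<le> (\<integral>\<^sup>+ y. \<Phi> (mix (Suc k) x y) (y k) \<partial>P)"
  using trunc_integrable(3)[OF H, of "Suc k"] trunc_integrable(3)[OF H, of k]
 proof eventually_elim
  case (elim x)
  then have "trunc (Suc k) H x - trunc k H x = (\<integral>y. H (mix (Suc k) x y) - H (mix k x y) \<partial>P)"
   by (simp add: trunc_def)
  then show ?case
   using P.nn_jensen_power4[of "\<lambda>y. H (mix (Suc k) x y) - H (mix k x y)"] elim
   by (simp add: \<Phi>_def flip: mixk)
 qed
 then have "(\<integral>\<^sup>+ x. ennreal ((trunc (Suc k) H x - trunc k H x) ^ 4) \<partial>P)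
   \<le> (\<integral>\<^sup>+ x. \<integral>\<^sup>+ y. \<Phi> (mix (Suc k) x y) (y k) \<partial>P \<partial>P)"
  by (rule nn_integral_mono_AE)
 also have "... = (\<integral>\<^sup>+ x. \<integral>\<^sup>+ z. \<integral>\<^sup>+ y. \<Phi> (mix (Suc k) x y) z \<partial>P \<partial>\<nu> \<partial>P)"
 proof (rule nn_integral_cong)
  fix x
  have m: "(\<lambda>y. \<Phi> (mix (Suc k) x y) (y k)) \<in> borel_measurable P"
  proof -
   have "(\<lambda>y. (mix (Suc k) x y, y k)) \<in> measurable P (P \<Otimes>\<^sub>M \<nu>)" by measurable
   from measurable_compose[OF this \<Phi>] show ?thesis by simp
  qed
  show "(\<integral>\<^sup>+ y. \<Phi> (mix (Suc k) x y) (y k) \<partial>P) = (\<integral>\<^sup>+ z. \<integral>\<^sup>+ y. \<Phi> (mix (Suc k) x y) z \<partial>P \<partial>\<nu>)"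
   unfolding nn_integral_upd[OF m, of k, symmetric] by (simp add: mixs)
 qed
 also have "... = (\<integral>\<^sup>+ z. \<integral>\<^sup>+ x. \<integral>\<^sup>+ y. \<Phi> (mix (Suc k) x y) z \<partial>P \<partial>P \<partial>\<nu>)"
 proof -
  interpret Q: pair_sigma_finite P \<nu> ..
  have "(\<lambda>p. \<integral>\<^sup>+ y. \<Phi> (mix (Suc k) (fst p) y) (snd p) \<partial>P) \<in> borel_measurable (P \<Otimes>\<^sub>M \<nu>)"
  proof (rule P.borel_measurable_nn_integral)
   have "(\<lambda>q. (mix (Suc k) (fst (fst q)) (snd q), snd (fst q))) \<in> measurable ((P \<Otimes>\<^sub>M \<nu>) \<Otimes>\<^sub>M P) (P \<Otimes>\<^sub>M \<nu>)"
   proof (intro measurable_Pair)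
    show "(\<lambda>q. mix (Suc k) (fst (fst q)) (snd q)) \<in> measurable ((P \<Otimes>\<^sub>M \<nu>) \<Otimes>\<^sub>M P) P"
     unfolding mix_def by (rule measurable_P_I) measurable
   qed measurable
   from measurable_compose[OF this \<Phi>]
   show "(\<lambda>(p, y). \<Phi> (mix (Suc k) (fst p) y) (snd p)) \<in> borel_measurable ((P \<Otimes>\<^sub>M \<nu>) \<Otimes>\<^sub>M P)"
    by (simp add: case_prod_beta')
  qed
  from Q.Fubini'[of "\<lambda>x z. \<integral>\<^sup>+ y. \<Phi> (mix (Suc k) x y) z \<partial>P"] this show ?thesis
   by (simp add: case_prod_beta')
 qed
 also have "... = (\<integral>\<^sup>+ z. \<integral>\<^sup>+ x. \<Phi> x z \<partial>P \<partial>\<nu>)"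
 proof (rule nn_integral_cong)
  fix z
  have "(\<lambda>w. (w, z)) \<in> measurable P (P \<Otimes>\<^sub>M \<nu>)" by measurable
  from measurable_compose[OF this \<Phi>] have "(\<lambda>w. \<Phi> w z) \<in> borel_measurable P" by simp
  then show "(\<integral>\<^sup>+ x. \<integral>\<^sup>+ y. \<Phi> (mix (Suc k) x y) z \<partial>P \<partial>P) = (\<integral>\<^sup>+ x. \<Phi> x z \<partial>P)"
   by (rule nn_integral_mix)
 qed
 finally show ?thesis unfolding \<Phi>_def .
qed

definition finitary :: "nat => (nat => real) set => bool" where
 "finitary k B \<longleftrightarrow> B \<in> sets P \<and> (\<forall>x y. (\<forall>i<k. x i = y i) \<longrightarrow> (x \<in> B \<longleftrightarrow> y \<in> B))"

lemma finitary_mono: "finitary k B ==> k \<le> l ==> finitary l B"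
 unfolding finitary_def by auto

text \<open>Sets depending on finitely many lags generate the product measure, hence approximate every event.\<close>

lemma finitary_approximation:
 assumes "A \<in> sets P"
 shows "\<forall>e>0. \<exists>k B. finitary k B \<and> measure P (sym_diff A B) < e"
proof -
 define gen where "gen = {{f \<in> UNIV. f i \<in> A} | i A. A \<in> sets \<nu>} \<inter> (UNIV :: (nat => real) set set)"
 have "sets P = sigma_sets UNIV gen"
  unfolding P_def sets_PiM_single gen_def by (simp add: PiE_UNIV_domain)
 with assms have "A \<in> sigma_sets UNIV gen" by simp
 then show ?thesis
 proof (induction rule: sigma_sets.induct)
  case (Basic a)
  then obtain i A where a: "a = {f. f i \<in> A}" "A \<in> sets \<nu>" unfolding gen_def by auto
  have "a \<in> sets P" unfolding a(1) using a(2) sets_\<nu> measurable_sets[OF component_measurable[of i], of A]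
   by (simp add: vimage_def)
  then have "finitary (Suc i) a" unfolding finitary_def a(1) by auto
  then show ?case by (intro allI impI exI[of _ "Suc i"] exI[of _ a]) auto
 next
  case Empty
  show ?case by (intro allI impI exI[of _ 0] exI[of _ "{}"]) (auto simp: finitary_def)
 next
  case (Compl a)
  show ?case
  proof (intro allI impI)
   fix e :: real assume "0 < e"
   then obtain k B where B: "finitary k B" "measure P (sym_diff a B) < e" using Compl by blast
   have "sym_diff (UNIV - a) (- B) = sym_diff a B" by auto
   moreover have "finitary k (- B)" using B(1) sets.compl_sets[of B P] unfolding finitary_def
    by (auto simp: Compl_eq_Diff_UNIV)
   ultimately show "\<exists>k B. finitary k B \<and> measure P (sym_diff (UNIV - a) B) < e" using B(2) by metis
  qed
 next
  case (Union a)
  have a: "a i \<in> sets P" for i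
   using Union.hyps \<open>sets P = sigma_sets UNIV gen\<close> by auto
  show ?case
  proof (intro allI impI)
   fix e :: real assume e: "0 < e"
   have "(\<lambda>n. measure P (\<Union>i<n. a i)) \<longlonglongrightarrow> measure P (\<Union>n. \<Union>i<n. a i)"
   proof (rule P.finite_Lim_measure_incseq)
    show "incseq (\<lambda>n. \<Union>i<n. a i)" unfolding incseq_def by (intro allI impI UN_mono) auto
   qed (use a in auto)
   also have "(\<Union>n. \<Union>i<n. a i) = (\<Union>i. a i)" by auto
   finally have "\<forall>\<^sub>F n in sequentially. dist (measure P (\<Union>i<n. a i)) (measure P (\<Union>i. a i)) < e/2"
    using e by (intro tendstoD) auto
   then obtain n where n: "dist (measure P (\<Union>i<n. a i)) (measure P (\<Union>i. a i)) < e/2"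
    by (auto simp: eventually_sequentially)
   define d where "d = e/(2*(real n+1))"
   have d: "0 < d" using e by (simp add: d_def)
   have "\<forall>i. \<exists>k B. finitary k B \<and> measure P (sym_diff (a i) B) < d" using Union.IH d by blast
   then obtain k B where B: "\<And>i. finitary (k i) (B i)" "\<And>i. measure P (sym_diff (a i) (B i)) < d" by metis
   define K where "K = Max (k ` {..n})"
   have "finitary K (B i)" if "i < n" for i
    using B(1)[of i] that by (rule_tac finitary_mono[of "k i"]) (auto simp: K_def)
   then have BK: "B i \<in> sets P" "\<And>x y. (\<forall>j<K. x j = y j) ==> x \<in> B i \<longleftrightarrow> y \<in> B i" if "i < n" for i
    using that unfolding finitary_def by blast+
   have fin: "finitary K (\<Union>i<n. B i)"
    unfolding finitary_def
   proof (intro conjI allI impI)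
    show "(\<Union>i<n. B i) \<in> sets P" using BK(1) by (intro sets.finite_UN) auto
    fix x y :: "nat => real" assume "\<forall>i<K. x i = y i"
    then have "x \<in> B i \<longleftrightarrow> y \<in> B i" if "i < n" for i using BK(2)[OF that] by blast
    then show "x \<in> (\<Union>i<n. B i) \<longleftrightarrow> y \<in> (\<Union>i<n. B i)" by auto
   qed
   have Bs: "B i \<in> sets P" for i using B(1) by (auto simp: finitary_def)
   have "sym_diff (\<Union>i. a i) (\<Union>i<n. B i) \<subseteq> ((\<Union>i. a i) - (\<Union>i<n. a i)) \<union> (\<Union>i<n. sym_diff (a i) (B i))"
    by blast
   then have "measure P (sym_diff (\<Union>i. a i) (\<Union>i<n. B i)) \<le> measure P (((\<Union>i. a i) - (\<Union>i<n. a i)) \<union> (\<Union>i<n. sym_diff (a i) (B i)))"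
    using a Bs by (intro P.finite_measure_mono) (auto intro!: sets.Un sets.Diff sets.finite_UN sets.countable_UN)
   also have "... \<le> measure P ((\<Union>i. a i) - (\<Union>i<n. a i))+measure P (\<Union>i<n. sym_diff (a i) (B i))"
    using a Bs by (intro measure_Un_le) (auto intro!: sets.Un sets.Diff sets.finite_UN sets.countable_UN)
   also have "measure P ((\<Union>i. a i) - (\<Union>i<n. a i)) = measure P (\<Union>i. a i) - measure P (\<Union>i<n. a i)"
    using a by (intro P.finite_measure_Diff) auto
   also have "... < e/2" using n unfolding dist_real_def by linarith
   also have "measure P (\<Union>i<n. sym_diff (a i) (B i)) \<le> (\<Sum>i<n. measure P (sym_diff (a i) (B i)))"
    using a Bs by (intro P.finite_measure_subadditive_finite) auto
   also have "... \<le> (\<Sum>i<n. d)" using B(2) by (intro sum_mono less_imp_le)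
   also have "... \<le> e/2" using e by (simp add: d_def field_simps)
   finally show "\<exists>k B'. finitary k B' \<and> measure P (sym_diff (\<Union>i. a i) B') < e"
    using fin by auto
  qed
 qed
qed

lemma L1_mix_tendsto:
 fixes H :: "(nat => real) => real"
 assumes "integrable P H"
 shows "(\<lambda>k. \<integral>p. \<bar>H (mix k (fst p) (snd p)) - H (fst p)\<bar> \<partial>(P \<Otimes>\<^sub>M P)) \<longlonglongrightarrow> 0"
 using assms
proof (induction rule: integrable_induct)
 case (base A c)
 note [measurable] = base(1)
 let ?I = "\<lambda>B. indicator B :: (nat => real) => real"
 show ?case
 proof (rule LIMSEQ_I)
  fix e :: real assume e: "0 < e"
  define d where "d = e/(\<bar>c\<bar>+1)/2"
  have d: "0 < d" using e by (simp add: d_def)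
  obtain K B where B: "finitary K B" "measure P (sym_diff A B) < d"
   using finitary_approximation[OF base(1)] d by blast
  then have [measurable]: "B \<in> sets P" by (auto simp: finitary_def)
  have i: "integrable P (\<lambda>x. \<bar>?I A x - ?I B x\<bar>)"
   by (rule P.integrable_const_bound[of _ 1]) (auto split: split_indicator)
  have AB: "(\<integral>x. \<bar>?I A x - ?I B x\<bar> \<partial>P) = measure P (sym_diff A B)"
  proof -
   have "(\<integral>x. \<bar>?I A x - ?I B x\<bar> \<partial>P) = (\<integral>x. ?I (sym_diff A B) x \<partial>P)"
    by (intro Bochner_Integration.integral_cong) (auto split: split_indicator)
   then show ?thesis by simp
  qed
  have "(\<integral>p. \<bar>?I A (mix k (fst p) (snd p)) *\<^sub>R c - ?I A (fst p) *\<^sub>R c\<bar> \<partial>(P \<Otimes>\<^sub>M P)) < e" if k: "K \<le> k" for k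
  proof -
   have Bk: "?I B (mix k x y) = ?I B x" for x y
   proof -
    have "\<forall>i<K. mix k x y i = x i" using k by (auto simp: mix_def)
    then have "mix k x y \<in> B \<longleftrightarrow> x \<in> B" using B(1) unfolding finitary_def by blast
    then show ?thesis by (simp add: indicator_def)
   qed
   have "(\<integral>p. \<bar>?I A (mix k (fst p) (snd p)) *\<^sub>R c - ?I A (fst p) *\<^sub>R c\<bar> \<partial>(P \<Otimes>\<^sub>M P))
    \<le> (\<integral>p. \<bar>c\<bar>*(\<bar>?I A (mix k (fst p) (snd p)) - ?I B (mix k (fst p) (snd p))\<bar>+\<bar>?I A (fst p) - ?I B (fst p)\<bar>) \<partial>(P \<Otimes>\<^sub>M P))"
   proof (intro integral_mono)
    show "integrable (P \<Otimes>\<^sub>M P) (\<lambda>p. \<bar>?I A (mix k (fst p) (snd p)) *\<^sub>R c - ?I A (fst p) *\<^sub>R c\<bar>)"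
     by (rule PP.integrable_const_bound[of _ "\<bar>c\<bar>"]) (auto split: split_indicator)
    show "integrable (P \<Otimes>\<^sub>M P) (\<lambda>p. \<bar>c\<bar>*(\<bar>?I A (mix k (fst p) (snd p)) - ?I B (mix k (fst p) (snd p))\<bar>+\<bar>?I A (fst p) - ?I B (fst p)\<bar>))"
     by (rule PP.integrable_const_bound[of _ "\<bar>c\<bar>*2"]) (auto split: split_indicator)
    fix p :: "(nat => real) \<times> (nat => real)"
    show "\<bar>?I A (mix k (fst p) (snd p)) *\<^sub>R c - ?I A (fst p) *\<^sub>R c\<bar>
     \<le> \<bar>c\<bar>*(\<bar>?I A (mix k (fst p) (snd p)) - ?I B (mix k (fst p) (snd p))\<bar>+\<bar>?I A (fst p) - ?I B (fst p)\<bar>)"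
     unfolding Bk by (auto split: split_indicator)
   qed
   also have "... = \<bar>c\<bar>*((\<integral>p. \<bar>?I A (mix k (fst p) (snd p)) - ?I B (mix k (fst p) (snd p))\<bar> \<partial>(P \<Otimes>\<^sub>M P))+(\<integral>p. \<bar>?I A (fst p) - ?I B (fst p)\<bar> \<partial>(P \<Otimes>\<^sub>M P)))"
    using integrable_mix(1)[OF i, of k] PP.integrable_fst'[of "\<lambda>p. \<bar>?I A (fst p) - ?I B (fst p)\<bar>"]
    by (subst integral_mult_right_zero, subst Bochner_Integration.integral_add)
     (auto intro!: PP.integrable_const_bound[of _ 1] split: split_indicator)
   also have "(\<integral>p. \<bar>?I A (mix k (fst p) (snd p)) - ?I B (mix k (fst p) (snd p))\<bar> \<partial>(P \<Otimes>\<^sub>M P)) = measure P (sym_diff A B)"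
    using integrable_mix(2)[OF i, of k] AB by simp
   also have "(\<integral>p. \<bar>?I A (fst p) - ?I B (fst p)\<bar> \<partial>(P \<Otimes>\<^sub>M P)) = measure P (sym_diff A B)"
   proof -
    have "integrable (P \<Otimes>\<^sub>M P) (\<lambda>(x, y). \<bar>?I A x - ?I B x\<bar>)"
     by (rule PP.integrable_const_bound[of _ 1]) (auto split: split_indicator)
    from PP.integral_fst[OF this] show ?thesis using AB by (simp add: case_prod_beta' P.prob_space)
   qed
   also have "\<bar>c\<bar>*(measure P (sym_diff A B)+measure P (sym_diff A B)) \<le> \<bar>c\<bar>*(d+d)"
    using B(2) by (intro mult_left_mono) auto
   also have "d+d = e/(\<bar>c\<bar>+1)" by (simp only: d_def field_sum_of_halves)
   also have "\<bar>c\<bar>*(e/(\<bar>c\<bar>+1)) < e" using e by (simp add: pos_divide_less_eq algebra_simps)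
   finally show ?thesis .
  qed
  then show "\<exists>no. \<forall>k\<ge>no. norm ((\<integral>p. \<bar>?I A (mix k (fst p) (snd p)) *\<^sub>R c - ?I A (fst p) *\<^sub>R c\<bar> \<partial>(P \<Otimes>\<^sub>M P)) - 0) < e"
   by (intro exI[of _ K]) auto
 qed
next
 case (add f g)
 have int: "integrable (P \<Otimes>\<^sub>M P) (\<lambda>p. \<bar>h (mix k (fst p) (snd p)) - h (fst p)\<bar>)" if "integrable P h" for h :: "(nat => real) => real" and k
 proof -
  have "integrable (P \<Otimes>\<^sub>M P) (\<lambda>p. h (fst p))"
   using integrable_mix(1)[OF that, of 0] PP.integrable_product_swap_iff[of "\<lambda>p. h (snd p)"]
   by (simp add: mix_def case_prod_beta')
  then show ?thesis using integrable_mix(1)[OF that, of k] by auto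
 qed
 show ?case
 proof (rule tendsto_sandwich[OF _ _ tendsto_const])
  show "(\<lambda>k. (\<integral>p. \<bar>f (mix k (fst p) (snd p)) - f (fst p)\<bar> \<partial>(P \<Otimes>\<^sub>M P))+(\<integral>p. \<bar>g (mix k (fst p) (snd p)) - g (fst p)\<bar> \<partial>(P \<Otimes>\<^sub>M P))) \<longlonglongrightarrow> 0"
   using tendsto_add[OF add.IH] by simp
  show "\<forall>\<^sub>F k in sequentially. (\<integral>p. \<bar>(f (mix k (fst p) (snd p))+g (mix k (fst p) (snd p))) - (f (fst p)+g (fst p))\<bar> \<partial>(P \<Otimes>\<^sub>M P))
   \<le> (\<integral>p. \<bar>f (mix k (fst p) (snd p)) - f (fst p)\<bar> \<partial>(P \<Otimes>\<^sub>M P))+(\<integral>p. \<bar>g (mix k (fst p) (snd p)) - g (fst p)\<bar> \<partial>(P \<Otimes>\<^sub>M P))"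
  proof (intro always_eventually allI)
   fix k
   have "(\<integral>p. \<bar>(f (mix k (fst p) (snd p))+g (mix k (fst p) (snd p))) - (f (fst p)+g (fst p))\<bar> \<partial>(P \<Otimes>\<^sub>M P))
    \<le> (\<integral>p. \<bar>f (mix k (fst p) (snd p)) - f (fst p)\<bar>+\<bar>g (mix k (fst p) (snd p)) - g (fst p)\<bar> \<partial>(P \<Otimes>\<^sub>M P))"
    using int[of f k] int[of g k] int[of "\<lambda>x. f x+g x" k] add.hyps
    by (intro integral_mono) auto
   then show "(\<integral>p. \<bar>(f (mix k (fst p) (snd p))+g (mix k (fst p) (snd p))) - (f (fst p)+g (fst p))\<bar> \<partial>(P \<Otimes>\<^sub>M P))
   \<le> (\<integral>p. \<bar>f (mix k (fst p) (snd p)) - f (fst p)\<bar> \<partial>(P \<Otimes>\<^sub>M P))+(\<integral>p. \<bar>g (mix k (fst p) (snd p)) - g (fst p)\<bar> \<partial>(P \<Otimes>\<^sub>M P))"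
    using int[of f k] int[of g k] add.hyps by simp
  qed
 qed auto
next
 case (lim f s)
 have fstint: "integrable (P \<Otimes>\<^sub>M P) (\<lambda>p. h (fst p))" "(\<integral>p. h (fst p) \<partial>(P \<Otimes>\<^sub>M P)) = (\<integral>x. h x \<partial>P)"
  if "integrable P h" for h :: "(nat => real) => real"
 proof -
  show 1: "integrable (P \<Otimes>\<^sub>M P) (\<lambda>p. h (fst p))"
   using integrable_mix(1)[OF that, of 0] PP.integrable_product_swap_iff[of "\<lambda>p. h (snd p)"]
   by (simp add: mix_def case_prod_beta')
  have "integrable (P \<Otimes>\<^sub>M P) (\<lambda>(x, y). h x)" using 1 by (simp add: case_prod_beta')
  from PP.integral_fst[OF this] show "(\<integral>p. h (fst p) \<partial>(P \<Otimes>\<^sub>M P)) = (\<integral>x. h x \<partial>P)"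
   by (simp add: case_prod_beta' P.prob_space)
 qed
 have int: "integrable (P \<Otimes>\<^sub>M P) (\<lambda>p. \<bar>h (mix k (fst p) (snd p)) - h (fst p)\<bar>)" if "integrable P h" for h :: "(nat => real) => real" and k
  using integrable_mix(1)[OF that, of k] fstint(1)[OF that] by auto
 have s: "integrable P (s i)" and f: "integrable P f" for i using lim.hyps by auto
 have conv: "(\<lambda>i. \<integral>x. \<bar>f x - s i x\<bar> \<partial>P) \<longlonglongrightarrow> 0"
 proof -
  have "(\<lambda>i. \<integral>x. \<bar>f x - s i x\<bar> \<partial>P) \<longlonglongrightarrow> (\<integral>x. 0 \<partial>P)"
  proof (rule integral_dominated_convergence[where w = "\<lambda>x. 3 * norm (f x)"])
   show "AE x in P. (\<lambda>i. \<bar>f x - s i x\<bar>) \<longlonglongrightarrow> 0"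
   proof (intro AE_I2)
    fix x
    have "(\<lambda>i. \<bar>f x - s i x\<bar>) \<longlonglongrightarrow> \<bar>f x - f x\<bar>"
     using lim.hyps(2)[of x] by (intro tendsto_intros) simp
    then show "(\<lambda>i. \<bar>f x - s i x\<bar>) \<longlonglongrightarrow> 0" by simp
   qed
   show "AE x in P. norm \<bar>f x - s i x\<bar> \<le> 3 * norm (f x)" for i
   proof (intro AE_I2)
    fix x
    show "norm \<bar>f x - s i x\<bar> \<le> 3 * norm (f x)" using lim.hyps(3)[of x i] by auto
   qed
  qed (use s f in auto)
  then show ?thesis by simp
 qed
 show ?case
 proof (rule LIMSEQ_I)
  fix e :: real assume e: "0 < e"
  have "\<forall>\<^sub>F i in sequentially. dist (\<integral>x. \<bar>f x - s i x\<bar> \<partial>P) 0 < e/4"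
   using e by (intro tendstoD[OF conv]) auto
  then obtain i where i: "dist (\<integral>x. \<bar>f x - s i x\<bar> \<partial>P) 0 < e/4"
   by (auto simp: eventually_sequentially)
  define h where "h x = f x - s i x" for x
  have h: "integrable P h" "integrable P (\<lambda>x. \<bar>h x\<bar>)" unfolding h_def using s f by auto
  have hi: "(\<integral>x. \<bar>h x\<bar> \<partial>P) < e/4" using i unfolding h_def by (auto simp: dist_real_def)
  obtain K where K': "\<And>k. K \<le> k ==> norm ((\<integral>p. \<bar>s i (mix k (fst p) (snd p)) - s i (fst p)\<bar> \<partial>(P \<Otimes>\<^sub>M P)) - 0) < e/4"
   using LIMSEQ_D[OF lim.IH[of i], of "e/4"] e by auto
  have K: "(\<integral>p. \<bar>s i (mix k (fst p) (snd p)) - s i (fst p)\<bar> \<partial>(P \<Otimes>\<^sub>M P)) < e/4" if "K \<le> k" for k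
   using K'[OF that] unfolding real_norm_def diff_zero by linarith
  have "(\<integral>p. \<bar>f (mix k (fst p) (snd p)) - f (fst p)\<bar> \<partial>(P \<Otimes>\<^sub>M P)) < e" if "K \<le> k" for k
  proof -
   have "(\<integral>p. \<bar>f (mix k (fst p) (snd p)) - f (fst p)\<bar> \<partial>(P \<Otimes>\<^sub>M P))
    \<le> (\<integral>p. \<bar>s i (mix k (fst p) (snd p)) - s i (fst p)\<bar>+(\<bar>h (mix k (fst p) (snd p))\<bar>+\<bar>h (fst p)\<bar>) \<partial>(P \<Otimes>\<^sub>M P))"
    using int[OF f, of k] int[OF s, of i k] integrable_mix(1)[OF h(2), of k] fstint(1)[OF h(2)]
    by (intro integral_mono) (auto simp: h_def)
   also have "... = (\<integral>p. \<bar>s i (mix k (fst p) (snd p)) - s i (fst p)\<bar> \<partial>(P \<Otimes>\<^sub>M P))+((\<integral>x. \<bar>h x\<bar> \<partial>P)+(\<integral>x. \<bar>h x\<bar> \<partial>P))"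
    using int[OF s, of i k] integrable_mix[OF h(2), of k] fstint[OF h(2)] by simp
   also have "... < e" using K[OF that] hi e by simp
   finally show ?thesis .
  qed
  then show "\<exists>no. \<forall>k\<ge>no. norm ((\<integral>p. \<bar>f (mix k (fst p) (snd p)) - f (fst p)\<bar> \<partial>(P \<Otimes>\<^sub>M P)) - 0) < e"
   by (intro exI[of _ K]) auto
 qed
qed

text \<open>Needed so that the telescoping sum of truncation steps reaches the function itself.\<close>

lemma trunc_tendsto_L1:
 assumes H: "integrable P H"
 shows "(\<lambda>k. \<integral>x. \<bar>trunc k H x - H x\<bar> \<partial>P) \<longlonglongrightarrow> 0"
proof (rule tendsto_sandwich[OF _ _ tendsto_const L1_mix_tendsto[OF H]])
 show "\<forall>\<^sub>F k in sequentially. (\<integral>x. \<bar>trunc k H x - H x\<bar> \<partial>P) \<le> (\<integral>p. \<bar>H (mix k (fst p) (snd p)) - H (fst p)\<bar> \<partial>(P \<Otimes>\<^sub>M P))"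
 proof (intro always_eventually allI)
  fix k
  note [measurable] = borel_measurable_integrable[OF H]
  have 1: "integrable (P \<Otimes>\<^sub>M P) (\<lambda>p. H (fst p))"
   using integrable_mix(1)[OF H, of 0] PP.integrable_product_swap_iff[of "\<lambda>p. H (snd p)"]
   by (simp add: mix_def case_prod_beta')
  have i: "integrable (P \<Otimes>\<^sub>M P) (\<lambda>(x, y). \<bar>H (mix k x y) - H x\<bar>)"
   using integrable_mix(1)[OF H, of k] 1 by (auto simp: case_prod_beta')
  have "(\<integral>x. \<bar>trunc k H x - H x\<bar> \<partial>P) \<le> (\<integral>x. \<integral>y. \<bar>H (mix k x y) - H x\<bar> \<partial>P \<partial>P)"
  proof (rule integral_mono_AE)
   show "integrable P (\<lambda>x. \<bar>trunc k H x - H x\<bar>)" using trunc_integrable(1)[OF H, of k] H by auto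
   show "integrable P (\<lambda>x. \<integral>y. \<bar>H (mix k x y) - H x\<bar> \<partial>P)" by (rule PP.integrable_fst[OF i])
   show "AE x in P. \<bar>trunc k H x - H x\<bar> \<le> (\<integral>y. \<bar>H (mix k x y) - H x\<bar> \<partial>P)"
    using trunc_integrable(3)[OF H, of k]
   proof eventually_elim
    case (elim x)
    then have "trunc k H x - H x = (\<integral>y. H (mix k x y) - H x \<partial>P)"
     by (simp add: trunc_def P.prob_space)
    then show ?case using integral_abs_bound[of P "\<lambda>y. H (mix k x y) - H x"] by simp
   qed
  qed
  also have "... = (\<integral>p. \<bar>H (mix k (fst p) (snd p)) - H (fst p)\<bar> \<partial>(P \<Otimes>\<^sub>M P))"
   using PP.integral_fst[OF i] by (simp add: case_prod_beta')
  finally show "(\<integral>x. \<bar>trunc k H x - H x\<bar> \<partial>P) \<le> (\<integral>p. \<bar>H (mix k (fst p) (snd p)) - H (fst p)\<bar> \<partial>(P \<Otimes>\<^sub>M P))" .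
 qed
qed auto

end

context iid_past
begin

lemma trunc_difference_moment:
 assumes H: "integrable P H" and \<rho>: "0 < \<rho>" "\<rho> < 1" and c: "0 \<le> c"
  and coupling: "\<And>k. (\<integral>\<^sup>+ z. \<integral>\<^sup>+ x. ennreal ((H x - H (x(k := z))) ^ 4) \<partial>P \<partial>\<nu>) \<le> ennreal ((c*\<rho> ^ k) ^ 4)"
  and "k \<le> l"
 shows "(\<integral>\<^sup>+ x. ennreal ((trunc l H x - trunc k H x) ^ 4) \<partial>P) \<le> ennreal ((c*\<rho> ^ k/(1 - \<rho>)) ^ 4)"
proof -
 note [measurable] = borel_measurable_integrable[OF H]
 let ?S = "{k..<l}"
 let ?W = "\<Sum>i\<in>?S. \<rho> ^ i"
 define u where "u i x = trunc (Suc i) H x - trunc i H x" for i x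
 have W: "0 \<le> ?W" using \<rho> by (intro sum_nonneg) auto
 have geo: "?W \<le> \<rho> ^ k/(1 - \<rho>)"
 proof -
  have "(1 - \<rho>)*?W = (\<Sum>i\<in>?S. - (\<rho> ^ Suc i) - - (\<rho> ^ i))"
   unfolding sum_distrib_left by (intro sum.cong) (auto simp: algebra_simps)
  also have "... = \<rho> ^ k - \<rho> ^ l"
   by (subst sum_Suc_diff'[OF assms(6), of "\<lambda>i. - (\<rho> ^ i)"]) simp
  finally have "(1 - \<rho>)*?W = \<rho> ^ k - \<rho> ^ l" .
  then have "?W = (\<rho> ^ k - \<rho> ^ l)/(1 - \<rho>)" using \<rho> by (simp add: field_simps)
  also have "... \<le> \<rho> ^ k/(1 - \<rho>)" using \<rho> by (intro divide_right_mono) auto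
  finally show ?thesis .
 qed
 have tel: "trunc l H x - trunc k H x = (\<Sum>i\<in>?S. u i x)" for x
  unfolding u_def using sum_Suc_diff'[OF assms(6), of "\<lambda>i. trunc i H x"] by simp
 have "(\<integral>\<^sup>+ x. ennreal ((trunc l H x - trunc k H x) ^ 4) \<partial>P)
   \<le> (\<integral>\<^sup>+ x. (\<Sum>i\<in>?S. ennreal (?W ^ 3/(\<rho> ^ i) ^ 3) * ennreal (u i x ^ 4)) \<partial>P)"
 proof (rule nn_integral_mono)
  fix x
  have "(\<Sum>i\<in>?S. u i x) ^ 4 \<le> ?W ^ 3*(\<Sum>i\<in>?S. u i x ^ 4/(\<rho> ^ i) ^ 3)"
   using \<rho> by (intro weighted_power4_sum_le) auto
  also have "... = (\<Sum>i\<in>?S. ?W ^ 3/(\<rho> ^ i) ^ 3 * u i x ^ 4)"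
   by (simp add: sum_distrib_left)
  finally have "ennreal ((\<Sum>i\<in>?S. u i x) ^ 4) \<le> ennreal (\<Sum>i\<in>?S. ?W ^ 3/(\<rho> ^ i) ^ 3 * u i x ^ 4)"
   by (rule ennreal_leI)
  also have "... = (\<Sum>i\<in>?S. ennreal (?W ^ 3/(\<rho> ^ i) ^ 3 * u i x ^ 4))"
   using W \<rho> by (subst sum_ennreal) auto
  also have "... = (\<Sum>i\<in>?S. ennreal (?W ^ 3/(\<rho> ^ i) ^ 3) * ennreal (u i x ^ 4))"
   using W \<rho> by (intro sum.cong refl ennreal_mult) auto
  finally show "ennreal ((trunc l H x - trunc k H x) ^ 4) \<le> (\<Sum>i\<in>?S. ennreal (?W ^ 3/(\<rho> ^ i) ^ 3) * ennreal (u i x ^ 4))"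
   unfolding tel .
 qed
 also have "... = (\<Sum>i\<in>?S. ennreal (?W ^ 3/(\<rho> ^ i) ^ 3)*(\<integral>\<^sup>+ x. ennreal (u i x ^ 4) \<partial>P))"
  unfolding u_def by (subst nn_integral_sum, measurable) (simp add: nn_integral_cmult)
 also have "... \<le> (\<Sum>i\<in>?S. ennreal (?W ^ 3/(\<rho> ^ i) ^ 3) * ennreal ((c*\<rho> ^ i) ^ 4))"
 proof (intro sum_mono mult_left_mono)
  fix i
  show "(\<integral>\<^sup>+ x. ennreal (u i x ^ 4) \<partial>P) \<le> ennreal ((c*\<rho> ^ i) ^ 4)"
   unfolding u_def by (rule order_trans[OF trunc_step[OF H] coupling])
 qed simp
 also have "... = (\<Sum>i\<in>?S. ennreal (?W ^ 3 * c ^ 4*\<rho> ^ i))"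
 proof (intro sum.cong refl)
  fix i
  have "?W ^ 3/(\<rho> ^ i) ^ 3*(c*\<rho> ^ i) ^ 4 = ?W ^ 3 * c ^ 4*\<rho> ^ i"
   using \<rho> by (simp add: power_mult_distrib power4_eq_xxxx power3_eq_cube)
  then show "ennreal (?W ^ 3/(\<rho> ^ i) ^ 3) * ennreal ((c*\<rho> ^ i) ^ 4) = ennreal (?W ^ 3 * c ^ 4*\<rho> ^ i)"
   using W \<rho> c by (subst ennreal_mult[symmetric]) auto
 qed
 also have "... = ennreal (\<Sum>i\<in>?S. ?W ^ 3 * c ^ 4*\<rho> ^ i)"
  using W \<rho> c by (subst sum_ennreal) auto
 also have "(\<Sum>i\<in>?S. ?W ^ 3 * c ^ 4*\<rho> ^ i) = c ^ 4*?W ^ 4"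
  by (simp add: sum_distrib_left[symmetric] power4_eq_xxxx power3_eq_cube)
 also have "ennreal (c ^ 4*?W ^ 4) \<le> ennreal (c ^ 4*(\<rho> ^ k/(1 - \<rho>)) ^ 4)"
  using geo W c by (intro ennreal_leI mult_left_mono power_mono) auto
 also have "c ^ 4*(\<rho> ^ k/(1 - \<rho>)) ^ 4 = (c*\<rho> ^ k/(1 - \<rho>)) ^ 4"
  by (simp add: power_mult_distrib power_divide)
 finally show ?thesis .
qed

text \<open>Telescope over the lags and let the number of retained lags tend to infinity, by Fatou.\<close>

lemma trunc_error_moment:
 assumes H: "integrable P H" and \<rho>: "0 < \<rho>" "\<rho> < 1" and c: "0 \<le> c"
  and coupling: "\<And>k. (\<integral>\<^sup>+ z. \<integral>\<^sup>+ x. ennreal ((H x - H (x(k := z))) ^ 4) \<partial>P \<partial>\<nu>) \<le> ennreal ((c*\<rho> ^ k) ^ 4)"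
 shows "(\<integral>\<^sup>+ x. ennreal ((H x - trunc k H x) ^ 4) \<partial>P) \<le> ennreal ((c*\<rho> ^ k/(1 - \<rho>)) ^ 4)"
proof -
 note [measurable] = borel_measurable_integrable[OF H]
 have "\<exists>r :: nat => nat. strict_mono r \<and> (AE x in P. (\<lambda>n. trunc (r n) H x - H x) \<longlonglongrightarrow> 0)"
  using trunc_integrable(1)[OF H] H trunc_tendsto_L1[OF H] by (intro tendsto_L1_AE_subseq) auto
 then obtain r :: "nat => nat" where r: "strict_mono r" "AE x in P. (\<lambda>n. trunc (r n) H x - H x) \<longlonglongrightarrow> 0"
  by auto
 have "(\<integral>\<^sup>+ x. ennreal ((H x - trunc k H x) ^ 4) \<partial>P)
   \<le> (\<integral>\<^sup>+ x. liminf (\<lambda>n. ennreal ((trunc (r n) H x - trunc k H x) ^ 4)) \<partial>P)"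
 proof (rule nn_integral_mono_AE)
  show "AE x in P. ennreal ((H x - trunc k H x) ^ 4) \<le> liminf (\<lambda>n. ennreal ((trunc (r n) H x - trunc k H x) ^ 4))"
   using r(2)
  proof eventually_elim
   case (elim x)
   then have "(\<lambda>n. trunc (r n) H x) \<longlonglongrightarrow> H x" by (rule LIM_zero_cancel)
   then have "(\<lambda>n. ennreal ((trunc (r n) H x - trunc k H x) ^ 4)) \<longlonglongrightarrow> ennreal ((H x - trunc k H x) ^ 4)"
    by (intro tendsto_ennrealI tendsto_intros)
   then have "liminf (\<lambda>n. ennreal ((trunc (r n) H x - trunc k H x) ^ 4)) = ennreal ((H x - trunc k H x) ^ 4)"
    by (rule lim_imp_Liminf[OF trivial_limit_sequentially])
   then show ?case by simp
  qed
 qed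
 also have "... \<le> liminf (\<lambda>n. \<integral>\<^sup>+ x. ennreal ((trunc (r n) H x - trunc k H x) ^ 4) \<partial>P)"
  by (rule nn_integral_liminf) measurable
 also have "... \<le> ennreal ((c*\<rho> ^ k/(1 - \<rho>)) ^ 4)"
 proof -
  have "\<forall>\<^sub>F n in sequentially. (\<integral>\<^sup>+ x. ennreal ((trunc (r n) H x - trunc k H x) ^ 4) \<partial>P) \<le> ennreal ((c*\<rho> ^ k/(1 - \<rho>)) ^ 4)"
   using eventually_ge_at_top[of k]
  proof eventually_elim
   case (elim n)
   then have "k \<le> r n" using seq_suble[OF r(1), of n] by simp
   then show ?case by (intro trunc_difference_moment[OF H \<rho> c coupling])
  qed
  then have "liminf (\<lambda>n. \<integral>\<^sup>+ x. ennreal ((trunc (r n) H x - trunc k H x) ^ 4) \<partial>P)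
    \<le> liminf (\<lambda>n. ennreal ((c*\<rho> ^ k/(1 - \<rho>)) ^ 4))"
   by (rule Liminf_mono)
  then show ?thesis by (simp add: Liminf_const)
 qed
 finally show ?thesis .
qed

end

context piecewise_stationary_model
begin

definition \<nu> :: "real measure" where "\<nu> = distr M borel (\<epsilon> 0)"

abbreviation Z :: "int+int => 'a => real" where "Z \<equiv> case_sum \<epsilon> \<epsilon>'"

lemma Z_measurable [measurable]: "Z i \<in> borel_measurable M"
 using indep unfolding indep_vars_def by auto

lemma \<epsilon>_measurable [measurable]: "\<epsilon> k \<in> borel_measurable M" and \<epsilon>'_measurable [measurable]: "\<epsilon>' k \<in> borel_measurable M"
 using Z_measurable[of "Inl k"] Z_measurable[of "Inr k"] by simp_all

lemma prob_space_\<nu>: "prob_space \<nu>"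
 unfolding \<nu>_def by (rule prob_space_distr) measurable

sublocale iid_past \<nu>
 by (rule iid_past.intro[OF prob_space_\<nu>]) (simp add: \<nu>_def)

lemma Z_law: "distr M borel (Z i) = \<nu>"
 using ident ident_copy by (cases i) (simp_all add: \<nu>_def)

text \<open>Any injective selection from the two noise sequences is an i.i.d. sequence; both stationarity and the coupling identity are instances.\<close>

lemma innovations_law:
 fixes f :: "nat => int+int"
 assumes "inj f"
 shows "distr M P (\<lambda>om n. Z (f n) om) = P"
proof -
 let ?Q = "\<Pi>\<^sub>M i\<in>(UNIV :: (int+int) set). \<nu>"
 have sQ: "sets ?Q = sets (\<Pi>\<^sub>M i\<in>UNIV. borel)"
  by (intro sets_PiM_cong) (simp_all add: sets_\<nu>)
 have "distr M (\<Pi>\<^sub>M i\<in>UNIV. borel) (\<lambda>om. \<lambda>i\<in>UNIV. Z i om) = ?Q"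
  using indep by (subst (asm) indep_vars_iff_distr_eq_PiM) (auto simp: Z_law)
 then have Q: "distr M ?Q (\<lambda>om i. Z i om) = ?Q"
  using sQ by (simp add: restrict_UNIV cong: distr_cong)
 have m1: "(\<lambda>om i. Z i om) \<in> measurable M ?Q"
 proof -
  have "(\<lambda>om. \<lambda>i\<in>UNIV. Z i om) \<in> measurable M ?Q"
   by (intro measurable_restrict) (simp add: measurable_cong_sets[OF refl sets_\<nu>])
  then show ?thesis by (simp add: restrict_UNIV)
 qed
 have m2: "(\<lambda>om n. om (f n)) \<in> measurable ?Q P"
  by (rule measurable_P_I) (simp add: measurable_cong_sets[OF refl sets_\<nu>, symmetric] measurable_component_singleton)
 have "distr ?Q P (\<lambda>om. \<lambda>n\<in>UNIV. om (f n)) = P"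
  unfolding P_def using prob_\<nu> assms by (intro distr_PiM_reindex) auto
 then have "distr ?Q P (\<lambda>om n. om (f n)) = P" by (simp add: restrict_UNIV)
 then have "P = distr (distr M ?Q (\<lambda>om i. Z i om)) P (\<lambda>om n. om (f n))" by (simp add: Q)
 also have "... = distr M P (\<lambda>om n. Z (f n) om)"
  using m1 m2 by (subst distr_distr) (auto simp: comp_def)
 finally show ?thesis by simp
qed

lemma past_measurable [measurable]: "past \<epsilon> k \<in> measurable M P"
 unfolding past_def by (rule measurable_P_I) measurable

lemma past_law: "distr M P (past \<epsilon> k) = P"
proof -
 have "inj (\<lambda>n. Inl (k - int n) :: int+int)" by (auto simp: inj_def)
 from innovations_law[OF this] show ?thesis by (simp add: past_def[abs_def])
qed

lemma nn_integral_past: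
 assumes [measurable]: "f \<in> borel_measurable P"
 shows "(\<integral>\<^sup>+ om. f (past \<epsilon> k om) \<partial>M) = (\<integral>\<^sup>+ x. f x \<partial>P)"
proof -
 have "(\<integral>\<^sup>+ x. f x \<partial>P) = (\<integral>\<^sup>+ x. f x \<partial>distr M P (past \<epsilon> k))" by (simp only: past_law)
 then show ?thesis by (simp add: nn_integral_distr)
qed

lemma integral_past:
 fixes f :: "(nat => real) => real"
 assumes [measurable]: "f \<in> borel_measurable P"
 shows "(\<integral>om. f (past \<epsilon> k om) \<partial>M) = (\<integral>x. f x \<partial>P)"
  and "integrable M (\<lambda>om. f (past \<epsilon> k om)) \<longleftrightarrow> integrable P f"
proof -
 have "(\<integral>x. f x \<partial>P) = (\<integral>x. f x \<partial>distr M P (past \<epsilon> k))" by (simp only: past_law)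
 then show "(\<integral>om. f (past \<epsilon> k om) \<partial>M) = (\<integral>x. f x \<partial>P)" by (simp add: integral_distr)
 have "integrable P f \<longleftrightarrow> integrable (distr M P (past \<epsilon> k)) f" by (simp only: past_law)
 then show "integrable M (\<lambda>om. f (past \<epsilon> k om)) \<longleftrightarrow> integrable P f" by (simp add: integrable_distr_eq)
qed

lemma nn_integral_coupling:
 assumes [measurable]: "H \<in> borel_measurable P"
 shows "(\<integral>\<^sup>+ om. ennreal ((H (past \<epsilon> 0 om) - H (coupled_past \<epsilon> \<epsilon>' k om)) ^ 4) \<partial>M)
  = (\<integral>\<^sup>+ z. \<integral>\<^sup>+ x. ennreal ((H x - H (x(k := z))) ^ 4) \<partial>P \<partial>\<nu>)"
proof -
 interpret S: sequence_space \<nu> ..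
 define f :: "nat => int+int" where "f n = (case n of 0 => Inr (- int k) | Suc i => Inl (0 - int i))" for n
 have inj: "inj f" unfolding inj_def f_def by (auto split: nat.splits)
 define \<Phi> where "\<Phi> z x = ennreal ((H x - H (x(k := z))) ^ 4)" for z x
 have tail[measurable]: "(\<lambda>w i. w (Suc i)) \<in> measurable P P" by (rule measurable_P_I) measurable
 have m0: "(\<lambda>p. H ((snd p)(k := fst p))) \<in> borel_measurable (\<nu> \<Otimes>\<^sub>M P)"
  by (rule measurable_compose[OF measurable_upd[of k] assms])
 have m: "(\<lambda>p. \<Phi> (fst p) (snd p)) \<in> borel_measurable (\<nu> \<Otimes>\<^sub>M P)"
  unfolding \<Phi>_def
  by (intro measurable_compose[OF _ measurable_ennreal] borel_measurable_power borel_measurable_diff m0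
    measurable_compose[OF measurable_snd assms])
 have m': "(\<lambda>w. \<Phi> (w 0) (\<lambda>i. w (Suc i))) \<in> borel_measurable P"
 proof -
  have "(\<lambda>w. (w 0, \<lambda>i. w (Suc i))) \<in> measurable P (\<nu> \<Otimes>\<^sub>M P)" by measurable
  from measurable_compose[OF this m] show ?thesis by simp
 qed
 have fm: "(\<lambda>om n. Z (f n) om) \<in> measurable M P" by (rule measurable_P_I) measurable
 have cm: "(\<lambda>(s, om). case_nat s om) \<in> measurable (\<nu> \<Otimes>\<^sub>M P) P"
 proof (rule measurable_P_I)
  show "(\<lambda>x. (case x of (s, om) => case_nat s om) i) \<in> borel_measurable (\<nu> \<Otimes>\<^sub>M P)" for i
   by (cases i) (auto simp: case_prod_beta')
 qed
 have iter: "distr (\<nu> \<Otimes>\<^sub>M P) P (\<lambda>(s, om). case_nat s om) = P"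
  using S.PiM_iter by (simp add: P_def)
 have Zf: "\<Phi> (Z (f 0) om) (\<lambda>i. Z (f (Suc i)) om) = ennreal ((H (past \<epsilon> 0 om) - H (coupled_past \<epsilon> \<epsilon>' k om)) ^ 4)" for om
 proof -
  have "Z (f 0) om = \<epsilon>' (- int k) om" "(\<lambda>i. Z (f (Suc i)) om) = past \<epsilon> 0 om"
   by (simp_all add: f_def past_def)
  then show ?thesis by (simp only: \<Phi>_def coupled_past_def)
 qed
 have "(\<integral>\<^sup>+ om. ennreal ((H (past \<epsilon> 0 om) - H (coupled_past \<epsilon> \<epsilon>' k om)) ^ 4) \<partial>M)
   = (\<integral>\<^sup>+ w. \<Phi> (w 0) (\<lambda>i. w (Suc i)) \<partial>distr M P (\<lambda>om n. Z (f n) om))"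
  unfolding Zf[symmetric] using m' by (intro nn_integral_distr[OF fm, symmetric]) simp
 also have "... = (\<integral>\<^sup>+ w. \<Phi> (w 0) (\<lambda>i. w (Suc i)) \<partial>distr (\<nu> \<Otimes>\<^sub>M P) P (\<lambda>(s, om). case_nat s om))"
  unfolding innovations_law[OF inj] iter ..
 also have "... = (\<integral>\<^sup>+ p. \<Phi> (fst p) (snd p) \<partial>(\<nu> \<Otimes>\<^sub>M P))"
  using m' by (subst nn_integral_distr[OF cm]) (simp_all add: case_prod_beta')
 also have "... = (\<integral>\<^sup>+ z. \<integral>\<^sup>+ x. \<Phi> z x \<partial>P \<partial>\<nu>)"
  using P.nn_integral_fst[OF m] by (simp only: fst_conv snd_conv)
 finally show ?thesis unfolding \<Phi>_def .
qed

lemma Lnorm_4_leD: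
 assumes "Lnorm M 4 W \<le> ennreal c" and "0 \<le> c"
 shows "(\<integral>\<^sup>+ om. ennreal (W om ^ 4) \<partial>M) \<le> ennreal (c ^ 4)"
proof -
 let ?I = "\<integral>\<^sup>+ om. ennreal (W om ^ 4) \<partial>M"
 have I: "(\<integral>\<^sup>+ om. ennreal (\<bar>W om\<bar> powr 4) \<partial>M) = ?I"
  by (intro nn_integral_cong) simp
 have fin: "?I \<noteq> \<infinity>"
  using assms(1) unfolding Lnorm_def I by (auto simp: Let_def top_unique split: if_splits)
 then have "ennreal (enn2real ?I powr (1/4)) \<le> ennreal c"
  using assms(1) unfolding Lnorm_def I by (simp add: Let_def)
 then have "enn2real ?I powr (1/4) \<le> c" using assms(2) by (simp add: ennreal_le_iff)
 then have "(enn2real ?I powr (1/4)) ^ 4 \<le> c ^ 4" by (intro power_mono) auto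
 moreover have "(enn2real ?I powr (1/4)) ^ 4 = enn2real ?I"
  by (cases "enn2real ?I = 0") (simp_all add: powr_power)
 ultimately have le: "enn2real ?I \<le> c ^ 4" by simp
 have "?I = ennreal (enn2real ?I)" using fin by (simp add: less_top)
 also have "... \<le> ennreal (c ^ 4)" using le by (rule ennreal_leI)
 finally show ?thesis .
qed

end

section \<open>Moments and covariances of the local processes\<close>


context prob_space
begin

lemma power4_integrableI:
 fixes f :: "'a => real"
 assumes [measurable]: "f \<in> borel_measurable M" and le: "(\<integral>\<^sup>+ om. ennreal (f om ^ 4) \<partial>M) \<le> ennreal B" and "0 \<le> B"
 shows "integrable M (\<lambda>om. f om ^ 4)" and "expectation (\<lambda>om. f om ^ 4) \<le> B"
proof -
 show i: "integrable M (\<lambda>om. f om ^ 4)"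
  using le by (intro integrableI_nonneg) (auto intro: le_less_trans[OF _ ennreal_less_top])
 have "ennreal (expectation (\<lambda>om. f om ^ 4)) = (\<integral>\<^sup>+ om. ennreal (f om ^ 4) \<partial>M)"
  using i by (intro nn_integral_eq_integral[symmetric]) auto
 then have "ennreal (expectation (\<lambda>om. f om ^ 4)) \<le> ennreal B" using le by simp
 then show "expectation (\<lambda>om. f om ^ 4) \<le> B" using assms(3) by (simp add: ennreal_le_iff)
qed

lemma square_le_of_power4:
 fixes f :: "'a => real"
 assumes [measurable]: "f \<in> borel_measurable M" and i: "integrable M (\<lambda>om. f om ^ 4)"
  and le: "expectation (\<lambda>om. f om ^ 4) \<le> b ^ 4" and "0 \<le> b"
 shows "integrable M (\<lambda>om. (f om)^2)" and "expectation (\<lambda>om. (f om)^2) \<le> b^2"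
proof -
 show "integrable M (\<lambda>om. (f om)^2)" by (rule integrable_power_le4[OF _ i]) auto
 have "(expectation (\<lambda>om. \<bar>(f om)\<^sup>2\<bar>))^2 \<le> expectation (\<lambda>om. ((f om)^2)^2)"
  using i by (intro abs_expectation_square_le(2)) auto
 then have "(expectation (\<lambda>om. (f om)^2))^2 \<le> (b^2)^2" using le by simp
 then show "expectation (\<lambda>om. (f om)^2) \<le> b^2" by (rule power2_le_imp_le) simp
qed

lemma expectation_mult_le:
 fixes f g :: "'a => real"
 assumes [measurable]: "f \<in> borel_measurable M" "g \<in> borel_measurable M"
  and f: "integrable M (\<lambda>om. (f om)^2)" "expectation (\<lambda>om. (f om)^2) \<le> a^2"
  and g: "integrable M (\<lambda>om. (g om)^2)" "expectation (\<lambda>om. (g om)^2) \<le> b^2"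
  and ab: "0 < a" "0 < b"
 shows "integrable M (\<lambda>om. f om * g om)" and "expectation (\<lambda>om. \<bar>f om * g om\<bar>) \<le> a * b"
  and "\<bar>expectation (\<lambda>om. f om * g om)\<bar> \<le> a * b"
proof -
 have le: "\<bar>x * y\<bar> \<le> (b/a * x^2+a/b * y^2)/2" for x y :: real
 proof -
  have "0 \<le> (b*\<bar>x\<bar> - a*\<bar>y\<bar>)^2/(a * b)" using ab by simp
  also have "... = b/a * x^2+a/b * y^2 - 2*\<bar>x * y\<bar>"
   using ab by (simp add: power2_diff abs_mult field_simps power2_eq_square)
  finally show ?thesis by simp
 qed
 have dom: "integrable M (\<lambda>om. (b/a*(f om)^2+a/b*(g om)^2)/2)" using f g by simp
 show i: "integrable M (\<lambda>om. f om * g om)"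
 proof (rule Bochner_Integration.integrable_bound[OF dom])
  show "AE om in M. norm (f om * g om) \<le> norm ((b/a*(f om)^2+a/b*(g om)^2)/2)"
  proof (intro AE_I2)
   fix om
   show "norm (f om * g om) \<le> norm ((b/a*(f om)^2+a/b*(g om)^2)/2)"
    using le[of "f om" "g om"] unfolding real_norm_def by linarith
  qed
 qed measurable
 have "expectation (\<lambda>om. \<bar>f om * g om\<bar>) \<le> expectation (\<lambda>om. (b/a*(f om)^2+a/b*(g om)^2)/2)"
  using i dom le by (intro integral_mono) auto
 also have "... = (b/a * expectation (\<lambda>om. (f om)^2)+a/b * expectation (\<lambda>om. (g om)^2))/2"
  using f g by simp
 also have "... \<le> (b/a * a^2+a/b * b^2)/2"
  using f g ab by (intro divide_right_mono add_mono mult_left_mono) auto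
 also have "... = a * b" using ab by (simp add: power2_eq_square)
 finally show 1: "expectation (\<lambda>om. \<bar>f om * g om\<bar>) \<le> a * b" .
 show "\<bar>expectation (\<lambda>om. f om * g om)\<bar> \<le> a * b"
  by (rule order_trans[OF integral_abs_bound 1])
qed

end

context piecewise_stationary_model
begin

lemma d_mono:
 assumes "i \<le> j" "j \<le> Suc r"
 shows "d i \<le> d j"
 using assms
proof (induction j rule: dec_induct)
 case (step n)
 then show ?case using d_less[of n] by simp
qed simp

lemma segment_eq:
 assumes "k \<le> r" "d k < t" "t \<le> d (Suc k)"
 shows "segment r d t = k"
proof -
 have "t \<noteq> 0" using d_mono[of 0 k] assms d_0 by auto
 moreover have "(THE k. k \<le> r \<and> d k < t \<and> t \<le> d (Suc k)) = k"
 proof (rule the_equality)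
  fix l assume l: "l \<le> r \<and> d l < t \<and> t \<le> d (Suc l)"
  have "\<not> l < k" using d_mono[of "Suc l" k] l assms by auto
  moreover have "\<not> k < l" using d_mono[of "Suc k" l] l assms by auto
  ultimately show "l = k" by simp
 qed (use assms in simp)
 ultimately show ?thesis by (simp add: segment_def)
qed

lemma segment_exists:
 assumes "0 < t" "t \<le> 1"
 obtains k where "k \<le> r" "d k < t" "t \<le> d (Suc k)" "segment r d t = k"
proof -
 define k where "k = (LEAST k. t \<le> d (Suc k))"
 have ex: "t \<le> d (Suc r)" using assms d_end by simp
 have k1: "t \<le> d (Suc k)" unfolding k_def by (rule LeastI[of _ r]) (rule ex)
 have k2: "k \<le> r" unfolding k_def by (rule Least_le) (rule ex)
 have k3: "d k < t"
 proof (cases k)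
  case 0
  then show ?thesis using assms d_0 by simp
 next
  case (Suc l)
  then have "\<not> t \<le> d (Suc l)" using not_less_Least[of l "\<lambda>k. t \<le> d (Suc k)"] unfolding k_def by auto
  then show ?thesis using Suc by simp
 qed
 show ?thesis by (rule that[OF k2 k3 k1 segment_eq[OF k2 k3 k1]])
qed

lemma pls_process_eq:
 assumes "1 \<le> k" "k \<le> n"
 shows "pls_process \<epsilon> r d G n k om = G (segment r d (real k/real n)) (real k/real n) (past \<epsilon> (int k) om)"
proof -
 let ?t = "real k/real n"
 have t: "0 < ?t" "?t \<le> 1" using assms by auto
 obtain l where l: "l \<le> r" "d l < ?t" "?t \<le> d (Suc l)" "segment r d ?t = l" by (rule segment_exists[OF t])
 have "pls_process \<epsilon> r d G n k om = (\<Sum>j\<in>{l}. G j ?t (past \<epsilon> (int k) om) * indicator {d j<..d (Suc j)} ?t)"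
  unfolding pls_process_def
 proof (rule sum.mono_neutral_right)
  show "\<forall>i\<in>{..r} - {l}. G i ?t (past \<epsilon> (int k) om) * indicator {d i<..d (Suc i)} ?t = 0"
  proof
   fix i assume i: "i \<in> {..r} - {l}"
   then have "\<not> (d i < ?t \<and> ?t \<le> d (Suc i))" using segment_eq[of i ?t] l(4) by blast
   then show "G i ?t (past \<epsilon> (int k) om) * indicator {d i<..d (Suc i)} ?t = 0" by simp
  qed
 qed (use l in auto)
 then show ?thesis using l by simp
qed

lemma G_section_measurable:
 assumes "k \<le> r" "t \<in> {d k..d (Suc k)}"
 shows "G k t \<in> borel_measurable P"
proof -
 have "(\<lambda>x. (t, x)) \<in> measurable (\<Pi>\<^sub>M i\<in>UNIV. borel) (restrict_space borel {d k..d (Suc k)} \<Otimes>\<^sub>M (\<Pi>\<^sub>M i\<in>UNIV. borel))"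
  using assms by (intro measurable_Pair1') (simp add: space_restrict_space)
 from measurable_compose[OF this G_measurable[OF assms(1)]]
 have "G k t \<in> borel_measurable (\<Pi>\<^sub>M i\<in>UNIV. borel)" by simp
 then show ?thesis using measurable_cong_sets[OF sets_P refl] by blast
qed

lemma indep_\<epsilon>: "indep_vars (\<lambda>_. borel) \<epsilon> UNIV"
proof -
 have "indep_vars (\<lambda>j. \<Pi>\<^sub>M i\<in>{Inl j}. borel) (\<lambda>j om. \<lambda>i\<in>{Inl j}. Z i om) UNIV"
  by (rule indep_vars_restrict[OF indep]) (auto simp: disjoint_family_on_def)
 then have "indep_vars (\<lambda>_. borel) (\<lambda>j om. (\<lambda>x. x (Inl j)) (\<lambda>i\<in>{Inl j}. Z i om)) UNIV"
  by (rule indep_vars_compose2) (auto intro: measurable_component_singleton)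
 then show ?thesis by simp
qed

sublocale indep_noise M \<epsilon>
 by standard (rule indep_\<epsilon>)

end

text \<open>The analytic consequences of the hypotheses on the process, with positive constants so that divisions are harmless.\<close>

locale short_memory_model = piecewise_stationary_model M \<epsilon> \<epsilon>' r d G
 for M :: "'a measure" and \<epsilon> \<epsilon>' r d G +
 fixes c \<rho> C :: real
 assumes c_pos: "0 < c" and \<rho>_pos: "0 < \<rho>" and \<rho>_less: "\<rho> < 1" and C_pos: "0 < C"
  and H_integrable: "\<And>t. 0 < t ==> t \<le> 1 ==> integrable M (\<lambda>om. G (segment r d t) t (past \<epsilon> 0 om))"
  and H_centered: "\<And>t. 0 < t ==> t \<le> 1 ==> expectation (\<lambda>om. G (segment r d t) t (past \<epsilon> 0 om)) = 0"
  and coupling: "\<And>t k. 0 < t ==> t \<le> 1 ==>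
   Lnorm M 4 (\<lambda>om. G (segment r d t) t (past \<epsilon> 0 om) - G (segment r d t) t (coupled_past \<epsilon> \<epsilon>' k om)) \<le> ennreal (c*\<rho> ^ k)"
  and lipschitz4: "\<And>k t s. k \<le> r ==> t \<in> {d k..d (Suc k)} ==> s \<in> {d k..d (Suc k)} ==>
   Lnorm M 4 (\<lambda>om. G k t (past \<epsilon> 0 om) - G k s (past \<epsilon> 0 om)) \<le> ennreal (C*\<bar>t - s\<bar>)"
begin

definition H :: "real => (nat => real) => real" where
 "H t = G (segment r d t) t"

definition X :: "real => int => 'a => real" where
 "X t k om = H t (past \<epsilon> k om)"

definition X' :: "nat => real => int => 'a => real" where
 "X' L t k om = trunc L (H t) (past \<epsilon> k om)"

definition b :: real where "b = c/(1 - \<rho>)"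

lemma b_pos: "0 < b"
 using c_pos \<rho>_less by (simp add: b_def)

lemma H_measurable [measurable]:
 assumes "0 < t" "t \<le> 1"
 shows "H t \<in> borel_measurable P"
proof -
 obtain k where "k \<le> r" "d k < t" "t \<le> d (Suc k)" "segment r d t = k" by (rule segment_exists[OF assms])
 then show ?thesis unfolding H_def using G_section_measurable[of k t] by auto
qed

lemma H_P:
 assumes t: "0 < t" "t \<le> 1"
 shows "integrable P (H t)" and "(\<integral>x. H t x \<partial>P) = 0"
 using H_integrable[OF t] H_centered[OF t] integral_past[OF H_measurable[OF t], of 0]
 by (simp_all add: H_def)

lemma X_measurable [measurable]:
 assumes t: "0 < t" "t \<le> 1"
 shows "X t k \<in> borel_measurable M" and "X' L t k \<in> borel_measurable M"
 unfolding X_def[abs_def] X'_def[abs_def]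
 using measurable_compose[OF past_measurable[of k] H_measurable[OF t]]
  measurable_compose[OF past_measurable[of k] trunc_measurable[OF H_measurable[OF t], of L]] by simp_all

lemma coupling_P:
 assumes t: "0 < t" "t \<le> 1"
 shows "(\<integral>\<^sup>+ z. \<integral>\<^sup>+ x. ennreal ((H t x - H t (x(k := z))) ^ 4) \<partial>P \<partial>\<nu>) \<le> ennreal ((c*\<rho> ^ k) ^ 4)"
proof -
 have "(\<integral>\<^sup>+ om. ennreal ((H t (past \<epsilon> 0 om) - H t (coupled_past \<epsilon> \<epsilon>' k om)) ^ 4) \<partial>M) \<le> ennreal ((c*\<rho> ^ k) ^ 4)"
  unfolding H_def using coupling[OF t, of k] c_pos \<rho>_pos by (intro Lnorm_4_leD) auto
 then show ?thesis unfolding nn_integral_coupling[OF H_measurable[OF t]] .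
qed

lemma X_X'_error:
 assumes t: "0 < t" "t \<le> 1"
 shows "integrable M (\<lambda>om. (X t k om - X' L t k om) ^ 4)"
  and "expectation (\<lambda>om. (X t k om - X' L t k om) ^ 4) \<le> (b*\<rho> ^ L) ^ 4"
proof -
 note [measurable] = H_measurable[OF t]
 have "(\<integral>\<^sup>+ om. ennreal ((X t k om - X' L t k om) ^ 4) \<partial>M) = (\<integral>\<^sup>+ x. ennreal ((H t x - trunc L (H t) x) ^ 4) \<partial>P)"
  unfolding X_def X'_def by (rule nn_integral_past) measurable
 also have "... \<le> ennreal ((c*\<rho> ^ L/(1 - \<rho>)) ^ 4)"
  using c_pos \<rho>_pos \<rho>_less by (intro trunc_error_moment H_P t coupling_P) auto
 finally have le: "(\<integral>\<^sup>+ om. ennreal ((X t k om - X' L t k om) ^ 4) \<partial>M) \<le> ennreal ((b*\<rho> ^ L) ^ 4)"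
  by (simp add: b_def)
 show "integrable M (\<lambda>om. (X t k om - X' L t k om) ^ 4)"
  and "expectation (\<lambda>om. (X t k om - X' L t k om) ^ 4) \<le> (b*\<rho> ^ L) ^ 4"
  by (rule power4_integrableI[OF _ le]; use t b_pos \<rho>_pos in simp)+
qed

lemma X'_0:
 assumes t: "0 < t" "t \<le> 1"
 shows "X' 0 t k om = 0"
 using H_P(2)[OF t] by (simp add: X'_def trunc_0)

lemma X_power4:
 assumes t: "0 < t" "t \<le> 1"
 shows "integrable M (\<lambda>om. X t k om ^ 4)" and "expectation (\<lambda>om. X t k om ^ 4) \<le> b ^ 4"
 using X_X'_error[OF t, of k 0] by (simp_all add: X'_0[OF t])

lemma X'_power4:
 assumes t: "0 < t" "t \<le> 1"
 shows "integrable M (\<lambda>om. X' L t k om ^ 4)" and "expectation (\<lambda>om. X' L t k om ^ 4) \<le> b ^ 4"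
proof -
 note [measurable] = H_measurable[OF t]
 have "(\<integral>\<^sup>+ om. ennreal (X' L t k om ^ 4) \<partial>M) = (\<integral>\<^sup>+ x. ennreal (trunc L (H t) x ^ 4) \<partial>P)"
  unfolding X'_def by (rule nn_integral_past) measurable
 also have "... = (\<integral>\<^sup>+ x. ennreal ((trunc L (H t) x - trunc 0 (H t) x) ^ 4) \<partial>P)"
  using H_P(2)[OF t] by (simp add: trunc_0)
 also have "... \<le> ennreal ((c*\<rho> ^ 0/(1 - \<rho>)) ^ 4)"
  using c_pos \<rho>_pos \<rho>_less by (intro trunc_difference_moment H_P t coupling_P) auto
 finally have le: "(\<integral>\<^sup>+ om. ennreal (X' L t k om ^ 4) \<partial>M) \<le> ennreal (b ^ 4)" by (simp add: b_def)
 show "integrable M (\<lambda>om. X' L t k om ^ 4)" and "expectation (\<lambda>om. X' L t k om ^ 4) \<le> b ^ 4"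
  by (rule power4_integrableI[OF _ le]; use t b_pos in simp)+
qed

lemma X'_mean:
 assumes t: "0 < t" "t \<le> 1"
 shows "expectation (X' L t k) = 0"
 unfolding X'_def[abs_def]
 using integral_past(1)[OF trunc_measurable[OF H_measurable[OF t], of L], of k] trunc_integrable(2)[OF H_P(1)[OF t], of L] H_P(2)[OF t]
 by simp

lemma X_mean:
 assumes t: "0 < t" "t \<le> 1"
 shows "expectation (X t k) = 0"
 unfolding X_def[abs_def] using integral_past(1)[OF H_measurable[OF t], of k] H_P(2)[OF t] by simp

lemma X_squares:
 assumes t: "0 < t" "t \<le> 1"
 shows "integrable M (\<lambda>om. (X t k om)^2)" "expectation (\<lambda>om. (X t k om)^2) \<le> b^2"
  and "integrable M (\<lambda>om. (X' L t k om)^2)" "expectation (\<lambda>om. (X' L t k om)^2) \<le> b^2"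
  and "integrable M (\<lambda>om. (X t k om - X' L t k om)^2)"
  and "expectation (\<lambda>om. (X t k om - X' L t k om)^2) \<le> (b*\<rho> ^ L)^2"
 using square_le_of_power4[OF _ X_power4[OF t], of k] square_le_of_power4[OF _ X'_power4[OF t], of L k]
  square_le_of_power4[OF _ X_X'_error[OF t], of k L] t b_pos \<rho>_pos by auto

lemma X'_window:
 assumes t: "0 < t" "t \<le> 1"
 shows "X' L t k \<in> borel_measurable (noise_field {k - int L+1..k})"
proof -
 define g where "g om = (\<lambda>i. if i < L then \<epsilon> (k - int i) om else 0)" for om
 have "g \<in> measurable (noise_field {k - int L+1..k}) P"
 proof (rule measurable_P_I)
  fix i
  show "(\<lambda>om. g om i) \<in> borel_measurable (noise_field {k - int L+1..k})"
   unfolding g_def by (cases "i < L") (auto intro!: measurable_noise_field_component)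
 qed
 from measurable_compose[OF this trunc_measurable[OF H_measurable[OF t], of L]]
 have "(\<lambda>om. trunc L (H t) (g om)) \<in> borel_measurable (noise_field {k - int L+1..k})" .
 moreover have "trunc L (H t) (g om) = X' L t k om" for om
  unfolding X'_def by (rule trunc_cong) (simp add: g_def past_def)
 ultimately show ?thesis by simp
qed

lemma X_past_field:
 assumes t: "0 < t" "t \<le> 1"
 shows "X t k \<in> borel_measurable (noise_field {..k})"
proof -
 have "past \<epsilon> k \<in> measurable (noise_field {..k}) P"
  unfolding past_def by (rule measurable_P_I) (auto intro!: measurable_noise_field_component)
 from measurable_compose[OF this H_measurable[OF t]] show ?thesis unfolding X_def[abs_def] .
qed

text \<open>Truncating the later variable at the lag distance makes it independent of the earlier one, so only the truncation error remains.\<close>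

lemma covariance_decay_forward:
 assumes t: "0 < t" "t \<le> 1" and s: "0 < s" "s \<le> 1"
 shows "\<bar>expectation (\<lambda>om. X s k om*X t (k+int h) om)\<bar> \<le> b^2*\<rho> ^ h"
proof -
 let ?l = "k+int h"
 have int: "integrable M (X s k)" "integrable M (X' h t ?l)"
  using integrable_power_le4[OF _ X_power4(1)[OF s, of k], of 1] integrable_power_le4[OF _ X'_power4(1)[OF t, of h ?l], of 1] s t
  by simp_all
 have "expectation (\<lambda>om. X s k om*X' h t ?l om) = expectation (X s k) * expectation (X' h t ?l)"
  by (rule expectation_mult_disjoint[OF X_past_field[OF s] X'_window[OF t]]) (use int in auto)
 then have 0: "expectation (\<lambda>om. X s k om*X' h t ?l om) = 0" by (simp add: X_mean[OF s])
 note cs = expectation_mult_le[of "X s k" "\<lambda>om. X t ?l om - X' h t ?l om" b "b*\<rho> ^ h"]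
 have i1: "integrable M (\<lambda>om. X s k om*(X t ?l om - X' h t ?l om))"
  and le: "\<bar>expectation (\<lambda>om. X s k om*(X t ?l om - X' h t ?l om))\<bar> \<le> b*(b*\<rho> ^ h)"
  using cs(1,3) X_squares[OF s] X_squares[OF t] s t b_pos \<rho>_pos by simp_all
 have i2: "integrable M (\<lambda>om. X s k om*X' h t ?l om)"
  by (rule integrable_mult_disjoint[OF X_past_field[OF s] X'_window[OF t]]) (use int in auto)
 have "expectation (\<lambda>om. X s k om*X t ?l om)
   = expectation (\<lambda>om. X s k om*(X t ?l om - X' h t ?l om) + X s k om*X' h t ?l om)"
  by (simp add: algebra_simps)
 also have "... = expectation (\<lambda>om. X s k om*(X t ?l om - X' h t ?l om))"
  using i1 i2 0 by simp
 finally show ?thesis using le by (simp add: power2_eq_square mult.assoc)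
qed

lemma covariance_decay:
 assumes t: "0 < t" "t \<le> 1" and s: "0 < s" "s \<le> 1"
 shows "\<bar>expectation (\<lambda>om. X s k om*X t l om)\<bar> \<le> b^2*\<rho> ^ nat \<bar>k - l\<bar>"
proof (cases "k \<le> l")
 case True
 then have "nat \<bar>k - l\<bar> = nat (l - k)" by simp
 then show ?thesis using True covariance_decay_forward[OF t s, of k "nat (l - k)"] by simp
next
 case False
 then have "nat \<bar>k - l\<bar> = nat (k - l)" by simp
 then show ?thesis using False covariance_decay_forward[OF s t, of l "nat (k - l)"]
  by (simp add: mult.commute[of "X s _ _"])
qed

lemma covariance_stationary_forward:
 assumes t: "0 < t" "t \<le> 1" and s: "0 < s" "s \<le> 1"
 shows "expectation (\<lambda>om. X s k om*X t (k+int h) om) = expectation (\<lambda>om. X s 0 om*X t (int h) om)"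
proof -
 have shift: "past \<epsilon> j om = (\<lambda>i. past \<epsilon> (j+int h) om (i+h))" for j om
  by (simp add: past_def algebra_simps)
 have m: "(\<lambda>x i. x (i+h)) \<in> measurable P P" by (rule measurable_P_I) measurable
 define \<Phi> where "\<Phi> x = H s (\<lambda>i. x (i+h))*H t x" for x
 have [measurable]: "\<Phi> \<in> borel_measurable P"
  unfolding \<Phi>_def using measurable_compose[OF m H_measurable[OF s]] H_measurable[OF t] by simp
 have "X s j om*X t (j+int h) om = \<Phi> (past \<epsilon> (j+int h) om)" for j om
  unfolding X_def \<Phi>_def using shift[of j om] by simp
 then have "expectation (\<lambda>om. X s j om*X t (j+int h) om) = (\<integral>x. \<Phi> x \<partial>P)" for j
  by (simp add: integral_past)
 from this[of k] this[of 0] show ?thesis by simp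
qed

lemma covariance_stationary:
 assumes t: "0 < t" "t \<le> 1" and s: "0 < s" "s \<le> 1"
 shows "expectation (\<lambda>om. X s k om*X t l om) = expectation (\<lambda>om. X s 0 om*X t (l - k) om)"
proof (cases "k \<le> l")
 case True
 then show ?thesis using covariance_stationary_forward[OF t s, of k "nat (l - k)"] by simp
next
 case False
 then have "expectation (\<lambda>om. X s k om*X t l om) = expectation (\<lambda>om. X t 0 om*X s (k - l) om)"
  using covariance_stationary_forward[OF s t, of l "nat (k - l)"] by (simp add: mult.commute)
 also have "... = expectation (\<lambda>om. X s 0 om*X t (l - k) om)"
  using False covariance_stationary_forward[OF s t, of "l - k" "nat (k - l)"] by (simp add: mult.commute)
 finally show ?thesis .
qed

abbreviation \<gamma> :: "real => int => real" where
 "\<gamma> \<equiv> local_acov M \<epsilon> r d G"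

lemma \<gamma>_eq:
 assumes t: "0 < t" "t \<le> 1"
 shows "\<gamma> t h = expectation (\<lambda>om. X t 0 om*X t h om)"
 unfolding local_acov_def Cov_def H_def[symmetric] X_def[symmetric] by (simp add: X_mean[OF t])

lemma \<gamma>_decay:
 assumes t: "0 < t" "t \<le> 1"
 shows "\<bar>\<gamma> t h\<bar> \<le> b^2*\<rho> ^ nat \<bar>h\<bar>"
 unfolding \<gamma>_eq[OF t] using covariance_decay[OF t t, of 0 h] by simp

lemma \<gamma>_even:
 assumes t: "0 < t" "t \<le> 1"
 shows "\<gamma> t (- h) = \<gamma> t h"
 unfolding \<gamma>_eq[OF t] using covariance_stationary[OF t t, of h 0] by (simp add: mult.commute)

lemma X_lipschitz:
 assumes t: "0 < t" "t \<le> 1" and s: "0 < s" "s \<le> 1" and "segment r d t = segment r d s" and "t \<noteq> s"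
 shows "integrable M (\<lambda>om. (X t k om - X s k om)^2)"
  and "expectation (\<lambda>om. (X t k om - X s k om)^2) \<le> (C*\<bar>t - s\<bar>)^2"
proof -
 note [measurable] = H_measurable[OF t] H_measurable[OF s]
 obtain i where i: "i \<le> r" "d i < t" "t \<le> d (Suc i)" "segment r d t = i" by (rule segment_exists[OF t])
 obtain j where j: "j \<le> r" "d j < s" "s \<le> d (Suc j)" "segment r d s = j" by (rule segment_exists[OF s])
 have ij: "j = i" using i j assms by simp
 have "(\<integral>\<^sup>+ om. ennreal ((X t k om - X s k om) ^ 4) \<partial>M) = (\<integral>\<^sup>+ x. ennreal ((H t x - H s x) ^ 4) \<partial>P)"
  unfolding X_def by (rule nn_integral_past) measurable
 also have "... = (\<integral>\<^sup>+ om. ennreal ((H t (past \<epsilon> 0 om) - H s (past \<epsilon> 0 om)) ^ 4) \<partial>M)"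
  by (rule nn_integral_past[symmetric]) measurable
 also have "... \<le> ennreal ((C*\<bar>t - s\<bar>) ^ 4)"
  unfolding H_def i(4) j(4) ij using C_pos i j ij
  by (intro Lnorm_4_leD lipschitz4) auto
 finally have le: "(\<integral>\<^sup>+ om. ennreal ((X t k om - X s k om) ^ 4) \<partial>M) \<le> ennreal ((C*\<bar>t - s\<bar>) ^ 4)" .
 have m: "(\<lambda>om. X t k om - X s k om) \<in> borel_measurable M" using s t by simp
 have nn: "0 \<le> C*\<bar>t - s\<bar>" using C_pos by simp
 note 4 = power4_integrableI[OF m le zero_le_power[OF nn]]
 show "integrable M (\<lambda>om. (X t k om - X s k om)^2)"
  and "expectation (\<lambda>om. (X t k om - X s k om)^2) \<le> (C*\<bar>t - s\<bar>)^2"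
  using square_le_of_power4[OF m 4 nn] by auto
qed

lemma covariance_lipschitz:
 assumes t: "0 < t" "t \<le> 1" and s: "0 < s" "s \<le> 1" and u: "0 < u" "u \<le> 1"
  and seg: "segment r d t = segment r d s"
 shows "\<bar>expectation (\<lambda>om. X t k om*X u l om) - expectation (\<lambda>om. X s k om*X u l om)\<bar> \<le> C * b*\<bar>t - s\<bar>"
proof (cases "t = s")
 case False
 have i: "integrable M (\<lambda>om. X t k om*X u l om)" "integrable M (\<lambda>om. X s k om*X u l om)"
  using expectation_mult_le(1)[of "X t k" "X u l" b b] expectation_mult_le(1)[of "X s k" "X u l" b b]
   X_squares[OF t] X_squares[OF s] X_squares[OF u] s t u b_pos by simp_all
 have "expectation (\<lambda>om. X t k om*X u l om) - expectation (\<lambda>om. X s k om*X u l om)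
   = expectation (\<lambda>om. (X t k om - X s k om)*X u l om)"
  using i by (simp add: left_diff_distrib)
 also have "\<bar>...\<bar> \<le> (C*\<bar>t - s\<bar>) * b"
  using X_lipschitz[OF t s seg False] X_squares[OF u] s t u b_pos C_pos False
  by (intro expectation_mult_le(3)) auto
 finally show ?thesis by (simp add: mult_ac)
qed simp

lemma \<gamma>_lipschitz:
 assumes t: "0 < t" "t \<le> 1" and s: "0 < s" "s \<le> 1" and seg: "segment r d t = segment r d s"
 shows "\<bar>\<gamma> t h - \<gamma> s h\<bar> \<le> 2*C * b*\<bar>t - s\<bar>"
proof -
 have "\<bar>expectation (\<lambda>om. X t 0 om*X t h om) - expectation (\<lambda>om. X s 0 om*X t h om)\<bar> \<le> C * b*\<bar>t - s\<bar>"
  by (rule covariance_lipschitz[OF t s t seg])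
 moreover have "\<bar>expectation (\<lambda>om. X t h om*X s 0 om) - expectation (\<lambda>om. X s h om*X s 0 om)\<bar> \<le> C * b*\<bar>t - s\<bar>"
  by (rule covariance_lipschitz[OF t s s seg])
 ultimately show ?thesis
  unfolding \<gamma>_eq[OF t] \<gamma>_eq[OF s] by (simp add: mult.commute[of "X _ h _"])
qed

lemma covariance_X':
 assumes t: "0 < t" "t \<le> 1" and s: "0 < s" "s \<le> 1"
 shows "integrable M (\<lambda>om. X t k om*X s l om)" "integrable M (\<lambda>om. X' L t k om*X' L s l om)"
  and "expectation (\<lambda>om. \<bar>X t k om*X s l om - X' L t k om*X' L s l om\<bar>) \<le> 2 * b^2*\<rho> ^ L"
proof -
 let ?d = "\<lambda>t k om. X t k om - X' L t k om"
 have br: "0 < b*\<rho> ^ L" using b_pos \<rho>_pos by simp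
 note 1 = expectation_mult_le[of "?d t k" "X s l" "b*\<rho> ^ L" b]
 note 2 = expectation_mult_le[of "X' L t k" "?d s l" b "b*\<rho> ^ L"]
 have 1: "integrable M (\<lambda>om. ?d t k om*X s l om)" "expectation (\<lambda>om. \<bar>?d t k om*X s l om\<bar>) \<le> b*\<rho> ^ L * b"
  using 1(1,2) X_squares[OF t] X_squares[OF s] s t b_pos br by simp_all
 have 2: "integrable M (\<lambda>om. X' L t k om*?d s l om)" "expectation (\<lambda>om. \<bar>X' L t k om*?d s l om\<bar>) \<le> b*(b*\<rho> ^ L)"
  using 2(1,2) X_squares[OF t] X_squares[OF s] s t b_pos br by simp_all
 show i1: "integrable M (\<lambda>om. X t k om*X s l om)" and i2: "integrable M (\<lambda>om. X' L t k om*X' L s l om)"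
  using expectation_mult_le(1)[of "X t k" "X s l" b b] expectation_mult_le(1)[of "X' L t k" "X' L s l" b b]
   X_squares[OF t] X_squares[OF s] s t b_pos by simp_all
 have "expectation (\<lambda>om. \<bar>X t k om*X s l om - X' L t k om*X' L s l om\<bar>)
   \<le> expectation (\<lambda>om. \<bar>?d t k om*X s l om\<bar>+\<bar>X' L t k om*?d s l om\<bar>)"
 proof (intro integral_mono)
  show "integrable M (\<lambda>om. \<bar>X t k om*X s l om - X' L t k om*X' L s l om\<bar>)" using i1 i2 by auto
  show "integrable M (\<lambda>om. \<bar>?d t k om*X s l om\<bar>+\<bar>X' L t k om*?d s l om\<bar>)" using 1(1) 2(1) by auto
  fix om
  have "X t k om*X s l om - X' L t k om*X' L s l om = ?d t k om*X s l om + X' L t k om*?d s l om"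
   by (simp add: algebra_simps)
  then show "\<bar>X t k om*X s l om - X' L t k om*X' L s l om\<bar> \<le> \<bar>?d t k om*X s l om\<bar>+\<bar>X' L t k om*?d s l om\<bar>"
   using abs_triangle_ineq[of "?d t k om*X s l om" "X' L t k om*?d s l om"] by simp
 qed
 also have "... = expectation (\<lambda>om. \<bar>?d t k om*X s l om\<bar>)+expectation (\<lambda>om. \<bar>X' L t k om*?d s l om\<bar>)"
  using 1(1) 2(1) by (intro Bochner_Integration.integral_add integrable_abs)
 also have "... \<le> 2 * b^2*\<rho> ^ L" using 1(2) 2(2) by (simp add: power2_eq_square mult_ac)
 finally show "expectation (\<lambda>om. \<bar>X t k om*X s l om - X' L t k om*X' L s l om\<bar>) \<le> 2 * b^2*\<rho> ^ L" .
qed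

end

section \<open>The smoothing kernel and its Fourier transform\<close>


text \<open>For a positive semidefinite matrix, Cauchy-Schwarz for the form itself bounds the square of the matrix by its norm times the matrix.\<close>

lemma psd_operator_bound:
 fixes a :: "'i => 'i => real"
 assumes sym: "\<And>j k. a j k = a k j" and \<kappa>: "0 < \<kappa>"
  and psd: "\<And>x. 0 \<le> (\<Sum>j\<in>I. \<Sum>k\<in>I. a j k * x j * x k)"
  and le: "\<And>x. (\<Sum>j\<in>I. \<Sum>k\<in>I. a j k * x j * x k) \<le> \<kappa>*(\<Sum>j\<in>I. (x j)^2)"
 shows "(\<Sum>j\<in>I. (\<Sum>k\<in>I. a j k * x k)^2) \<le> \<kappa>*(\<Sum>j\<in>I. \<Sum>k\<in>I. a j k * x j * x k)"
proof -
 define q where "q x = (\<Sum>j\<in>I. \<Sum>k\<in>I. a j k * x j * x k)" for x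
 define y where "y j = (\<Sum>k\<in>I. a j k * x k)" for j
 define Y where "Y = (\<Sum>j\<in>I. (y j)^2)"
 have xy: "(\<Sum>j\<in>I. \<Sum>k\<in>I. a j k * y j * x k) = Y"
  unfolding Y_def y_def power2_eq_square by (simp add: sum_distrib_left sum_distrib_right mult_ac)
 have yx: "(\<Sum>j\<in>I. \<Sum>k\<in>I. a j k * x j * y k) = Y"
  by (subst sum.swap) (simp add: xy[symmetric] sym mult_ac)
 have "0 \<le> q (\<lambda>j. x j - y j/\<kappa>)" unfolding q_def by (rule psd)
 also have "q (\<lambda>j. x j - y j/\<kappa>)
   = (\<Sum>j\<in>I. \<Sum>k\<in>I. a j k * x j * x k - (a j k * y j * x k)/\<kappa> - (a j k * x j * y k)/\<kappa>+(a j k * y j * y k)/\<kappa>^2)"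
  unfolding q_def using \<kappa> by (intro sum.cong refl) (simp add: field_simps power2_eq_square)
 also have "... = q x - Y/\<kappa> - Y/\<kappa>+q y/\<kappa>^2"
  unfolding q_def sum.distrib sum_subtractf sum_divide_distrib[symmetric] xy yx ..
 also have "... \<le> q x - Y/\<kappa> - Y/\<kappa>+(\<kappa>*Y)/\<kappa>^2"
  using le[of y] unfolding q_def Y_def by (intro add_left_mono divide_right_mono) auto
 also have "... = q x - Y/\<kappa>" using \<kappa> by (simp add: power2_eq_square)
 finally have "Y/\<kappa> \<le> q x" by simp
 then have "Y \<le> \<kappa> * q x" using \<kappa> by (simp add: field_simps)
 then show ?thesis unfolding Y_def y_def q_def .
qed

locale smoothing_kernel =
 fixes K :: "real => real" and B :: real
 assumes K_continuous: "continuous_on UNIV K"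
  and K_nonneg: "\<And>x. 0 \<le> K x" and K_le: "\<And>x. K x \<le> B"
  and K_even: "\<And>x. K (- x) = K x"
  and K_outside: "\<And>x. 1 < \<bar>x\<bar> ==> K x = 0"
  and K_integral: "has_bochner_integral lborel K 1"
begin

lemma K_measurable [measurable]: "K \<in> borel_measurable borel"
 using K_continuous by (rule borel_measurable_continuous_onI)

lemma K_integrable: "integrable lborel K" and K_int_1: "(\<integral>v. K v \<partial>lborel) = 1"
 using K_integral by (simp_all add: has_bochner_integral_iff)

lemma B_pos: "0 < B"
proof (rule ccontr)
 assume "\<not> 0 < B"
 then have "K v = 0" for v using K_nonneg[of v] K_le[of v] by linarith
 then show False using K_int_1 by simp
qed

lemma K_mult_integrable:
 assumes [measurable]: "f \<in> borel_measurable borel" and "\<And>v. \<bar>f v\<bar> \<le> c"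
 shows "integrable lborel (\<lambda>v. K v * f v)"
proof (rule Bochner_Integration.integrable_bound)
 show "integrable lborel (\<lambda>v. c*K v)" using K_integrable by simp
 show "AE v in lborel. norm (K v * f v) \<le> norm (c*K v)"
 proof (intro AE_I2)
  fix v
  have "\<bar>f v\<bar>*K v \<le> \<bar>c\<bar>*K v" using assms(2)[of v] K_nonneg[of v] by (intro mult_right_mono) auto
  then show "norm (K v * f v) \<le> norm (c*K v)" using K_nonneg[of v] by (simp add: abs_mult mult.commute)
 qed
qed measurable

definition Khat :: "real => real" where
 "Khat x = (\<integral>v. K v * cos (x * v) \<partial>lborel)"

lemma Kcos_integrable: "integrable lborel (\<lambda>v. K v * cos (x * v))"
 by (rule K_mult_integrable[of _ 1]) auto

lemma Khat_abs_le: "\<bar>Khat x\<bar> \<le> 1"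
proof -
 have "\<bar>Khat x\<bar> \<le> (\<integral>v. \<bar>K v * cos (x * v)\<bar> \<partial>lborel)" unfolding Khat_def by (rule integral_abs_bound)
 also have "... \<le> (\<integral>v. K v \<partial>lborel)"
  by (intro integral_mono integrable_abs Kcos_integrable K_integrable)
   (simp add: abs_mult K_nonneg mult_right_le_one_le)
 finally show ?thesis by (simp add: K_int_1)
qed

lemma cos_lipschitz: "\<bar>cos x - cos y\<bar> \<le> \<bar>x - y\<bar>" for x y :: real
proof -
 have "cos x - cos y = - 2 * sin ((x+y)/2) * sin ((x - y)/2)"
  using cos_diff_cos[of x y] sin_minus[of "(x - y)/2"] by (simp add: minus_divide_left)
 then have "\<bar>cos x - cos y\<bar> = 2*(\<bar>sin ((x+y)/2)\<bar>*\<bar>sin ((x - y)/2)\<bar>)"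
  by (simp add: abs_mult)
 also have "... \<le> 2*(1*\<bar>(x - y)/2\<bar>)"
  by (intro mult_left_mono mult_mono abs_sin_x_le_abs_x) auto
 finally show ?thesis by simp
qed

lemma Khat_lipschitz: "\<bar>Khat x - Khat y\<bar> \<le> \<bar>x - y\<bar>"
proof -
 have "Khat x - Khat y = (\<integral>v. K v * cos (x * v) - K v * cos (y * v) \<partial>lborel)"
  unfolding Khat_def using Kcos_integrable by simp
 also have "\<bar>...\<bar> \<le> (\<integral>v. \<bar>K v * cos (x * v) - K v * cos (y * v)\<bar> \<partial>lborel)" by (rule integral_abs_bound)
 also have "... \<le> (\<integral>v. \<bar>x - y\<bar>*K v \<partial>lborel)"
 proof (intro integral_mono)
  fix v
  show "\<bar>K v * cos (x * v) - K v * cos (y * v)\<bar> \<le> \<bar>x - y\<bar>*K v"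
  proof (cases "1 < \<bar>v\<bar>")
   case True then show ?thesis by (simp add: K_outside)
  next
   case False
   have "\<bar>cos (x * v) - cos (y * v)\<bar> \<le> \<bar>x * v - y * v\<bar>" by (rule cos_lipschitz)
   also have "... = \<bar>x - y\<bar>*\<bar>v\<bar>" by (simp add: left_diff_distrib[symmetric] abs_mult)
   also have "... \<le> \<bar>x - y\<bar>*1" using False by (intro mult_left_mono) auto
   finally have "K v * \<bar>cos (x * v) - cos (y * v)\<bar> \<le> K v * \<bar>x - y\<bar>" using K_nonneg[of v] by (intro mult_left_mono) auto
   then show ?thesis using K_nonneg[of v] by (simp add: right_diff_distrib[symmetric] abs_mult mult.commute)
  qed
 qed (use K_integrable Kcos_integrable in auto)
 finally show ?thesis using K_int_1 by simp
qed

lemma Khat_even: "Khat (- x) = Khat x"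
 by (simp add: Khat_def)

lemma Khat_0: "Khat 0 = 1"
 by (simp add: Khat_def K_int_1)

lemma Khat_measurable [measurable]: "Khat \<in> borel_measurable borel"
proof (rule borel_measurable_continuous_onI)
 show "continuous_on UNIV Khat"
  by (rule lipschitz_on_continuous_on[of 1]) (auto intro!: lipschitz_onI simp: dist_real_def Khat_lipschitz)
qed

lemma Khat_square_lipschitz: "\<bar>(Khat x)\<^sup>2 - (Khat y)\<^sup>2\<bar> \<le> 2*\<bar>x - y\<bar>"
proof -
 have "\<bar>(Khat x)\<^sup>2 - (Khat y)\<^sup>2\<bar> = \<bar>Khat x + Khat y\<bar>*\<bar>Khat x - Khat y\<bar>"
  by (simp add: power2_eq_square abs_mult[symmetric] algebra_simps)
 also have "... \<le> 2*\<bar>x - y\<bar>"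
  using Khat_abs_le[of x] Khat_abs_le[of y] Khat_lipschitz[of x y] by (intro mult_mono) auto
 finally show ?thesis .
qed

lemma Ksin_zero: "(\<integral>v. K v * sin (x * v) \<partial>lborel) = 0"
proof -
 have "(\<integral>v. K v * sin (x * v) \<partial>lborel) = (\<integral>v. K (- v) * sin (x*(- v)) \<partial>lborel)"
  using lborel_integral_real_affine[of "-1" "\<lambda>v. K v * sin (x * v)" 0] by simp
 then show ?thesis by (simp add: K_even)
qed

lemma Khat_shifted: "(\<integral>v. K v * cos (\<alpha>+x * v) \<partial>lborel) = Khat x * cos \<alpha>"
proof -
 have s: "integrable lborel (\<lambda>v. K v * sin (x * v))" by (rule K_mult_integrable[of _ 1]) auto
 have "(\<integral>v. K v * cos (\<alpha>+x * v) \<partial>lborel) = (\<integral>v. cos \<alpha>*(K v * cos (x * v)) - sin \<alpha>*(K v * sin (x * v)) \<partial>lborel)"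
  by (intro Bochner_Integration.integral_cong) (auto simp: cos_add algebra_simps)
 also have "... = cos \<alpha>*Khat x - sin \<alpha>*(\<integral>v. K v * sin (x * v) \<partial>lborel)"
  using s Kcos_integrable by (simp add: Khat_def)
 finally show ?thesis by (simp add: Ksin_zero mult.commute[of _ "cos \<alpha>"])
qed

lemma trig_square:
 fixes x :: "int => real"
 shows "(\<Sum>j\<in>I. \<Sum>k\<in>I. x j * x k * cos (of_int (j - k)*\<alpha>))
  = (\<Sum>j\<in>I. x j * cos (of_int j*\<alpha>))^2+(\<Sum>j\<in>I. x j * sin (of_int j*\<alpha>))^2"
 unfolding power2_eq_square sum_product sum.distrib[symmetric]
 by (intro sum.cong refl) (simp add: left_diff_distrib cos_diff algebra_simps)

text \<open>The coefficient matrix is an average, with weight \<open>K\<close>, of rank-two positive matrices; this gives positivity and the operator bound.\<close>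

lemma form_eq_integral:
 fixes x :: "int => real"
 assumes "finite I"
 shows "(\<Sum>j\<in>I. \<Sum>k\<in>I. Khat (\<delta> * of_int (j - k)) * cos (of_int (j - k)*\<theta>) * x j * x k)
  = (\<integral>v. K v * (\<Sum>j\<in>I. \<Sum>k\<in>I. x j * x k * cos (of_int (j - k)*(\<theta>+\<delta> * v))) \<partial>lborel)"
proof -
 have i: "integrable lborel (\<lambda>v. K v * cos (of_int l*\<theta>+\<delta> * of_int l * v))" for l
  by (rule K_mult_integrable[of _ 1]) auto
 have "(\<integral>v. K v * (\<Sum>j\<in>I. \<Sum>k\<in>I. x j * x k * cos (of_int (j - k)*(\<theta>+\<delta> * v))) \<partial>lborel)
  = (\<integral>v. (\<Sum>j\<in>I. \<Sum>k\<in>I. x j * x k*(K v * cos (of_int (j - k)*\<theta>+\<delta> * of_int (j - k) * v))) \<partial>lborel)"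
  by (simp add: sum_distrib_left algebra_simps)
 also have "... = (\<Sum>j\<in>I. \<Sum>k\<in>I. x j * x k*(\<integral>v. K v * cos (of_int (j - k)*\<theta>+\<delta> * of_int (j - k) * v) \<partial>lborel))"
  using i by (simp add: Bochner_Integration.integral_sum del: of_int_diff)
 also have "... = (\<Sum>j\<in>I. \<Sum>k\<in>I. Khat (\<delta> * of_int (j - k)) * cos (of_int (j - k)*\<theta>) * x j * x k)"
  unfolding Khat_shifted by (simp add: mult_ac)
 finally show ?thesis by simp
qed

lemma form_nonneg:
 assumes "finite I"
 shows "0 \<le> (\<Sum>j\<in>I. \<Sum>k\<in>I. Khat (\<delta> * of_int (j - k)) * cos (of_int (j - k)*\<theta>) * x j * x k)"
 unfolding form_eq_integral[OF assms] trig_square using K_nonneg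
 by (intro Bochner_Integration.integral_nonneg) auto

lemma cos_period_integral:
 fixes l :: int
 assumes \<delta>: "0 < \<delta>"
 shows "(\<integral>v. cos (of_int l*(\<theta>+\<delta> * v)) * indicator {- (pi/\<delta>)..pi/\<delta>} v \<partial>lborel) = (if l = 0 then 2 * pi/\<delta> else 0)"
proof (cases "l = 0")
 case True
 then show ?thesis using \<delta> by simp
next
 case False
 define F where "F v = sin (of_int l*(\<theta>+\<delta> * v))/(of_int l*\<delta>)" for v
 have "(\<integral>v. cos (of_int l*(\<theta>+\<delta> * v)) * indicator {- (pi/\<delta>)..pi/\<delta>} v \<partial>lborel) = F (pi/\<delta>) - F (- (pi/\<delta>))"
 proof (rule integral_FTC_Icc_real)
  show "- (pi/\<delta>) \<le> pi/\<delta>" using \<delta> by simp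
  show "DERIV F v :> cos (of_int l*(\<theta>+\<delta> * v))" for v
   unfolding F_def using False \<delta> by (auto intro!: derivative_eq_intros)
 qed (auto intro!: continuous_intros)
 also have "... = 0"
 proof -
  have d: "\<delta>*(pi/\<delta>) = pi" "\<delta>*(- (pi/\<delta>)) = - pi" using \<delta> by simp_all
  have e: "of_int l*(\<theta>+pi) = of_int l*(\<theta> + - pi)+2 * pi * of_int l" by (simp add: algebra_simps)
  have "sin (of_int l*(\<theta>+\<delta>*(pi/\<delta>))) = sin (of_int l*(\<theta>+\<delta>*(- (pi/\<delta>))))"
   unfolding d e sin_add[of _ "2 * pi * of_int l"] cos_int_2pin sin_int_2pin by simp
  then show ?thesis unfolding F_def by simp
 qed
 finally show ?thesis using False by simp
qed

lemma form_le:
 fixes x :: "int => real"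
 assumes I: "finite I" and \<delta>: "0 < \<delta>" "\<delta> \<le> pi"
 shows "(\<Sum>j\<in>I. \<Sum>k\<in>I. Khat (\<delta> * of_int (j - k)) * cos (of_int (j - k)*\<theta>) * x j * x k)
  \<le> B*(2 * pi/\<delta>)*(\<Sum>j\<in>I. (x j)^2)"
proof -
 define p where "p v = (\<Sum>j\<in>I. \<Sum>k\<in>I. x j * x k * cos (of_int (j - k)*(\<theta>+\<delta> * v)))" for v
 let ?J = "{- (pi/\<delta>)..pi/\<delta>}"
 have p0: "0 \<le> p v" for v unfolding p_def trig_square by simp
 have c: "integrable lborel (\<lambda>v. cos (of_int l*(\<theta>+\<delta> * v)) * indicator ?J v)" for l
 proof -
  have "continuous_on ?J (\<lambda>v. cos (of_int l*(\<theta>+\<delta> * v)))" by (intro continuous_intros)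
  from borel_integrable_atLeastAtMost'[OF this] show ?thesis
   by (simp add: set_integrable_def mult.commute[of "indicator ?J _"])
 qed
 have pJ: "p v * indicator ?J v = (\<Sum>j\<in>I. \<Sum>k\<in>I. x j * x k*(cos (of_int (j - k)*(\<theta>+\<delta> * v)) * indicator ?J v))" for v
  unfolding p_def by (simp add: sum_distrib_right mult.assoc)
 have pint: "integrable lborel (\<lambda>v. p v * indicator ?J v)"
  unfolding pJ using c by (intro Bochner_Integration.integrable_sum integrable_mult_right)
 have pval: "(\<integral>v. p v * indicator ?J v \<partial>lborel) = (2 * pi/\<delta>)*(\<Sum>j\<in>I. (x j)^2)"
 proof -
  have "(\<integral>v. p v * indicator ?J v \<partial>lborel) = (\<Sum>j\<in>I. \<Sum>k\<in>I. x j * x k*(if j - k = 0 then 2 * pi/\<delta> else 0))"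
   unfolding pJ using c cos_period_integral[OF \<delta>(1)] by (simp add: Bochner_Integration.integral_sum del: of_int_diff)
  also have "... = (\<Sum>j\<in>I. \<Sum>k\<in>I. if j = k then x j * x k*(2 * pi/\<delta>) else 0)"
   by (intro sum.cong refl) auto
  also have "... = (\<Sum>j\<in>I. x j * x j*(2 * pi/\<delta>))"
   using I by (intro sum.cong refl) (simp add: sum.delta)
  finally show ?thesis by (simp add: sum_distrib_left power2_eq_square mult_ac)
 qed
 have le: "K v * p v \<le> B*(p v * indicator ?J v)" for v
 proof (cases "1 < \<bar>v\<bar>")
  case True
  then show ?thesis using K_outside[of v] B_pos p0[of v] by simp
 next
  case False
  have "1 \<le> pi/\<delta>" using \<delta> by simp
  then have "v \<in> ?J" using False by auto
  then show ?thesis using K_le[of v] p0[of v] by (simp add: mult_right_mono)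
 qed
 have "(\<integral>v. K v * p v \<partial>lborel) \<le> (\<integral>v. B*(p v * indicator ?J v) \<partial>lborel)"
 proof (rule integral_mono)
  show "integrable lborel (\<lambda>v. K v * p v)"
  proof (rule K_mult_integrable[of _ "\<Sum>j\<in>I. \<Sum>k\<in>I. \<bar>x j * x k\<bar>"])
   show "p \<in> borel_measurable borel" unfolding p_def by measurable
   show "\<bar>p v\<bar> \<le> (\<Sum>j\<in>I. \<Sum>k\<in>I. \<bar>x j * x k\<bar>)" for v
    unfolding p_def by (intro order_trans[OF sum_abs] sum_mono) (simp add: abs_mult mult_right_le_one_le)
  qed
 qed (use pint le in auto)
 also have "... = B*(2 * pi/\<delta>)*(\<Sum>j\<in>I. (x j)^2)" using pint pval by simp
 finally show ?thesis unfolding form_eq_integral[OF I] p_def .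
qed

subsection \<open>Plancherel\<close>

definition \<mu> :: "real measure" where "\<mu> = density lborel (\<lambda>v. ennreal (K v))"

lemma prob_\<mu>: "prob_space \<mu>"
proof
 have "emeasure \<mu> (space \<mu>) = (\<integral>\<^sup>+ v. ennreal (K v) \<partial>lborel)"
  unfolding \<mu>_def by (simp add: emeasure_density)
 also have "... = ennreal 1"
  using K_integrable K_nonneg K_int_1 by (subst nn_integral_eq_integral) auto
 finally show "emeasure \<mu> (space \<mu>) = 1" by simp
qed

lemma sets_\<mu> [measurable_cong]: "sets \<mu> = sets borel"
 by (simp add: \<mu>_def)

lemma integral_\<mu>: "f \<in> borel_measurable borel ==> (\<integral>v. f v \<partial>\<mu>) = (\<integral>v. K v * f v \<partial>lborel)" for f :: "real => real"
 unfolding \<mu>_def using K_nonneg by (subst integral_density) auto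

abbreviation N01 :: "real measure" where "N01 \<equiv> density lborel std_normal_density"

lemma cos_normal: "(\<integral>x. cos (t * x) \<partial>N01) = exp (- (t^2)/2)"
proof -
 interpret real_distribution N01 by (rule real_dist_normal_dist)
 have "Re (char N01 t) = (\<integral>x. Re (iexp (t * x)) \<partial>N01)"
  unfolding char_def by (intro integral_Re[symmetric] integrable_iexp) auto
 then show ?thesis by (simp add: char_std_normal_distribution Re_exp)
qed

text \<open>A Gaussian factor makes Fubini applicable; it is removed in the limit by monotone convergence.\<close>

lemma gaussian_plancherel:
 assumes \<epsilon>: "0 < \<epsilon>"
 shows "integrable lborel (\<lambda>y. (Khat y)^2 * exp (- ((\<epsilon> * y)^2)/2))"
  and "(\<integral>y. (Khat y)^2 * exp (- ((\<epsilon> * y)^2)/2) \<partial>lborel) = 2 * pi*(\<integral>u. \<integral>z. K (u - \<epsilon> * z) \<partial>N01 \<partial>\<mu>)"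
proof -
 interpret \<mu>: prob_space \<mu> by (rule prob_\<mu>)
 interpret N: prob_space N01 by (rule prob_space_normal_density) simp
 interpret NU: pair_prob_space N01 \<mu> ..
 interpret UV: pair_prob_space \<mu> \<mu> ..
 let ?n = "std_normal_density"
 have n: "?n (\<epsilon> * y) = exp (- ((\<epsilon> * y)^2)/2)/sqrt (2 * pi)" for y
  by (simp add: std_normal_density_def)
 have Kh: "Khat x = (\<integral>u. cos (x * u) \<partial>\<mu>)" for x unfolding Khat_def by (subst integral_\<mu>) auto
 \<comment> \<open>Fubini, twice, for bounded functions on products of probability spaces\<close>
 have E: "(\<integral>x. (Khat (x/\<epsilon>))^2 \<partial>N01) = (\<integral>u. \<integral>v. exp (- (((u - v)/\<epsilon>)^2)/2) \<partial>\<mu> \<partial>\<mu>)"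
 proof -
  have sq: "(Khat y)^2 = (\<integral>u. \<integral>v. cos (y*(u - v)) \<partial>\<mu> \<partial>\<mu>)" for y
  proof -
   have s0: "(\<integral>u. sin (y * u) \<partial>\<mu>) = 0" by (subst integral_\<mu>) (auto simp: Ksin_zero)
   have ci: "integrable \<mu> (\<lambda>u. cos (y * u))" "integrable \<mu> (\<lambda>u. sin (y * u))"
    by (rule \<mu>.integrable_const_bound[of _ 1]; simp)+
   have "(\<integral>v. cos (y*(u - v)) \<partial>\<mu>) = cos (y * u)*Khat y" for u
   proof -
    have "(\<integral>v. cos (y*(u - v)) \<partial>\<mu>) = (\<integral>v. cos (y * u) * cos (y * v)+sin (y * u) * sin (y * v) \<partial>\<mu>)"
     by (intro Bochner_Integration.integral_cong) (auto simp: right_diff_distrib cos_diff)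
    also have "... = cos (y * u)*Khat y" using ci s0 by (simp add: Kh)
    finally show ?thesis .
   qed
   then show ?thesis using ci by (simp add: Kh power2_eq_square)
  qed
  have "(\<integral>x. (Khat (x/\<epsilon>))^2 \<partial>N01) = (\<integral>x. \<integral>u. \<integral>v. cos (x/\<epsilon>*(u - v)) \<partial>\<mu> \<partial>\<mu> \<partial>N01)"
   by (simp only: sq)
  also have "... = (\<integral>u. \<integral>x. \<integral>v. cos (x/\<epsilon>*(u - v)) \<partial>\<mu> \<partial>N01 \<partial>\<mu>)"
  proof (rule NU.Fubini_integral[symmetric])
   have m: "(\<lambda>(x, u). \<integral>v. cos (x/\<epsilon>*(u - v)) \<partial>\<mu>) \<in> borel_measurable (N01 \<Otimes>\<^sub>M \<mu>)" by measurable
   show "integrable (N01 \<Otimes>\<^sub>M \<mu>) (\<lambda>(x, u). \<integral>v. cos (x/\<epsilon>*(u - v)) \<partial>\<mu>)"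
   proof (rule NU.P.integrable_const_bound[of _ 1])
    show "AE p in N01 \<Otimes>\<^sub>M \<mu>. norm (case p of (x, u) => \<integral>v. cos (x/\<epsilon>*(u - v)) \<partial>\<mu>) \<le> 1"
    proof (intro AE_I2, clarify)
     fix x u
     have "norm (\<integral>v. cos (x/\<epsilon>*(u - v)) \<partial>\<mu>) \<le> (\<integral>v. norm (cos (x/\<epsilon>*(u - v))) \<partial>\<mu>)"
      by (rule integral_norm_bound)
     also have "... \<le> (\<integral>v. 1 \<partial>\<mu>)"
      by (intro integral_mono \<mu>.integrable_const_bound[of _ 1]) auto
     finally show "norm (\<integral>v. cos (x/\<epsilon>*(u - v)) \<partial>\<mu>) \<le> 1" by (simp add: \<mu>.prob_space)
    qed
   qed (rule m)
  qed
  also have "... = (\<integral>u. \<integral>v. \<integral>x. cos (x/\<epsilon>*(u - v)) \<partial>N01 \<partial>\<mu> \<partial>\<mu>)"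
  proof (rule Bochner_Integration.integral_cong[OF refl])
   fix u
   have "integrable (N01 \<Otimes>\<^sub>M \<mu>) (\<lambda>(x, v). cos (x/\<epsilon>*(u - v)))"
    by (rule NU.P.integrable_const_bound[of _ 1]) (auto simp: case_prod_beta')
   then show "(\<integral>x. \<integral>v. cos (x/\<epsilon>*(u - v)) \<partial>\<mu> \<partial>N01) = (\<integral>v. \<integral>x. cos (x/\<epsilon>*(u - v)) \<partial>N01 \<partial>\<mu>)"
    by (rule NU.Fubini_integral[symmetric])
  qed
  also have "... = (\<integral>u. \<integral>v. exp (- (((u - v)/\<epsilon>)^2)/2) \<partial>\<mu> \<partial>\<mu>)"
  proof (intro Bochner_Integration.integral_cong refl)
   fix u v
   show "(\<integral>x. cos (x/\<epsilon>*(u - v)) \<partial>N01) = exp (- (((u - v)/\<epsilon>)^2)/2)"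
    using cos_normal[of "(u - v)/\<epsilon>"] by (simp add: mult.commute)
  qed
  finally show ?thesis .
 qed
 have inner: "(\<integral>v. exp (- (((u - v)/\<epsilon>)^2)/2) \<partial>\<mu>) = \<epsilon> * sqrt (2 * pi)*(\<integral>z. K (u - \<epsilon> * z) \<partial>N01)" for u
 proof -
  have "(\<integral>v. exp (- (((u - v)/\<epsilon>)^2)/2) \<partial>\<mu>) = (\<integral>v. K v * exp (- (((u - v)/\<epsilon>)^2)/2) \<partial>lborel)"
   by (rule integral_\<mu>) measurable
  also have "... = \<epsilon>*(\<integral>z. K (u - \<epsilon> * z) * exp (- (z^2)/2) \<partial>lborel)"
   using \<epsilon> lborel_integral_real_affine[of "- \<epsilon>" "\<lambda>v. K v * exp (- (((u - v)/\<epsilon>)^2)/2)" u] by simp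
  also have "(\<integral>z. K (u - \<epsilon> * z) * exp (- (z^2)/2) \<partial>lborel) = (\<integral>z. sqrt (2 * pi)*(?n z*K (u - \<epsilon> * z)) \<partial>lborel)"
   by (intro Bochner_Integration.integral_cong) (auto simp: std_normal_density_def)
  also have "... = sqrt (2 * pi)*(\<integral>z. K (u - \<epsilon> * z) \<partial>N01)"
   by (subst integral_density) auto
  finally show ?thesis by simp
 qed
 have "integrable N01 (\<lambda>x. (Khat (x/\<epsilon>))^2)"
  using Khat_abs_le by (intro N.integrable_const_bound[of _ 1]) (auto simp: abs_square_le_1)
 then have "integrable lborel (\<lambda>x. ?n x*(Khat (x/\<epsilon>))^2)"
  by (subst (asm) integrable_density) auto
 then have "integrable lborel (\<lambda>y. ?n (0+\<epsilon> * y)*(Khat ((0+\<epsilon> * y)/\<epsilon>))^2)"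
  using \<epsilon> by (intro lborel_integrable_real_affine) auto
 then have i: "integrable lborel (\<lambda>y. sqrt (2 * pi)*(?n (0+\<epsilon> * y)*(Khat ((0+\<epsilon> * y)/\<epsilon>))^2))" by (rule integrable_mult_right)
 have "sqrt (2 * pi)*(?n (0+\<epsilon> * y)*(Khat ((0+\<epsilon> * y)/\<epsilon>))^2) = (Khat y)^2 * exp (- ((\<epsilon> * y)^2)/2)" for y
  using \<epsilon> by (simp add: n)
 note i = i[unfolded this]
 show "integrable lborel (\<lambda>y. (Khat y)^2 * exp (- ((\<epsilon> * y)^2)/2))" by (rule i)
 have "(\<integral>x. (Khat (x/\<epsilon>))^2 \<partial>N01) = (\<integral>x. ?n x*(Khat (x/\<epsilon>))^2 \<partial>lborel)"
  by (subst integral_density) auto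
 also have "... = \<epsilon>*(\<integral>y. ?n (\<epsilon> * y)*(Khat y)^2 \<partial>lborel)"
  using \<epsilon> lborel_integral_real_affine[of \<epsilon> "\<lambda>x. ?n x*(Khat (x/\<epsilon>))^2" 0] by simp
 also have "(\<integral>y. ?n (\<epsilon> * y)*(Khat y)^2 \<partial>lborel) = (\<integral>y. (Khat y)^2 * exp (- ((\<epsilon> * y)^2)/2)/sqrt (2 * pi) \<partial>lborel)"
  by (intro Bochner_Integration.integral_cong) (auto simp: n)
 finally have *: "\<epsilon>*((\<integral>y. (Khat y)^2 * exp (- ((\<epsilon> * y)^2)/2) \<partial>lborel)/sqrt (2 * pi))
   = \<epsilon> * sqrt (2 * pi)*(\<integral>u. \<integral>z. K (u - \<epsilon> * z) \<partial>N01 \<partial>\<mu>)"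
  unfolding E inner by simp
 have cancel: "A = w * w*D" if "\<epsilon>*(A/w) = \<epsilon> * w*D" "0 < w" for A D w :: real
  using that \<epsilon> by (simp add: field_simps)
 show "(\<integral>y. (Khat y)^2 * exp (- ((\<epsilon> * y)^2)/2) \<partial>lborel) = 2 * pi*(\<integral>u. \<integral>z. K (u - \<epsilon> * z) \<partial>N01 \<partial>\<mu>)"
  using cancel[OF *] by simp
qed

lemma plancherel: "has_bochner_integral lborel (\<lambda>y. (Khat y)^2) (2 * pi*(\<integral>v. (K v)^2 \<partial>lborel))"
proof -
 interpret \<mu>: prob_space \<mu> by (rule prob_\<mu>)
 interpret N: prob_space N01 by (rule prob_space_normal_density) simp
 define e where "e i = 1/(real i+1)" for i :: nat
 have e: "0 < e i" for i by (simp add: e_def)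
 have e_lim: "e \<longlonglongrightarrow> 0"
  unfolding e_def using LIMSEQ_inverse_real_of_nat by (simp add: inverse_eq_divide add.commute)
 have isC: "isCont K u" for u using K_continuous by (simp add: continuous_on_eq_continuous_at)
 have bnd: "\<bar>K v\<bar> \<le> B" for v using K_nonneg[of v] K_le[of v] by simp
 have inner: "(\<lambda>i. \<integral>z. K (u - e i * z) \<partial>N01) \<longlonglongrightarrow> (\<integral>z. K u \<partial>N01)" for u
 proof (rule integral_dominated_convergence[where w = "\<lambda>_. B"])
  show "AE z in N01. (\<lambda>i. K (u - e i * z)) \<longlonglongrightarrow> K u"
  proof (intro AE_I2)
   fix z
   have "(\<lambda>i. u - e i * z) \<longlonglongrightarrow> u - 0 * z" by (intro tendsto_intros e_lim)
   then show "(\<lambda>i. K (u - e i * z)) \<longlonglongrightarrow> K u" by (intro isCont_tendsto_compose[OF isC]) simp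
  qed
 qed (use bnd in auto)
 have inner_bnd: "\<bar>\<integral>z. K (u - e i * z) \<partial>N01\<bar> \<le> B" for u i
 proof -
  have "\<bar>\<integral>z. K (u - e i * z) \<partial>N01\<bar> \<le> (\<integral>z. \<bar>K (u - e i * z)\<bar> \<partial>N01)" by (rule integral_abs_bound)
  also have "... \<le> (\<integral>z. B \<partial>N01)"
   using bnd B_pos by (intro integral_mono N.integrable_const_bound[of _ B]) auto
  also have "... = B" using N.prob_space by simp
  finally show ?thesis .
 qed
 have "(\<lambda>i. \<integral>u. \<integral>z. K (u - e i * z) \<partial>N01 \<partial>\<mu>) \<longlonglongrightarrow> (\<integral>u. (\<integral>z. K u \<partial>N01) \<partial>\<mu>)"
 proof (rule integral_dominated_convergence[where w = "\<lambda>_. B"])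
  show "(\<lambda>u. \<integral>z. K (u - e i * z) \<partial>N01) \<in> borel_measurable \<mu>" for i by measurable
  show "(\<lambda>u. \<integral>z. K u \<partial>N01) \<in> borel_measurable \<mu>" by measurable
 qed (use inner inner_bnd in auto)
 also have "(\<integral>u. (\<integral>z. K u \<partial>N01) \<partial>\<mu>) = (\<integral>u. K u \<partial>\<mu>)" using N.prob_space by simp
 also have "... = (\<integral>v. (K v)^2 \<partial>lborel)" by (subst integral_\<mu>) (auto simp: power2_eq_square)
 finally have lim: "(\<lambda>i. \<integral>y. (Khat y)^2 * exp (- ((e i * y)^2)/2) \<partial>lborel) \<longlonglongrightarrow> 2 * pi*(\<integral>v. (K v)^2 \<partial>lborel)"
  unfolding gaussian_plancherel(2)[OF e] by (intro tendsto_intros)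
 show ?thesis
 proof (rule has_bochner_integral_monotone_convergence[OF _ _ _ lim])
  show "integrable lborel (\<lambda>y. (Khat y)^2 * exp (- ((e i * y)^2)/2))" for i
   by (rule gaussian_plancherel(1)[OF e])
  show "AE y in lborel. mono (\<lambda>i. (Khat y)^2 * exp (- ((e i * y)^2)/2))"
  proof (intro AE_I2 monoI mult_left_mono)
   fix y :: real and i j :: nat assume "i \<le> j"
   then have "e j \<le> e i" by (simp add: e_def frac_le)
   then have "(e j*\<bar>y\<bar>)^2 \<le> (e i*\<bar>y\<bar>)^2" using e[of j] by (intro power_mono mult_right_mono) auto
   then show "exp (- ((e i * y)^2)/2) \<le> exp (- ((e j * y)^2)/2)" by (simp add: power_mult_distrib)
  qed simp
  show "AE y in lborel. (\<lambda>i. (Khat y)^2 * exp (- ((e i * y)^2)/2)) \<longlonglongrightarrow> (Khat y)^2"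
  proof (intro AE_I2)
   fix y
   have "(\<lambda>i. (Khat y)^2 * exp (- ((e i * y)^2)/2)) \<longlonglongrightarrow> (Khat y)^2 * exp (- ((0 * y)^2)/2)"
    by (intro tendsto_intros e_lim) auto
   then show "(\<lambda>i. (Khat y)^2 * exp (- ((e i * y)^2)/2)) \<longlonglongrightarrow> (Khat y)^2" by simp
  qed
 qed measurable
qed

text \<open>The summand is Lipschitz, so on a window of length \<open>N \<delta>\<close> the Riemann error is of order \<open>N \<delta> ^ 2\<close>.\<close>

lemma riemann_sum_tendsto:
 fixes N :: "nat => int" and \<delta> :: "nat => real"
 assumes \<delta>: "\<And>n. 0 < \<delta> n" and N: "\<And>n. 0 \<le> N n"
  and large: "filterlim (\<lambda>n. of_int (N n)*\<delta> n) at_top sequentially"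
  and fine: "(\<lambda>n. (2 * of_int (N n)+1)*(\<delta> n)^2) \<longlonglongrightarrow> 0"
 shows "(\<lambda>n. \<delta> n*(\<Sum>l\<in>{- N n..N n}. (Khat (\<delta> n * of_int l))^2)) \<longlonglongrightarrow> 2 * pi*(\<integral>v. (K v)^2 \<partial>lborel)"
proof -
 let ?g = "\<lambda>y. (Khat y)^2"
 have gi: "integrable lborel ?g" and gv: "(\<integral>y. ?g y \<partial>lborel) = 2 * pi*(\<integral>v. (K v)^2 \<partial>lborel)"
  using plancherel by (simp_all add: has_bochner_integral_iff)
 define cell where "cell n l = {\<delta> n * of_int l ..< \<delta> n * of_int (l+1)}" for n and l :: int
 define J where "J n = {- (of_int (N n)*\<delta> n) ..< (of_int (N n)+1)*\<delta> n}" for n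
 have ind: "indicator (J n) y = (\<Sum>l\<in>{- N n..N n}. indicator (cell n l) y :: real)" for n y
 proof -
  have iff: "y \<in> cell n l \<longleftrightarrow> l = \<lfloor>y/\<delta> n\<rfloor>" for l
  proof -
   have "l = \<lfloor>y/\<delta> n\<rfloor> \<longleftrightarrow> of_int l \<le> y/\<delta> n \<and> y/\<delta> n < of_int l+1"
    using floor_eq_iff[of "y/\<delta> n" l] by auto
   also have "... \<longleftrightarrow> y \<in> cell n l"
    using \<delta>[of n] unfolding cell_def
    by (simp add: pos_le_divide_eq pos_divide_less_eq mult.commute)
   finally show ?thesis by simp
  qed
  have "(\<Sum>l\<in>{- N n..N n}. indicator (cell n l) y :: real) = (\<Sum>l\<in>{- N n..N n}. if l = \<lfloor>y/\<delta> n\<rfloor> then 1 else 0)"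
   by (intro sum.cong) (auto simp: indicator_def iff)
  also have "... = (if \<lfloor>y/\<delta> n\<rfloor> \<in> {- N n..N n} then 1 else 0)" by (simp add: sum.delta)
  also have "\<lfloor>y/\<delta> n\<rfloor> \<in> {- N n..N n} \<longleftrightarrow> y \<in> J n"
  proof -
   have "\<lfloor>y/\<delta> n\<rfloor> \<in> {- N n..N n} \<longleftrightarrow> of_int (- N n) \<le> y/\<delta> n \<and> y/\<delta> n < of_int (N n)+1"
    unfolding atLeastAtMost_iff le_floor_iff floor_le_iff ..
   also have "... \<longleftrightarrow> y \<in> J n"
    using \<delta>[of n] unfolding J_def by (simp add: pos_le_divide_eq pos_divide_less_eq)
   finally show ?thesis .
  qed
  finally show ?thesis by (simp add: indicator_def)
 qed
 have celli: "integrable lborel (\<lambda>y. ?g y * indicator (cell n l) y)" for n l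
  unfolding cell_def using integrable_real_mult_indicator[OF _ gi] by simp
 have cell1: "(\<integral>y. indicator (cell n l) y \<partial>lborel) = \<delta> n" and cell1i: "integrable lborel (indicator (cell n l) :: real => real)" for n l
  unfolding cell_def using \<delta>[of n] by (simp_all add: algebra_simps)
 have cell_err: "\<bar>(\<integral>y. ?g y * indicator (cell n l) y \<partial>lborel) - \<delta> n*?g (\<delta> n * of_int l)\<bar> \<le> 2*(\<delta> n)^2" for n l
 proof -
  let ?c = "?g (\<delta> n * of_int l)"
  have eq: "(\<integral>y. ?g y * indicator (cell n l) y \<partial>lborel) - \<delta> n*?c = (\<integral>y. ?g y * indicator (cell n l) y - ?c * indicator (cell n l) y \<partial>lborel)"
   using celli[of n l] cell1[of n l] cell1i[of n l] by simp
  have "\<bar>\<integral>y. ?g y * indicator (cell n l) y - ?c * indicator (cell n l) y \<partial>lborel\<bar> \<le> (\<integral>y. \<bar>?g y * indicator (cell n l) y - ?c * indicator (cell n l) y\<bar> \<partial>lborel)"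
   by (rule integral_abs_bound)
  also have "... \<le> (\<integral>y. 2*\<delta> n * indicator (cell n l) y \<partial>lborel)"
  proof (intro integral_mono)
   fix y
   show "\<bar>?g y * indicator (cell n l) y - ?c * indicator (cell n l) y\<bar> \<le> 2*\<delta> n * indicator (cell n l) y"
   proof (cases "y \<in> cell n l")
    case True
    then have "\<bar>y - \<delta> n * of_int l\<bar> \<le> \<delta> n" unfolding cell_def by (auto simp: algebra_simps)
    then show ?thesis using True Khat_square_lipschitz[of y "\<delta> n * of_int l"] by simp
   qed simp
  qed (use celli[of n l] cell1i[of n l] in auto)
  also have "... = 2*(\<delta> n)^2" using cell1[of n l] by (simp add: power2_eq_square)
  finally show ?thesis unfolding eq .
 qed
 have sum: "(\<integral>y. ?g y * indicator (J n) y \<partial>lborel) = (\<Sum>l\<in>{- N n..N n}. \<integral>y. ?g y * indicator (cell n l) y \<partial>lborel)" for n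
  unfolding ind sum_distrib_left using celli by (intro Bochner_Integration.integral_sum)
 have err: "norm (\<delta> n*(\<Sum>l\<in>{- N n..N n}. ?g (\<delta> n * of_int l)) - (\<integral>y. ?g y * indicator (J n) y \<partial>lborel)) \<le> 2*((2 * of_int (N n)+1)*(\<delta> n)^2)" for n
 proof -
  have "norm (\<delta> n*(\<Sum>l\<in>{- N n..N n}. ?g (\<delta> n * of_int l)) - (\<integral>y. ?g y * indicator (J n) y \<partial>lborel))
   = \<bar>\<Sum>l\<in>{- N n..N n}. ((\<integral>y. ?g y * indicator (cell n l) y \<partial>lborel) - \<delta> n*?g (\<delta> n * of_int l))\<bar>"
   unfolding sum by (simp add: sum_subtractf sum_distrib_left abs_minus_commute)
  also have "... \<le> (\<Sum>l\<in>{- N n..N n}. 2*(\<delta> n)^2)"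
   using cell_err by (intro order_trans[OF sum_abs] sum_mono)
  also have "... = real (card {- N n..N n})*(2*(\<delta> n)^2)" by simp
  also have "real (card {- N n..N n}) = 2 * of_int (N n)+1" using N[of n] by simp
  finally show ?thesis by (simp add: algebra_simps)
 qed
 have "(\<lambda>n. \<integral>y. ?g y * indicator (J n) y \<partial>lborel) \<longlonglongrightarrow> (\<integral>y. ?g y \<partial>lborel)"
 proof (rule integral_dominated_convergence[where w = ?g])
  show "AE y in lborel. (\<lambda>n. ?g y * indicator (J n) y) \<longlonglongrightarrow> ?g y"
  proof (intro AE_I2)
   fix y
   have "\<forall>\<^sub>F n in sequentially. \<bar>y\<bar>+1 \<le> of_int (N n)*\<delta> n"
    using large unfolding filterlim_at_top by blast
   then have "\<forall>\<^sub>F n in sequentially. ?g y * indicator (J n) y = ?g y"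
   proof eventually_elim
    case (elim n)
    then have "y \<in> J n" unfolding J_def using \<delta>[of n] by (auto simp: algebra_simps)
    then show ?case by simp
   qed
   then show "(\<lambda>n. ?g y * indicator (J n) y) \<longlonglongrightarrow> ?g y" by (rule tendsto_eventually)
  qed
 qed (use gi in \<open>auto simp: J_def indicator_def\<close>)
 moreover have "(\<lambda>n. \<delta> n*(\<Sum>l\<in>{- N n..N n}. ?g (\<delta> n * of_int l)) - (\<integral>y. ?g y * indicator (J n) y \<partial>lborel)) \<longlonglongrightarrow> 0"
  by (rule Lim_null_comparison[OF always_eventually tendsto_mult_right_zero[OF fine, of 2]]) (use err in blast)
 ultimately have "(\<lambda>n. (\<delta> n*(\<Sum>l\<in>{- N n..N n}. ?g (\<delta> n * of_int l)) - (\<integral>y. ?g y * indicator (J n) y \<partial>lborel))+(\<integral>y. ?g y * indicator (J n) y \<partial>lborel)) \<longlonglongrightarrow> 0+(\<integral>y. ?g y \<partial>lborel)"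
  by (intro tendsto_add)
 then show ?thesis by (simp add: gv)
qed

text \<open>Summation by parts against the bounded partial sums of the cosine.\<close>

lemma oscillating_sum_le:
 assumes N: "0 \<le> N" and \<delta>: "0 < \<delta>" and \<theta>: "0 < sin \<theta>"
 shows "\<bar>\<Sum>l\<in>{- N..N}. (Khat (\<delta> * of_int l))^2 * cos (2 * of_int l*\<theta>)\<bar> \<le> (1+2 * of_int N*\<delta>)/sin \<theta>"
proof -
 define g where "g l = (Khat (\<delta> * of_int l))^2" for l :: int
 define s where "s l = sin ((2 * of_int l - 1)*\<theta>)" for l :: int
 have g: "0 \<le> g l" "g l \<le> 1" for l
  using Khat_abs_le[of "\<delta> * of_int l"] by (auto simp: g_def abs_square_le_1)
 have s: "\<bar>s l\<bar> \<le> 1" for l by (simp add: s_def)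
 have gd: "\<bar>g l - g (l - 1)\<bar> \<le> 2*\<delta>" for l
  using Khat_square_lipschitz[of "\<delta> * of_int l" "\<delta> * of_int (l - 1)"] \<delta> by (simp add: g_def algebra_simps)
 have tel: "2 * sin \<theta> * cos (2 * of_int l*\<theta>) = s (l+1) - s l" for l
 proof -
  have "s (l+1) = sin (2 * of_int l*\<theta>+\<theta>)" "s l = sin (2 * of_int l*\<theta> - \<theta>)"
   by (simp_all add: s_def algebra_simps)
  then show ?thesis by (simp add: sin_add sin_diff)
 qed
 \<comment> \<open>summation by parts\<close>
 have parts: "(\<Sum>l\<in>{- N..N}. g l*(s (l+1) - s l)) = g N * s (N+1) - g (- N) * s (- N) - (\<Sum>l\<in>{- N+1..N}. (g l - g (l - 1)) * s l)"
 proof -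
  have "(\<Sum>l\<in>{- M..M'}. g l*(s (l+1) - s l)) = g M' * s (M'+1) - g (- M) * s (- M) - (\<Sum>l\<in>{- M+1..M'}. (g l - g (l - 1)) * s l)"
   if "- M \<le> M'" for M M' :: int
   using that
  proof (induction M' rule: int_ge_induct)
   case base
   then show ?case by (simp add: algebra_simps)
  next
   case (step i)
   have "{- M..i+1} = insert (i+1) {- M..i}" "{- M+1..i+1} = insert (i+1) {- M+1..i}"
    using step.hyps by auto
   then show ?case using step.IH by (simp add: algebra_simps)
  qed
  from this[of N N] N show ?thesis by simp
 qed
 have gs: "\<bar>g l * s l'\<bar> \<le> 1" for l l'
  using g[of l] s[of l'] by (simp add: abs_mult mult_le_one)
 have "\<bar>\<Sum>l\<in>{- N+1..N}. (g l - g (l - 1)) * s l\<bar> \<le> (\<Sum>l\<in>{- N+1..N}. 2*\<delta>*1)"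
  unfolding abs_mult[symmetric]
  by (rule order_trans[OF sum_abs], rule sum_mono, unfold abs_mult, rule mult_mono[OF gd s]) (use \<delta> in auto)
 also have "... = real (card {- N+1..N})*(2*\<delta>)" by simp
 also have "real (card {- N+1..N}) = 2 * of_int N" using N by simp
 finally have rest: "\<bar>\<Sum>l\<in>{- N+1..N}. (g l - g (l - 1)) * s l\<bar> \<le> 2 * of_int N*(2*\<delta>)" .
 have "\<bar>\<Sum>l\<in>{- N..N}. g l*(s (l+1) - s l)\<bar> \<le> 1+1+2 * of_int N*(2*\<delta>)"
  unfolding parts using gs[of N "N+1"] gs[of "- N" "- N"] rest by linarith
 moreover have "(\<Sum>l\<in>{- N..N}. g l*(s (l+1) - s l)) = 2 * sin \<theta>*(\<Sum>l\<in>{- N..N}. g l * cos (2 * of_int l*\<theta>))"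
  unfolding sum_distrib_left tel[symmetric] by (intro sum.cong refl) simp
 ultimately have "2 * sin \<theta>*\<bar>\<Sum>l\<in>{- N..N}. g l * cos (2 * of_int l*\<theta>)\<bar> \<le> 2*(1+2 * of_int N*\<delta>)"
  using \<theta> by (simp add: abs_mult)
 then show ?thesis using \<theta> by (simp add: g_def field_simps)
qed

end

section \<open>Normal limits with varying variance\<close>


lemma real_distribution_normal_law: "0 < v ==> real_distribution (normal_law 0 v)"
 unfolding normal_law_def real_distribution_def real_distribution_axioms_def
 using prob_space_normal_density[of "sqrt v" 0] by simp

lemma char_normal_law:
 assumes v: "0 < v"
 shows "char (normal_law 0 v) s = complex_of_real (exp (- (v * s^2)/2))"
proof -
 let ?N = "density lborel std_normal_density"
 interpret N: prob_space ?N by (rule prob_space_normal_density) simp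
 have w: "0 < sqrt v" using v by simp
 have "distributed ?N lborel (\<lambda>x. x) (\<lambda>x. ennreal (normal_density 0 1 x))"
  unfolding distributed_def using distr_id2[of lborel ?N] by simp
 then have "distributed ?N lborel (\<lambda>x. 0+sqrt v * x) (\<lambda>x. ennreal (normal_density (0+sqrt v * 0) (\<bar>sqrt v\<bar>*1) x))"
  using w by (intro N.normal_density_affine) auto
 then have D: "normal_law 0 v = distr ?N lborel (\<lambda>x. sqrt v * x)"
  using w by (simp add: distributed_def normal_law_def)
 have "char (normal_law 0 v) s = (CLINT x|?N. iexp (s*(sqrt v * x)))"
  unfolding char_def D by (subst integral_distr) auto
 also have "... = char ?N (s * sqrt v)" by (simp add: char_def mult.assoc)
 also have "... = complex_of_real (exp (- (v * s^2)/2))"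
 proof -
  have "- (s * sqrt v)\<^sup>2/2 = - (v * s^2)/2" using v by (simp add: power_mult_distrib)
  then show ?thesis unfolding char_std_normal_distribution by (simp add: exp_of_real[symmetric] del: of_real_mult of_real_power)
 qed
 finally show ?thesis .
qed

text \<open>Levy's continuity theorem along subsequences on which the variances converge.\<close>

lemma weakly_merging_normal_lawI:
 assumes \<mu>: "\<And>n. real_distribution (\<mu> n)"
  and v: "\<And>n. 1 \<le> n ==> 0 < v n" "\<And>n. v n \<le> V"
  and char: "\<And>s. (\<lambda>n. char (\<mu> n) s - complex_of_real (exp (- (v n * s^2)/2))) \<longlonglongrightarrow> 0"
 shows "weakly_merging \<mu> (\<lambda>n. normal_law 0 (v n))"
 unfolding weakly_merging_def
proof (intro allI impI)
 fix g :: "real => real" assume g: "continuous_on UNIV g \<and> bounded (range g)"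
 then obtain B where B: "\<And>x. norm (g x) \<le> B" by (auto simp: bounded_iff)
 have cont: "isCont g x" for x using g by (simp add: continuous_on_eq_continuous_at)
 let ?x = "\<lambda>n. (\<integral>x. g x \<partial>\<mu> n) - (\<integral>x. g x \<partial>normal_law 0 (v n))"
 show "?x \<longlonglongrightarrow> 0"
 proof (rule ccontr)
  assume "\<not> ?x \<longlonglongrightarrow> 0"
  then obtain e where e: "0 < e" "\<not> (\<forall>\<^sub>F n in sequentially. dist (?x n) 0 < e)"
   unfolding tendsto_iff by auto
  have "\<exists>n. k < n \<and> e \<le> dist (?x n) 0" for k
  proof (rule ccontr)
   assume "\<not> ?thesis"
   then have "\<forall>\<^sub>F n in sequentially. dist (?x n) 0 < e"
    unfolding eventually_sequentially by (intro exI[of _ "Suc k"]) (auto simp: not_le Suc_le_eq)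
   then show False using e by simp
  qed
  then obtain h where h: "\<And>k. k < h k" "\<And>k. e \<le> dist (?x (h k)) 0" by metis
  define r where "r = rec_nat (h 0) (\<lambda>_. h)"
  have r_Suc: "r (Suc k) = h (r k)" and r_0: "r 0 = h 0" for k by (simp_all add: r_def)
  have r: "strict_mono r" by (rule strict_monoI_Suc) (simp add: r_Suc h(1))
  have far: "e \<le> dist (?x (r k)) 0" for k
   by (cases k) (simp_all only: r_Suc r_0 h(2))
  have r1: "1 \<le> r k" for k
   using h(1)[of 0] strict_mono_less_eq[OF r, of 0 k] by (simp add: r_0)
  have "bounded (range (v \<circ> r))"
   using v(1)[OF r1] v(2) by (intro boundedI[of _ V]) (auto simp: less_imp_le)
  then obtain w q where q: "strict_mono q" "((v \<circ> r) \<circ> q) \<longlonglongrightarrow> w"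
   using bounded_imp_convergent_subsequence by blast
  define p where "p = r \<circ> q"
  have p: "strict_mono p" unfolding p_def using r q(1) by (rule strict_mono_o)
  have vp: "(\<lambda>n. v (p n)) \<longlonglongrightarrow> w" using q(2) by (simp add: p_def comp_def)
  have vp0: "0 < v (p n)" for n using v(1)[OF r1] by (simp add: p_def)
  have w0: "0 \<le> w" using vp vp0 by (intro LIMSEQ_le_const[OF vp]) (auto intro: less_imp_le)
  define Lim where "Lim = (if 0 < w then normal_law 0 w else return borel 0)"
  have Lim: "real_distribution Lim"
  proof (cases "0 < w")
   case True then show ?thesis by (simp add: Lim_def real_distribution_normal_law)
  next
   case False
   interpret prob_space "return borel (0::real)" by (rule prob_space_return) simp
   have "real_distribution (return borel 0)" by (unfold_locales) auto
   then show ?thesis using False by (simp add: Lim_def)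
  qed
  have charL: "char Lim s = complex_of_real (exp (- (w * s^2)/2))" for s
  proof (cases "0 < w")
   case True then show ?thesis by (simp add: Lim_def char_normal_law)
  next
   case False
   then have "w = 0" using w0 by simp
   then show ?thesis by (simp add: Lim_def char_def integral_return)
  qed
  have gauss: "(\<lambda>n. complex_of_real (exp (- (v (p n) * s^2)/2))) \<longlonglongrightarrow> char Lim s" for s
   unfolding charL by (intro tendsto_intros vp) auto
  have "weak_conv_m (\<lambda>n. normal_law 0 (v (p n))) Lim"
   using gauss by (intro levy_continuity Lim real_distribution_normal_law vp0) (simp add: char_normal_law vp0)
  then have 1: "(\<lambda>n. \<integral>x. g x \<partial>normal_law 0 (v (p n))) \<longlonglongrightarrow> (\<integral>x. g x \<partial>Lim)"
   by (rule weak_conv_imp_integral_bdd_continuous_conv[OF real_distribution_normal_law[OF vp0] Lim _ cont B])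
  have "(\<lambda>n. (char (\<mu> (p n)) s - complex_of_real (exp (- (v (p n) * s^2)/2)))+complex_of_real (exp (- (v (p n) * s^2)/2))) \<longlonglongrightarrow> 0+char Lim s" for s
   using LIMSEQ_subseq_LIMSEQ[OF char[of s] p] gauss by (intro tendsto_add) (simp_all add: comp_def)
  then have "weak_conv_m (\<lambda>n. \<mu> (p n)) Lim"
   by (intro levy_continuity Lim \<mu>) simp
  then have 2: "(\<lambda>n. \<integral>x. g x \<partial>\<mu> (p n)) \<longlonglongrightarrow> (\<integral>x. g x \<partial>Lim)"
   by (rule weak_conv_imp_integral_bdd_continuous_conv[OF \<mu> Lim _ cont B])
  have "(\<lambda>n. ?x (p n)) \<longlonglongrightarrow> (\<integral>x. g x \<partial>Lim) - (\<integral>x. g x \<partial>Lim)" by (intro tendsto_diff 1 2)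
  then have "\<forall>\<^sub>F n in sequentially. dist (?x (p n)) 0 < e" using e(1) by (intro tendstoD) simp
  then obtain n where "dist (?x (p n)) 0 < e" by (auto simp: eventually_sequentially)
  then show False using far[of "q n"] by (simp add: p_def)
 qed
qed

section \<open>Spectral densities and the coefficient matrix\<close>


lemma geometric_int_sum_le:
 fixes \<rho> :: real
 assumes \<rho>: "0 < \<rho>" "\<rho> < 1" and F: "finite F" and far: "\<And>h. h \<in> F ==> int H \<le> \<bar>h\<bar>"
 shows "(\<Sum>h\<in>F. \<rho> ^ nat \<bar>h\<bar>) \<le> 2*\<rho> ^ H/(1 - \<rho>)"
proof -
 have half: "(\<Sum>h\<in>A. \<rho> ^ nat \<bar>h\<bar>) \<le> \<rho> ^ H/(1 - \<rho>)"
  if A: "A \<subseteq> F" and inj: "inj_on (\<lambda>h. nat \<bar>h\<bar>) A" for A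
 proof -
  have fin: "finite A" using A F finite_subset by blast
  let ?T = "(\<lambda>h. nat \<bar>h\<bar>) ` A"
  have s: "summable (\<lambda>i. \<rho> ^ (i + H))" using \<rho> by (simp add: summable_mult2 power_add)
  have sub: "?T \<subseteq> (\<lambda>i. i + H) ` {..Max (insert 0 ?T)}"
  proof
   fix x assume x: "x \<in> ?T"
   then have "H \<le> x" using far A by force
   moreover have "x \<le> Max (insert 0 ?T)" using x fin by (intro Max_ge) auto
   ultimately show "x \<in> (\<lambda>i. i + H) ` {..Max (insert 0 ?T)}" by (intro image_eqI[of _ _ "x - H"]) auto
  qed
  have "(\<Sum>h\<in>A. \<rho> ^ nat \<bar>h\<bar>) = (\<Sum>i\<in>?T. \<rho> ^ i)" using inj by (subst sum.reindex) auto
  also have "... \<le> (\<Sum>i\<in>(\<lambda>i. i + H) ` {..Max (insert 0 ?T)}. \<rho> ^ i)"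
   using sub \<rho> by (intro sum_mono2) auto
  also have "... = (\<Sum>i\<in>{..Max (insert 0 ?T)}. \<rho> ^ (i + H))" by (subst sum.reindex) auto
  also have "... \<le> (\<Sum>i. \<rho> ^ (i + H))" using s \<rho> by (intro sum_le_suminf) auto
  also have "... = \<rho> ^ H/(1 - \<rho>)" using \<rho> by (simp add: power_add suminf_mult2[symmetric] suminf_geometric)
  finally show ?thesis .
 qed
 have "F = {h \<in> F. 0 \<le> h} \<union> {h \<in> F. h < 0}" by auto
 then have "(\<Sum>h\<in>F. \<rho> ^ nat \<bar>h\<bar>) = (\<Sum>h\<in>{h \<in> F. 0 \<le> h}. \<rho> ^ nat \<bar>h\<bar>)+(\<Sum>h\<in>{h \<in> F. h < 0}. \<rho> ^ nat \<bar>h\<bar>)"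
  using F by (subst sum.union_disjoint[symmetric]) auto
 also have "... \<le> \<rho> ^ H/(1 - \<rho>)+\<rho> ^ H/(1 - \<rho>)"
  by (intro add_mono half) (auto simp: inj_on_def)
 finally show ?thesis by simp
qed

text \<open>Cauchy-Schwarz for the Hilbert-Schmidt inner product.\<close>

lemma trace_difference_le:
 fixes f g :: "'i => 'i => real"
 assumes F: "(\<Sum>j\<in>I. \<Sum>l\<in>I. (f j l)^2) \<le> F" and G: "(\<Sum>j\<in>I. \<Sum>l\<in>I. (g j l)^2) \<le> G"
  and E: "(\<Sum>j\<in>I. \<Sum>l\<in>I. (f j l - g j l)^2) \<le> E"
 shows "\<bar>(\<Sum>j\<in>I. \<Sum>l\<in>I. f j l * f l j) - (\<Sum>j\<in>I. \<Sum>l\<in>I. g j l * g l j)\<bar> \<le> sqrt E*(sqrt F+sqrt G)"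
proof -
 have cs: "\<bar>\<Sum>j\<in>I. \<Sum>l\<in>I. x j l * y l j\<bar> \<le> sqrt X * sqrt Y"
  if X: "(\<Sum>j\<in>I. \<Sum>l\<in>I. (x j l)^2) \<le> X" and Y: "(\<Sum>j\<in>I. \<Sum>l\<in>I. (y j l)^2) \<le> Y" for x y :: "'i => 'i => real" and X Y
 proof -
  have Y': "(\<Sum>j\<in>I. \<Sum>l\<in>I. (y l j)^2) \<le> Y" using Y by (subst sum.swap)
  have "(\<Sum>j\<in>I. \<Sum>l\<in>I. x j l * y l j)^2 = (\<Sum>p\<in>I \<times> I. x (fst p) (snd p) * y (snd p) (fst p))^2"
   by (simp add: sum.cartesian_product case_prod_beta')
  also have "... \<le> (\<Sum>p\<in>I \<times> I. (x (fst p) (snd p))^2)*(\<Sum>p\<in>I \<times> I. (y (snd p) (fst p))^2)"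
   by (rule Cauchy_Schwarz_ineq_sum)
  also have "... = (\<Sum>j\<in>I. \<Sum>l\<in>I. (x j l)^2)*(\<Sum>j\<in>I. \<Sum>l\<in>I. (y l j)^2)"
   by (simp add: sum.cartesian_product case_prod_beta')
  also have "... \<le> X*Y"
   using X Y' by (intro mult_mono) (auto intro!: sum_nonneg order_trans[OF _ X])
  finally have "\<bar>\<Sum>j\<in>I. \<Sum>l\<in>I. x j l * y l j\<bar> \<le> sqrt (X*Y)" by (simp add: real_le_rsqrt)
  then show ?thesis by (simp add: real_sqrt_mult)
 qed
 have eq: "(\<Sum>j\<in>I. \<Sum>l\<in>I. f j l * f l j) - (\<Sum>j\<in>I. \<Sum>l\<in>I. g j l * g l j)
  = (\<Sum>j\<in>I. \<Sum>l\<in>I. (f j l - g j l) * f l j)+(\<Sum>j\<in>I. \<Sum>l\<in>I. g j l*(f l j - g l j))"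
  by (simp add: sum_subtractf[symmetric] sum.distrib[symmetric] algebra_simps)
 have "\<bar>(\<Sum>j\<in>I. \<Sum>l\<in>I. f j l * f l j) - (\<Sum>j\<in>I. \<Sum>l\<in>I. g j l * g l j)\<bar>
  \<le> \<bar>\<Sum>j\<in>I. \<Sum>l\<in>I. (f j l - g j l) * f l j\<bar>+\<bar>\<Sum>j\<in>I. \<Sum>l\<in>I. g j l*(f l j - g l j)\<bar>"
  unfolding eq by (rule abs_triangle_ineq)
 also have "... \<le> sqrt E * sqrt F+sqrt G * sqrt E" by (intro add_mono cs E F G)
 finally show ?thesis by (simp add: algebra_simps)
qed

locale spectral_setting = short_memory_model M \<epsilon> \<epsilon>' r d G c \<rho> C+smoothing_kernel K B
 for M :: "'a measure" and \<epsilon> \<epsilon>' r d G c \<rho> C K B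
begin

abbreviation f :: "real => real => real" where
 "f \<equiv> local_spectral_density M \<epsilon> r d G"

definition gmax :: real where "gmax = 2 * b^2/(1 - \<rho>)"

lemma gmax_pos: "0 < gmax"
 using b_pos \<rho>_less by (simp add: gmax_def)

lemma \<gamma>_cos_sum_le:
 assumes t: "0 < t" "t \<le> 1" and F: "finite F" and far: "\<And>h. h \<in> F ==> int q \<le> \<bar>h\<bar>"
 shows "(\<Sum>h\<in>F. \<bar>\<gamma> t h * cos (of_int h*\<theta>)\<bar>) \<le> gmax*\<rho> ^ q"
proof -
 have "(\<Sum>h\<in>F. \<bar>\<gamma> t h * cos (of_int h*\<theta>)\<bar>) \<le> (\<Sum>h\<in>F. b^2*\<rho> ^ nat \<bar>h\<bar>)"
 proof (intro sum_mono)
  fix h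
  have "\<bar>\<gamma> t h * cos (of_int h*\<theta>)\<bar> \<le> \<bar>\<gamma> t h\<bar>*1"
   unfolding abs_mult by (intro mult_left_mono) auto
  then show "\<bar>\<gamma> t h * cos (of_int h*\<theta>)\<bar> \<le> b^2*\<rho> ^ nat \<bar>h\<bar>" using \<gamma>_decay[OF t, of h] by simp
 qed
 also have "... \<le> b^2*(2*\<rho> ^ q/(1 - \<rho>))"
  unfolding sum_distrib_left[symmetric] by (intro mult_left_mono geometric_int_sum_le \<rho>_pos \<rho>_less F far) auto
 finally show ?thesis by (simp add: gmax_def mult_ac)
qed

lemma spectral_truncation:
 assumes t: "0 < t" "t \<le> 1"
 shows "\<bar>2 * pi * f t \<theta> - (\<Sum>h\<in>{- int q..int q}. \<gamma> t h * cos (of_int h*\<theta>))\<bar> \<le> gmax*\<rho> ^ q"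
  and "\<bar>2 * pi * f t \<theta>\<bar> \<le> gmax"
proof -
 let ?u = "\<lambda>h. \<gamma> t h * cos (of_int h*\<theta>)"
 have abs: "(\<lambda>h. norm (?u h)) summable_on A" for A
 proof (rule nonneg_bdd_above_summable_on)
  show "bdd_above (sum (\<lambda>h. norm (?u h)) ` {F. F \<subseteq> A \<and> finite F})"
   using \<gamma>_cos_sum_le[OF t, of _ 0] by (intro bdd_aboveI[of _ gmax]) auto
 qed simp
 have summ: "?u summable_on A" for A using abs by (rule abs_summable_summable)
 have tail: "\<bar>infsum ?u A\<bar> \<le> gmax*\<rho> ^ q" if "\<And>h. h \<in> A ==> int q \<le> \<bar>h\<bar>" for A q
 proof -
  have "norm (infsum ?u A) \<le> infsum (\<lambda>h. norm (?u h)) A" by (rule norm_infsum_bound[OF abs])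
  also have "... \<le> gmax*\<rho> ^ q"
  proof (rule infsum_le_finite_sums[OF abs])
   fix F assume "finite F" "F \<subseteq> A"
   then show "(\<Sum>h\<in>F. norm (?u h)) \<le> gmax*\<rho> ^ q"
    using \<gamma>_cos_sum_le[OF t, of F q \<theta>] that by auto
  qed
  finally show ?thesis by simp
 qed
 have f: "2 * pi * f t \<theta> = infsum ?u UNIV" by (simp add: local_spectral_density_def)
 show "\<bar>2 * pi * f t \<theta>\<bar> \<le> gmax" unfolding f using tail[of UNIV 0] by simp
 let ?A = "{- int q..int q}"
 have out: "int q \<le> \<bar>h\<bar>" if "h \<in> - ?A" for h using that by auto
 have "infsum ?u (?A \<union> - ?A) = infsum ?u ?A+infsum ?u (- ?A)"
  by (intro infsum_Un_disjoint summ) auto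
 then have e: "2 * pi * f t \<theta> - (\<Sum>h\<in>?A. ?u h) = infsum ?u (- ?A)" unfolding f by simp
 show "\<bar>2 * pi * f t \<theta> - (\<Sum>h\<in>?A. ?u h)\<bar> \<le> gmax*\<rho> ^ q"
  unfolding e by (rule tail[OF out])
qed

lemma spectral_equicontinuity:
 assumes t: "0 < t" "t \<le> 1" and s: "0 < s" "s \<le> 1" and seg: "segment r d t = segment r d s"
 shows "\<bar>2 * pi * f t \<theta> - 2 * pi * f s \<theta>\<bar> \<le> (2 * real q+1)*(2*C * b*\<bar>t - s\<bar>)+2 * gmax*\<rho> ^ q"
proof -
 let ?S = "\<lambda>t. \<Sum>h\<in>{- int q..int q}. \<gamma> t h * cos (of_int h*\<theta>)"
 have "\<bar>?S t - ?S s\<bar> \<le> (\<Sum>h\<in>{- int q..int q}. 2*C * b*\<bar>t - s\<bar>)"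
  unfolding sum_subtractf[symmetric] left_diff_distrib[symmetric]
 proof (intro order_trans[OF sum_abs] sum_mono)
  fix h
  have "\<bar>(\<gamma> t h - \<gamma> s h) * cos (of_int h*\<theta>)\<bar> \<le> \<bar>\<gamma> t h - \<gamma> s h\<bar>*1"
   unfolding abs_mult by (intro mult_left_mono) auto
  then show "\<bar>(\<gamma> t h - \<gamma> s h) * cos (of_int h*\<theta>)\<bar> \<le> 2*C * b*\<bar>t - s\<bar>"
   using \<gamma>_lipschitz[OF t s seg, of h] by simp
 qed
 also have "... = (2 * real q+1)*(2*C * b*\<bar>t - s\<bar>)" by simp
 finally show ?thesis using spectral_truncation(1)[OF t, of \<theta> q] spectral_truncation(1)[OF s, of \<theta> q] by linarith
qed

text \<open>Indices within distance \<open>N\<close> of a break point, where neighbours may belong to another segment.\<close>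

definition bad :: "nat => nat => int set" where
 "bad n N = {j \<in> {1..int n}. \<exists>i\<le>Suc r. \<bar>of_int j - real n * d i\<bar> \<le> real N}"

lemma card_bad_le: "real (card (bad n N)) \<le> real (r+2)*(2 * real N+1)"
proof -
 have "bad n N \<subseteq> (\<Union>i\<in>{..Suc r}. {\<lceil>real n * d i - real N\<rceil>..\<lfloor>real n * d i+real N\<rfloor>})"
 proof
  fix j assume "j \<in> bad n N"
  then obtain i where i: "i \<le> Suc r" "\<bar>of_int j - real n * d i\<bar> \<le> real N" unfolding bad_def by blast
  then have "\<lceil>real n * d i - real N\<rceil> \<le> j" "j \<le> \<lfloor>real n * d i+real N\<rfloor>"
   unfolding ceiling_le_iff le_floor_iff by linarith+
  then show "j \<in> (\<Union>i\<in>{..Suc r}. {\<lceil>real n * d i - real N\<rceil>..\<lfloor>real n * d i+real N\<rfloor>})"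
   using i(1) by (intro UN_I[of i]) (simp_all only: atMost_iff atLeastAtMost_iff)
 qed
 then have "card (bad n N) \<le> card (\<Union>i\<in>{..Suc r}. {\<lceil>real n * d i - real N\<rceil>..\<lfloor>real n * d i+real N\<rfloor>})"
  by (intro card_mono) auto
 also have "... \<le> (\<Sum>i\<in>{..Suc r}. card {\<lceil>real n * d i - real N\<rceil>..\<lfloor>real n * d i+real N\<rfloor>})"
  by (rule card_UN_le) simp
 also have "... \<le> (\<Sum>i\<in>{..Suc r}. 2*N+1)"
 proof (intro sum_mono)
  fix i
  have "\<lfloor>real n * d i+real N\<rfloor> - \<lceil>real n * d i - real N\<rceil> \<le> 2 * int N" by linarith
  then show "card {\<lceil>real n * d i - real N\<rceil>..\<lfloor>real n * d i+real N\<rfloor>} \<le> 2*N+1" by simp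
 qed
 finally have "card (bad n N) \<le> (r+2)*(2*N+1)" by simp
 then have "real (card (bad n N)) \<le> real ((r+2)*(2*N+1))" by (simp only: of_nat_le_iff)
 then show ?thesis by (simp add: algebra_simps)
qed

lemma good_index:
 assumes j: "j \<in> {1..int n} - bad n N" and n: "1 \<le> n"
 shows "1 \<le> j - int N" "j+int N \<le> int n"
  and "\<And>t. \<bar>t - of_int j/real n\<bar> \<le> real N/real n ==>
    0 < t \<and> t \<le> 1 \<and> segment r d t = segment r d (of_int j/real n)"
proof -
 have far: "real N < \<bar>of_int j - real n * d i\<bar>" if "i \<le> Suc r" for i
  using j that unfolding bad_def by auto
 have far0: "real N < of_int j" using far[of 0] j by (simp add: d_0)
 show "1 \<le> j - int N" using far0 by linarith
 have far1: "real N < real n - of_int j" using far[of "Suc r"] j by (simp add: d_end)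
 show "j+int N \<le> int n" using far1 by linarith
 fix t :: real assume t: "\<bar>t - of_int j/real n\<bar> \<le> real N/real n"
 have n0: "0 < real n" using n by simp
 have tn: "\<bar>real n * t - of_int j\<bar> \<le> real N"
 proof -
  have "real n*\<bar>t - of_int j/real n\<bar> \<le> real n*(real N/real n)" using t n0 by (intro mult_left_mono) auto
  moreover have "real n*\<bar>t - of_int j/real n\<bar> = \<bar>real n * t - of_int j\<bar>"
  proof -
   have "real n*\<bar>t - of_int j/real n\<bar> = \<bar>real n*(t - of_int j/real n)\<bar>" by (simp add: abs_mult)
   also have "real n*(t - of_int j/real n) = real n * t - of_int j" using n0 by (simp add: right_diff_distrib)
   finally show ?thesis .
  qed
  ultimately show ?thesis using n0 by simp
 qed
 have j01: "0 < of_int j/real n" "of_int j/real n \<le> 1" using j n0 by auto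
 obtain k where k: "k \<le> r" "d k < of_int j/real n" "of_int j/real n \<le> d (Suc k)" "segment r d (of_int j/real n) = k"
  by (rule segment_exists[OF j01])
 have kk: "real n * d k < of_int j" "of_int j \<le> real n * d (Suc k)"
  using k(2,3) n0 by (simp_all add: field_simps)
 have "real N < of_int j - real n * d k" using far[of k] k(1) kk(1) by simp
 then have "real n * d k < real n * t" using tn by linarith
 then have 1: "d k < t" using n0 by simp
 have "real N < real n * d (Suc k) - of_int j" using far[of "Suc k"] k(1) kk(2) by simp
 then have "real n * t < real n * d (Suc k)" using tn by linarith
 then have 2: "t < d (Suc k)" using n0 by simp
 have "0 \<le> d k" "d (Suc k) \<le> 1" using d_mono[of 0 k] d_mono[of "Suc k" "Suc r"] k(1) d_0 d_end by auto
 then show "0 < t \<and> t \<le> 1 \<and> segment r d t = segment r d (of_int j/real n)"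
  using 1 2 segment_eq[of k t] k by auto
qed

definition S :: real where "S = 6 * b^2/(1 - \<rho>)"

lemma S_pos: "0 < S"
 using b_pos \<rho>_less by (simp add: S_def)

lemma X'_covariance_far:
 assumes t: "0 < t" "t \<le> 1" and s: "0 < s" "s \<le> 1" and "int L < \<bar>k - l\<bar>"
 shows "expectation (\<lambda>om. X' L t k om*X' L s l om) = 0"
proof -
 have int: "integrable M (X' L t k)" if "0 < t" "t \<le> 1" for t k
 proof -
  have "integrable M (\<lambda>om. X' L t k om ^ 1)"
   by (rule integrable_power_le4[OF _ X'_power4(1)[OF that]]) (use that in simp_all)
  then show ?thesis by simp
 qed
 have "expectation (\<lambda>om. X' L t k om*X' L s l om) = expectation (X' L t k) * expectation (X' L s l)"
  by (rule expectation_mult_disjoint[OF X'_window[OF t] X'_window[OF s]])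
   (use assms int in auto)
 then show ?thesis by (simp add: X'_mean[OF t])
qed

lemma X'_covariance_error:
 assumes t: "0 < t" "t \<le> 1" and s: "0 < s" "s \<le> 1"
 shows "\<bar>expectation (\<lambda>om. X t k om*X s l om) - expectation (\<lambda>om. X' L t k om*X' L s l om)\<bar> \<le> 2 * b^2*\<rho> ^ L"
proof -
 have "expectation (\<lambda>om. X t k om*X s l om) - expectation (\<lambda>om. X' L t k om*X' L s l om)
  = expectation (\<lambda>om. X t k om*X s l om - X' L t k om*X' L s l om)"
  using covariance_X'(1)[OF t s, of k l] covariance_X'(2)[OF t s, of L k l] by simp
 then have "\<bar>expectation (\<lambda>om. X t k om*X s l om) - expectation (\<lambda>om. X' L t k om*X' L s l om)\<bar>
  \<le> expectation (\<lambda>om. \<bar>X t k om*X s l om - X' L t k om*X' L s l om\<bar>)"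
  using integral_abs_bound[of M "\<lambda>om. X t k om*X s l om - X' L t k om*X' L s l om"] by simp
 then show ?thesis using covariance_X'(3)[OF t s, of k l L] by linarith
qed

lemma X'_covariance_decay:
 assumes t: "0 < t" "t \<le> 1" and s: "0 < s" "s \<le> 1"
 shows "\<bar>expectation (\<lambda>om. X' L t k om*X' L s l om)\<bar> \<le> 3 * b^2*\<rho> ^ nat \<bar>k - l\<bar>"
proof (cases "int L < \<bar>k - l\<bar>")
 case True
 then show ?thesis using X'_covariance_far[OF t s True] \<rho>_pos by simp
next
 case False
 then have "\<rho> ^ L \<le> \<rho> ^ nat \<bar>k - l\<bar>" using \<rho>_pos \<rho>_less by (intro power_decreasing) auto
 then have "2 * b^2*\<rho> ^ L \<le> 2 * b^2*\<rho> ^ nat \<bar>k - l\<bar>" by (intro mult_left_mono) auto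
 then show ?thesis
  using X'_covariance_error[OF t s, of k l L] covariance_decay[OF s t, of k l] by linarith
qed

end

text \<open>One sample size with its truncation length \<open>L\<close>. The bound on \<open>m\<close> keeps \<open>\<delta>\<close> below \<open>pi\<close>, so frequencies are not wrapped around.\<close>

locale spectral_sample = spectral_setting M \<epsilon> \<epsilon>' r d G c \<rho> C K B
 for M :: "'a measure" and \<epsilon> \<epsilon>' r d G c \<rho> C K B +
 fixes n :: nat and m \<theta> :: real and L :: nat
 assumes n: "1 \<le> n" and m: "0 < m" and mn: "2 * m \<le> real n"
begin

definition t :: "int => real" where "t j = of_int j/real n"

definition I :: "int set" where "I = {1..int n}"

definition \<delta> :: real where "\<delta> = 2 * pi * m/real n"

definition s :: real where "s = sqrt m/(2 * pi * real n)"

definition v :: real where "v = B/(4 * pi^2 * real n)"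

definition A0 :: "real => int => int => real" where
 "A0 \<alpha> j k = s*(Khat (\<delta> * of_int (j - k)) * cos (of_int (j - k)*\<alpha>))"

abbreviation A :: "int => int => real" where "A \<equiv> A0 \<theta>"

definition A_far :: "int => int => real" where
 "A_far j k = (if \<bar>j - k\<bar> \<le> 5 * int L then 0 else A j k)"

lemma t_range: "j \<in> I ==> 0 < t j" "j \<in> I ==> t j \<le> 1"
 using n by (auto simp: t_def I_def)

lemma finite_I: "finite I" and card_I: "card I = n"
 by (simp_all add: I_def)

lemma pos: "0 < \<delta>" "\<delta> \<le> pi" "0 < s" "0 < v" "0 < real n"
 using n m mn B_pos by (auto simp: \<delta>_def s_def v_def field_simps)

lemma A0_sym: "A0 \<alpha> j k = A0 \<alpha> k j"
proof -
 have "Khat (\<delta> * of_int (j - k)) = Khat (- (\<delta> * of_int (k - j)))" by (simp add: algebra_simps)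
 moreover have "cos (of_int (j - k)*\<alpha>) = cos (- (of_int (k - j)*\<alpha>))" by (simp add: algebra_simps)
 ultimately show ?thesis by (simp only: A0_def Khat_even cos_minus)
qed

lemma A0_abs_le: "\<bar>A0 \<alpha> j k\<bar> \<le> s"
proof -
 have "\<bar>Khat (\<delta> * of_int (j - k))\<bar>*\<bar>cos (of_int (j - k)*\<alpha>)\<bar> \<le> 1*1"
  by (intro mult_mono Khat_abs_le) auto
 then have "s*(\<bar>Khat (\<delta> * of_int (j - k))\<bar>*\<bar>cos (of_int (j - k)*\<alpha>)\<bar>) \<le> s*(1*1)"
  using pos(3) by (intro mult_left_mono) auto
 then show ?thesis using pos(3) by (simp only: A0_def abs_mult abs_of_pos mult_1_right)
qed

definition \<kappa> :: real where "\<kappa> = B/(2 * pi * sqrt m)"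

lemma \<kappa>: "0 < \<kappa>" "s*(B*(2 * pi/\<delta>)) = \<kappa>" "\<kappa> * s = v"
proof -
 have q: "sqrt m * sqrt m = m" using m by simp
 have cancel: "x*B/(2 * pi*(x * x)) = B/(2 * pi * x)" if "0 < x" for x :: real
  using that by (simp add: field_simps)
 show "0 < \<kappa>" using B_pos m by (simp add: \<kappa>_def)
 have "s*(B*(2 * pi/\<delta>)) = sqrt m*B/(2 * pi * m)"
  using pos(5) m by (simp add: s_def \<delta>_def field_simps)
 also have "... = sqrt m*B/(2 * pi*(sqrt m * sqrt m))" by (simp only: q)
 also have "... = \<kappa>" unfolding \<kappa>_def by (rule cancel) (use m in simp)
 finally show "s*(B*(2 * pi/\<delta>)) = \<kappa>" .
 show "\<kappa> * s = v" using m pos(5) by (simp add: \<kappa>_def s_def v_def power2_eq_square)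
qed

lemma A0_form: "(\<Sum>j\<in>J. \<Sum>k\<in>J. A0 \<alpha> j k * x j * x k) = s*(\<Sum>j\<in>J. \<Sum>k\<in>J. Khat (\<delta> * of_int (j - k)) * cos (of_int (j - k)*\<alpha>) * x j * x k)"
 unfolding A0_def sum_distrib_left by (intro sum.cong refl) (simp only: mult.assoc)

lemma A0_operator: "(\<Sum>j\<in>I. (\<Sum>k\<in>I. A0 \<alpha> j k * x k)^2) \<le> \<kappa>*(\<Sum>j\<in>I. \<Sum>k\<in>I. A0 \<alpha> j k * x j * x k)"
 and A0_form_le: "(\<Sum>j\<in>I. \<Sum>k\<in>I. A0 \<alpha> j k * x j * x k) \<le> \<kappa>*(\<Sum>j\<in>I. (x j)^2)"
proof -
 have psd: "0 \<le> (\<Sum>j\<in>I. \<Sum>k\<in>I. A0 \<alpha> j k * x j * x k)" for x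
  unfolding A0_form using pos(3) by (intro mult_nonneg_nonneg form_nonneg finite_I) auto
 have le: "(\<Sum>j\<in>I. \<Sum>k\<in>I. A0 \<alpha> j k * x j * x k) \<le> \<kappa>*(\<Sum>j\<in>I. (x j)^2)" for x
  unfolding A0_form \<kappa>(2)[symmetric] mult.assoc[of s]
  using pos by (intro mult_left_mono form_le finite_I) auto
 show "(\<Sum>j\<in>I. \<Sum>k\<in>I. A0 \<alpha> j k * x j * x k) \<le> \<kappa>*(\<Sum>j\<in>I. (x j)^2)" by (rule le)
 show "(\<Sum>j\<in>I. (\<Sum>k\<in>I. A0 \<alpha> j k * x k)^2) \<le> \<kappa>*(\<Sum>j\<in>I. \<Sum>k\<in>I. A0 \<alpha> j k * x j * x k)"
  by (rule psd_operator_bound[OF A0_sym \<kappa>(1) psd le])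
qed

lemma A0_row:
 assumes "j \<in> I"
 shows "(\<Sum>k\<in>I. (A0 \<alpha> j k)^2) \<le> v"
proof -
 let ?x = "\<lambda>k. if k = j then 1 else 0 :: real"
 have e: "(\<Sum>k\<in>I. A0 \<alpha> i k*?x k) = A0 \<alpha> i j" for i
  using assms finite_I by (simp add: if_distrib cong: if_cong)
 have inner: "(\<Sum>k\<in>I. A0 \<alpha> i k*?x i*?x k) = (if i = j then A0 \<alpha> j j else 0)" for i
 proof -
  have "(\<Sum>k\<in>I. A0 \<alpha> i k*?x i*?x k) = ?x i*(\<Sum>k\<in>I. A0 \<alpha> i k*?x k)"
   unfolding sum_distrib_left by (intro sum.cong refl) (simp only: mult_ac)
  then show ?thesis unfolding e by simp
 qed
 have q: "(\<Sum>i\<in>I. \<Sum>k\<in>I. A0 \<alpha> i k*?x i*?x k) = A0 \<alpha> j j"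
  unfolding inner using assms finite_I by simp
 have "(\<Sum>k\<in>I. (A0 \<alpha> j k)^2) = (\<Sum>i\<in>I. (\<Sum>k\<in>I. A0 \<alpha> i k*?x k)^2)"
  unfolding e by (intro sum.cong refl arg_cong[where f="\<lambda>x. x^2"] A0_sym)
 also have "... \<le> \<kappa>*A0 \<alpha> j j" unfolding q[symmetric] by (rule A0_operator)
 also have "... = v" by (simp add: A0_def Khat_0 \<kappa>(3))
 finally show ?thesis .
qed

lemma A_far_row:
 assumes "j \<in> I"
 shows "(\<Sum>k\<in>I. (A_far j k)^2) \<le> v"
 by (rule order_trans[OF sum_mono A0_row[OF assms, of \<theta>]]) (simp add: A_far_def)

lemma band_card: "real (card {k \<in> I. \<bar>j - k\<bar> \<le> 5 * int L}) \<le> 10 * real L+1"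
proof -
 have "card {k \<in> I. \<bar>j - k\<bar> \<le> 5 * int L} \<le> card {j - 5 * int L..j+5 * int L}"
  by (intro card_mono) auto
 then show ?thesis by simp
qed

definition \<kappa>_far :: real where "\<kappa>_far = 2*\<kappa>^2+2*((10 * real L+1)^2 * s^2)"

lemma A_far_operator: "(\<Sum>j\<in>I. (\<Sum>k\<in>I. A_far j k * x k)^2) \<le> \<kappa>_far*(\<Sum>k\<in>I. (x k)^2)"
proof -
 let ?N = "\<lambda>j. {k \<in> I. \<bar>j - k\<bar> \<le> 5 * int L}"
 let ?R = "10 * real L+1"
 have split: "(\<Sum>k\<in>I. A_far j k * x k) = (\<Sum>k\<in>I. A j k * x k) - (\<Sum>k\<in>?N j. A j k * x k)" for j
 proof -
  have "(\<Sum>k\<in>?N j. A j k * x k) = (\<Sum>k\<in>I. if \<bar>j - k\<bar> \<le> 5 * int L then A j k * x k else 0)"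
   using finite_I by (simp add: sum.inter_filter)
  then show ?thesis unfolding A_far_def sum_subtractf[symmetric]
   by (simp add: sum_subtractf[symmetric]) (intro sum.cong; simp)
 qed
 have band: "(\<Sum>k\<in>?N j. A j k * x k)^2 \<le> (\<Sum>k\<in>?N j. ?R*(s^2*(x k)^2))" for j
 proof -
  have "(\<Sum>k\<in>?N j. A j k * x k)^2 \<le> real (card (?N j))*(\<Sum>k\<in>?N j. (A j k * x k)^2)"
   using Cauchy_Schwarz_ineq_sum[of "\<lambda>_. 1" "\<lambda>k. A j k * x k" "?N j"] by simp
  also have "... \<le> ?R*(\<Sum>k\<in>?N j. s^2*(x k)^2)"
  proof (intro mult_mono band_card sum_mono sum_nonneg)
   fix k
   have "\<bar>A j k\<bar>\<^sup>2 \<le> s^2" by (intro power_mono A0_abs_le) simp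
   then show "(A j k * x k)^2 \<le> s^2*(x k)^2" by (simp add: power_mult_distrib mult_right_mono)
  qed auto
  finally show ?thesis by (simp add: sum_distrib_left)
 qed
 have "(\<Sum>j\<in>I. (\<Sum>k\<in>I. A_far j k * x k)^2) \<le> (\<Sum>j\<in>I. 2*(\<Sum>k\<in>I. A j k * x k)^2+2*(\<Sum>k\<in>?N j. A j k * x k)^2)"
 proof (intro sum_mono)
  fix j
  have "(p - q)^2 \<le> 2 * p^2+2 * q^2" for p q :: real
   using zero_le_power2[of "p+q"] by (simp add: power2_eq_square algebra_simps)
  then show "(\<Sum>k\<in>I. A_far j k * x k)^2 \<le> 2*(\<Sum>k\<in>I. A j k * x k)^2+2*(\<Sum>k\<in>?N j. A j k * x k)^2"
   unfolding split .
 qed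
 also have "... = 2*(\<Sum>j\<in>I. (\<Sum>k\<in>I. A j k * x k)^2)+2*(\<Sum>j\<in>I. (\<Sum>k\<in>?N j. A j k * x k)^2)"
  by (simp add: sum.distrib sum_distrib_left)
 also have "... \<le> 2*(\<kappa>*(\<kappa>*(\<Sum>k\<in>I. (x k)^2)))+2*(?R^2 * s^2*(\<Sum>k\<in>I. (x k)^2))"
 proof (intro add_mono mult_left_mono)
  show "(\<Sum>j\<in>I. (\<Sum>k\<in>I. A j k * x k)^2) \<le> \<kappa>*(\<kappa>*(\<Sum>k\<in>I. (x k)^2))"
   using \<kappa>(1) by (intro order_trans[OF A0_operator] mult_left_mono A0_form_le) auto
  have "(\<Sum>j\<in>I. (\<Sum>k\<in>?N j. A j k * x k)^2) \<le> (\<Sum>j\<in>I. \<Sum>k\<in>?N j. ?R*(s^2*(x k)^2))"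
   by (intro sum_mono band)
  also have "... = (\<Sum>j\<in>I. \<Sum>k\<in>I. if \<bar>j - k\<bar> \<le> 5 * int L then ?R*(s^2*(x k)^2) else 0)"
   using finite_I by (simp add: sum.inter_filter)
  also have "... = (\<Sum>k\<in>I. \<Sum>j\<in>I. if \<bar>k - j\<bar> \<le> 5 * int L then ?R*(s^2*(x k)^2) else 0)"
   by (subst sum.swap) (simp add: abs_minus_commute)
  also have "... = (\<Sum>k\<in>I. real (card (?N k))*(?R*(s^2*(x k)^2)))"
   using finite_I by (simp add: sum.inter_filter[symmetric])
  also have "... \<le> (\<Sum>k\<in>I. ?R*(?R*(s^2*(x k)^2)))"
   by (intro sum_mono mult_right_mono band_card) auto
  finally show "(\<Sum>j\<in>I. (\<Sum>k\<in>?N j. A j k * x k)^2) \<le> ?R^2 * s^2*(\<Sum>k\<in>I. (x k)^2)"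
   by (simp add: sum_distrib_left power2_eq_square mult.assoc)
 qed auto
 also have "... = \<kappa>_far*(\<Sum>k\<in>I. (x k)^2)" by (simp add: \<kappa>_far_def power2_eq_square algebra_simps)
 finally show ?thesis .
qed

definition XL :: "int => 'a => real" where "XL j = X' L (t j) j"

lemma XL_row_sum:
 assumes "i \<in> I"
 shows "(\<Sum>j\<in>I. \<bar>expectation (\<lambda>om. XL i om*XL j om)\<bar>) \<le> S"
proof -
 have "(\<Sum>j\<in>I. \<bar>expectation (\<lambda>om. XL i om*XL j om)\<bar>) \<le> (\<Sum>j\<in>I. 3 * b^2*\<rho> ^ nat \<bar>i - j\<bar>)"
  unfolding XL_def using assms t_range by (intro sum_mono X'_covariance_decay) auto
 also have "... = 3 * b^2*(\<Sum>h\<in>(\<lambda>j. i - j) ` I. \<rho> ^ nat \<bar>h\<bar>)"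
  by (subst sum.reindex) (auto simp: inj_on_def sum_distrib_left)
 also have "... \<le> 3 * b^2*(2*\<rho> ^ 0/(1 - \<rho>))"
  using finite_I by (intro mult_left_mono geometric_int_sum_le \<rho>_pos \<rho>_less) auto
 finally show ?thesis by (simp add: S_def)
qed

lemma far_form_XL: "far_form M \<epsilon> XL I (int L) (1+b ^ 4) S A_far v"
proof unfold_locales
 fix j assume j: "j \<in> I"
 note tj = t_range[OF j]
 show "XL j \<in> borel_measurable (noise_field {j - int L..j})"
  unfolding XL_def by (rule measurable_noise_field_mono[OF X'_window[OF tj]]) auto
 show "expectation (XL j) = 0" unfolding XL_def by (rule X'_mean[OF tj])
 show "integrable M (\<lambda>om. XL j om ^ 4)" unfolding XL_def by (rule X'_power4(1)[OF tj])
 show "expectation (\<lambda>om. XL j om ^ 4) \<le> 1+b ^ 4" unfolding XL_def using X'_power4(2)[OF tj, of L j] by simp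
 show "(\<Sum>k\<in>I. \<bar>expectation (\<lambda>om. XL j om*XL k om)\<bar>) \<le> S" by (rule XL_row_sum[OF j])
 show "(\<Sum>k\<in>I. (A_far j k)^2) \<le> v" by (rule A_far_row[OF j])
next
 show "A_far j k = A_far k j" for j k by (simp add: A_far_def A0_sym abs_minus_commute)
 show "finite I" by (rule finite_I)
 show "0 < S" by (rule S_pos)
 show "0 < v" by (rule pos(4))
 show "A_far j k = 0" if "\<bar>j - k\<bar> \<le> 5 * int L" for j k using that by (simp add: A_far_def)
qed simp_all

lemmas dependent_array_XL = far_form.axioms(1)[OF far_form_XL]

abbreviation \<sigma> :: "int => int => real" where "\<sigma> \<equiv> dependent_array.\<sigma> M XL"

lemmas \<sigma>_def = dependent_array.\<sigma>_def[OF dependent_array_XL]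
lemmas \<sigma>_sym = dependent_array.\<sigma>_sym[OF dependent_array_XL]
lemmas \<sigma>_far = dependent_array.\<sigma>_far[OF dependent_array_XL]
lemmas row_sum_\<sigma> = dependent_array.row_sum_\<sigma>[OF dependent_array_XL]

definition g :: "int => real" where "g k = 2 * pi * f (t k) \<theta>"

lemma g_le: "k \<in> I ==> \<bar>g k\<bar> \<le> gmax"
 unfolding g_def using spectral_truncation(2) t_range by auto

definition \<eta>_good :: real where
 "\<eta>_good = (2 * real L+1)*(C * b*(real L/real n)+2 * b^2*\<rho> ^ L)+gmax*\<rho> ^ L"

lemma local_symbol_trivial:
 assumes k: "k \<in> I"
 shows "\<bar>(\<Sum>i\<in>I. cos (of_int (j - i)*\<theta>)*\<sigma> i k) - cos (of_int (j - k)*\<theta>) * g k\<bar> \<le> S+gmax"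
proof -
 have "\<bar>\<Sum>i\<in>I. cos (of_int (j - i)*\<theta>)*\<sigma> i k\<bar> \<le> (\<Sum>i\<in>I. \<bar>\<sigma> k i\<bar>)"
 proof (intro order_trans[OF sum_abs] sum_mono)
  fix i
  show "\<bar>cos (of_int (j - i)*\<theta>)*\<sigma> i k\<bar> \<le> \<bar>\<sigma> k i\<bar>"
   unfolding abs_mult \<sigma>_sym[of k i] by (intro mult_left_le_one_le) auto
 qed
 also have "... \<le> S" by (rule row_sum_\<sigma>[OF k])
 finally have 1: "\<bar>\<Sum>i\<in>I. cos (of_int (j - i)*\<theta>)*\<sigma> i k\<bar> \<le> S" .
 have "\<bar>cos (of_int (j - k)*\<theta>) * g k\<bar> \<le> \<bar>g k\<bar>"
  unfolding abs_mult by (intro mult_left_le_one_le) auto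
 then show ?thesis using 1 g_le[OF k] by linarith
qed

text \<open>Within one segment the covariance is nearly stationary, and a stationary covariance acts on a pure oscillation by multiplication.\<close>

lemma local_symbol_good:
 assumes k: "k \<in> I - bad n L"
 shows "\<bar>(\<Sum>i\<in>I. cos (of_int (j - i)*\<theta>)*\<sigma> i k) - cos (of_int (j - k)*\<theta>) * g k\<bar> \<le> \<eta>_good"
proof -
 have kI: "k \<in> I" using k by simp
 have k': "k \<in> {1..int n} - bad n L" using k by (simp add: I_def)
 note good = good_index[OF k' n]
 let ?W = "{- int L..int L}"
 define u where "u h = cos (of_int (j - k - h)*\<theta>)" for h
 have u: "\<bar>u h\<bar> \<le> 1" for h by (simp add: u_def)
 have in_I: "k+h \<in> I" if "h \<in> ?W" for h using that good(1,2) by (auto simp: I_def)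
 \<comment> \<open>only the lags up to \<open>L\<close> contribute, and all of them stay inside the sample\<close>
 have sum1: "(\<Sum>i\<in>I. cos (of_int (j - i)*\<theta>)*\<sigma> i k) = (\<Sum>h\<in>?W. u h*\<sigma> (k+h) k)"
 proof -
  have "(\<Sum>i\<in>I. cos (of_int (j - i)*\<theta>)*\<sigma> i k) = (\<Sum>i\<in>(\<lambda>h. k+h) ` ?W. cos (of_int (j - i)*\<theta>)*\<sigma> i k)"
  proof (rule sum.mono_neutral_right[OF finite_I])
   show "(\<lambda>h. k+h) ` ?W \<subseteq> I" using in_I by (intro image_subsetI)
   show "\<forall>i\<in>I - (\<lambda>h. k+h) ` ?W. cos (of_int (j - i)*\<theta>)*\<sigma> i k = 0"
   proof
    fix i assume i: "i \<in> I - (\<lambda>h. k+h) ` ?W"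
    have "i - k \<notin> ?W"
    proof
     assume "i - k \<in> ?W"
     then have "k+(i - k) \<in> (\<lambda>h. k+h) ` ?W" by (rule imageI)
     then show False using i by simp
    qed
    then have "int L < \<bar>i - k\<bar>" by auto
    then show "cos (of_int (j - i)*\<theta>)*\<sigma> i k = 0" using \<sigma>_far[of i k] i kI by simp
   qed
  qed
  also have "... = (\<Sum>h\<in>?W. u h*\<sigma> (k+h) k)"
   by (subst sum.reindex) (auto simp: u_def diff_diff_eq)
  finally show ?thesis .
 qed
 \<comment> \<open>the sine terms cancel because the autocovariance is even in the lag\<close>
 have sum2: "(\<Sum>h\<in>?W. u h*\<gamma> (t k) h) = cos (of_int (j - k)*\<theta>)*(\<Sum>h\<in>?W. \<gamma> (t k) h * cos (of_int h*\<theta>))"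
 proof -
  have "(\<Sum>h\<in>?W. sin (of_int h*\<theta>)*\<gamma> (t k) h) = (\<Sum>h\<in>?W. sin (of_int (- h)*\<theta>)*\<gamma> (t k) (- h))"
   by (rule sum.reindex_bij_witness[of _ uminus uminus]) auto
  also have "... = - (\<Sum>h\<in>?W. sin (of_int h*\<theta>)*\<gamma> (t k) h)"
   using \<gamma>_even[OF t_range[OF kI]] by (simp add: sum_negf)
  finally have odd: "(\<Sum>h\<in>?W. sin (of_int h*\<theta>)*\<gamma> (t k) h) = 0" by simp
  have "u h = cos (of_int (j - k)*\<theta>) * cos (of_int h*\<theta>)+sin (of_int (j - k)*\<theta>) * sin (of_int h*\<theta>)" for h
   unfolding u_def of_int_diff[of "j - k" h] left_diff_distrib[of _ _ \<theta>] cos_diff ..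
  then have "(\<Sum>h\<in>?W. u h*\<gamma> (t k) h) = (\<Sum>h\<in>?W. cos (of_int (j - k)*\<theta>)*(\<gamma> (t k) h * cos (of_int h*\<theta>))+sin (of_int (j - k)*\<theta>)*(sin (of_int h*\<theta>)*\<gamma> (t k) h))"
   by (intro sum.cong refl) (simp add: algebra_simps)
  also have "... = cos (of_int (j - k)*\<theta>)*(\<Sum>h\<in>?W. \<gamma> (t k) h * cos (of_int h*\<theta>))+sin (of_int (j - k)*\<theta>)*(\<Sum>h\<in>?W. sin (of_int h*\<theta>)*\<gamma> (t k) h)"
   unfolding sum.distrib sum_distrib_left ..
  finally show ?thesis by (simp add: odd)
 qed
 have cov: "\<bar>\<sigma> (k+h) k - \<gamma> (t k) h\<bar> \<le> C * b*(real L/real n)+2 * b^2*\<rho> ^ L" if h: "h \<in> ?W" for h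
 proof -
  note kh = in_I[OF h]
  have dist: "\<bar>t (k+h) - t k\<bar> = \<bar>of_int h\<bar>/real n" by (simp add: t_def add_divide_distrib)
  have hL: "\<bar>of_int h\<bar>/real n \<le> real L/real n" using h pos(5) by (intro divide_right_mono) auto
  have "\<bar>t (k+h) - of_int k/real n\<bar> \<le> real L/real n" using dist hL by (simp add: t_def)
  from good(3)[OF this] have seg: "segment r d (t (k+h)) = segment r d (t k)" by (simp add: t_def)
  have 1: "\<bar>expectation (\<lambda>om. X (t (k+h)) (k+h) om*X (t k) k om) - \<sigma> (k+h) k\<bar> \<le> 2 * b^2*\<rho> ^ L"
   unfolding \<sigma>_def XL_def by (rule X'_covariance_error[OF t_range[OF kh] t_range[OF kI]])
  have 2: "\<bar>expectation (\<lambda>om. X (t (k+h)) (k+h) om*X (t k) k om) - expectation (\<lambda>om. X (t k) (k+h) om*X (t k) k om)\<bar> \<le> C * b*\<bar>t (k+h) - t k\<bar>"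
   by (rule covariance_lipschitz[OF t_range[OF kh] t_range[OF kI] t_range[OF kI] seg])
  have 3: "expectation (\<lambda>om. X (t k) (k+h) om*X (t k) k om) = \<gamma> (t k) h"
   using covariance_stationary[OF t_range[OF kI] t_range[OF kI], of "k+h" k] \<gamma>_eq[OF t_range[OF kI], of "- h"] \<gamma>_even[OF t_range[OF kI], of h] by simp
  have "C * b*\<bar>t (k+h) - t k\<bar> \<le> C * b*(real L/real n)"
   unfolding dist using hL C_pos b_pos by (intro mult_left_mono) auto
  then show ?thesis using 1 2 unfolding 3 by linarith
 qed
 have "\<bar>(\<Sum>h\<in>?W. u h*\<sigma> (k+h) k) - (\<Sum>h\<in>?W. u h*\<gamma> (t k) h)\<bar> \<le> (\<Sum>h\<in>?W. C * b*(real L/real n)+2 * b^2*\<rho> ^ L)"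
  unfolding sum_subtractf[symmetric] right_diff_distrib[symmetric]
 proof (intro order_trans[OF sum_abs] sum_mono)
  fix h assume h: "h \<in> ?W"
  have "\<bar>u h*(\<sigma> (k+h) k - \<gamma> (t k) h)\<bar> \<le> \<bar>\<sigma> (k+h) k - \<gamma> (t k) h\<bar>"
   unfolding abs_mult using u[of h] by (intro mult_left_le_one_le) auto
  then show "\<bar>u h*(\<sigma> (k+h) k - \<gamma> (t k) h)\<bar> \<le> C * b*(real L/real n)+2 * b^2*\<rho> ^ L" using cov[OF h] by linarith
 qed
 also have "... = (2 * real L+1)*(C * b*(real L/real n)+2 * b^2*\<rho> ^ L)" by simp
 finally have 1: "\<bar>(\<Sum>h\<in>?W. u h*\<sigma> (k+h) k) - (\<Sum>h\<in>?W. u h*\<gamma> (t k) h)\<bar> \<le> (2 * real L+1)*(C * b*(real L/real n)+2 * b^2*\<rho> ^ L)" .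
 have "\<bar>cos (of_int (j - k)*\<theta>)*((\<Sum>h\<in>?W. \<gamma> (t k) h * cos (of_int h*\<theta>)) - g k)\<bar> \<le> \<bar>(\<Sum>h\<in>?W. \<gamma> (t k) h * cos (of_int h*\<theta>)) - g k\<bar>"
  unfolding abs_mult by (intro mult_left_le_one_le) auto
 also have "... \<le> gmax*\<rho> ^ L"
  unfolding g_def using spectral_truncation(1)[OF t_range[OF kI], of \<theta> L] by (simp add: abs_minus_commute)
 finally have 2: "\<bar>(\<Sum>h\<in>?W. u h*\<gamma> (t k) h) - cos (of_int (j - k)*\<theta>) * g k\<bar> \<le> gmax*\<rho> ^ L"
  unfolding sum2 by (simp only: right_diff_distrib)
 show ?thesis unfolding sum1 \<eta>_good_def using 1 2 by linarith
qed

end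

section \<open>The asymptotic variance at fixed sample size\<close>


lemma square_add_le: "(x+y)^2 \<le> 2 * x^2+2 * y^2" for x y :: real
 using zero_le_power2[of "x - y"] by (simp add: power2_eq_square algebra_simps)

lemma abs_square_diff_le:
 fixes x y :: real
 assumes "\<bar>x\<bar> \<le> G" "\<bar>y\<bar> \<le> G" "\<bar>x - y\<bar> \<le> e"
 shows "\<bar>x^2 - y\<^sup>2\<bar> \<le> 2*G * e"
proof -
 have "x^2 - y\<^sup>2 = (x+y)*(x - y)" by (simp add: power2_eq_square algebra_simps)
 then have "\<bar>x^2 - y\<^sup>2\<bar> = \<bar>x+y\<bar>*\<bar>x - y\<bar>" by (simp only: abs_mult)
 also have "... \<le> (2*G) * e" using assms by (intro mult_mono) linarith+
 finally show ?thesis .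
qed

context spectral_sample
begin

abbreviation \<tau> :: real where "\<tau> \<equiv> far_form.\<tau> M XL I A_far"

definition Acov :: "int => int => real" where
 "Acov j l = (\<Sum>k\<in>I. A_far j k*\<sigma> k l)"

lemma A_far_sym: "A_far j k = A_far k j"
 by (rule far_form.a_sym[OF far_form_XL])

lemma \<tau>_eq_trace: "\<tau> = (\<Sum>j\<in>I. \<Sum>l\<in>I. Acov j l*Acov l j)"
proof -
 have "(\<Sum>l\<in>I. Acov j l*Acov l j) = (\<Sum>i\<in>I. \<sigma> j i*(\<Sum>k\<in>I. \<Sum>l\<in>I. A_far j k*A_far i l*\<sigma> k l))" for j
 proof -
  have "(\<Sum>l\<in>I. Acov j l*Acov l j) = (\<Sum>l\<in>I. \<Sum>i\<in>I. Acov j l*(A_far l i*\<sigma> i j))"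
   by (simp only: Acov_def[of _ j] sum_distrib_left)
  also have "... = (\<Sum>i\<in>I. \<Sum>l\<in>I. Acov j l*(A_far l i*\<sigma> i j))" by (rule sum.swap)
  also have "... = (\<Sum>i\<in>I. \<sigma> j i*(\<Sum>l\<in>I. \<Sum>k\<in>I. A_far j k*A_far i l*\<sigma> k l))"
  proof (intro sum.cong refl)
   fix i
   have tm: "Acov j l*(A_far l i*\<sigma> i j) = \<sigma> j i*(\<Sum>k\<in>I. A_far j k*A_far i l*\<sigma> k l)" for l
   proof -
    have "(\<Sum>k\<in>I. A_far j k*A_far i l*\<sigma> k l) = A_far i l*Acov j l"
     unfolding Acov_def sum_distrib_left by (intro sum.cong refl) (simp only: mult_ac)
    then show ?thesis by (simp only: A_far_sym[of l i] \<sigma>_sym[of i j] mult_ac)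
   qed
   show "(\<Sum>l\<in>I. Acov j l*(A_far l i*\<sigma> i j)) = \<sigma> j i*(\<Sum>l\<in>I. \<Sum>k\<in>I. A_far j k*A_far i l*\<sigma> k l)"
    by (simp only: tm sum_distrib_left[symmetric])
  qed
  also have "... = (\<Sum>i\<in>I. \<sigma> j i*(\<Sum>k\<in>I. \<Sum>l\<in>I. A_far j k*A_far i l*\<sigma> k l))"
   by (intro sum.cong refl arg_cong[where f="\<lambda>z. \<sigma> j _ * z"] sum.swap)
  finally show ?thesis .
 qed
 then show ?thesis by (simp only: far_form.\<tau>_def[OF far_form_XL])
qed

lemma covariance_operator: "(\<Sum>l\<in>I. (\<Sum>k\<in>I. x k*\<sigma> k l)^2) \<le> S^2*(\<Sum>k\<in>I. (x k)^2)"
proof -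
 have "(\<Sum>k\<in>I. x k*\<sigma> k l) = (\<Sum>k\<in>I. \<sigma> l k * x k)" for l
  by (intro sum.cong refl) (simp only: \<sigma>_sym[of _ l] mult.commute)
 then show ?thesis using dependent_array.covariance_operator_bound[OF dependent_array_XL, of x] by simp
qed

lemma Acov_square_sum: "(\<Sum>j\<in>I. \<Sum>l\<in>I. (Acov j l)^2) \<le> S^2*(real n * v)"
proof -
 have "(\<Sum>l\<in>I. (Acov j l)^2) \<le> S^2 * v" if "j \<in> I" for j
  unfolding Acov_def by (rule order_trans[OF covariance_operator mult_left_mono[OF A_far_row[OF that]]]) simp
 then have "(\<Sum>j\<in>I. \<Sum>l\<in>I. (Acov j l)^2) \<le> (\<Sum>j\<in>I. S^2 * v)" by (rule sum_mono)
 then show ?thesis by (simp add: card_I algebra_simps)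
qed

lemma abs_\<tau>_le: "\<bar>\<tau>\<bar> \<le> S^2*(real n * v)"
proof -
 have "\<bar>(\<Sum>j\<in>I. \<Sum>l\<in>I. Acov j l*Acov l j) - (\<Sum>j\<in>I. \<Sum>l\<in>I. 0*0)\<bar>
   \<le> sqrt (S^2*(real n * v))*(sqrt (S^2*(real n * v))+sqrt 0)"
  by (rule trace_difference_le) (use Acov_square_sum in simp_all)
 moreover have "sqrt x*(sqrt x+sqrt 0) = x" if "0 \<le> x" for x :: real using that by simp
 moreover have "0 \<le> S^2*(real n * v)" using pos by simp
 ultimately show ?thesis by (simp only: \<tau>_eq_trace mult_zero_left sum.neutral_const diff_zero)
qed

definition symbol :: "int => int => real" where "symbol j l = A j l * g l"

lemma symbol_square_sum: "(\<Sum>j\<in>I. \<Sum>l\<in>I. (symbol j l)^2) \<le> gmax^2*(real n * v)"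
proof -
 have "(\<Sum>l\<in>I. (symbol j l)^2) \<le> gmax^2 * v" if j: "j \<in> I" for j
 proof -
  have "(\<Sum>l\<in>I. (symbol j l)^2) \<le> (\<Sum>l\<in>I. gmax^2*(A j l)^2)"
  proof (intro sum_mono)
   fix l assume "l \<in> I"
   from g_le[OF this] have "(g l)^2 \<le> gmax^2" by (rule abs_le_square_iff[THEN iffD1, OF order_trans[OF _ abs_ge_self]])
   then have "(A j l)^2*(g l)^2 \<le> (A j l)^2 * gmax^2" by (rule mult_left_mono) simp
   then show "(symbol j l)^2 \<le> gmax^2*(A j l)^2" by (simp only: symbol_def power_mult_distrib mult.commute)
  qed
  also have "... \<le> gmax^2 * v" unfolding sum_distrib_left[symmetric] by (intro mult_left_mono A0_row[OF j]) simp
  finally show ?thesis .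
 qed
 then have "(\<Sum>j\<in>I. \<Sum>l\<in>I. (symbol j l)^2) \<le> (\<Sum>j\<in>I. gmax^2 * v)" by (rule sum_mono)
 then show ?thesis by (simp add: card_I algebra_simps)
qed

definition \<eta> :: "int => real" where "\<eta> l = (if l \<in> bad n L then S+gmax else \<eta>_good)"

lemma local_symbol:
 assumes l: "l \<in> I"
 shows "\<bar>(\<Sum>i\<in>I. cos (of_int (j - i)*\<theta>)*\<sigma> i l) - cos (of_int (j - l)*\<theta>) * g l\<bar> \<le> \<eta> l"
 using local_symbol_trivial[OF l] local_symbol_good[of l] l by (simp add: \<eta>_def)

definition symbol_error :: real where
 "symbol_error = 2*(S^2*(real n*((10 * real L+1) * s^2)))
  + 4*((real n)^2*(s*\<delta> * real L*S)^2
   + v * (real n*\<eta>_good^2+real (card (bad n L))*(S+gmax)^2))"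

lemma near_row: "(\<Sum>k\<in>I. (A_far j k - A j k)^2) \<le> (10 * real L+1) * s^2"
proof -
 have "(\<Sum>k\<in>I. (A_far j k - A j k)^2) = (\<Sum>k\<in>I. if \<bar>j - k\<bar> \<le> 5 * int L then (A j k)\<^sup>2 else 0)"
  by (intro sum.cong refl) (simp add: A_far_def)
 also have "... = (\<Sum>k\<in>{k \<in> I. \<bar>j - k\<bar> \<le> 5 * int L}. (A j k)^2)"
  using finite_I by (simp only: sum.inter_filter)
 also have "... \<le> (\<Sum>k\<in>{k \<in> I. \<bar>j - k\<bar> \<le> 5 * int L}. s^2)"
  by (intro sum_mono abs_le_square_iff[THEN iffD1] order_trans[OF A0_abs_le] abs_ge_self)
 also have "... \<le> (10 * real L+1) * s^2"
  unfolding sum_constant by (intro mult_right_mono band_card) simp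
 finally show ?thesis .
qed

text \<open>\<open>Khat\<close> varies slowly over the correlation length, so it may be pulled out; the rest is the action on an oscillation.\<close>

lemma frequency_freezing:
 assumes l: "l \<in> I"
 shows "\<bar>(\<Sum>k\<in>I. A j k*\<sigma> k l) - symbol j l\<bar> \<le> s*\<delta> * real L*S+\<bar>A0 0 j l\<bar>*\<eta> l"
proof -
 let ?c = "\<lambda>k. cos (of_int (j - k)*\<theta>)"
 let ?h = "\<lambda>k. Khat (\<delta> * of_int (j - k))"
 have A00: "A0 0 j l = s*?h l" by (simp add: A0_def)
 have split: "(\<Sum>k\<in>I. A j k*\<sigma> k l) - symbol j l
  = (\<Sum>k\<in>I. s*((?h k - ?h l)*?c k*\<sigma> k l)) + A0 0 j l*((\<Sum>k\<in>I. ?c k*\<sigma> k l) - ?c l * g l)"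
 proof -
  have "(\<Sum>k\<in>I. A j k*\<sigma> k l) = (\<Sum>k\<in>I. s*((?h k - ?h l)*?c k*\<sigma> k l))+s*?h l*(\<Sum>k\<in>I. ?c k*\<sigma> k l)"
   unfolding A0_def sum_distrib_left sum.distrib[symmetric] by (intro sum.cong refl) (simp add: algebra_simps)
  moreover have "symbol j l = s*?h l*(?c l * g l)" by (simp only: symbol_def A0_def mult.assoc)
  ultimately show ?thesis by (simp only: A00 right_diff_distrib add_diff_eq)
 qed
 have "\<bar>\<Sum>k\<in>I. s*((?h k - ?h l)*?c k*\<sigma> k l)\<bar> \<le> (\<Sum>k\<in>I. (s*\<delta> * real L)*\<bar>\<sigma> l k\<bar>)"
 proof (intro order_trans[OF sum_abs] sum_mono)
  fix k assume k: "k \<in> I"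
  show "\<bar>s*((?h k - ?h l)*?c k*\<sigma> k l)\<bar> \<le> (s*\<delta> * real L)*\<bar>\<sigma> l k\<bar>"
  proof (cases "int L < \<bar>k - l\<bar>")
   case True
   then show ?thesis using \<sigma>_far[OF k l] \<sigma>_sym[of l k] by simp
  next
   case False
   have "\<bar>?h k - ?h l\<bar> \<le> \<bar>\<delta> * of_int (j - k) - \<delta> * of_int (j - l)\<bar>" by (rule Khat_lipschitz)
   also have "... = \<delta>*\<bar>of_int (l - k)\<bar>"
    unfolding right_diff_distrib[symmetric] abs_mult using pos(1) by simp
   also have "... \<le> \<delta> * real L" using False pos(1) by (intro mult_left_mono) auto
   finally have "\<bar>?h k - ?h l\<bar>*\<bar>?c k\<bar> \<le> (\<delta> * real L)*1" using pos(1) by (intro mult_mono) auto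
   then have "s*(\<bar>?h k - ?h l\<bar>*\<bar>?c k\<bar>*\<bar>\<sigma> k l\<bar>) \<le> s*((\<delta> * real L)*1*\<bar>\<sigma> k l\<bar>)"
    using pos(3) by (intro mult_left_mono mult_right_mono) auto
   then show ?thesis using pos(3) by (simp add: abs_mult \<sigma>_sym[of l k] mult.assoc)
  qed
 qed
 also have "... \<le> (s*\<delta> * real L)*S"
  unfolding sum_distrib_left[symmetric] using pos by (intro mult_left_mono row_sum_\<sigma>[OF l]) auto
 finally have 1: "\<bar>\<Sum>k\<in>I. s*((?h k - ?h l)*?c k*\<sigma> k l)\<bar> \<le> s*\<delta> * real L*S" .
 have 2: "\<bar>A0 0 j l*((\<Sum>k\<in>I. ?c k*\<sigma> k l) - ?c l * g l)\<bar> \<le> \<bar>A0 0 j l\<bar>*\<eta> l"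
  unfolding abs_mult by (intro mult_left_mono local_symbol[OF l]) simp
 show ?thesis unfolding split using 1 2 by linarith
qed

lemma symbol_calculus: "(\<Sum>j\<in>I. \<Sum>l\<in>I. (Acov j l - symbol j l)^2) \<le> symbol_error"
proof -
 let ?E = "\<lambda>j l. (\<Sum>k\<in>I. A j k*\<sigma> k l) - symbol j l"
 let ?N = "\<lambda>j l. \<Sum>k\<in>I. (A_far j k - A j k)*\<sigma> k l"
 have split: "Acov j l - symbol j l = ?N j l+?E j l" for j l
  by (simp add: Acov_def sum_subtractf left_diff_distrib)
 have N: "(\<Sum>j\<in>I. \<Sum>l\<in>I. (?N j l)^2) \<le> S^2*(real n*((10 * real L+1) * s^2))"
 proof -
  have "(\<Sum>l\<in>I. (?N j l)^2) \<le> S^2*((10 * real L+1) * s^2)" for j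
   by (rule order_trans[OF covariance_operator mult_left_mono[OF near_row]]) simp
  then have "(\<Sum>j\<in>I. \<Sum>l\<in>I. (?N j l)^2) \<le> (\<Sum>j\<in>I. S^2*((10 * real L+1) * s^2))" by (rule sum_mono)
  also have "... = S^2*(real n*((10 * real L+1) * s^2))" by (simp add: card_I)
  finally show ?thesis .
 qed
 have col: "(\<Sum>j\<in>I. (A0 0 j l)^2) \<le> v" if "l \<in> I" for l
  using A0_row[OF that, of 0] by (simp only: A0_sym[of 0 l])
 have \<eta>: "(\<Sum>l\<in>I. (\<eta> l)^2) \<le> real n*\<eta>_good^2+real (card (bad n L))*(S+gmax)^2"
 proof -
  have "(\<Sum>l\<in>I. (\<eta> l)^2) \<le> (\<Sum>l\<in>I. \<eta>_good^2+(if l \<in> bad n L then (S+gmax)\<^sup>2 else 0))"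
   by (intro sum_mono) (simp add: \<eta>_def)
  also have "... = real n*\<eta>_good^2+(\<Sum>l\<in>{l \<in> I. l \<in> bad n L}. (S+gmax)^2)"
   using finite_I by (simp add: sum.distrib sum.inter_filter[symmetric] card_I)
  also have "{l \<in> I. l \<in> bad n L} = bad n L" by (auto simp: bad_def I_def)
  finally show ?thesis by simp
 qed
 have E: "(\<Sum>j\<in>I. \<Sum>l\<in>I. (?E j l)^2) \<le> 2*((real n)^2*(s*\<delta> * real L*S)^2)
   + 2*(v * (real n*\<eta>_good^2+real (card (bad n L))*(S+gmax)^2))"
 proof -
  have "(\<Sum>j\<in>I. \<Sum>l\<in>I. (?E j l)^2) \<le> (\<Sum>j\<in>I. \<Sum>l\<in>I. 2*(s*\<delta> * real L*S)^2+2*((\<eta> l)^2*(A0 0 j l)^2))"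
  proof (intro sum_mono)
   fix j l assume l: "l \<in> I"
   have "(?E j l)^2 \<le> (s*\<delta> * real L*S+\<bar>A0 0 j l\<bar>*\<eta> l)^2"
    by (intro abs_le_square_iff[THEN iffD1] order_trans[OF frequency_freezing[OF l]] abs_ge_self)
   also have "... \<le> 2*(s*\<delta> * real L*S)^2+2*(\<bar>A0 0 j l\<bar>*\<eta> l)^2" by (rule square_add_le)
   also have "(\<bar>A0 0 j l\<bar>*\<eta> l)^2 = (\<eta> l)^2*(A0 0 j l)^2" by (simp add: power_mult_distrib)
   finally show "(?E j l)^2 \<le> 2*(s*\<delta> * real L*S)^2+2*((\<eta> l)^2*(A0 0 j l)^2)" .
  qed
  also have "... = 2*((real n)^2*(s*\<delta> * real L*S)^2)+2*(\<Sum>j\<in>I. \<Sum>l\<in>I. (\<eta> l)^2*(A0 0 j l)^2)"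
   by (simp add: sum.distrib sum_distrib_left card_I power2_eq_square[of "real n"] mult_ac)
  also have "(\<Sum>j\<in>I. \<Sum>l\<in>I. (\<eta> l)^2*(A0 0 j l)^2) = (\<Sum>l\<in>I. (\<eta> l)^2*(\<Sum>j\<in>I. (A0 0 j l)^2))"
   unfolding sum_distrib_left by (rule sum.swap)
  finally have eq: "(\<Sum>j\<in>I. \<Sum>l\<in>I. (?E j l)^2) \<le> 2*((real n)^2*(s*\<delta> * real L*S)^2)
    + 2*(\<Sum>l\<in>I. (\<eta> l)^2*(\<Sum>j\<in>I. (A0 0 j l)^2))" .
  have "(\<Sum>l\<in>I. (\<eta> l)^2*(\<Sum>j\<in>I. (A0 0 j l)^2)) \<le> (\<Sum>l\<in>I. (\<eta> l)^2 * v)"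
   by (intro sum_mono mult_left_mono col) auto
  also have "... = v * (\<Sum>l\<in>I. (\<eta> l)^2)" by (simp add: sum_distrib_left mult.commute)
  also have "... \<le> v * (real n*\<eta>_good^2+real (card (bad n L))*(S+gmax)^2)"
   using pos(4) by (intro mult_left_mono \<eta>) auto
  finally show ?thesis using eq by linarith
 qed
 have "(\<Sum>j\<in>I. \<Sum>l\<in>I. (Acov j l - symbol j l)^2) \<le> (\<Sum>j\<in>I. \<Sum>l\<in>I. 2*(?N j l)^2+2*(?E j l)^2)"
  unfolding split by (intro sum_mono square_add_le)
 also have "... = 2*(\<Sum>j\<in>I. \<Sum>l\<in>I. (?N j l)^2)+2*(\<Sum>j\<in>I. \<Sum>l\<in>I. (?E j l)^2)"
  by (simp only: sum.distrib sum_distrib_left)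
 finally have le: "(\<Sum>j\<in>I. \<Sum>l\<in>I. (Acov j l - symbol j l)^2) \<le> 2*(\<Sum>j\<in>I. \<Sum>l\<in>I. (?N j l)^2)+2*(\<Sum>j\<in>I. \<Sum>l\<in>I. (?E j l)^2)" .
 have "z \<le> 2 * x'+4*(y1+y2)" if "z \<le> 2 * x+2 * y" "x \<le> x'" "y \<le> 2 * y1+2 * y2" for x y z x' y1 y2 :: real
 proof -
  have "2 * x+2 * y \<le> 2 * x'+2*(2 * y1+2 * y2)" using that(2,3) by (intro add_mono mult_left_mono) simp_all
  from order_trans[OF that(1) this] show ?thesis by (simp add: algebra_simps)
 qed
 from this[OF le N E] show ?thesis unfolding symbol_error_def .
qed

definition weight :: "int => real" where
 "weight l = (s*Khat (\<delta> * of_int l) * cos (of_int l*\<theta>))^2"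

definition W :: "nat => real" where "W N = real n*(\<Sum>l\<in>{- int N..int N}. weight l)"

lemma weight_nonneg: "0 \<le> weight l" by (simp add: weight_def)

lemma W_mono: "N \<le> N' ==> W N \<le> W N'"
 by (auto simp: W_def weight_nonneg intro!: mult_left_mono sum_mono2)

lemma W_nonneg: "0 \<le> W N"
 by (simp add: W_def weight_nonneg sum_nonneg)

lemma A_square: "(A j k)^2 = weight (j - k)"
 by (simp only: A0_def weight_def mult.assoc)

lemma \<tau>_symbol: "\<bar>\<tau> - (\<Sum>j\<in>I. \<Sum>l\<in>I. weight (j - l)*(g j * g l))\<bar>
  \<le> sqrt symbol_error*(sqrt (S^2*(real n * v))+sqrt (gmax^2*(real n * v)))"
proof -
 have "symbol j l * symbol l j = weight (j - l)*(g j * g l)" for j l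
  unfolding A_square[symmetric] symbol_def A0_sym[of \<theta> l j] power2_eq_square by (simp only: mult_ac)
 then show ?thesis
  using trace_difference_le[OF Acov_square_sum symbol_square_sum symbol_calculus] by (simp only: \<tau>_eq_trace)
qed

definition osc :: "nat => nat => real" where
 "osc q N = (2 * real q+1)*(2*C * b*(real N/real n))+2 * gmax*\<rho> ^ q"

lemma osc_nonneg: "0 \<le> osc q N"
 unfolding osc_def using C_pos b_pos gmax_pos \<rho>_pos by (intro add_nonneg_nonneg mult_nonneg_nonneg) auto

lemma spectral_oscillation:
 assumes k: "k \<in> I - bad n N" and x: "\<bar>x - t k\<bar> \<le> real N/real n"
 shows "\<bar>2 * pi * f x \<theta> - g k\<bar> \<le> osc q N"
proof -
 have k': "k \<in> {1..int n} - bad n N" using k by (simp add: I_def)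
 note good = good_index(3)[OF k' n x[unfolded t_def]]
 have kI: "k \<in> I" using k by simp
 have "\<bar>2 * pi * f x \<theta> - 2 * pi * f (t k) \<theta>\<bar> \<le> (2 * real q+1)*(2*C * b*\<bar>x - t k\<bar>)+2 * gmax*\<rho> ^ q"
  using good by (intro spectral_equicontinuity t_range[OF kI]) (simp_all add: t_def)
 also have "... \<le> osc q N" unfolding osc_def using C_pos b_pos gmax_pos x by (intro add_mono mult_left_mono) auto
 finally show ?thesis by (simp only: g_def)
qed

lemma row_symbol_good:
 assumes j: "j \<in> I - bad n N" and Nn: "N \<le> n"
 shows "\<bar>real n*(\<Sum>k\<in>I. weight (j - k) * g k) - W N * g j\<bar> \<le> W n * osc q N+gmax*(W n - W N)"
proof -
 have jI: "j \<in> I" using j by simp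
 have j': "j \<in> {1..int n} - bad n N" using j by (simp add: I_def)
 let ?near = "{k \<in> I. \<bar>j - k\<bar> \<le> int N}" and ?far = "{k \<in> I. \<not> \<bar>j - k\<bar> \<le> int N}"
 have near_eq: "(\<Sum>k\<in>?near. w (j - k)) = (\<Sum>l\<in>{- int N..int N}. w l)" for w :: "int => real"
  by (rule sum.reindex_bij_witness[of _ "\<lambda>l. j - l" "\<lambda>k. j - k"]) (use good_index(1,2)[OF j' n] in \<open>auto simp: I_def\<close>)
 have part: "(\<Sum>k\<in>I. w k) = (\<Sum>k\<in>?near. w k)+(\<Sum>k\<in>?far. w k)" for w :: "int => real"
 proof -
  have "I = ?near \<union> ?far" by auto
  then have "(\<Sum>k\<in>I. w k) = (\<Sum>k\<in>?near \<union> ?far. w k)" by simp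
  also have "... = (\<Sum>k\<in>?near. w k)+(\<Sum>k\<in>?far. w k)" using finite_I by (intro sum.union_disjoint) auto
  finally show ?thesis .
 qed
 have tail: "real n*(\<Sum>k\<in>?far. weight (j - k)) \<le> W n - W N"
 proof -
  have "(\<Sum>k\<in>I. weight (j - k)) = (\<Sum>l\<in>(\<lambda>k. j - k) ` I. weight l)"
   by (subst sum.reindex) (auto simp: inj_on_def)
  also have "... \<le> (\<Sum>l\<in>{- int n..int n}. weight l)"
   using jI by (intro sum_mono2) (auto simp: I_def weight_nonneg)
  finally have "(\<Sum>k\<in>?far. weight (j - k)) \<le> (\<Sum>l\<in>{- int n..int n}. weight l) - (\<Sum>l\<in>{- int N..int N}. weight l)"
   unfolding part[of "\<lambda>k. weight (j - k)"] near_eq[of weight] by linarith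
  then show ?thesis unfolding W_def right_diff_distrib[symmetric] by (rule mult_left_mono) simp
 qed
 have "\<bar>(\<Sum>k\<in>?near. weight (j - k) * g k) - (\<Sum>k\<in>?near. weight (j - k)) * g j\<bar> \<le> (\<Sum>k\<in>?near. weight (j - k) * osc q N)"
  unfolding sum_distrib_right sum_subtractf[symmetric] right_diff_distrib[symmetric]
 proof (intro order_trans[OF sum_abs] sum_mono)
  fix k assume k: "k \<in> ?near"
  have "\<bar>t k - t j\<bar> = \<bar>of_int (j - k)\<bar>/real n" by (simp add: t_def diff_divide_distrib[symmetric] abs_minus_commute)
  also have "... \<le> real N/real n" using k pos(5) by (intro divide_right_mono) auto
  finally have "\<bar>g k - g j\<bar> \<le> osc q N" using spectral_oscillation[OF j, of "t k"] by (simp only: g_def[of k])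
  then show "\<bar>weight (j - k)*(g k - g j)\<bar> \<le> weight (j - k) * osc q N"
   unfolding abs_mult using weight_nonneg by (simp add: mult_left_mono)
 qed
 then have 1: "\<bar>real n*(\<Sum>k\<in>?near. weight (j - k) * g k) - W N * g j\<bar> \<le> W N * osc q N"
 proof -
  assume a: "\<bar>(\<Sum>k\<in>?near. weight (j - k) * g k) - (\<Sum>k\<in>?near. weight (j - k)) * g j\<bar> \<le> (\<Sum>k\<in>?near. weight (j - k) * osc q N)"
  have "real n*\<bar>(\<Sum>k\<in>?near. weight (j - k) * g k) - (\<Sum>l\<in>{- int N..int N}. weight l) * g j\<bar> \<le> real n*((\<Sum>l\<in>{- int N..int N}. weight l) * osc q N)"
   using a unfolding sum_distrib_right[symmetric] near_eq[of weight] by (rule mult_left_mono) simp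
  moreover have "real n*\<bar>x\<bar> = \<bar>real n * x\<bar>" for x by (simp add: abs_mult)
  ultimately show ?thesis by (simp only: W_def right_diff_distrib mult.assoc)
 qed
 have "\<bar>\<Sum>k\<in>?far. weight (j - k) * g k\<bar> \<le> (\<Sum>k\<in>?far. weight (j - k) * gmax)"
 proof (intro order_trans[OF sum_abs] sum_mono)
  fix k assume "k \<in> ?far"
  then show "\<bar>weight (j - k) * g k\<bar> \<le> weight (j - k) * gmax"
   unfolding abs_mult using weight_nonneg g_le[of k] by (simp add: mult_left_mono)
 qed
 then have "real n*\<bar>\<Sum>k\<in>?far. weight (j - k) * g k\<bar> \<le> real n*(\<Sum>k\<in>?far. weight (j - k) * gmax)"
  by (rule mult_left_mono) simp
 also have "... = gmax*(real n*(\<Sum>k\<in>?far. weight (j - k)))" unfolding sum_distrib_right[symmetric] by (simp only: mult_ac)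
 also have "... \<le> gmax*(W n - W N)" using gmax_pos by (intro mult_left_mono tail) simp
 finally have 2: "\<bar>real n*(\<Sum>k\<in>?far. weight (j - k) * g k)\<bar> \<le> gmax*(W n - W N)" by (simp add: abs_mult)
 have 3: "W N * osc q N \<le> W n * osc q N" by (intro mult_right_mono W_mono Nn osc_nonneg)
 show ?thesis unfolding part[of "\<lambda>k. weight (j - k) * g k"] distrib_left using 1 2 3 by linarith
qed

lemma row_symbol_bad:
 assumes j: "j \<in> I" and Nn: "N \<le> n"
 shows "\<bar>real n*(\<Sum>k\<in>I. weight (j - k) * g k) - W N * g j\<bar> \<le> 2 * gmax*W n"
proof -
 have "\<bar>\<Sum>k\<in>I. weight (j - k) * g k\<bar> \<le> (\<Sum>k\<in>I. weight (j - k) * gmax)"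
 proof (intro order_trans[OF sum_abs] sum_mono)
  fix k assume "k \<in> I"
  then show "\<bar>weight (j - k) * g k\<bar> \<le> weight (j - k) * gmax"
   unfolding abs_mult using weight_nonneg g_le[of k] by (simp add: mult_left_mono)
 qed
 also have "... = (\<Sum>l\<in>(\<lambda>k. j - k) ` I. weight l) * gmax"
  unfolding sum_distrib_right by (subst sum.reindex) (auto simp: inj_on_def)
 also have "... \<le> (\<Sum>l\<in>{- int n..int n}. weight l) * gmax"
  using j gmax_pos by (intro mult_right_mono sum_mono2) (auto simp: I_def weight_nonneg)
 finally have "real n*\<bar>\<Sum>k\<in>I. weight (j - k) * g k\<bar> \<le> real n*((\<Sum>l\<in>{- int n..int n}. weight l) * gmax)"
  by (rule mult_left_mono) simp
 then have 1: "\<bar>real n*(\<Sum>k\<in>I. weight (j - k) * g k)\<bar> \<le> W n * gmax"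
  unfolding W_def abs_mult by (simp only: abs_of_nat mult.assoc)
 have "W N*\<bar>g j\<bar> \<le> W n * gmax"
  by (intro mult_mono W_mono Nn g_le[OF j] W_nonneg) auto
 then have "\<bar>W N * g j\<bar> \<le> W n * gmax" unfolding abs_mult using W_nonneg by simp
 from order_trans[OF abs_triangle_ineq4 add_mono[OF 1 this]] show ?thesis by (simp add: mult_ac)
qed

lemma card_bad_sum:
 fixes x y :: real
 assumes "0 \<le> x"
 shows "(\<Sum>j\<in>I. if j \<in> bad n N then y else x) \<le> real n * x+real (card (bad n N))*\<bar>y\<bar>"
proof -
 have "(\<Sum>j\<in>I. if j \<in> bad n N then y else x) \<le> (\<Sum>j\<in>I. x+(if j \<in> bad n N then \<bar>y\<bar> else 0))"
  using assms by (intro sum_mono) auto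
 also have "... = real n * x+(\<Sum>j\<in>{j \<in> I. j \<in> bad n N}. \<bar>y\<bar>)"
  using finite_I by (simp add: sum.distrib sum.inter_filter[symmetric] card_I)
 also have "{j \<in> I. j \<in> bad n N} = bad n N" by (auto simp: bad_def I_def)
 finally show ?thesis by simp
qed

lemma symbol_sum:
 assumes Nn: "N \<le> n"
 shows "\<bar>(\<Sum>j\<in>I. \<Sum>l\<in>I. weight (j - l)*(g j * g l)) - W N*(1/real n*(\<Sum>j\<in>I. (g j)^2))\<bar>
  \<le> gmax*(W n * osc q N+gmax*(W n - W N))+real (card (bad n N))/real n*(2 * gmax^2*W n)"
proof -
 let ?r = "\<lambda>j. real n*(\<Sum>k\<in>I. weight (j - k) * g k) - W N * g j"
 let ?x = "W n * osc q N+gmax*(W n - W N)"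
 have x0: "0 \<le> ?x" using W_nonneg osc_nonneg gmax_pos W_mono[OF Nn] by (intro add_nonneg_nonneg mult_nonneg_nonneg) auto
 have eq: "(\<Sum>j\<in>I. \<Sum>l\<in>I. weight (j - l)*(g j * g l)) - W N*(1/real n*(\<Sum>j\<in>I. (g j)^2))
   = 1/real n*(\<Sum>j\<in>I. g j*?r j)"
 proof -
  have "real n*(\<Sum>j\<in>I. \<Sum>l\<in>I. weight (j - l)*(g j * g l)) = (\<Sum>j\<in>I. g j*(real n*(\<Sum>k\<in>I. weight (j - k) * g k)))"
   unfolding sum_distrib_left by (intro sum.cong refl) (simp only: mult_ac)
  moreover have "W N*(\<Sum>j\<in>I. (g j)^2) = (\<Sum>j\<in>I. g j*(W N * g j))"
   unfolding sum_distrib_left power2_eq_square by (intro sum.cong refl) (simp only: mult_ac)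
  ultimately have "real n*(\<Sum>j\<in>I. \<Sum>l\<in>I. weight (j - l)*(g j * g l)) - W N*(\<Sum>j\<in>I. (g j)^2) = (\<Sum>j\<in>I. g j*?r j)"
   by (simp only: right_diff_distrib sum_subtractf)
  then show ?thesis using pos(5) by (simp add: field_simps)
 qed
 have "\<bar>\<Sum>j\<in>I. g j*?r j\<bar> \<le> (\<Sum>j\<in>I. gmax*(if j \<in> bad n N then 2 * gmax*W n else ?x))"
 proof (intro order_trans[OF sum_abs] sum_mono)
  fix j assume j: "j \<in> I"
  have "\<bar>?r j\<bar> \<le> (if j \<in> bad n N then 2 * gmax*W n else ?x)"
   using row_symbol_bad[OF j Nn] row_symbol_good[of j N q, OF _ Nn] j by (cases "j \<in> bad n N") simp_all
  then show "\<bar>g j*?r j\<bar> \<le> gmax*(if j \<in> bad n N then 2 * gmax*W n else ?x)"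
   unfolding abs_mult using gmax_pos by (intro mult_mono g_le[OF j]) auto
 qed
 also have "... \<le> gmax*(real n*?x+real (card (bad n N))*\<bar>2 * gmax*W n\<bar>)"
  unfolding sum_distrib_left[symmetric] using gmax_pos x0 by (intro mult_left_mono card_bad_sum) auto
 finally have "1/real n*\<bar>\<Sum>j\<in>I. g j*?r j\<bar> \<le> 1/real n*(gmax*(real n*?x+real (card (bad n N))*\<bar>2 * gmax*W n\<bar>))"
  by (rule mult_left_mono) simp
 also have "... = gmax*?x+real (card (bad n N))/real n*(2 * gmax^2*W n)"
 proof -
  have a: "\<bar>2 * gmax*W n\<bar> = 2 * gmax*W n" using gmax_pos W_nonneg[of n] by simp
  have "1/y*(G*(y * x+c*(2*G * w))) = G * x+c/y*(2*G^2 * w)" if "0 < y" for y G x c w :: real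
   using that by (simp add: field_simps power2_eq_square)
  from this[OF pos(5)] show ?thesis unfolding a .
 qed
 finally show ?thesis unfolding eq by (simp add: abs_mult)
qed

text \<open>Compare the spectral density with the step function of its values at the right end points.\<close>

lemma spectral_riemann_sum:
 assumes N: "1 \<le> N" and meas: "(\<lambda>x. f x \<theta> * indicator {0<..1} x) \<in> borel_measurable borel"
 shows "\<bar>1/real n*(\<Sum>j\<in>I. (g j)^2) - 4 * pi^2*(LBINT x:{0..1}. (f x \<theta>)^2)\<bar>
  \<le> 2 * gmax * osc q N+real (card (bad n N))/real n*(2 * gmax^2)"
proof -
 define h where "h x = 2 * pi * f x \<theta>" for x
 define F where "F x = (h x)^2 * indicator {0<..1} x" for x
 define J where "J j = {of_int (j - 1)/real n<..of_int j/real n}" for j :: int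
 define err where "err j = (if j \<in> bad n N then 2 * gmax^2 else 2 * gmax * osc q N)" for j
 have h_le: "\<bar>h x\<bar> \<le> gmax" if "0 < x" "x \<le> 1" for x using spectral_truncation(2)[OF that] by (simp add: h_def)
 have sq: "x^2 \<le> gmax^2" if "\<bar>x\<bar> \<le> gmax" for x
  using that gmax_pos abs_le_square_iff[of x gmax] by simp
 have F_meas: "F \<in> borel_measurable borel"
 proof -
  have "F = (\<lambda>x. (2 * pi*(f x \<theta> * indicator {0<..1} x))^2)"
   by (auto simp: F_def h_def fun_eq_iff indicator_def)
  then show ?thesis using meas by simp
 qed
 have bdd: "\<bar>F x\<bar> \<le> gmax^2 * indicator {0<..1} x" for x
  using sq[OF h_le[of x]] by (auto simp: F_def indicator_def)
 have ind: "integrable lborel (indicator {a<..c} :: real => real)" for a c :: real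
  by (cases "a \<le> c") (auto simp: integrable_indicator_iff)
 have F_int: "integrable lborel F"
  by (rule Bochner_Integration.integrable_bound[OF integrable_mult_right[OF ind[of 0 1], of "gmax^2"]])
   (use F_meas bdd in \<open>auto intro: order_trans[OF _ abs_ge_self]\<close>)
 have J_int: "(\<integral>x. indicator (J j) x \<partial>lborel) = 1/real n" for j
 proof -
  have "of_int (j - 1)/real n \<le> of_int j/real n" using pos(5) by (intro divide_right_mono) auto
  then show ?thesis using pos(5) by (simp add: J_def diff_divide_distrib[symmetric])
 qed
 have J_integrable: "integrable lborel (indicator (J j) :: real => real)" for j unfolding J_def by (rule ind)
 define \<phi> where "\<phi> x = (\<Sum>j\<in>I. (g j)^2 * indicator (J j) x)" for x
 define \<psi> where "\<psi> x = (\<Sum>j\<in>I. err j * indicator (J j) x)" for x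
 have \<phi>: "integrable lborel \<phi>" "(\<integral>x. \<phi> x \<partial>lborel) = 1/real n*(\<Sum>j\<in>I. (g j)^2)"
  unfolding \<phi>_def using J_integrable J_int by (simp_all add: sum_divide_distrib)
 have \<psi>: "integrable lborel \<psi>" "(\<integral>x. \<psi> x \<partial>lborel) = 1/real n*(\<Sum>j\<in>I. err j)"
  unfolding \<psi>_def using J_integrable J_int by (simp_all add: sum_divide_distrib)
 have J_iff: "x \<in> J j \<longleftrightarrow> j = \<lceil>real n * x\<rceil>" for x j
 proof -
  have "x \<in> J j \<longleftrightarrow> of_int j - 1 < real n * x \<and> real n * x \<le> of_int j"
   using pos(5) by (simp add: J_def pos_divide_less_eq pos_le_divide_eq mult.commute)
  also have "... \<longleftrightarrow> j = \<lceil>real n * x\<rceil>" using ceiling_correct[of "real n * x"] ceiling_unique[of j "real n * x"] by auto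
  finally show ?thesis .
 qed
 have pointwise: "\<bar>\<phi> x - F x\<bar> \<le> \<psi> x" for x
 proof (cases "0 < x \<and> x \<le> 1")
  case True
  let ?j = "\<lceil>real n * x\<rceil>"
  have jI: "?j \<in> I" using True pos(5) mult_left_le[of x "real n"] by (auto simp: I_def ceiling_le_iff)
  have one: "(\<Sum>j\<in>I. w j * indicator (J j) x) = w ?j" for w :: "int => real"
  proof -
   have "(\<Sum>j\<in>I. w j * indicator (J j) x) = (\<Sum>j\<in>I. if j = ?j then w ?j else 0)"
    by (intro sum.cong refl) (simp add: indicator_def J_iff)
   then show ?thesis using jI finite_I by simp
  qed
  have F: "F x = (h x)^2" using True by (simp add: F_def)
  show ?thesis
  proof (cases "?j \<in> bad n N")
   case bad: True
   have "\<bar>(g ?j)\<^sup>2 - (h x)\<^sup>2\<bar> \<le> 2 * gmax^2"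
    using sq[OF g_le[OF jI]] sq[OF h_le[of x]] True zero_le_power2[of "g ?j"] zero_le_power2[of "h x"] by linarith
   then show ?thesis unfolding \<phi>_def \<psi>_def one F err_def using bad by simp
  next
   case good: False
   have "x \<in> J ?j" by (simp add: J_iff)
   then have b: "of_int (?j - 1)/real n < x" "x \<le> t ?j" unfolding J_def t_def by auto
   have "of_int (?j - 1)/real n = t ?j - 1/real n" by (simp add: t_def diff_divide_distrib)
   moreover have "1/real n \<le> real N/real n" using N by (intro divide_right_mono) auto
   ultimately have "\<bar>x - t ?j\<bar> \<le> real N/real n" using b by linarith
   then have "\<bar>h x - g ?j\<bar> \<le> osc q N" unfolding h_def using good jI by (intro spectral_oscillation) auto
   then have "\<bar>(g ?j)\<^sup>2 - (h x)\<^sup>2\<bar> \<le> 2 * gmax * osc q N"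
    using True by (intro abs_square_diff_le g_le[OF jI] h_le) (auto simp: abs_minus_commute)
   then show ?thesis unfolding \<phi>_def \<psi>_def one F err_def using good by simp
  qed
 next
  case False
  have "x \<notin> J j" if "j \<in> I" for j
  proof
   assume "x \<in> J j"
   then have "0 < x" "x \<le> t j" using that pos(5) unfolding J_def t_def by (auto simp: I_def intro: le_less_trans[rotated])
   then show False using t_range(2)[OF that] False by linarith
  qed
  then have z: "(\<Sum>j\<in>I. w j * indicator (J j) x) = 0" for w :: "int => real"
   by (intro sum.neutral) simp
  have "F x = 0" using False by (simp add: F_def)
  then show ?thesis unfolding \<phi>_def \<psi>_def z by simp
 qed
 have "\<bar>(\<integral>x. \<phi> x \<partial>lborel) - (\<integral>x. F x \<partial>lborel)\<bar> = \<bar>\<integral>x. \<phi> x - F x \<partial>lborel\<bar>" using \<phi>(1) F_int by simp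
 also have "... \<le> (\<integral>x. \<bar>\<phi> x - F x\<bar> \<partial>lborel)" by (rule integral_abs_bound)
 also have "... \<le> (\<integral>x. \<psi> x \<partial>lborel)" using \<phi>(1) \<psi>(1) F_int pointwise by (intro integral_mono) auto
 finally have 1: "\<bar>1/real n*(\<Sum>j\<in>I. (g j)^2) - (\<integral>x. F x \<partial>lborel)\<bar> \<le> 1/real n*(\<Sum>j\<in>I. err j)"
  unfolding \<phi>(2) \<psi>(2) .
 have "(\<Sum>j\<in>I. err j) \<le> real n*(2 * gmax * osc q N)+real (card (bad n N))*\<bar>2 * gmax\<^sup>2\<bar>"
  unfolding err_def using gmax_pos osc_nonneg by (intro card_bad_sum) simp
 then have "1/real n*(\<Sum>j\<in>I. err j) \<le> 1/real n*(real n*(2 * gmax * osc q N)+real (card (bad n N))*\<bar>2 * gmax\<^sup>2\<bar>)"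
  by (rule mult_left_mono) simp
 also have "... = 2 * gmax * osc q N+real (card (bad n N))/real n*(2 * gmax^2)"
  using pos(5) by (simp add: distrib_left)
 finally have 2: "1/real n*(\<Sum>j\<in>I. err j) \<le> 2 * gmax * osc q N+real (card (bad n N))/real n*(2 * gmax^2)" .
 \<comment> \<open>the left endpoint belongs to the interval of integration but not to the model; it has measure zero\<close>
 have "(\<integral>x. F x \<partial>lborel) = 4 * pi^2*(LBINT x:{0..1}. (f x \<theta>)^2)"
 proof -
  have "(LBINT x:{0..1}. (f x \<theta>)^2) = (\<integral>x. F x/(4 * pi^2)+indicator {0} x*(f 0 \<theta>)^2 \<partial>lborel)"
   unfolding set_lebesgue_integral_def
   by (intro Bochner_Integration.integral_cong refl) (auto simp: F_def h_def indicator_def power_mult_distrib)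
  also have "... = (\<integral>x. F x/(4 * pi^2) \<partial>lborel)+integral\<^sup>L lborel (\<lambda>x::real. indicator {0} x*(f 0 \<theta>)^2)"
   using F_int by simp
  also have "... = (\<integral>x. F x \<partial>lborel)/(4 * pi^2)" by simp
  finally show ?thesis by simp
 qed
 with 1 2 show ?thesis by simp
qed

text \<open>Three approximations combined: symbols replace matrices, a window of lags replaces all lags, and an integral replaces a sum over times.\<close>

lemma \<tau>_limit_error:
 assumes N: "1 \<le> N" "N \<le> n" and meas: "(\<lambda>x. f x \<theta> * indicator {0<..1} x) \<in> borel_measurable borel"
 shows "\<bar>\<tau> - W N*(4 * pi^2*(LBINT x:{0..1}. (f x \<theta>)^2))\<bar>
  \<le> sqrt symbol_error*(sqrt (S^2*(real n * v))+sqrt (gmax^2*(real n * v)))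
   + gmax*(W n * osc q N+gmax*(W n - W N))+real (card (bad n N))/real n*(2 * gmax^2*W n)
   + W n*(2 * gmax * osc q N+real (card (bad n N))/real n*(2 * gmax^2))"
proof -
 let ?R = "1/real n*(\<Sum>j\<in>I. (g j)^2)" and ?F = "4 * pi^2*(LBINT x:{0..1}. (f x \<theta>)^2)"
 let ?e = "2 * gmax * osc q N+real (card (bad n N))/real n*(2 * gmax^2)"
 have e0: "0 \<le> ?e" using gmax_pos osc_nonneg by (intro add_nonneg_nonneg mult_nonneg_nonneg divide_nonneg_nonneg) auto
 have "\<bar>W N*?R - W N*?F\<bar> = W N*\<bar>?R - ?F\<bar>"
  unfolding right_diff_distrib[symmetric] abs_mult using W_nonneg[of N] by simp
 also have "... \<le> W n*?e"
  by (intro mult_mono W_mono N(2) spectral_riemann_sum N(1) meas W_nonneg) simp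
 finally show ?thesis using \<tau>_symbol symbol_sum[OF N(2), of q] by linarith
qed

lemma characteristic_function_far:
 "cmod (expectation (\<lambda>om. iexp (u * far_form.T XL I A_far om)) - complex_of_real (exp (- \<tau> * u^2)))
  \<le> \<bar>u\<bar>*(real n*(u^2*((4 * real L+1)^2*((1+b ^ 4)*(sqrt v * v * (S+3*(1+b ^ 4)^2*(real L+1) ^ 4)/2))*(2+4*S)))
   + 2*\<bar>u\<bar>*(sqrt (real n*(24 * real L+1)*(10 * real L+1)^2*(S * v)^2*(1+b ^ 4))
    + sqrt (2*S^2*(\<kappa>_far*(S^2*(real n * v)))))) * exp (2*\<bar>\<tau>\<bar> * u^2)"
proof -
 have "0 \<le> \<kappa>_far" by (simp add: \<kappa>_far_def)
 from far_form.characteristic_function_bound[OF far_form_XL A_far_operator this, of u]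
 show ?thesis unfolding card_I far_form.remainder_def[OF far_form_XL] far_form.q_def[OF far_form_XL] by simp
qed

abbreviation XX :: "int => 'a => real" where "XX j \<equiv> X (t j) j"

definition stat :: "'a => real" where
 "stat om = (\<Sum>j\<in>I. \<Sum>k\<in>I. A j k*(XX j om*XX k om - expectation (\<lambda>om. XX j om*XX k om)))"

lemma XX_integrable: "j \<in> I ==> k \<in> I ==> integrable M (\<lambda>om. XX j om*XX k om)"
 by (intro covariance_X'(1) t_range)

lemma XL_integrable: "j \<in> I ==> k \<in> I ==> integrable M (\<lambda>om. XL j om*XL k om)"
 unfolding XL_def by (intro covariance_X'(2) t_range)

lemma stat_measurable: "stat \<in> borel_measurable M"
proof -
 have "XX j \<in> borel_measurable M" if "j \<in> I" for j by (intro X_measurable(1) t_range that)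
 then show ?thesis unfolding stat_def
  by (intro borel_measurable_sum borel_measurable_times borel_measurable_diff borel_measurable_const)
qed

lemma far_T_eq: "far_form.T XL I A_far om = (\<Sum>j\<in>I. \<Sum>k\<in>I. A_far j k*(XL j om*XL k om - \<sigma> j k))"
 unfolding far_form.T_def[OF far_form_XL] far_form.Y_def[OF far_form_XL] sum_distrib_left
proof (intro sum.cong refl)
 fix j k assume jk: "j \<in> I" "k \<in> I"
 have "A_far j k*\<sigma> j k = 0" using \<sigma>_far[OF jk] by (cases "\<bar>j - k\<bar> \<le> 5 * int L") (simp_all add: A_far_def)
 then show "XL j om*(A_far j k*XL k om) = A_far j k*(XL j om*XL k om - \<sigma> j k)"
  by (simp add: right_diff_distrib mult_ac)
qed

lemma stat_approximation:
 shows "integrable M (\<lambda>om. stat om - far_form.T XL I A_far om)"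
  and "expectation (\<lambda>om. \<bar>stat om - far_form.T XL I A_far om\<bar>)
   \<le> (real n)^2*(s*(4 * b^2*\<rho> ^ L))
    + sqrt (real n*(24 * real L+1)*(10 * real L+1)^2 * s^2*(1+b ^ 4))"
proof -
 define c where "c j k om = (XX j om*XX k om - XL j om*XL k om) - (expectation (\<lambda>om. XX j om*XX k om) - \<sigma> j k)" for j k om
 define D1 where "D1 om = (\<Sum>j\<in>I. \<Sum>k\<in>I. A j k * c j k om)" for om
 define Q where "Q om = (\<Sum>j\<in>I. \<Sum>k\<in>{k \<in> I. \<bar>k - j\<bar> \<le> 5 * int L}. A j k*(XL j om*XL k om - \<sigma> j k))" for om
 have split: "stat om - far_form.T XL I A_far om = D1 om + Q om" for om
 proof -
  have "Q om = (\<Sum>j\<in>I. \<Sum>k\<in>I. (A j k - A_far j k)*(XL j om*XL k om - \<sigma> j k))"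
   unfolding Q_def
  proof (rule sum.cong[OF refl])
   fix j
   have "(\<Sum>k\<in>{k \<in> I. \<bar>k - j\<bar> \<le> 5 * int L}. A j k*(XL j om*XL k om - \<sigma> j k))
     = (\<Sum>k\<in>I. if \<bar>k - j\<bar> \<le> 5 * int L then A j k*(XL j om*XL k om - \<sigma> j k) else 0)"
    using finite_I by (simp only: sum.inter_filter)
   also have "... = (\<Sum>k\<in>I. (A j k - A_far j k)*(XL j om*XL k om - \<sigma> j k))"
    by (intro sum.cong refl) (simp add: A_far_def abs_minus_commute)
   finally show "(\<Sum>k\<in>{k \<in> I. \<bar>k - j\<bar> \<le> 5 * int L}. A j k*(XL j om*XL k om - \<sigma> j k))
     = (\<Sum>k\<in>I. (A j k - A_far j k)*(XL j om*XL k om - \<sigma> j k))" .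
  qed
  then show ?thesis unfolding stat_def far_T_eq D1_def c_def sum_subtractf[symmetric] sum.distrib[symmetric]
   by (simp only:) (simp add: sum_subtractf[symmetric] sum.distrib[symmetric] algebra_simps)
 qed
 have c: "integrable M (c j k)" "expectation (\<lambda>om. \<bar>c j k om\<bar>) \<le> 4 * b^2*\<rho> ^ L" if j: "j \<in> I" and k: "k \<in> I" for j k
 proof -
  let ?w = "\<lambda>om. XX j om*XX k om - XL j om*XL k om"
  let ?y = "expectation (\<lambda>om. XX j om*XX k om) - \<sigma> j k"
  have i: "integrable M ?w" using XX_integrable[OF j k] XL_integrable[OF j k] by simp
  then show "integrable M (c j k)" unfolding c_def by simp
  have w: "expectation (\<lambda>om. \<bar>?w om\<bar>) \<le> 2 * b^2*\<rho> ^ L"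
   unfolding XL_def by (intro covariance_X'(3) t_range j k)
  have y: "\<bar>?y\<bar> \<le> 2 * b^2*\<rho> ^ L"
   unfolding \<sigma>_def XL_def by (intro X'_covariance_error t_range j k)
  have "expectation (\<lambda>om. \<bar>c j k om\<bar>) \<le> expectation (\<lambda>om. \<bar>?w om\<bar>+\<bar>?y\<bar>)"
   unfolding c_def using i by (intro integral_mono) auto
  also have "... = expectation (\<lambda>om. \<bar>?w om\<bar>)+\<bar>?y\<bar>" using i by (simp add: prob_space)
  finally show "expectation (\<lambda>om. \<bar>c j k om\<bar>) \<le> 4 * b^2*\<rho> ^ L" using w y by linarith
 qed
 have D1_int: "integrable M D1" unfolding D1_def using c(1) by (intro Bochner_Integration.integrable_sum integrable_mult_right)
 have D1: "expectation (\<lambda>om. \<bar>D1 om\<bar>) \<le> (real n)^2*(s*(4 * b^2*\<rho> ^ L))"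
 proof -
  have "expectation (\<lambda>om. \<bar>D1 om\<bar>) \<le> expectation (\<lambda>om. \<Sum>j\<in>I. \<Sum>k\<in>I. s*\<bar>c j k om\<bar>)"
  proof (intro integral_mono)
   show "integrable M (\<lambda>om. \<bar>D1 om\<bar>)" using D1_int by simp
   show "integrable M (\<lambda>om. \<Sum>j\<in>I. \<Sum>k\<in>I. s*\<bar>c j k om\<bar>)"
    using c(1) by (intro Bochner_Integration.integrable_sum integrable_mult_right integrable_abs)
   show "\<bar>D1 om\<bar> \<le> (\<Sum>j\<in>I. \<Sum>k\<in>I. s*\<bar>c j k om\<bar>)" for om
    unfolding D1_def
   proof (intro order_trans[OF sum_abs] sum_mono)
    fix j k
    show "\<bar>A j k * c j k om\<bar> \<le> s*\<bar>c j k om\<bar>" unfolding abs_mult by (intro mult_right_mono A0_abs_le) simp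
   qed
  qed
  also have "... = (\<Sum>j\<in>I. \<Sum>k\<in>I. s * expectation (\<lambda>om. \<bar>c j k om\<bar>))"
   using c(1) by (simp add: Bochner_Integration.integral_sum)
  also have "... \<le> (\<Sum>j\<in>I. \<Sum>k\<in>I. s*(4 * b^2*\<rho> ^ L))"
   using pos(3) by (intro sum_mono mult_left_mono c(2)) auto
  also have "... = (real n)^2*(s*(4 * b^2*\<rho> ^ L))" by (simp add: card_I power2_eq_square)
  finally show ?thesis .
 qed
 have bound: "\<bar>A j k\<bar> \<le> s" for j k by (rule A0_abs_le)
 have W5: "0 \<le> 5 * int L" by simp
 have Q2: "integrable M (\<lambda>om. (Q om)^2)"
   "expectation (\<lambda>om. (Q om)^2) \<le> real n*(24 * real L+1)*(10 * real L+1)^2 * s^2*(1+b ^ 4)"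
  using dependent_array.band_form_square[OF dependent_array_XL W5 bound] unfolding Q_def by (simp_all add: card_I)
 have XL_meas: "XL j \<in> borel_measurable M" if "j \<in> I" for j unfolding XL_def by (intro X_measurable(2) t_range that)
 have Q_meas: "Q \<in> borel_measurable M" unfolding Q_def
  using XL_meas by (intro borel_measurable_sum borel_measurable_times borel_measurable_diff borel_measurable_const) auto
 have Q_int: "integrable M Q" by (rule square_integrable_imp_integrable[OF Q_meas Q2(1)])
 have Q: "expectation (\<lambda>om. \<bar>Q om\<bar>) \<le> sqrt (real n*(24 * real L+1)*(10 * real L+1)^2 * s^2*(1+b ^ 4))"
 proof (rule real_le_rsqrt)
  have "(expectation (\<lambda>om. \<bar>Q om\<bar>))^2 \<le> expectation (\<lambda>om. \<bar>Q om\<bar>\<^sup>2)"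
   using variance_positive[of "\<lambda>om. \<bar>Q om\<bar>"] variance_eq[of "\<lambda>om. \<bar>Q om\<bar>"] Q_int Q2(1) by simp
  then show "(expectation (\<lambda>om. \<bar>Q om\<bar>))^2 \<le> real n*(24 * real L+1)*(10 * real L+1)^2 * s^2*(1+b ^ 4)"
   using Q2(2) by simp
 qed
 show "integrable M (\<lambda>om. stat om - far_form.T XL I A_far om)" unfolding split using D1_int Q_int by simp
 have "expectation (\<lambda>om. \<bar>D1 om + Q om\<bar>) \<le> expectation (\<lambda>om. \<bar>D1 om\<bar>+\<bar>Q om\<bar>)"
  using D1_int Q_int by (intro integral_mono) auto
 also have "... = expectation (\<lambda>om. \<bar>D1 om\<bar>)+expectation (\<lambda>om. \<bar>Q om\<bar>)" using D1_int Q_int by simp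
 finally show "expectation (\<lambda>om. \<bar>stat om - far_form.T XL I A_far om\<bar>)
   \<le> (real n)^2*(s*(4 * b^2*\<rho> ^ L))
    + sqrt (real n*(24 * real L+1)*(10 * real L+1)^2 * s^2*(1+b ^ 4))"
  unfolding split using D1 Q by linarith
qed

lemma characteristic_function_stat:
 "cmod (expectation (\<lambda>om. iexp (u * stat om)) - expectation (\<lambda>om. iexp (u * far_form.T XL I A_far om)))
  \<le> \<bar>u\<bar>*((real n)^2*(s*(4 * b^2*\<rho> ^ L))
    + sqrt (real n*(24 * real L+1)*(10 * real L+1)^2 * s^2*(1+b ^ 4)))"
proof -
 let ?T = "far_form.T XL I A_far"
 have T_meas [measurable]: "?T \<in> borel_measurable M" by (rule far_form.T_measurable[OF far_form_XL])
 note stat_measurable [measurable]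
 have int: "integrable M (\<lambda>om. iexp (u * y om))" if [measurable]: "y \<in> borel_measurable M" for y
  by (rule integrable_const_bound[of _ 1]) auto
 have "cmod (expectation (\<lambda>om. iexp (u * stat om)) - expectation (\<lambda>om. iexp (u*?T om)))
   = cmod (expectation (\<lambda>om. iexp (u * stat om) - iexp (u*?T om)))"
  using int[OF stat_measurable] int[OF T_meas] by simp
 also have "... \<le> expectation (\<lambda>om. cmod (iexp (u * stat om) - iexp (u*?T om)))"
  by (rule integral_norm_bound)
 also have "... \<le> expectation (\<lambda>om. \<bar>u\<bar>*\<bar>stat om - ?T om\<bar>)"
 proof (rule integral_mono)
  show "integrable M (\<lambda>om. cmod (iexp (u * stat om) - iexp (u*?T om)))"
   using int[OF stat_measurable] int[OF T_meas] by simp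
  show "integrable M (\<lambda>om. \<bar>u\<bar>*\<bar>stat om - ?T om\<bar>)" using stat_approximation(1) by simp
  fix om
  have e: "iexp (u * stat om) - iexp (u*?T om) = iexp (u*?T om)*(iexp (u * stat om - u*?T om) - 1)"
   by (simp add: right_diff_distrib exp_add[symmetric] algebra_simps)
  have "cmod (iexp (u * stat om) - iexp (u*?T om)) = cmod (iexp (u * stat om - u*?T om) - 1)"
   unfolding e norm_mult by simp
  then show "cmod (iexp (u * stat om) - iexp (u*?T om)) \<le> \<bar>u\<bar>*\<bar>stat om - ?T om\<bar>"
   using norm_iexp_minus_1_le[of "u * stat om - u*?T om"] by (simp only: abs_mult[symmetric] right_diff_distrib)
 qed
 finally have 1: "cmod (expectation (\<lambda>om. iexp (u * stat om)) - expectation (\<lambda>om. iexp (u*?T om)))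
   \<le> \<bar>u\<bar> * expectation (\<lambda>om. \<bar>stat om - ?T om\<bar>)" by simp
 show ?thesis by (rule order_trans[OF 1 mult_left_mono[OF stat_approximation(2)]]) simp
qed

lemma smoothed_periodogram_eq:
 "sqrt m * smoothed_periodogram (pls_process \<epsilon> r d G) K n m \<theta> om = (\<Sum>j\<in>I. \<Sum>k\<in>I. A j k*(XX j om*XX k om))"
proof -
 define x where "x j = XX j om" for j
 have pls: "pls_process \<epsilon> r d G n j om = x (int j)" if "j \<in> {1..n}" for j
  using pls_process_eq[of j n om] that by (simp add: x_def X_def H_def t_def)
 define \<Phi> where "\<Phi> \<alpha> = (\<Sum>j\<in>I. \<Sum>k\<in>I. x j * x k * cos (of_int (j - k)*\<alpha>))" for \<alpha>
 have per: "periodogram (pls_process \<epsilon> r d G) n \<alpha> om = 1/(2 * pi * real n)*\<Phi> \<alpha>" for \<alpha>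
 proof -
  let ?z = "\<lambda>j. complex_of_real (x j) * exp (\<i> * complex_of_real (of_int j*\<alpha>))"
  have "(\<Sum>j=1..n. complex_of_real (pls_process \<epsilon> r d G n j om) * exp (\<i> * complex_of_real (real j*\<alpha>))) = (\<Sum>j=1..n. ?z (int j))"
   by (intro sum.cong refl) (simp add: pls)
  also have "... = (\<Sum>j\<in>I. ?z j)"
   by (rule sum.reindex_bij_witness[of _ nat int]) (auto simp: I_def)
  finally have e: "(\<Sum>j=1..n. complex_of_real (pls_process \<epsilon> r d G n j om) * exp (\<i> * complex_of_real (real j*\<alpha>))) = (\<Sum>j\<in>I. ?z j)" .
  have z: "?z j = Complex (x j * cos (of_int j*\<alpha>)) (x j * sin (of_int j*\<alpha>))" for j
   by (simp add: complex_eq_iff Re_exp Im_exp)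
  have "(cmod (\<Sum>j\<in>I. ?z j))^2 = (\<Sum>j\<in>I. x j * cos (of_int j*\<alpha>))^2+(\<Sum>j\<in>I. x j * sin (of_int j*\<alpha>))^2"
   unfolding z cmod_power2 Re_sum Im_sum by simp
  also have "... = \<Phi> \<alpha>" unfolding \<Phi>_def by (rule trig_square[symmetric])
  finally show ?thesis unfolding periodogram_def e by simp
 qed
 have m0: "m \<noteq> 0" using m by simp
 have "smoothed_periodogram (pls_process \<epsilon> r d G) K n m \<theta> om
   = (\<integral>u. indicator {- m..m} u*(1/m*K (u/m)*(1/(2 * pi * real n)*\<Phi> (\<theta>+2 * pi * u/real n))) \<partial>lborel)"
  unfolding smoothed_periodogram_def set_lebesgue_integral_def per by simp
 also have "... = \<bar>m\<bar> *\<^sub>R (\<integral>v. indicator {- m..m} (0+m * v)*(1/m*K ((0+m * v)/m)*(1/(2 * pi * real n)*\<Phi> (\<theta>+2 * pi*(0+m * v)/real n))) \<partial>lborel)"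
  by (rule lborel_integral_real_affine[OF m0])
 also have "... = m*(\<integral>v. 1/m*(1/(2 * pi * real n))*(K v * \<Phi> (\<theta>+\<delta> * v)) \<partial>lborel)"
 proof -
  have "indicator {- m..m} (0+m * v)*(1/m*K ((0+m * v)/m)*(1/(2 * pi * real n)*\<Phi> (\<theta>+2 * pi*(0+m * v)/real n)))
    = 1/m*(1/(2 * pi * real n))*(K v * \<Phi> (\<theta>+\<delta> * v))" for v
  proof (cases "\<bar>v\<bar> \<le> 1")
   case True
   then have "m*\<bar>v\<bar> \<le> m*1" using m by (intro mult_left_mono) auto
   then have "\<bar>m * v\<bar> \<le> m" using m by (simp add: abs_mult)
   then have "0+m * v \<in> {- m..m}" by (auto simp: abs_le_iff)
   moreover have "2 * pi*(0+m * v)/real n = \<delta> * v" by (simp add: \<delta>_def)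
   moreover have "(0+m * v)/m = v" using m by simp
   ultimately show ?thesis by (simp only: indicator_simps mult_1_left mult_ac)
  next
   case False
   then have "K v = 0" by (intro K_outside) simp
   moreover have "(0+m * v)/m = v" using m by simp
   ultimately show ?thesis by (simp only: mult_zero_left mult_zero_right)
  qed
  then show ?thesis using m by (simp only: real_scaleR_def abs_of_pos)
 qed
 also have "... = 1/(2 * pi * real n)*(\<integral>v. K v * \<Phi> (\<theta>+\<delta> * v) \<partial>lborel)" using m by simp
 also have "(\<integral>v. K v * \<Phi> (\<theta>+\<delta> * v) \<partial>lborel)
   = (\<Sum>j\<in>I. \<Sum>k\<in>I. Khat (\<delta> * of_int (j - k)) * cos (of_int (j - k)*\<theta>) * x j * x k)"
  unfolding \<Phi>_def by (rule form_eq_integral[OF finite_I, symmetric])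
 finally have "sqrt m * smoothed_periodogram (pls_process \<epsilon> r d G) K n m \<theta> om
   = s*(\<Sum>j\<in>I. \<Sum>k\<in>I. Khat (\<delta> * of_int (j - k)) * cos (of_int (j - k)*\<theta>) * x j * x k)"
  by (simp add: s_def)
 then show ?thesis unfolding A0_form[symmetric] by (simp only: x_def mult.assoc)
qed

lemma stat_eq:
 "stat om = sqrt m*(smoothed_periodogram (pls_process \<epsilon> r d G) K n m \<theta> om
  - (\<integral>om'. smoothed_periodogram (pls_process \<epsilon> r d G) K n m \<theta> om' \<partial>M))"
proof -
 let ?F = "smoothed_periodogram (pls_process \<epsilon> r d G) K n m \<theta>"
 have "sqrt m*(\<integral>om'. ?F om' \<partial>M) = expectation (\<lambda>om'. sqrt m*?F om')" by simp
 also have "... = (\<Sum>j\<in>I. \<Sum>k\<in>I. A j k * expectation (\<lambda>om. XX j om*XX k om))"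
  unfolding smoothed_periodogram_eq using XX_integrable by (simp add: Bochner_Integration.integral_sum)
 finally have "sqrt m*(?F om - (\<integral>om'. ?F om' \<partial>M)) = (\<Sum>j\<in>I. \<Sum>k\<in>I. A j k*(XX j om*XX k om)) - (\<Sum>j\<in>I. \<Sum>k\<in>I. A j k * expectation (\<lambda>om. XX j om*XX k om))"
  by (simp only: right_diff_distrib smoothed_periodogram_eq)
 then show ?thesis unfolding stat_def by (simp only: right_diff_distrib sum_subtractf)
qed

end

section \<open>Error bounds in terms of one small parameter\<close>


context spectral_setting
begin

definition \<beta> :: real where "\<beta> = B/(4 * pi^2)"

lemma \<beta>_pos: "0 < \<beta>" using B_pos by (simp add: \<beta>_def)

definition osc_rate :: real where "osc_rate = 2*C * b+2 * gmax"

definition var_rate :: "real => real => real" where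
 "var_rate w e = sqrt (2*(S^2 * e)+4*(S^2 * e+\<beta>*((C * b+2 * b^2+gmax)^2 * e^2+real (r+2) * e*(S+gmax)^2)))
    * ((S+gmax) * sqrt \<beta>)
  + gmax*(w*(osc_rate * e)+gmax * e)+real (r+2) * e*(2 * gmax^2 * w)
  + w*(2 * gmax*(osc_rate * e)+real (r+2) * e*(2 * gmax^2))"

definition cf_rate :: "real => real => real" where
 "cf_rate u e = \<bar>u\<bar>*(4 * b^2 * e+sqrt ((1+b ^ 4) * e))
  + \<bar>u\<bar>*(u^2*((1+b ^ 4)*((S+3*(1+b ^ 4)^2) * e*(\<beta> * sqrt \<beta>))*(2+4*S))
    + 2*\<bar>u\<bar>*(sqrt (e*((S*\<beta>)^2*(1+b ^ 4)))+sqrt (2*S^2*((2*B^2+2) * e*(S^2*\<beta>)))))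
   * exp (2*(S^2*\<beta>) * u^2)"

lemma rates_tendsto:
 assumes "e \<longlonglongrightarrow> 0"
 shows "(\<lambda>i. var_rate w (e i)) \<longlonglongrightarrow> 0" and "(\<lambda>i. cf_rate u (e i)) \<longlonglongrightarrow> 0"
proof -
 have "(\<lambda>i. var_rate w (e i)) \<longlonglongrightarrow> var_rate w 0"
  unfolding var_rate_def by (intro tendsto_intros assms)
 then show "(\<lambda>i. var_rate w (e i)) \<longlonglongrightarrow> 0" by (simp add: var_rate_def)
 have "(\<lambda>i. cf_rate u (e i)) \<longlonglongrightarrow> cf_rate u 0"
  unfolding cf_rate_def by (intro tendsto_intros assms)
 then show "(\<lambda>i. cf_rate u (e i)) \<longlonglongrightarrow> 0" by (simp add: cf_rate_def)
qed

definition WW :: "nat => real => real => nat => real" where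
 "WW n m \<theta> N = (2 * pi * m/real n)*(\<Sum>l\<in>{- int N..int N}. (Khat (2 * pi * m/real n * of_int l))^2*(cos (of_int l*\<theta>))^2)/(8 * pi ^ 3)"

lemma spectral_measurable: "(\<lambda>x. f x \<theta> * indicator {0<..1} x) \<in> borel_measurable borel"
proof -
 have cont: "continuous_on {d k<..d (Suc k)} (\<lambda>x. 2 * pi * f x \<theta>)" if k: "k \<le> r" for k
  unfolding continuous_on_iff
 proof (intro ballI allI impI)
  fix x e :: real assume x: "x \<in> {d k<..d (Suc k)}" and e: "0 < e"
  have dk: "0 \<le> d k" "d (Suc k) \<le> 1" using d_mono[of 0 k] d_mono[of "Suc k" "Suc r"] k d_0 d_end by auto
  obtain q where q: "\<rho> ^ q < e/(4 * gmax)" using real_arch_pow_inv[of "e/(4 * gmax)" \<rho>] e gmax_pos \<rho>_less by auto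
  then have q': "2 * gmax*\<rho> ^ q < e/2" using gmax_pos by (simp add: field_simps)
  define a where "a = (2 * real q+1)*(2*C * b)"
  have a: "0 < a" using C_pos b_pos by (simp add: a_def)
  show "\<exists>D>0. \<forall>y\<in>{d k<..d (Suc k)}. dist y x < D \<longrightarrow> dist (2 * pi * f y \<theta>) (2 * pi * f x \<theta>) < e"
  proof (intro exI[of _ "e/(2 * a)"] conjI ballI impI)
   show "0 < e/(2 * a)" using a e by simp
   fix y assume y: "y \<in> {d k<..d (Suc k)}" and yx: "dist y x < e/(2 * a)"
   have "\<bar>2 * pi * f y \<theta> - 2 * pi * f x \<theta>\<bar> \<le> (2 * real q+1)*(2*C * b*\<bar>y - x\<bar>)+2 * gmax*\<rho> ^ q"
    using x y dk segment_eq[OF k, of x] segment_eq[OF k, of y] by (intro spectral_equicontinuity) auto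
   moreover have "a*\<bar>y - x\<bar> < e/2" using yx a by (simp add: dist_real_def field_simps)
   ultimately show "dist (2 * pi * f y \<theta>) (2 * pi * f x \<theta>) < e"
    using q' by (simp add: dist_real_def a_def mult.assoc)
  qed
 qed
 have eq: "f x \<theta> * indicator {0<..1} x = 1/(2 * pi)*(\<Sum>k\<le>r. indicator {d k<..d (Suc k)} x *\<^sub>R (2 * pi * f x \<theta>))" for x
 proof (cases "0 < x \<and> x \<le> 1")
  case True
  then obtain k where k: "k \<le> r" "d k < x" "x \<le> d (Suc k)" "segment r d x = k" using segment_exists by blast
  have "(\<Sum>j\<le>r. indicator {d j<..d (Suc j)} x *\<^sub>R (2 * pi * f x \<theta>)) = (\<Sum>j\<le>r. if j = k then 2 * pi * f x \<theta> else 0)"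
  proof (rule sum.cong[OF refl])
   fix j assume j: "j \<in> {..r}"
   have "x \<in> {d j<..d (Suc j)} \<longleftrightarrow> j = k"
   proof
    assume "x \<in> {d j<..d (Suc j)}"
    then have "segment r d x = j" using j by (intro segment_eq) simp_all
    then show "j = k" using k(4) by simp
   next
    assume "j = k"
    then show "x \<in> {d j<..d (Suc j)}" using k(2,3) by simp
   qed
   then show "indicator {d j<..d (Suc j)} x *\<^sub>R (2 * pi * f x \<theta>) = (if j = k then 2 * pi * f x \<theta> else 0)"
    by (cases "j = k") simp_all
  qed
  then show ?thesis using k(1) True by simp
 next
  case False
  have "x \<notin> {d j<..d (Suc j)}" if "j \<le> r" for j
  proof -
   have "0 \<le> d j" "d (Suc j) \<le> 1" using d_mono[of 0 j] d_mono[of "Suc j" "Suc r"] that d_0 d_end by simp_all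
   then show ?thesis using False by auto
  qed
  then have "(\<Sum>k\<le>r. indicator {d k<..d (Suc k)} x *\<^sub>R (2 * pi * f x \<theta>)) = 0" by (intro sum.neutral) simp
  then show ?thesis using False by simp
 qed
 show ?thesis unfolding eq
  by (intro borel_measurable_times borel_measurable_const borel_measurable_sum borel_measurable_continuous_on_indicator cont) auto
qed

end

context spectral_sample
begin

lemma scaled: "real n * v = \<beta>" "real n * s^2 = m/(4 * pi^2 * real n)" "sqrt v = sqrt \<beta>/sqrt (real n)"
proof -
 show nv: "real n * v = \<beta>" using pos(5) by (simp add: v_def \<beta>_def)
 show "real n * s^2 = m/(4 * pi^2 * real n)"
  using pos(5) m by (simp add: s_def power_divide power_mult_distrib power2_eq_square[of "real n"])
 have "v = \<beta>/real n" using pos(5) nv by (simp add: field_simps)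
 then show "sqrt v = sqrt \<beta>/sqrt (real n)" by (simp add: real_sqrt_divide)
qed

lemma W_eq: "W N = WW n m \<theta> N"
proof -
 have "W N = real n * s^2*(\<Sum>l\<in>{- int N..int N}. (Khat (\<delta> * of_int l))^2*(cos (of_int l*\<theta>))^2)"
  unfolding W_def weight_def power_mult_distrib by (simp only: sum_distrib_left mult.assoc)
 moreover have "real n * s^2 = (2 * pi * m/real n)/(8 * pi ^ 3)"
  unfolding scaled(2) by (simp add: power2_eq_square power3_eq_cube)
 ultimately show ?thesis by (simp add: WW_def \<delta>_def)
qed

lemma rate_bounds:
 assumes e: "0 \<le> e" and m1: "1 \<le> m"
  and e1: "real n * sqrt m*\<rho> ^ L \<le> e"
  and e2: "(24 * real L+1)*(10 * real L+1)^2 * m/real n \<le> e"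
  and e3: "(4 * real L+1)^2*(real L+1) ^ 4/sqrt (real n) \<le> e"
  and e4: "m ^ 3*(real L)^2/(real n)^2 \<le> e" and e5: "1/m \<le> e"
  and e6: "(2 * real L+1)*\<rho> ^ L \<le> e"
  and e7: "(2 * real q+1) * real N/real n \<le> e" and e8: "\<rho> ^ q \<le> e"
  and e9: "(2 * real N+1)/real n \<le> e" and e10: "WW n m \<theta> n - WW n m \<theta> N \<le> e" and w: "WW n m \<theta> n \<le> w"
  and N: "1 \<le> N" "N \<le> n"
 shows "\<bar>\<tau> - WW n m \<theta> N*(4 * pi^2*(LBINT x:{0..1}. (f x \<theta>)^2))\<bar> \<le> var_rate w e"
  and "cmod (expectation (\<lambda>om. iexp (u * stat om)) - complex_of_real (exp (- \<tau> * u^2))) \<le> cf_rate u e"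
proof -
 note gp = gmax_pos
 have L0: "0 \<le> real L" by simp
 have n0: "0 < real n" by (rule pos(5))
 have pi4: "1 \<le> 4 * pi^2"
 proof -
  have "1^2 \<le> pi^2" using pi_gt3 by (intro power_mono) auto
  then show ?thesis by simp
 qed
 have shrink: "x/(4 * pi^2) \<le> x" if "0 \<le> x" for x :: real
 proof -
  have "x*1 \<le> x*(4 * pi^2)" using that pi4 by (intro mult_left_mono)
  then show ?thesis using pi4 by (simp add: pos_divide_le_eq)
 qed
 let ?p = "(24 * real L+1)*(10 * real L+1)^2"
 have R1: "1 \<le> (10 * real L+1)^2" by simp
 have pa: "10 * real L+1 \<le> ?p" "2 * real L+1 \<le> ?p" "(10 * real L+1)^2 \<le> ?p" "?p \<le> ?p * m" "(2 * real L+1) * real L \<le> ?p"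
 proof -
  have base: "(24 * real L+1)*1 \<le> ?p" using R1 by (intro mult_left_mono) auto
  show "10 * real L+1 \<le> ?p" by (rule order_trans[OF _ base]) simp
  show "2 * real L+1 \<le> ?p" by (rule order_trans[OF _ base]) simp
  show "(10 * real L+1)^2 \<le> ?p" using mult_right_mono[of 1 "24 * real L+1" "(10 * real L+1)^2"] by simp
  have "?p*1 \<le> ?p * m" using m1 by (intro mult_left_mono) auto
  then show "?p \<le> ?p * m" by simp
  have "real L*1 \<le> (10 * real L+1)*(10 * real L+1)" by (intro mult_mono) auto
  then have "(2 * real L+1) * real L \<le> (24 * real L+1)*(10 * real L+1)^2"
   unfolding power2_eq_square by (intro mult_mono) auto
  then show "(2 * real L+1) * real L \<le> ?p" .
 qed
 have div: "x/real n \<le> e" if "x \<le> ?p * m" for x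
  by (rule order_trans[OF divide_right_mono[OF that] e2]) simp
 have divp: "x/real n \<le> e" if "x \<le> ?p" for x
  by (rule div[OF order_trans[OF that pa(4)]])
 have cardL: "real (card (bad n L))/real n \<le> real (r+2) * e"
 proof -
  have "real (card (bad n L))/real n \<le> real (r+2)*((2 * real L+1)/real n)"
   using card_bad_le[of n L] n0 by (simp add: divide_right_mono)
  also have "... \<le> real (r+2) * e" using pa(2) by (intro mult_left_mono divp) auto
  finally show ?thesis .
 qed
 have cardN: "real (card (bad n N))/real n \<le> real (r+2) * e"
 proof -
  have "real (card (bad n N))/real n \<le> real (r+2)*((2 * real N+1)/real n)"
   using card_bad_le[of n N] n0 by (simp add: divide_right_mono)
  also have "... \<le> real (r+2) * e" using e9 by (intro mult_left_mono) auto
  finally show ?thesis .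
 qed
 have osc: "osc q N \<le> osc_rate * e"
 proof -
  have "osc q N = 2*C * b*((2 * real q+1) * real N/real n)+2 * gmax*\<rho> ^ q" by (simp add: osc_def)
  also have "... \<le> 2*C * b * e+2 * gmax * e" using e7 e8 C_pos b_pos gp by (intro add_mono mult_left_mono) auto
  finally show ?thesis by (simp add: osc_rate_def algebra_simps)
 qed
 have rhoL: "\<rho> ^ L \<le> e"
 proof -
  have "1*\<rho> ^ L \<le> (2 * real L+1)*\<rho> ^ L" using \<rho>_pos by (intro mult_right_mono) auto
  then show ?thesis using e6 by simp
 qed
 have eta: "0 \<le> \<eta>_good" "\<eta>_good \<le> (C * b+2 * b^2+gmax) * e"
 proof -
  show "0 \<le> \<eta>_good" unfolding \<eta>_good_def using C_pos b_pos gp \<rho>_pos by simp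
  have "\<eta>_good = C * b*((2 * real L+1) * real L/real n)+2 * b^2*((2 * real L+1)*\<rho> ^ L)+gmax*\<rho> ^ L"
   by (simp add: \<eta>_good_def distrib_left mult_ac)
  also have "... \<le> C * b * e+2 * b^2 * e+gmax * e"
   using C_pos b_pos gp e6 rhoL by (intro add_mono mult_left_mono divp pa(5)) auto
  finally show "\<eta>_good \<le> (C * b+2 * b^2+gmax) * e" by (simp add: algebra_simps)
 qed
 have sym: "symbol_error \<le> 2*(S^2 * e)+4*(S^2 * e+\<beta>*((C * b+2 * b^2+gmax)^2 * e^2+real (r+2) * e*(S+gmax)^2))"
 proof -
  have t1: "real n*((10 * real L+1) * s^2) \<le> e"
  proof -
   have "real n*((10 * real L+1) * s^2) = (10 * real L+1)*(real n * s^2)" by simp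
   also have "... = (10 * real L+1) * m/real n/(4 * pi^2)" unfolding scaled(2) by simp
   also have "... \<le> (10 * real L+1) * m/real n" using m by (intro shrink) simp
   also have "... \<le> e" using pa(1) m by (intro div mult_right_mono) auto
   finally show ?thesis .
  qed
  have t2: "(real n)^2*(s*\<delta> * real L*S)^2 \<le> S^2 * e"
  proof -
   have "(real n)^2*(s*\<delta> * real L*S)^2 = S^2*((real n * s^2) * real n*\<delta>^2*(real L)^2)"
    by (simp add: power_mult_distrib power2_eq_square[of "real n"] mult_ac)
   also have "(real n * s^2) * real n*\<delta>^2*(real L)^2 = m ^ 3*(real L)^2/(real n)^2"
    unfolding scaled(2) \<delta>_def using n0 by (simp add: power_divide power_mult_distrib power2_eq_square power3_eq_cube)
   also have "S^2*... \<le> S^2 * e" by (intro mult_left_mono e4) simp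
   finally show ?thesis .
  qed
  have t3: "v * (real n*\<eta>_good^2+real (card (bad n L))*(S+gmax)^2)
    \<le> \<beta>*((C * b+2 * b^2+gmax)^2 * e^2+real (r+2) * e*(S+gmax)^2)"
  proof -
   have "v * (real n*\<eta>_good^2+real (card (bad n L))*(S+gmax)^2)
     = (real n * v)*(\<eta>_good^2+real (card (bad n L))/real n*(S+gmax)^2)"
    using n0 by (simp add: field_simps)
   also have "... \<le> \<beta>*(((C * b+2 * b^2+gmax) * e)^2+real (r+2) * e*(S+gmax)^2)"
    unfolding scaled(1) using \<beta>_pos eta cardL by (intro mult_left_mono add_mono power_mono mult_right_mono) auto
   finally show ?thesis by (simp add: power_mult_distrib)
  qed
  have t1': "S^2*(real n*((10 * real L+1) * s^2)) \<le> S^2 * e" by (intro mult_left_mono t1) simp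
  show ?thesis unfolding symbol_error_def
   by (intro add_mono mult_left_mono t1' t2 t3) simp_all
 qed
 have root: "sqrt (S^2*(real n * v))+sqrt (gmax^2*(real n * v)) = (S+gmax) * sqrt \<beta>"
  unfolding scaled(1) using S_pos gp by (simp add: real_sqrt_mult distrib_right)
 have W0: "0 \<le> WW n m \<theta> n" using W_nonneg[of n] by (simp only: W_eq)
 have w0: "0 \<le> w" using W0 w by linarith
 have osc0: "0 \<le> osc_rate * e" using osc osc_nonneg[of q N] by linarith
 have "\<bar>\<tau> - W N*(4 * pi^2*(LBINT x:{0..1}. (f x \<theta>)^2))\<bar>
  \<le> sqrt symbol_error*((S+gmax) * sqrt \<beta>)
   + gmax*(W n * osc q N+gmax*(W n - W N))+real (card (bad n N))/real n*(2 * gmax^2*W n)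
   + W n*(2 * gmax * osc q N+real (card (bad n N))/real n*(2 * gmax^2))"
  using \<tau>_limit_error[OF N spectral_measurable, of q] unfolding root .
 also have "... \<le> var_rate w e"
  unfolding var_rate_def W_eq
 proof (intro add_mono)
  let ?c = "real (card (bad n N))/real n"
  have c0: "0 \<le> ?c" by simp
  have G0: "0 \<le> 2 * gmax^2" by simp
  show "sqrt symbol_error*((S+gmax) * sqrt \<beta>) \<le> sqrt (2*(S^2 * e)+4*(S^2 * e+\<beta>*((C * b+2 * b^2+gmax)^2 * e^2+real (r+2) * e*(S+gmax)^2)))*((S+gmax) * sqrt \<beta>)"
   using S_pos gp \<beta>_pos by (intro mult_right_mono real_sqrt_le_mono sym) simp
  have wo: "WW n m \<theta> n * osc q N \<le> w*(osc_rate * e)" by (intro mult_mono w osc w0 osc_nonneg)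
  have ge: "gmax*(WW n m \<theta> n - WW n m \<theta> N) \<le> gmax * e" using gp by (intro mult_left_mono e10) simp
  show "gmax*(WW n m \<theta> n * osc q N+gmax*(WW n m \<theta> n - WW n m \<theta> N)) \<le> gmax*(w*(osc_rate * e)+gmax * e)"
   using gp by (intro mult_left_mono add_mono wo ge) simp
  have c': "0 \<le> real (r+2) * e" using e by simp
  show "?c*(2 * gmax^2*WW n m \<theta> n) \<le> real (r+2) * e*(2 * gmax^2 * w)"
   by (intro mult_mono cardN mult_left_mono[OF w G0] c' mult_nonneg_nonneg[OF G0 W0])
  have 1: "2 * gmax * osc q N \<le> 2 * gmax*(osc_rate * e)" using gp by (intro mult_left_mono osc) simp
  have 2: "?c*(2 * gmax^2) \<le> real (r+2) * e*(2 * gmax^2)" by (intro mult_right_mono cardN G0)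
  have 3: "0 \<le> 2 * gmax * osc q N+?c*(2 * gmax^2)"
   using gp osc_nonneg[of q N] by (intro add_nonneg_nonneg mult_nonneg_nonneg c0 G0) simp_all
  show "WW n m \<theta> n*(2 * gmax * osc q N+?c*(2 * gmax^2)) \<le> w*(2 * gmax*(osc_rate * e)+real (r+2) * e*(2 * gmax^2))"
   by (intro mult_mono w add_mono[OF 1 2] w0 3)
 qed
 finally show "\<bar>\<tau> - WW n m \<theta> N*(4 * pi^2*(LBINT x:{0..1}. (f x \<theta>)^2))\<bar> \<le> var_rate w e" by (simp only: W_eq)
 let ?D = "1+b ^ 4"
 have D0: "0 \<le> ?D" by simp
 have c1: "(real n)^2*(s*(4 * b^2*\<rho> ^ L)) \<le> 4 * b^2 * e"
 proof -
  have "(real n)^2 * s = real n * sqrt m/(2 * pi)" using n0 by (simp add: s_def power2_eq_square)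
  then have "(real n)^2*(s*(4 * b^2*\<rho> ^ L)) = 4 * b^2*((real n * sqrt m*\<rho> ^ L)/(2 * pi))"
   by (simp only: mult.assoc[symmetric]) (simp add: mult_ac)
  also have "... \<le> 4 * b^2 * e"
  proof (intro mult_left_mono)
   have "(real n * sqrt m*\<rho> ^ L)/(2 * pi) \<le> (real n * sqrt m*\<rho> ^ L)/1"
    using pi_gt3 m \<rho>_pos by (intro divide_left_mono) auto
   then show "(real n * sqrt m*\<rho> ^ L)/(2 * pi) \<le> e" using e1 by simp
  qed simp
  finally show ?thesis .
 qed
 have c2: "real n*(24 * real L+1)*(10 * real L+1)^2 * s^2*?D \<le> ?D * e"
 proof -
  have "real n*(24 * real L+1)*(10 * real L+1)^2 * s^2*?D = ?D*(?p*(real n * s^2))" by (simp only: mult_ac)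
  also have "?p*(real n * s^2) = ?p * m/real n/(4 * pi^2)" unfolding scaled(2) by simp
  also have "?D*... \<le> ?D * e"
  proof (intro mult_left_mono D0)
   show "?p * m/real n/(4 * pi^2) \<le> e" by (rule order_trans[OF shrink e2]) (use m in simp)
  qed
  finally show ?thesis .
 qed
 have c3: "real n*(u^2*((4 * real L+1)^2*(?D*(sqrt v * v * (S+3*?D^2*(real L+1) ^ 4)/2))*(2+4*S)))
   \<le> u^2*(?D*((S+3*?D^2) * e*(\<beta> * sqrt \<beta>))*(2+4*S))"
 proof -
  let ?x = "(4 * real L+1)^2*(S+3*?D^2*(real L+1) ^ 4)/sqrt (real n)/2"
  have x: "?x \<le> (S+3*?D^2) * e"
  proof -
   have one: "1 \<le> (real L+1) ^ 4" by simp
   have "S+3*?D^2*(real L+1) ^ 4 \<le> (S+3*?D^2)*(real L+1) ^ 4"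
    using mult_left_mono[OF one, of S] S_pos by (simp add: distrib_right)
   then have "(4 * real L+1)^2*(S+3*?D^2*(real L+1) ^ 4)/sqrt (real n)
     \<le> (4 * real L+1)^2*((S+3*?D^2)*(real L+1) ^ 4)/sqrt (real n)"
    by (intro divide_right_mono mult_left_mono) auto
   also have "... = (S+3*?D^2)*((4 * real L+1)^2*(real L+1) ^ 4/sqrt (real n))" by simp
   also have "... \<le> (S+3*?D^2) * e" using S_pos by (intro mult_left_mono e3) auto
   finally have y: "(4 * real L+1)^2*(S+3*?D^2*(real L+1) ^ 4)/sqrt (real n) \<le> (S+3*?D^2) * e" .
   have "0 \<le> (4 * real L+1)^2*(S+3*?D^2*(real L+1) ^ 4)/sqrt (real n)" using S_pos by simp
   moreover have "z/2 \<le> z" if "0 \<le> z" for z :: real using that by simp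
   ultimately show ?thesis using y order_trans by blast
  qed
  have "real n*(u^2*((4 * real L+1)^2*(?D*(sqrt v * v * (S+3*?D^2*(real L+1) ^ 4)/2))*(2+4*S)))
    = u^2*(?D*(?x*((real n * v) * sqrt \<beta>))*(2+4*S))"
   unfolding scaled(3) by (simp only: times_divide_eq_right times_divide_eq_left divide_divide_eq_left mult_ac)
  also have "... \<le> u^2*(?D*((S+3*?D^2) * e*(\<beta> * sqrt \<beta>))*(2+4*S))"
   unfolding scaled(1) using x \<beta>_pos S_pos by (intro mult_left_mono mult_right_mono) auto
  finally show ?thesis .
 qed
 have c4: "real n*(24 * real L+1)*(10 * real L+1)^2*(S * v)^2*?D \<le> e*((S*\<beta>)^2*?D)"
 proof -
  have "real n*?p*(S * v)^2*?D = ?p/real n*((S*(real n * v))^2*?D)"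
   using n0 by (simp add: power2_eq_square[of "_*_"] power2_eq_square[of "real n"] field_simps)
  also have "... \<le> e*((S*(real n * v))^2*?D)" using pa(4) by (intro mult_right_mono div) auto
  finally show ?thesis unfolding scaled(1) by (simp only: mult.assoc)
 qed
 have c5: "2*S^2*(\<kappa>_far*(S^2*(real n * v))) \<le> 2*S^2*((2*B^2+2) * e*(S^2*\<beta>))"
 proof -
  have "\<kappa>^2 = B^2*(1/m)/(4 * pi^2)" using m by (simp add: \<kappa>_def power_divide power_mult_distrib)
  also have "... \<le> B^2*(1/m)" using m by (intro shrink) simp
  also have "... \<le> B^2 * e" by (intro mult_left_mono e5) simp
  finally have k1: "\<kappa>^2 \<le> B^2 * e" .
  have "1 * s^2 \<le> real n * s^2" using n by (intro mult_right_mono) auto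
  then have "(10 * real L+1)^2 * s^2 \<le> (10 * real L+1)^2*(real n * s^2)" by (intro mult_left_mono) auto
  also have "... = (10 * real L+1)^2 * m/real n/(4 * pi^2)" unfolding scaled(2) by simp
  also have "... \<le> (10 * real L+1)^2 * m/real n" using m by (intro shrink) simp
  also have "... \<le> e" using pa(3) m by (intro div mult_right_mono) auto
  finally have "\<kappa>_far \<le> (2*B^2+2) * e" unfolding \<kappa>_far_def using k1 by (simp add: algebra_simps)
  then show ?thesis unfolding scaled(1) using \<beta>_pos by (intro mult_left_mono mult_right_mono) auto
 qed
 have ex: "exp (2*\<bar>\<tau>\<bar> * u^2) \<le> exp (2*(S^2*\<beta>) * u^2)"
  using abs_\<tau>_le unfolding scaled(1) by (simp add: mult_right_mono)
 let ?a = "\<bar>u\<bar>*((real n)^2*(s*(4 * b^2*\<rho> ^ L))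
    + sqrt (real n*(24 * real L+1)*(10 * real L+1)^2 * s^2*?D))"
 let ?i = "real n*(u^2*((4 * real L+1)^2*(?D*(sqrt v * v * (S+3*?D^2*(real L+1) ^ 4)/2))*(2+4*S)))
   + 2*\<bar>u\<bar>*(sqrt (real n*(24 * real L+1)*(10 * real L+1)^2*(S * v)^2*?D)
    + sqrt (2*S^2*(\<kappa>_far*(S^2*(real n * v)))))"
 let ?i' = "u^2*(?D*((S+3*?D^2) * e*(\<beta> * sqrt \<beta>))*(2+4*S))
    + 2*\<bar>u\<bar>*(sqrt (e*((S*\<beta>)^2*?D))+sqrt (2*S^2*((2*B^2+2) * e*(S^2*\<beta>))))"
 have ii: "?i \<le> ?i'" by (intro add_mono mult_left_mono real_sqrt_le_mono c3 c4 c5) auto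
 have i0: "0 \<le> ?i'" using e S_pos \<beta>_pos by (intro add_nonneg_nonneg mult_nonneg_nonneg) auto
 have "\<bar>u\<bar>*?i * exp (2*\<bar>\<tau>\<bar> * u^2) \<le> \<bar>u\<bar>*?i' * exp (2*(S^2*\<beta>) * u^2)"
  using i0 by (intro mult_mono mult_left_mono ii ex mult_nonneg_nonneg) auto
 moreover have "?a \<le> \<bar>u\<bar>*(4 * b^2 * e+sqrt (?D * e))"
  by (intro mult_left_mono add_mono real_sqrt_le_mono c1 c2) simp
 moreover have "cmod (expectation (\<lambda>om. iexp (u * stat om)) - complex_of_real (exp (- \<tau> * u^2))) \<le> ?a+\<bar>u\<bar>*?i * exp (2*\<bar>\<tau>\<bar> * u^2)"
  using norm_triangle_le[OF add_mono[OF characteristic_function_stat[of u] characteristic_function_far[of u]]] by simp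
 ultimately show "cmod (expectation (\<lambda>om. iexp (u * stat om)) - complex_of_real (exp (- \<tau> * u^2))) \<le> cf_rate u e"
  unfolding cf_rate_def by linarith
qed

end

section \<open>Limits along a sequence of samples\<close>


lemma sin_lower_bound:
 assumes "0 < lo" "hi < pi" "lo \<le> x" "x \<le> hi"
 shows "min (sin lo) (sin hi) \<le> sin x"
proof (cases "x \<le> pi/2")
 case True
 then have "sin lo \<le> sin x" using assms by (intro sin_monotone_2pi_le) auto
 then show ?thesis by linarith
next
 case False
 then have "sin (pi - hi) \<le> sin (pi - x)" using assms by (intro sin_monotone_2pi_le) auto
 then show ?thesis by simp
qed

context spectral_setting
begin

lemma spectral_power_bounds:
 shows "(LBINT y:{0..1}. (f y \<theta>)^2) \<le> (gmax/(2 * pi))^2"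
  and "0 \<le> lo ==> (\<And>y. 0 < y ==> y \<le> 1 ==> lo \<le> f y \<theta>) ==> lo\<^sup>2 \<le> (LBINT y:{0..1}. (f y \<theta>)^2)"
proof -
 define F where "F y = (f y \<theta> * indicator {0<..1} y)^2" for y
 let ?J = "indicator {0<..1} :: real => real"
 have J: "integrable lborel ?J" "(\<integral>y. ?J y \<partial>lborel) = 1" by (simp_all add: integrable_indicator_iff)
 have F_meas: "F \<in> borel_measurable borel"
  unfolding F_def by (intro borel_measurable_power spectral_measurable)
 have le: "F y \<le> (gmax/(2 * pi))^2*?J y" for y
 proof (cases "0 < y \<and> y \<le> 1")
  case True
  then have "\<bar>2 * pi * f y \<theta>\<bar> \<le> gmax" by (intro spectral_truncation(2)) auto
  then have "\<bar>f y \<theta>\<bar> \<le> gmax/(2 * pi)" by (simp add: abs_mult field_simps)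
  then have "(f y \<theta>)^2 \<le> (gmax/(2 * pi))^2" by (intro abs_le_square_iff[THEN iffD1] order_trans[OF _ abs_ge_self])
  then show ?thesis using True by (simp add: F_def)
 next
  case False
  then show ?thesis by (simp add: F_def)
 qed
 have F_int: "integrable lborel F"
  by (rule Bochner_Integration.integrable_bound[OF integrable_mult_right[OF J(1), of "(gmax/(2 * pi))^2"]])
   (use F_meas le in \<open>auto simp: F_def\<close>)
 have "(LBINT y:{0..1}. (f y \<theta>)^2) = (\<integral>y. F y+indicator {0} y*(f 0 \<theta>)^2 \<partial>lborel)"
  unfolding set_lebesgue_integral_def
  by (intro Bochner_Integration.integral_cong refl) (auto simp: F_def indicator_def)
 also have "... = (\<integral>y. F y \<partial>lborel)+integral\<^sup>L lborel (\<lambda>y::real. indicator {0} y*(f 0 \<theta>)^2)"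
  using F_int by simp
 finally have eq: "(LBINT y:{0..1}. (f y \<theta>)^2) = (\<integral>y. F y \<partial>lborel)" by simp
 have "(\<integral>y. F y \<partial>lborel) \<le> (\<integral>y. (gmax/(2 * pi))^2*?J y \<partial>lborel)"
  using le by (intro integral_mono F_int integrable_mult_right J(1))
 then show "(LBINT y:{0..1}. (f y \<theta>)^2) \<le> (gmax/(2 * pi))^2" unfolding eq by simp
 assume lo: "0 \<le> lo" "\<And>y. 0 < y ==> y \<le> 1 ==> lo \<le> f y \<theta>"
 have "lo^2*?J y \<le> F y" for y
  using power_mono[OF lo(2) lo(1), of y 2] by (cases "0 < y \<and> y \<le> 1") (auto simp: F_def)
 then have "(\<integral>y. lo^2*?J y \<partial>lborel) \<le> (\<integral>y. F y \<partial>lborel)"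
  by (intro integral_mono F_int integrable_mult_right J(1))
 then show "lo^2 \<le> (LBINT y:{0..1}. (f y \<theta>)^2)" unfolding eq by simp
qed

end

lemma le_sum_of_ten:
 fixes p1 p2 p3 p4 p5 p6 p7 p8 p9 p10 :: real
 assumes "0 \<le> p1" "0 \<le> p2" "0 \<le> p3" "0 \<le> p4" "0 \<le> p5" "0 \<le> p6" "0 \<le> p7" "0 \<le> p8" "0 \<le> p9" "0 \<le> p10"
 defines "s \<equiv> p1+p2+p3+p4+p5+p6+p7+p8+p9+p10"
 shows "0 \<le> s" "p1 \<le> s" "p2 \<le> s" "p3 \<le> s" "p4 \<le> s" "p5 \<le> s" "p6 \<le> s" "p7 \<le> s" "p8 \<le> s" "p9 \<le> s" "p10 \<le> s"
 using assms by linarith+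

locale spectral_sequence = spectral_setting M \<epsilon> \<epsilon>' r d G c \<rho> C K B
 for M :: "'a measure" and \<epsilon> \<epsilon>' r d G c \<rho> C K B +
 fixes n :: "nat => nat" and m \<theta> :: "nat => real" and a :: real
 assumes n: "\<And>i. 1 \<le> n i" and n_lim: "filterlim n at_top sequentially"
  and m1: "\<And>i. 1 \<le> m i" and m_lim: "filterlim m at_top sequentially"
  and mn: "\<And>i. 2 * m i \<le> real (n i)" and rate: "\<And>i. m i \<le> real (n i) powr (1/3)"
  and frequency: "(a = 1/2 \<and> (\<exists>lo hi. 0 < lo \<and> hi < pi \<and> (\<forall>i. lo \<le> \<theta> i \<and> \<theta> i \<le> hi)))
   \<or> (a = 1 \<and> (\<forall>i. \<theta> i = 0 \<or> \<theta> i = pi))"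
begin

abbreviation x :: "nat => real" where "x i \<equiv> real (n i)"

lemma x_lim: "filterlim x at_top sequentially"
 by (rule filterlim_compose[OF filterlim_real_sequentially n_lim])

lemma x1: "1 \<le> x i" using n[of i] by simp

definition \<delta> :: "nat => real" where "\<delta> i = 2 * pi * m i/x i"

lemma \<delta>_pos: "0 < \<delta> i"
 unfolding \<delta>_def using m1[of i] x1[of i] by (intro divide_pos_pos mult_pos_pos) auto

lemma tendsto_dominated:
 fixes y z :: "nat => real"
 assumes "\<And>i. 0 \<le> y i" "\<And>i. y i \<le> z i" "z \<longlonglongrightarrow> 0"
 shows "y \<longlonglongrightarrow> 0"
 by (rule tendsto_sandwich[OF _ _ tendsto_const assms(3)]) (use assms in auto)

lemma at_n: "(\<phi> \<longlongrightarrow> 0) at_top ==> (\<lambda>i. \<phi> (x i)) \<longlonglongrightarrow> 0" for \<phi> :: "real => real"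
 by (rule filterlim_compose[OF _ x_lim])

lemma at_m: "(\<phi> \<longlongrightarrow> 0) at_top ==> (\<lambda>i. \<phi> (m i)) \<longlonglongrightarrow> 0" for \<phi> :: "real => real"
 by (rule filterlim_compose[OF _ m_lim])

lemma fine: "(\<lambda>i. x i*(\<delta> i)^2) \<longlonglongrightarrow> 0"
proof (rule tendsto_dominated)
 fix i
 show "0 \<le> x i*(\<delta> i)^2" by simp
 have "(m i)^2 \<le> (x i powr (1/3))^2" using m1[of i] rate[of i] by (intro power_mono) auto
 then have "4 * pi^2*(m i)^2/x i \<le> 4 * pi^2*(x i powr (1/3))^2/x i"
  by (intro divide_right_mono mult_left_mono) auto
 moreover have "x i*(\<delta> i)^2 = 4 * pi^2*(m i)^2/x i"
  using x1[of i] by (simp add: \<delta>_def power2_eq_square)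
 ultimately show "x i*(\<delta> i)^2 \<le> 4 * pi^2*(x i powr (1/3))^2/x i" by simp
next
 show "(\<lambda>i. 4 * pi^2*(x i powr (1/3))^2/x i) \<longlonglongrightarrow> 0"
  by (rule at_n) real_asymp
qed

lemma \<delta>_lim: "\<delta> \<longlonglongrightarrow> 0"
proof (rule tendsto_dominated)
 fix i
 show "0 \<le> \<delta> i" using \<delta>_pos[of i] by simp
 show "\<delta> i \<le> 2 * pi * x i powr (1/3)/x i"
  unfolding \<delta>_def using rate[of i] by (intro divide_right_mono mult_left_mono) auto
next
 show "(\<lambda>i. 2 * pi * x i powr (1/3)/x i) \<longlonglongrightarrow> 0" by (rule at_n) real_asymp
qed

definition K2 :: real where "K2 = (\<integral>v. (K v)^2 \<partial>lborel)"

lemma WW_tendsto: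
 assumes N: "\<And>i. N i \<le> n i" and large: "filterlim (\<lambda>i. real (N i)*\<delta> i) at_top sequentially"
 shows "(\<lambda>i. WW (n i) (m i) (\<theta> i) (N i)) \<longlonglongrightarrow> a*K2/(4 * pi^2)"
proof -
 let ?k = "\<lambda>i l. (Khat (\<delta> i * of_int l))^2"
 have fineN: "(\<lambda>i. (2 * of_int (int (N i))+1)*(\<delta> i)^2) \<longlonglongrightarrow> 0"
 proof (rule tendsto_dominated)
  fix i
  show "0 \<le> (2 * of_int (int (N i))+1)*(\<delta> i)^2" by simp
  have "2 * real (N i)+1 \<le> 3 * x i" using N[of i] n[of i] by linarith
  then have "(2 * real (N i)+1)*(\<delta> i)^2 \<le> (3 * x i)*(\<delta> i)^2" by (rule mult_right_mono) simp
  then show "(2 * of_int (int (N i))+1)*(\<delta> i)^2 \<le> 3*(x i*(\<delta> i)^2)" by (simp add: mult.assoc)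
 next
  show "(\<lambda>i. 3*(x i*(\<delta> i)^2)) \<longlonglongrightarrow> 0" using tendsto_mult_right_zero[OF fine] .
 qed
 have base: "(\<lambda>i. \<delta> i*(\<Sum>l\<in>{- int (N i)..int (N i)}. ?k i l)) \<longlonglongrightarrow> 2 * pi*K2"
  unfolding K2_def using large fineN by (intro riemann_sum_tendsto \<delta>_pos) simp_all
 have "(\<lambda>i. \<delta> i*(\<Sum>l\<in>{- int (N i)..int (N i)}. ?k i l*(cos (of_int l*\<theta> i))^2)) \<longlonglongrightarrow> a*(2 * pi*K2)"
  using frequency
 proof
  assume "a = 1 \<and> (\<forall>i. \<theta> i = 0 \<or> \<theta> i = pi)"
  then have a: "a = 1" and \<theta>: "\<theta> i = 0 \<or> \<theta> i = pi" for i by auto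
  have "(cos (of_int l*\<theta> i))^2 = 1" for i l
  proof -
   have "sin (of_int l*\<theta> i) = 0" using \<theta>[of i] by (auto simp: sin_zero_iff_int2)
   then show ?thesis using sin_cos_squared_add[of "of_int l*\<theta> i"] by simp
  qed
  then show ?thesis using base a by simp
 next
  assume "a = 1/2 \<and> (\<exists>lo hi. 0 < lo \<and> hi < pi \<and> (\<forall>i. lo \<le> \<theta> i \<and> \<theta> i \<le> hi))"
  then obtain lo hi where a: "a = 1/2" and lh: "0 < lo" "hi < pi" "\<And>i. lo \<le> \<theta> i" "\<And>i. \<theta> i \<le> hi" by blast
  define s0 where "s0 = min (sin lo) (sin hi)"
  have "lo \<le> hi" using lh(3,4)[of 0] by linarith
  then have s0: "0 < s0" using lh(1,2) by (auto simp: s0_def intro!: sin_gt_zero)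
  have s0_le: "s0 \<le> sin (\<theta> i)" for i unfolding s0_def by (rule sin_lower_bound[OF lh(1,2)]) (use lh in auto)
  let ?o = "\<lambda>i. \<Sum>l\<in>{- int (N i)..int (N i)}. ?k i l * cos (2 * of_int l*\<theta> i)"
  have "(\<lambda>i. \<delta> i*?o i) \<longlonglongrightarrow> 0"
  proof (rule tendsto_rabs_zero_cancel, rule tendsto_dominated)
   fix i
   have "\<bar>?o i\<bar> \<le> (1+2 * of_int (int (N i))*\<delta> i)/sin (\<theta> i)"
    using s0 s0_le[of i] by (intro oscillating_sum_le \<delta>_pos) auto
   also have "... \<le> (1+2 * of_int (int (N i))*\<delta> i)/s0"
    using s0 s0_le[of i] \<delta>_pos[of i] by (intro divide_left_mono) auto
   finally have "\<delta> i*\<bar>?o i\<bar> \<le> \<delta> i*((1+2 * of_int (int (N i))*\<delta> i)/s0)"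
    using \<delta>_pos[of i] by (intro mult_left_mono) auto
   also have "... = \<delta> i*(1/s0)+1/s0*(2 * real (N i)*(\<delta> i)^2)"
    using s0 by (simp add: field_simps power2_eq_square)
   also have "... \<le> \<delta> i*(1/s0)+1/s0*((2 * of_int (int (N i))+1)*(\<delta> i)^2)"
    using s0 by (intro add_left_mono mult_left_mono mult_right_mono) auto
   finally show "\<bar>\<delta> i*?o i\<bar> \<le> \<delta> i*(1/s0)+1/s0*((2 * of_int (int (N i))+1)*(\<delta> i)^2)"
    unfolding abs_mult using \<delta>_pos[of i] by simp
  next
   show "(\<lambda>i. \<delta> i*(1/s0)+1/s0*((2 * of_int (int (N i))+1)*(\<delta> i)^2)) \<longlonglongrightarrow> 0"
    by (intro tendsto_add_zero tendsto_mult_left_zero[OF \<delta>_lim] tendsto_mult_right_zero[OF fineN])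
  qed simp
  then have "(\<lambda>i. 1/2*(\<delta> i*(\<Sum>l\<in>{- int (N i)..int (N i)}. ?k i l))+1/2*(\<delta> i*?o i)) \<longlonglongrightarrow> 1/2*(2 * pi*K2)+1/2*0"
   by (intro tendsto_intros base)
  moreover have "1/2*(\<delta> i*(\<Sum>l\<in>{- int (N i)..int (N i)}. ?k i l))+1/2*(\<delta> i*?o i)
    = \<delta> i*(\<Sum>l\<in>{- int (N i)..int (N i)}. ?k i l*(cos (of_int l*\<theta> i))^2)" for i
  proof -
   have "?k i l*(cos (of_int l*\<theta> i))^2 = 1/2*?k i l+1/2*(?k i l * cos (2 * of_int l*\<theta> i))" for l
   proof -
    have e: "cos (2 * of_int l*\<theta> i) = 2*(cos (of_int l*\<theta> i))^2 - 1"
     using cos_double_cos[of "of_int l*\<theta> i"] by (simp add: mult.assoc)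
    show ?thesis unfolding e by (simp add: algebra_simps)
   qed
   then have "(\<Sum>l\<in>{- int (N i)..int (N i)}. ?k i l*(cos (of_int l*\<theta> i))^2)
     = 1/2*(\<Sum>l\<in>{- int (N i)..int (N i)}. ?k i l)+1/2*?o i"
    by (simp only: sum.distrib sum_distrib_left)
   then show ?thesis by (simp only: distrib_left mult.left_commute)
  qed
  ultimately show ?thesis by (simp add: a)
 qed
 then have "(\<lambda>i. \<delta> i*(\<Sum>l\<in>{- int (N i)..int (N i)}. ?k i l*(cos (of_int l*\<theta> i))^2)/(8 * pi ^ 3)) \<longlonglongrightarrow> a*(2 * pi*K2)/(8 * pi ^ 3)"
  by (rule tendsto_divide[OF _ tendsto_const]) simp
 then show ?thesis unfolding WW_def \<delta>_def by (simp add: power2_eq_square power3_eq_cube)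
qed

text \<open>The correlation length must grow faster than \<open>log n\<close> but slower than any power that occurs; the windows \<open>N\<close> and \<open>q\<close> balance \<open>N m/n \<rightarrow> \<infinity>\<close> against \<open>q N/n \<rightarrow> 0\<close>, however slowly \<open>m\<close> grows.\<close>

definition L :: "nat => nat" where "L i = nat \<lceil>x i powr (1/40)\<rceil>"
definition N :: "nat => nat" where "N i = nat \<lceil>x i/sqrt (m i)\<rceil>"
definition q :: "nat => nat" where "q i = nat \<lceil>m i powr (1/4)\<rceil>"

lemma nat_ceiling_bounds: "0 \<le> y ==> y \<le> real (nat \<lceil>y\<rceil>)" "0 \<le> y ==> real (nat \<lceil>y\<rceil>) \<le> y+1" for y :: real
 by linarith+

lemma L_bounds: "x i powr (1/40) \<le> real (L i)" "real (L i) \<le> x i powr (1/40)+1"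
 unfolding L_def by (intro nat_ceiling_bounds; simp)+

lemma q_bounds: "m i powr (1/4) \<le> real (q i)" "real (q i) \<le> m i powr (1/4)+1"
 unfolding q_def by (intro nat_ceiling_bounds; simp)+

lemma sqrt_m: "1 \<le> sqrt (m i)" "sqrt (m i) \<le> m i" "sqrt (m i) \<le> x i"
proof -
 show 1: "1 \<le> sqrt (m i)" using m1[of i] by simp
 have "sqrt (m i)*1 \<le> sqrt (m i) * sqrt (m i)" using 1 by (intro mult_left_mono) auto
 then show "sqrt (m i) \<le> m i" using m1[of i] by simp
 then show "sqrt (m i) \<le> x i" using mn[of i] m1[of i] by linarith
qed

lemma N_bounds: "x i/sqrt (m i) \<le> real (N i)" "real (N i) \<le> x i/sqrt (m i)+1" "1 \<le> N i" "N i \<le> n i"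
proof -
 have p: "0 < x i/sqrt (m i)" using sqrt_m(1)[of i] x1[of i] by (intro divide_pos_pos) linarith+
 show 1: "x i/sqrt (m i) \<le> real (N i)" "real (N i) \<le> x i/sqrt (m i)+1"
  unfolding N_def using p by (intro nat_ceiling_bounds; simp)+
 show "1 \<le> N i" using p unfolding N_def by linarith
 have "x i/sqrt (m i) \<le> x i/1" using sqrt_m(1)[of i] x1[of i] by (intro divide_left_mono) auto
 then have "\<lceil>x i/sqrt (m i)\<rceil> \<le> int (n i)" by (simp add: ceiling_le_iff)
 then show "N i \<le> n i" unfolding N_def by linarith
qed

lemma N_rate: "real (N i)/x i \<le> 2/sqrt (m i)" "(2 * real (N i)+1)/x i \<le> 5/sqrt (m i)"
proof -
 have "real (N i)/x i \<le> (x i/sqrt (m i)+1)/x i" using N_bounds(2)[of i] by (intro divide_right_mono) auto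
 also have "... = 1/sqrt (m i)+1/x i" using x1[of i] by (simp add: add_divide_distrib)
 also have inv: "1/x i \<le> 1/sqrt (m i)" using sqrt_m(1,3)[of i] by (intro divide_left_mono mult_pos_pos) linarith+
 finally show 1: "real (N i)/x i \<le> 2/sqrt (m i)" by simp
 have "(2 * real (N i)+1)/x i = 2*(real (N i)/x i)+1/x i" by (simp add: add_divide_distrib)
 then show "(2 * real (N i)+1)/x i \<le> 5/sqrt (m i)" using 1 inv by simp
qed

definition cc :: real where "cc = - ln \<rho>"

lemma cc: "0 < cc" "\<rho> ^ k \<le> exp (- (cc * y))" if "y \<le> real k" for k y
proof -
 show p: "0 < cc" using \<rho>_pos \<rho>_less by (simp add: cc_def)
 have "\<rho> ^ k = exp (- (cc * real k))"
  using \<rho>_pos by (simp add: cc_def exp_of_nat_mult mult.commute[of "ln \<rho>"])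
 also have "... \<le> exp (- (cc * y))" using p that by simp
 finally show "\<rho> ^ k \<le> exp (- (cc * y))" .
qed

lemma cc_pos: "0 < cc" by (rule cc(1)[of 0 0]) simp

lemma W_limits:
 "(\<lambda>i. WW (n i) (m i) (\<theta> i) (N i)) \<longlonglongrightarrow> a*K2/(4 * pi^2)"
 "(\<lambda>i. WW (n i) (m i) (\<theta> i) (n i)) \<longlonglongrightarrow> a*K2/(4 * pi^2)"
proof -
 have lm: "filterlim (\<lambda>i. 2 * pi * sqrt (m i)) at_top sequentially"
 proof -
  have "filterlim (\<lambda>y::real. 2 * pi * sqrt y) at_top at_top" by real_asymp
  then show ?thesis by (rule filterlim_compose[OF _ m_lim])
 qed
 have le: "2 * pi * sqrt (m i) \<le> real (N i)*\<delta> i" for i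
 proof -
  have e: "x i/sqrt (m i)*\<delta> i = 2 * pi*(m i/sqrt (m i))" using x1[of i] by (simp add: \<delta>_def)
  have "m i/sqrt (m i) = sqrt (m i)" using m1[of i] by (simp add: real_div_sqrt)
  then have "2 * pi * sqrt (m i) = x i/sqrt (m i)*\<delta> i" unfolding e by simp
  also have "... \<le> real (N i)*\<delta> i" using N_bounds(1) \<delta>_pos[of i] by (intro mult_right_mono) auto
  finally show ?thesis .
 qed
 have le': "2 * pi * sqrt (m i) \<le> real (n i)*\<delta> i" for i
 proof -
  have "real (N i)*\<delta> i \<le> real (n i)*\<delta> i" using N_bounds(4)[of i] \<delta>_pos[of i] by (intro mult_right_mono) auto
  then show ?thesis using le[of i] by linarith
 qed
 show "(\<lambda>i. WW (n i) (m i) (\<theta> i) (N i)) \<longlonglongrightarrow> a*K2/(4 * pi^2)"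
  by (intro WW_tendsto N_bounds filterlim_at_top_mono[OF lm]) (use le in simp)
 show "(\<lambda>i. WW (n i) (m i) (\<theta> i) (n i)) \<longlonglongrightarrow> a*K2/(4 * pi^2)"
  by (intro WW_tendsto filterlim_at_top_mono[OF lm]) (use le' in simp_all)
qed

definition small :: "nat => real" where
 "small i = x i * sqrt (m i)*\<rho> ^ L i
  + (24 * real (L i)+1)*(10 * real (L i)+1)^2 * m i/x i
  + (4 * real (L i)+1)^2*(real (L i)+1) ^ 4/sqrt (x i)
  + m i ^ 3*(real (L i))^2/(x i)^2+1/m i
  + (2 * real (L i)+1)*\<rho> ^ L i
  + (2 * real (q i)+1) * real (N i)/x i+\<rho> ^ q i+(2 * real (N i)+1)/x i
  + \<bar>WW (n i) (m i) (\<theta> i) (n i) - WW (n i) (m i) (\<theta> i) (N i)\<bar>"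

lemma small_tendsto: "small \<longlonglongrightarrow> 0"
proof -
 have m0: "0 \<le> m i" "0 < m i" for i using m1[of i] by auto
 have mx: "m i \<le> x i" "sqrt (m i) \<le> x i" for i using mn[of i] m0[of i] sqrt_m(3)[of i] by auto
 note exp_L = cc(2)[OF L_bounds(1)]
 have 1: "(\<lambda>i. x i * sqrt (m i)*\<rho> ^ L i) \<longlonglongrightarrow> 0"
 proof (rule tendsto_dominated)
  show "0 \<le> x i * sqrt (m i)*\<rho> ^ L i" for i using \<rho>_pos m0[of i] by simp
  show "x i * sqrt (m i)*\<rho> ^ L i \<le> x i * x i * exp (- (cc * x i powr (1/40)))" for i
   using \<rho>_pos m0[of i] mx by (intro mult_mono exp_L) auto
  show "(\<lambda>i. x i * x i * exp (- (cc * x i powr (1/40)))) \<longlonglongrightarrow> 0"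
   by (rule at_n) (use cc_pos in real_asymp)
 qed
 have 2: "(\<lambda>i. (24 * real (L i)+1)*(10 * real (L i)+1)^2 * m i/x i) \<longlonglongrightarrow> 0"
 proof (rule tendsto_dominated)
  show "0 \<le> (24 * real (L i)+1)*(10 * real (L i)+1)^2 * m i/x i" for i using m0[of i] by simp
  show "(24 * real (L i)+1)*(10 * real (L i)+1)^2 * m i/x i
    \<le> (24*(x i powr (1/40)+1)+1)*(10*(x i powr (1/40)+1)+1)^2 * x i powr (1/3)/x i" for i
   using L_bounds(2)[of i] m0[of i] by (intro divide_right_mono mult_mono power_mono rate) auto
  show "(\<lambda>i. (24*(x i powr (1/40)+1)+1)*(10*(x i powr (1/40)+1)+1)^2 * x i powr (1/3)/x i) \<longlonglongrightarrow> 0"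
   by (rule at_n) real_asymp
 qed
 have 3: "(\<lambda>i. (4 * real (L i)+1)^2*(real (L i)+1) ^ 4/sqrt (x i)) \<longlonglongrightarrow> 0"
 proof (rule tendsto_dominated)
  show "0 \<le> (4 * real (L i)+1)^2*(real (L i)+1) ^ 4/sqrt (x i)" for i by simp
  show "(4 * real (L i)+1)^2*(real (L i)+1) ^ 4/sqrt (x i)
    \<le> (4*(x i powr (1/40)+1)+1)^2*(x i powr (1/40)+1+1) ^ 4/sqrt (x i)" for i
   using L_bounds(2)[of i] by (intro divide_right_mono mult_mono power_mono) auto
  show "(\<lambda>i. (4*(x i powr (1/40)+1)+1)^2*(x i powr (1/40)+1+1) ^ 4/sqrt (x i)) \<longlonglongrightarrow> 0"
   by (rule at_n) real_asymp
 qed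
 have 4: "(\<lambda>i. m i ^ 3*(real (L i))^2/(x i)^2) \<longlonglongrightarrow> 0"
 proof (rule tendsto_dominated)
  show "0 \<le> m i ^ 3*(real (L i))^2/(x i)^2" for i using m0[of i] by simp
  show "m i ^ 3*(real (L i))^2/(x i)^2 \<le> (x i powr (1/3)) ^ 3*(x i powr (1/40)+1)^2/(x i)^2" for i
   using L_bounds(2)[of i] m0[of i] by (intro divide_right_mono mult_mono power_mono rate) auto
  show "(\<lambda>i. (x i powr (1/3)) ^ 3*(x i powr (1/40)+1)^2/(x i)^2) \<longlonglongrightarrow> 0"
   by (rule at_n) real_asymp
 qed
 have 5: "(\<lambda>i. 1/m i) \<longlonglongrightarrow> 0" by (rule at_m) real_asymp
 have 6: "(\<lambda>i. (2 * real (L i)+1)*\<rho> ^ L i) \<longlonglongrightarrow> 0"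
 proof (rule tendsto_dominated)
  show "0 \<le> (2 * real (L i)+1)*\<rho> ^ L i" for i using \<rho>_pos by simp
  show "(2 * real (L i)+1)*\<rho> ^ L i \<le> (2*(x i powr (1/40)+1)+1) * exp (- (cc * x i powr (1/40)))" for i
   using L_bounds(2)[of i] \<rho>_pos by (intro mult_mono exp_L) auto
  show "(\<lambda>i. (2*(x i powr (1/40)+1)+1) * exp (- (cc * x i powr (1/40)))) \<longlonglongrightarrow> 0"
   by (rule at_n) (use cc_pos in real_asymp)
 qed
 have 7: "(\<lambda>i. (2 * real (q i)+1) * real (N i)/x i) \<longlonglongrightarrow> 0"
 proof (rule tendsto_dominated)
  show "0 \<le> (2 * real (q i)+1) * real (N i)/x i" for i by simp
  show "(2 * real (q i)+1) * real (N i)/x i \<le> (2*(m i powr (1/4)+1)+1)*(2/sqrt (m i))" for i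
   unfolding times_divide_eq_right[of _ "real (N i)", symmetric]
   using q_bounds(2)[of i] by (intro mult_mono N_rate) auto
  show "(\<lambda>i. (2*(m i powr (1/4)+1)+1)*(2/sqrt (m i))) \<longlonglongrightarrow> 0"
   by (rule at_m) real_asymp
 qed
 have 8: "(\<lambda>i. \<rho> ^ q i) \<longlonglongrightarrow> 0"
 proof (rule tendsto_dominated)
  show "0 \<le> \<rho> ^ q i" for i using \<rho>_pos by simp
  show "\<rho> ^ q i \<le> exp (- (cc * m i powr (1/4)))" for i by (rule cc(2)[OF q_bounds(1)])
  show "(\<lambda>i. exp (- (cc * m i powr (1/4)))) \<longlonglongrightarrow> 0"
   by (rule at_m) (use cc_pos in real_asymp)
 qed
 have 9: "(\<lambda>i. (2 * real (N i)+1)/x i) \<longlonglongrightarrow> 0"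
 proof (rule tendsto_dominated)
  show "0 \<le> (2 * real (N i)+1)/x i" for i by simp
  show "(2 * real (N i)+1)/x i \<le> 5/sqrt (m i)" for i by (rule N_rate)
  show "(\<lambda>i. 5/sqrt (m i)) \<longlonglongrightarrow> 0" by (rule at_m) real_asymp
 qed
 have 10: "(\<lambda>i. \<bar>WW (n i) (m i) (\<theta> i) (n i) - WW (n i) (m i) (\<theta> i) (N i)\<bar>) \<longlonglongrightarrow> 0"
  using tendsto_rabs[OF tendsto_diff[OF W_limits(2,1)]] by simp
 show ?thesis unfolding small_def
  by (intro tendsto_add_zero 1 2 3 4 5 6 7 8 9 10)
qed

definition F2 :: "nat => real" where "F2 i = (LBINT y:{0..1}. (f y (\<theta> i))^2)"

lemma F2_bounds: "0 \<le> F2 i" "4 * pi^2*F2 i \<le> gmax^2"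
proof -
 show "0 \<le> F2 i" unfolding F2_def set_lebesgue_integral_def by (intro Bochner_Integration.integral_nonneg) simp
 have "4 * pi^2*F2 i \<le> 4 * pi^2*(gmax/(2 * pi))^2"
  unfolding F2_def by (intro mult_left_mono spectral_power_bounds(1)) simp
 then show "4 * pi^2*F2 i \<le> gmax^2" by (simp add: power_divide power_mult_distrib)
qed

lemma K2_nonneg: "0 \<le> K2" unfolding K2_def by simp

lemma a_nonneg: "0 \<le> a" using frequency by auto

definition T :: "nat => 'a => real" where
 "T i om = sqrt (m i)*(smoothed_periodogram (pls_process \<epsilon> r d G) K (n i) (m i) (\<theta> i) om
  - (\<integral>om'. smoothed_periodogram (pls_process \<epsilon> r d G) K (n i) (m i) (\<theta> i) om' \<partial>M))"

lemma sample_approximation: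
 assumes w: "\<And>i. WW (n i) (m i) (\<theta> i) (n i) \<le> w"
 shows "\<exists>\<tau>. \<bar>\<tau> - WW (n i) (m i) (\<theta> i) (N i)*(4 * pi^2*F2 i)\<bar> \<le> var_rate w (small i) \<and>
  cmod (expectation (\<lambda>om. iexp (u*T i om)) - complex_of_real (exp (- \<tau> * u^2))) \<le> cf_rate u (small i)"
proof -
 interpret S: spectral_sample M \<epsilon> \<epsilon>' r d G c \<rho> C K B "n i" "m i" "\<theta> i" "L i"
  by unfold_locales (use n m1[of i] mn in auto)
 have m0: "0 \<le> m i" using m1[of i] by simp
 have p: "0 \<le> x i * sqrt (m i)*\<rho> ^ L i"
  "0 \<le> (24 * real (L i)+1)*(10 * real (L i)+1)^2 * m i/x i"
  "0 \<le> (4 * real (L i)+1)^2*(real (L i)+1) ^ 4/sqrt (x i)"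
  "0 \<le> m i ^ 3*(real (L i))^2/(x i)^2" "0 \<le> 1/m i"
  "0 \<le> (2 * real (L i)+1)*\<rho> ^ L i"
  "0 \<le> (2 * real (q i)+1) * real (N i)/x i" "0 \<le> \<rho> ^ q i" "0 \<le> (2 * real (N i)+1)/x i"
  "0 \<le> \<bar>WW (n i) (m i) (\<theta> i) (n i) - WW (n i) (m i) (\<theta> i) (N i)\<bar>"
  using m0 \<rho>_pos by simp_all
 note sm = le_sum_of_ten[OF p, folded small_def]
 have sT: "S.stat om = T i om" for om unfolding T_def by (rule S.stat_eq)
 have e10: "WW (n i) (m i) (\<theta> i) (n i) - WW (n i) (m i) (\<theta> i) (N i) \<le> small i"
  by (rule order_trans[OF abs_ge_self sm(11)])
 note rb = S.rate_bounds[OF sm(1) m1 sm(2-10) e10 w N_bounds(3,4)]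
 show ?thesis
  by (rule exI, rule conjI[OF rb(1)[folded F2_def] rb(2)[of u, unfolded sT]])
qed

theorem characteristic_limit:
 "(\<lambda>i. expectation (\<lambda>om. iexp (u*T i om)) - complex_of_real (exp (- (2 * a*K2*F2 i * u^2)/2))) \<longlonglongrightarrow> 0"
proof -
 let ?l = "a*K2/(4 * pi^2)"
 have "Bseq (\<lambda>i. WW (n i) (m i) (\<theta> i) (n i))"
  by (rule convergent_imp_Bseq[OF convergentI[OF W_limits(2)]])
 then obtain w where "\<And>i. norm (WW (n i) (m i) (\<theta> i) (n i)) \<le> w" unfolding Bseq_def by blast
 then have w: "WW (n i) (m i) (\<theta> i) (n i) \<le> w" for i using order_trans[OF abs_ge_self] by auto
 have "\<forall>i. \<exists>\<tau>. \<bar>\<tau> - WW (n i) (m i) (\<theta> i) (N i)*(4 * pi^2*F2 i)\<bar> \<le> var_rate w (small i) \<and>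
  cmod (expectation (\<lambda>om. iexp (u*T i om)) - complex_of_real (exp (- \<tau> * u^2))) \<le> cf_rate u (small i)"
  using sample_approximation[OF w] by (rule allI)
 from choice[OF this] obtain \<tau> where
  \<tau>: "\<forall>i. \<bar>\<tau> i - WW (n i) (m i) (\<theta> i) (N i)*(4 * pi^2*F2 i)\<bar> \<le> var_rate w (small i) \<and>
  cmod (expectation (\<lambda>om. iexp (u*T i om)) - complex_of_real (exp (- \<tau> i * u^2))) \<le> cf_rate u (small i)" ..
 note rates = rates_tendsto[OF small_tendsto]
 have 1: "(\<lambda>i. \<tau> i - WW (n i) (m i) (\<theta> i) (N i)*(4 * pi^2*F2 i)) \<longlonglongrightarrow> 0"
  by (rule Lim_null_comparison[OF always_eventually rates(1)[of w]]) (use \<tau> in simp)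
 have 2: "(\<lambda>i. (WW (n i) (m i) (\<theta> i) (N i) - ?l)*(4 * pi^2*F2 i)) \<longlonglongrightarrow> 0"
 proof (rule Lim_null_comparison[OF always_eventually])
  have "(\<lambda>i. \<bar>WW (n i) (m i) (\<theta> i) (N i) - ?l\<bar>) \<longlonglongrightarrow> 0"
   using W_limits(1) by (intro tendsto_rabs_zero LIM_zero)
  then show "(\<lambda>i. \<bar>WW (n i) (m i) (\<theta> i) (N i) - ?l\<bar> * gmax^2) \<longlonglongrightarrow> 0" by (rule tendsto_mult_left_zero)
  show "\<forall>i. norm ((WW (n i) (m i) (\<theta> i) (N i) - ?l)*(4 * pi^2*F2 i)) \<le> \<bar>WW (n i) (m i) (\<theta> i) (N i) - ?l\<bar> * gmax^2"
  proof
   fix i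
   have "\<bar>4 * pi^2*F2 i\<bar> \<le> gmax^2" using F2_bounds[of i] by simp
   then show "norm ((WW (n i) (m i) (\<theta> i) (N i) - ?l)*(4 * pi^2*F2 i)) \<le> \<bar>WW (n i) (m i) (\<theta> i) (N i) - ?l\<bar> * gmax^2"
    unfolding real_norm_def abs_mult[of "_ - _"] by (rule mult_left_mono) simp
  qed
 qed
 let ?y = "\<lambda>i. (a*K2*F2 i - \<tau> i) * u^2"
 have lim: "(\<lambda>i. - ((\<tau> i - WW (n i) (m i) (\<theta> i) (N i)*(4 * pi^2*F2 i))+(WW (n i) (m i) (\<theta> i) (N i) - ?l)*(4 * pi^2*F2 i)) * u^2) \<longlonglongrightarrow> - (0+0) * u^2"
  by (intro tendsto_intros 1 2)
 have eq: "- ((\<tau> i - WW (n i) (m i) (\<theta> i) (N i)*(4 * pi^2*F2 i))+(WW (n i) (m i) (\<theta> i) (N i) - ?l)*(4 * pi^2*F2 i)) * u^2 = ?y i" for i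
  by (simp add: left_diff_distrib)
 have "?y \<longlonglongrightarrow> - (0+0) * u^2" using lim unfolding eq .
 then have "?y \<longlonglongrightarrow> 0" by simp
 then have "(\<lambda>i. exp (?y i) - 1) \<longlonglongrightarrow> exp 0 - 1" by (intro tendsto_intros)
 then have z: "(\<lambda>i. \<bar>exp (?y i) - 1\<bar>) \<longlonglongrightarrow> 0" using tendsto_rabs_zero by simp
 have 3: "(\<lambda>i. exp (- \<tau> i * u^2) - exp (- (a*K2*F2 i * u^2))) \<longlonglongrightarrow> 0"
 proof (rule Lim_null_comparison[OF always_eventually z], rule allI)
  fix i
  have "- \<tau> i * u^2 = - (a*K2*F2 i * u^2)+?y i" by (simp add: algebra_simps)
  then have e: "exp (- \<tau> i * u^2) - exp (- (a*K2*F2 i * u^2)) = exp (- (a*K2*F2 i * u^2))*(exp (?y i) - 1)"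
   by (simp only: exp_add right_diff_distrib mult_1_right)
  have "0 \<le> a*K2*F2 i * u^2" using a_nonneg K2_nonneg F2_bounds(1)[of i] by simp
  then have "exp (- (a*K2*F2 i * u^2))*\<bar>exp (?y i) - 1\<bar> \<le> 1*\<bar>exp (?y i) - 1\<bar>"
   by (intro mult_right_mono) auto
  then show "norm (exp (- \<tau> i * u^2) - exp (- (a*K2*F2 i * u^2))) \<le> \<bar>exp (?y i) - 1\<bar>"
   unfolding e by (simp add: abs_mult)
 qed
 have 4: "(\<lambda>i. expectation (\<lambda>om. iexp (u*T i om)) - complex_of_real (exp (- \<tau> i * u^2))) \<longlonglongrightarrow> 0"
  by (rule Lim_null_comparison[OF always_eventually rates(2)[of u]]) (use \<tau> in blast)
 have "(\<lambda>i. (expectation (\<lambda>om. iexp (u*T i om)) - complex_of_real (exp (- \<tau> i * u^2)))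
   + complex_of_real (exp (- \<tau> i * u^2) - exp (- (a*K2*F2 i * u^2)))) \<longlonglongrightarrow> 0+complex_of_real 0"
  by (intro tendsto_add 4 tendsto_of_real 3)
 moreover have "(2 * a*K2*F2 i * u^2)/2 = a*K2*F2 i * u^2" for i by simp
 ultimately show ?thesis by (simp only: of_real_diff of_real_0 add_0_right diff_add_cancel add_diff_eq minus_divide_left[symmetric])
qed

end

section \<open>The limit theorem\<close>


context smoothing_kernel
begin

lemma K_square_integrable: "integrable lborel (\<lambda>v. (K v)^2)"
proof -
 have "\<bar>K v\<bar> \<le> B" for v using K_nonneg[of v] K_le[of v] by simp
 then show ?thesis unfolding power2_eq_square by (intro K_mult_integrable K_measurable)
qed

lemma K_square_integral_pos: "0 < (\<integral>v. (K v)^2 \<partial>lborel)"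
proof (rule ccontr)
 assume "\<not> ?thesis"
 moreover have "0 \<le> (\<integral>v. (K v)^2 \<partial>lborel)" by simp
 ultimately have "(\<integral>v. (K v)^2 \<partial>lborel) = 0" by linarith
 then have "AE v in lborel. (K v)^2 = 0"
  using integral_nonneg_eq_0_iff_AE[OF K_square_integrable] by simp
 then have "AE v in lborel. K v = 0" by simp
 then have "(\<integral>v. K v \<partial>lborel) = 0" by (rule integral_eq_zero_AE)
 then show False using K_int_1 by simp
qed

lemma K_square_window: "(LBINT v:{- 1..1}. (K v)^2) = (\<integral>v. (K v)^2 \<partial>lborel)"
 unfolding set_lebesgue_integral_def
proof (intro Bochner_Integration.integral_cong refl)
 fix v :: real
 show "indicator {- 1..1} v *\<^sub>R (K v)\<^sup>2 = (K v)^2"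
  using K_outside[of v] by (cases "\<bar>v\<bar> \<le> 1") (auto simp: indicator_def abs_le_iff)
qed

end

context spectral_sequence
begin

lemma T_measurable: "T i \<in> borel_measurable M"
proof -
 interpret S: spectral_sample M \<epsilon> \<epsilon>' r d G c \<rho> C K B "n i" "m i" "\<theta> i" "L i"
  by unfold_locales (use n m1[of i] mn in auto)
 have "T i = S.stat" unfolding T_def S.stat_eq by (rule ext) simp
 then show ?thesis using S.stat_measurable by simp
qed

lemma weakly_merging_T:
 assumes pos: "\<And>i. 0 < F2 i"
 shows "weakly_merging (\<lambda>i. distr M borel (T i)) (\<lambda>i. normal_law 0 (2 * a*K2*F2 i))"
proof (rule weakly_merging_normal_lawI)
 have a0: "0 < a" using frequency by auto
 have K0: "0 < K2" unfolding K2_def by (rule K_square_integral_pos)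
 show "real_distribution (distr M borel (T i))" for i
  using T_measurable by (rule real_distribution_distr)
 show "0 < 2 * a*K2*F2 i" for i using a0 K0 pos by simp
 show "2 * a*K2*F2 i \<le> 2 * a*K2*(gmax^2/(4 * pi^2))" for i
  using a0 K0 F2_bounds(2)[of i] by (intro mult_left_mono) (auto simp: field_simps)
 fix u
 have "char (distr M borel (T i)) u = expectation (\<lambda>om. iexp (u*T i om))" for i
  unfolding char_def using T_measurable[of i] by (subst integral_distr) auto
 then show "(\<lambda>i. char (distr M borel (T i)) u - complex_of_real (exp (- (2 * a*K2*F2 i * u^2)/2))) \<longlonglongrightarrow> 0"
  using characteristic_limit[of u] by simp
qed

end

context spectral_setting
begin

theorem smoothed_periodogram_limit:
 fixes m \<theta> :: "nat => real" and a :: real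
 assumes m: "filterlim m at_top sequentially" and rate: "\<forall>\<^sub>F n in sequentially. m n \<le> real n powr (1/3)"
  and frequency: "(a = 1/2 \<and> (\<exists>lo hi. 0 < lo \<and> hi < pi \<and> (\<forall>n\<ge>1. lo \<le> \<theta> n \<and> \<theta> n \<le> hi)))
   \<or> (a = 1 \<and> (\<forall>n\<ge>1. \<theta> n = 0 \<or> \<theta> n = pi))"
  and pos: "\<And>n. 1 \<le> n ==> 0 < (LBINT t:{0..1}. (f t (\<theta> n))^2)"
 shows "weakly_merging
   (\<lambda>n. distr M borel (\<lambda>om. sqrt (m n)*(smoothed_periodogram (pls_process \<epsilon> r d G) K n (m n) (\<theta> n) om
    - (\<integral>om'. smoothed_periodogram (pls_process \<epsilon> r d G) K n (m n) (\<theta> n) om' \<partial>M))))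
   (\<lambda>n. normal_law 0 (2 * a*(LBINT t:{-1..1}. (K t)^2)*(LBINT t:{0..1}. (f t (\<theta> n))^2)))"
  (is "weakly_merging ?\<mu> ?\<nu>")
proof -
 have "\<forall>\<^sub>F x in at_top. 2 * x powr (1/3) \<le> (x::real)" by real_asymp
 then have half: "\<forall>\<^sub>F n in sequentially. 2 * real n powr (1/3) \<le> real n"
  by (rule eventually_compose_filterlim[OF _ filterlim_real_sequentially])
 have "\<forall>\<^sub>F n in sequentially. 1 \<le> m n" using m by (simp add: filterlim_at_top)
 with rate half have "\<forall>\<^sub>F n in sequentially. 1 \<le> m n \<and> m n \<le> real n powr (1/3) \<and> 2 * m n \<le> real n"
  by eventually_elim linarith
 then obtain n0 where n0: "\<And>n. n0 \<le> n ==> 1 \<le> m n \<and> m n \<le> real n powr (1/3) \<and> 2 * m n \<le> real n"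
  unfolding eventually_sequentially by blast
 define k where "k i = i + Suc n0" for i
 have k: "n0 \<le> k i" "1 \<le> k i" for i by (simp_all add: k_def)
 have k_lim: "filterlim k at_top sequentially" unfolding k_def[abs_def] by (rule filterlim_add_const_nat_at_top)
 interpret Q: spectral_sequence M \<epsilon> \<epsilon>' r d G c \<rho> C K B k "\<lambda>i. m (k i)" "\<lambda>i. \<theta> (k i)" a
 proof unfold_locales
  show "1 \<le> k i" for i by (rule k)
  show "filterlim k at_top sequentially" by (rule k_lim)
  show "1 \<le> m (k i)" "2 * m (k i) \<le> real (k i)" "m (k i) \<le> real (k i) powr (1/3)" for i using n0[OF k(1)] by blast+
  show "filterlim (\<lambda>i. m (k i)) at_top sequentially" by (rule filterlim_compose[OF m k_lim])
  show "(a = 1/2 \<and> (\<exists>lo hi. 0 < lo \<and> hi < pi \<and> (\<forall>i. lo \<le> \<theta> (k i) \<and> \<theta> (k i) \<le> hi)))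
   \<or> (a = 1 \<and> (\<forall>i. \<theta> (k i) = 0 \<or> \<theta> (k i) = pi))"
   using frequency
  proof
   assume "a = 1/2 \<and> (\<exists>lo hi. 0 < lo \<and> hi < pi \<and> (\<forall>n\<ge>1. lo \<le> \<theta> n \<and> \<theta> n \<le> hi))"
   then obtain lo hi where "a = 1/2" "0 < lo" "hi < pi" "\<forall>n\<ge>1. lo \<le> \<theta> n \<and> \<theta> n \<le> hi" by blast
   then show ?thesis using k(2) by (intro disjI1 conjI exI[of _ lo] exI[of _ hi] allI) simp_all
  next
   assume "a = 1 \<and> (\<forall>n\<ge>1. \<theta> n = 0 \<or> \<theta> n = pi)"
   then have a1: "a = 1" and th: "\<theta> n = 0 \<or> \<theta> n = pi" if "1 \<le> n" for n using that by simp_all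
   show ?thesis by (intro disjI2 conjI allI a1[OF order_refl] th k(2))
  qed
 qed
 have "weakly_merging (\<lambda>i. distr M borel (Q.T i)) (\<lambda>i. normal_law 0 (2 * a*Q.K2*Q.F2 i))"
  by (rule Q.weakly_merging_T) (unfold Q.F2_def, rule pos[OF k(2)])
 moreover have "distr M borel (Q.T i) = ?\<mu> (k i)" for i unfolding Q.T_def[abs_def] ..
 moreover have "normal_law 0 (2 * a*Q.K2*Q.F2 i) = ?\<nu> (k i)" for i
  by (simp only: Q.K2_def Q.F2_def K_square_window)
 ultimately have wm: "weakly_merging (\<lambda>i. ?\<mu> (k i)) (\<lambda>i. ?\<nu> (k i))" by simp
 show ?thesis unfolding weakly_merging_def
 proof (intro allI impI)
  fix g :: "real => real" assume g: "continuous_on UNIV g \<and> bounded (range g)"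
  then have "(\<lambda>i. (\<integral>x. g x \<partial>?\<mu> (i + Suc n0)) - (\<integral>x. g x \<partial>?\<nu> (i + Suc n0))) \<longlonglongrightarrow> 0"
   using wm unfolding weakly_merging_def k_def by blast
  then show "(\<lambda>n. (\<integral>x. g x \<partial>?\<mu> n) - (\<integral>x. g x \<partial>?\<nu> n)) \<longlonglongrightarrow> 0" by (rule LIMSEQ_offset)
 qed
qed

end

lemma smoothing_kernelI:
 fixes K :: "real => real"
 assumes even: "\<And>x. K (- x) = K x" and C1: "K C1_differentiable_on UNIV" and nonneg: "\<And>x. 0 \<le> K x"
  and int: "has_bochner_integral lborel K 1" and supp: "closure {x. K x \<noteq> 0} = {-1..1}"
 obtains B where "smoothing_kernel K B"
proof -
 have cont: "continuous_on UNIV K" by (rule C1_differentiable_imp_continuous_on[OF C1])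
 have out: "K x = 0" if "1 < \<bar>x\<bar>" for x
 proof (rule ccontr)
  assume "K x \<noteq> 0"
  then have "x \<in> closure {x. K x \<noteq> 0}" by (intro closure_subset[THEN subsetD]) simp
  then have "x \<in> {-1..1}" unfolding supp .
  then show False using that by (auto simp: abs_if split: if_splits)
 qed
 have "compact (K ` {-1..1})" by (intro compact_continuous_image continuous_on_subset[OF cont]) auto
 then have "bounded (K ` {-1..1})" by (rule compact_imp_bounded)
 then obtain B where B: "\<And>x. x \<in> {-1..1} ==> norm (K x) \<le> B" unfolding bounded_iff by blast
 have "K x \<le> max B 0" for x
 proof (cases "\<bar>x\<bar> \<le> 1")
  case True
  then have "x \<in> {-1..1}" by (auto simp: abs_le_iff)
  from B[OF this] show ?thesis by simp
 next
  case False
  then show ?thesis using out[of x] by simp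
 qed
 then have "smoothing_kernel K (max B 0)"
  by (intro smoothing_kernel.intro cont nonneg even out int)
 then show ?thesis by (rule that)
qed

context piecewise_stationary_model
begin

lemma grid_point_moments:
 assumes jn: "1 \<le> j" "j \<le> n" and mean: "(\<integral>om. pls_process \<epsilon> r d G n j om \<partial>M) = 0"
  and second: "Lnorm M 2 (pls_process \<epsilon> r d G n j) < \<infinity>"
 defines "t \<equiv> real j/real n"
 shows "integrable M (\<lambda>om. G (segment r d t) t (past \<epsilon> 0 om))"
  and "(\<integral>om. G (segment r d t) t (past \<epsilon> 0 om) \<partial>M) = 0"
proof -
 let ?g = "G (segment r d t) t"
 have t: "0 < t" "t \<le> 1" using jn by (simp_all add: t_def)
 obtain k where k: "k \<le> r" "d k < t" "t \<le> d (Suc k)" "segment r d t = k" by (rule segment_exists[OF t])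
 have g: "?g \<in> borel_measurable P" unfolding k(4) by (rule G_section_measurable[OF k(1)]) (use k in auto)
 have X: "pls_process \<epsilon> r d G n j = (\<lambda>om. ?g (past \<epsilon> (int j) om))"
  by (rule ext) (simp only: pls_process_eq[OF jn] t_def)
 have X_meas: "(\<lambda>om. ?g (past \<epsilon> (int j) om)) \<in> borel_measurable M"
  by (rule measurable_compose[OF _ g]) measurable
 have "(\<integral>\<^sup>+ om. ennreal (\<bar>?g (past \<epsilon> (int j) om)\<bar> powr 2) \<partial>M) < \<infinity>"
  using second unfolding Lnorm_def X by (auto simp: Let_def less_top split: if_splits)
 then have "integrable M (\<lambda>om. (?g (past \<epsilon> (int j) om))^2)"
  using X_meas by (intro integrableI_bounded) simp_all
 then have i: "integrable M (\<lambda>om. ?g (past \<epsilon> (int j) om))" by (rule square_integrable_imp_integrable[OF X_meas])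
 show "integrable M (\<lambda>om. ?g (past \<epsilon> 0 om))" using i integral_past(2)[OF g] by simp
 show "(\<integral>om. ?g (past \<epsilon> 0 om) \<partial>M) = 0" using mean integral_past(1)[OF g] unfolding X by simp
qed

lemma L1_lipschitz:
 assumes le: "Lnorm M 4 (\<lambda>om. G k t (past \<epsilon> 0 om) - G k s (past \<epsilon> 0 om)) \<le> ennreal e" and e: "0 < e"
  and k: "k \<le> r" and t: "t \<in> {d k..d (Suc k)}" and s: "s \<in> {d k..d (Suc k)}"
 shows "integrable M (\<lambda>om. G k t (past \<epsilon> 0 om) - G k s (past \<epsilon> 0 om))"
  and "expectation (\<lambda>om. \<bar>G k t (past \<epsilon> 0 om) - G k s (past \<epsilon> 0 om)\<bar>) \<le> e"
proof -
 let ?w = "\<lambda>om. G k t (past \<epsilon> 0 om) - G k s (past \<epsilon> 0 om)"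
 have w: "?w \<in> borel_measurable M"
  by (intro borel_measurable_diff measurable_compose[OF _ G_section_measurable[OF k t]] measurable_compose[OF _ G_section_measurable[OF k s]]) measurable
 have e0: "0 \<le> e" using e by simp
 note n4 = Lnorm_4_leD[OF le e0]
 have e4: "0 \<le> e ^ 4" by simp
 note p4 = power4_integrableI[OF w n4 e4]
 note sq = square_le_of_power4[OF w p4 e0]
 note ab = abs_expectation_square_le[OF w sq(1)]
 show "integrable M ?w" by (rule ab(1))
 have "(expectation (\<lambda>om. \<bar>?w om\<bar>))^2 \<le> e^2" using ab(2) sq(2) by (rule order_trans)
 then show "expectation (\<lambda>om. \<bar>?w om\<bar>) \<le> e" using e0 by (rule power2_le_imp_le)
qed

lemma dep_measure_ge:
 assumes t: "0 < t" "t \<le> 1"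
 shows "Lnorm M p (\<lambda>om. G (segment r d t) t (past \<epsilon> 0 om) - G (segment r d t) t (coupled_past \<epsilon> \<epsilon>' k om))
  \<le> dep_measure M \<epsilon> \<epsilon>' r d G k p"
proof -
 obtain l where l: "l \<le> r" "d l < t" "t \<le> d (Suc l)" "segment r d t = l" by (rule segment_exists[OF t])
 let ?S = "\<lambda>l. SUP t\<in>{d l<..d (Suc l)}. Lnorm M p (\<lambda>om. G l t (past \<epsilon> 0 om) - G l t (coupled_past \<epsilon> \<epsilon>' k om))"
 have "Lnorm M p (\<lambda>om. G l t (past \<epsilon> 0 om) - G l t (coupled_past \<epsilon> \<epsilon>' k om)) \<le> ?S l"
  using l by (intro SUP_upper) simp
 also have "?S l \<le> Max (?S ` {..r})" using l(1) by (intro Max_ge) simp_all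
 finally show ?thesis unfolding dep_measure_def l(4) .
qed

text \<open>Centring is known only at times \<open>j/n\<close>; these are dense, and the Lipschitz condition extends it to all times.\<close>

lemma short_memory_modelI:
 fixes \<rho> C :: real
 assumes mean: "\<And>n j. 1 \<le> j ==> j \<le> n ==> (\<integral>om. pls_process \<epsilon> r d G n j om \<partial>M) = 0"
  and second: "\<And>n j. 1 \<le> j ==> j \<le> n ==> Lnorm M 2 (pls_process \<epsilon> r d G n j) < \<infinity>"
  and rho: "0 \<le> \<rho>" "\<rho> < 1"
  and dep_finite: "\<And>k. dep_measure M \<epsilon> \<epsilon>' r d G k 4 < \<infinity>"
  and dep_decay: "(\<lambda>k. enn2real (dep_measure M \<epsilon> \<epsilon>' r d G k 4)) \<in> O(\<lambda>k. \<rho> ^ k)"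
  and lipschitz: "\<And>k t s. k \<le> r ==> t \<in> {d k..d (Suc k)} ==> s \<in> {d k..d (Suc k)} ==>
     Lnorm M 4 (\<lambda>om. G k t (past \<epsilon> 0 om) - G k s (past \<epsilon> 0 om)) \<le> ennreal (C*\<bar>t - s\<bar>)"
 obtains c \<rho>' C' where "short_memory_model M \<epsilon> \<epsilon>' r d G c \<rho>' C'"
proof -
 define C' where "C' = max C 1"
 have C': "0 < C'" by (simp add: C'_def)
 have lip: "Lnorm M 4 (\<lambda>om. G k t (past \<epsilon> 0 om) - G k s (past \<epsilon> 0 om)) \<le> ennreal (C'*\<bar>t - s\<bar>)"
  if "k \<le> r" "t \<in> {d k..d (Suc k)}" "s \<in> {d k..d (Suc k)}" for k t s
  by (rule order_trans[OF lipschitz[OF that] ennreal_leI]) (auto simp: C'_def intro: mult_right_mono)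
 define \<rho>' where "\<rho>' = max \<rho> (1/2)"
 have \<rho>': "0 < \<rho>'" "\<rho>' < 1" "\<rho> \<le> \<rho>'" using rho by (auto simp: \<rho>'_def)
 define D where "D k = enn2real (dep_measure M \<epsilon> \<epsilon>' r d G k 4)" for k
 have D0: "0 \<le> D k" for k by (simp add: D_def)
 have dep: "dep_measure M \<epsilon> \<epsilon>' r d G k 4 = ennreal (D k)" for k using dep_finite[of k] by (simp add: D_def)
 from dep_decay obtain c0 where c0: "0 < c0" "\<forall>\<^sub>F k in sequentially. norm (D k) \<le> c0 * norm (\<rho> ^ k)"
  unfolding D_def by (elim landau_o.bigE)
 from c0(2) obtain k0 where k0: "\<And>k. k0 \<le> k ==> norm (D k) \<le> c0 * norm (\<rho> ^ k)"
  unfolding eventually_sequentially by blast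
 define c where "c = c0+(\<Sum>j<k0. D j)/\<rho>' ^ k0"
 have rest: "0 \<le> (\<Sum>j<k0. D j)/\<rho>' ^ k0" using \<rho>' D0 by (intro divide_nonneg_nonneg sum_nonneg) auto
 then have c: "0 < c" unfolding c_def using c0(1) by linarith
 have D_le: "D k \<le> c*\<rho>' ^ k" for k
 proof (cases "k0 \<le> k")
  case True
  have "D k \<le> c0*\<rho> ^ k" using k0[OF True] D0[of k] rho by simp
  also have "... \<le> c*\<rho>' ^ k" using c0(1) rest \<rho>' rho by (intro mult_mono power_mono) (auto simp: c_def)
  finally show ?thesis .
 next
  case False
  have "D k \<le> (\<Sum>j<k0. D j)" using False D0 by (intro member_le_sum) auto
  also have "... = (\<Sum>j<k0. D j)/\<rho>' ^ k0*\<rho>' ^ k0" using \<rho>' by simp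
  also have "... \<le> (\<Sum>j<k0. D j)/\<rho>' ^ k0*\<rho>' ^ k"
   using False \<rho>' rest by (intro mult_left_mono power_decreasing) auto
  also have "... \<le> c*\<rho>' ^ k" using c0(1) \<rho>' by (intro mult_right_mono) (auto simp: c_def)
  finally show ?thesis .
 qed
 \<comment> \<open>every interior time is a limit of observation times \<open>j/n\<close> from the same segment\<close>
 have near: "\<exists>s. integrable M (\<lambda>om. G (segment r d t) s (past \<epsilon> 0 om)) \<and> expectation (\<lambda>om. G (segment r d t) s (past \<epsilon> 0 om)) = 0
   \<and> d (segment r d t) < s \<and> s < t \<and> t - s < e \<and> segment r d t \<le> r \<and> t \<le> d (Suc (segment r d t))"
  if t: "0 < t" "t \<le> 1" and e: "0 < e" for t e
 proof -
  obtain k where k: "k \<le> r" "d k < t" "t \<le> d (Suc k)" "segment r d t = k" by (rule segment_exists[OF t])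
  have "max (d k) (t - e) < t" using k e by simp
  then obtain s where s: "s \<in> \<rat>" "max (d k) (t - e) < s" "s < t" using Rats_dense_in_real by blast
  have dk: "0 \<le> d k" using d_mono[of 0 k] k(1) d_0 by simp
  then have s0: "0 < s" using s(2) by simp
  obtain j n where jn: "n \<noteq> 0" "\<bar>s\<bar> = real j/real n" using Rats_abs_nat_div_natE[OF s(1)] by metis
  then have sj: "s = real j/real n" using s0 by simp
  then have j1: "1 \<le> j" using s0 jn(1) by (cases j) auto
  have "real j/real n < 1" using sj s(3) t(2) by linarith
  then have "real j < real n" using jn(1) by (simp add: divide_less_eq_1_pos)
  then have jle: "j \<le> n" by simp
  have seg: "segment r d s = k" using s k by (intro segment_eq) auto
  note gp = grid_point_moments[OF j1 jle mean[OF j1 jle] second[OF j1 jle], folded sj]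
  show ?thesis unfolding k(4)
   using gp[unfolded seg] s k by (intro exI[of _ s]) auto
 qed
 have H: "integrable M (\<lambda>om. G (segment r d t) t (past \<epsilon> 0 om))"
   "\<bar>expectation (\<lambda>om. G (segment r d t) t (past \<epsilon> 0 om))\<bar> \<le> C' * e"
  if t: "0 < t" "t \<le> 1" and e: "0 < e" for t e
 proof -
  let ?k = "segment r d t"
  obtain s where s: "integrable M (\<lambda>om. G ?k s (past \<epsilon> 0 om))" "expectation (\<lambda>om. G ?k s (past \<epsilon> 0 om)) = 0"
   "d ?k < s" "s < t" "t - s < e" "?k \<le> r" "t \<le> d (Suc ?k)" using near[OF t e] by blast
  have ts: "t \<in> {d ?k..d (Suc ?k)}" "s \<in> {d ?k..d (Suc ?k)}" using s(3,4,7) by auto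
  have pos: "0 < C'*\<bar>t - s\<bar>" using C' s(4) by simp
  note li = L1_lipschitz[OF lip[OF s(6) ts] pos s(6) ts]
  have "integrable M (\<lambda>om. (G ?k t (past \<epsilon> 0 om) - G ?k s (past \<epsilon> 0 om)) + G ?k s (past \<epsilon> 0 om))"
   by (rule Bochner_Integration.integrable_add[OF li(1) s(1)])
  then show i: "integrable M (\<lambda>om. G ?k t (past \<epsilon> 0 om))" by simp
  have "expectation (\<lambda>om. G ?k t (past \<epsilon> 0 om)) = expectation (\<lambda>om. G ?k t (past \<epsilon> 0 om) - G ?k s (past \<epsilon> 0 om))"
   using i s(1,2) by simp
  then have "\<bar>expectation (\<lambda>om. G ?k t (past \<epsilon> 0 om))\<bar> \<le> expectation (\<lambda>om. \<bar>G ?k t (past \<epsilon> 0 om) - G ?k s (past \<epsilon> 0 om)\<bar>)"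
   by (simp only: integral_abs_bound)
  also have "... \<le> C'*\<bar>t - s\<bar>" by (rule li(2))
  also have "... \<le> C' * e" using C' s(4,5) by (intro mult_left_mono) auto
  finally show "\<bar>expectation (\<lambda>om. G ?k t (past \<epsilon> 0 om))\<bar> \<le> C' * e" .
 qed
 have "short_memory_model M \<epsilon> \<epsilon>' r d G c \<rho>' C'"
 proof unfold_locales
  fix t :: real assume t: "0 < t" "t \<le> 1"
  show "integrable M (\<lambda>om. G (segment r d t) t (past \<epsilon> 0 om))" by (rule H(1)[OF t zero_less_one])
  show "expectation (\<lambda>om. G (segment r d t) t (past \<epsilon> 0 om)) = 0" (is "?E = 0")
  proof (rule ccontr)
   assume "?E \<noteq> 0"
   then have "0 < \<bar>?E\<bar>/(2*C')" using C' by simp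
   from H(2)[OF t this] have "\<bar>?E\<bar> \<le> \<bar>?E\<bar>/2" using C' by simp
   then show False using \<open>?E \<noteq> 0\<close> by simp
  qed
  fix k
  show "Lnorm M 4 (\<lambda>om. G (segment r d t) t (past \<epsilon> 0 om) - G (segment r d t) t (coupled_past \<epsilon> \<epsilon>' k om)) \<le> ennreal (c*\<rho>' ^ k)"
   by (rule order_trans[OF dep_measure_ge[OF t]]) (simp only: dep ennreal_leI[OF D_le])
 qed (use c \<rho>' C' lip in \<open>blast+\<close>)
 then show ?thesis by (rule that)
qed

end

lemma bandwidth_rate:
 fixes m :: "nat => real" and p :: nat
 assumes "(\<lambda>n. m n/(real n powr (real p/(4*(real p+2)))*(ln (real n))^2)) \<longlonglongrightarrow> 0"
 shows "\<forall>\<^sub>F n in sequentially. m n \<le> real n powr (1/3)"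
proof -
 have "\<forall>\<^sub>F x in at_top. x powr (1/4)*(ln x)^2 \<le> (x::real) powr (1/3)" by real_asymp
 then have 1: "\<forall>\<^sub>F n in sequentially. real n powr (1/4)*(ln (real n))^2 \<le> real n powr (1/3)"
  by (rule eventually_compose_filterlim[OF _ filterlim_real_sequentially])
 have 2: "\<forall>\<^sub>F n in sequentially. m n/(real n powr (real p/(4*(real p+2)))*(ln (real n))^2) < 1"
  by (rule order_tendstoD(2)[OF assms]) simp
 have exponent: "real p/(4*(real p+2)) \<le> 1/4" by (simp add: field_simps)
 show ?thesis using 1 2 eventually_ge_at_top[of 2]
 proof eventually_elim
  case (elim n)
  let ?\<alpha> = "real p/(4*(real p+2))"
  have "0 < real n powr ?\<alpha>*(ln (real n))^2" using elim(3) by simp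
  then have "m n \<le> real n powr ?\<alpha>*(ln (real n))^2" using elim(2) by (simp add: pos_divide_less_eq)
  also have "... \<le> real n powr (1/4)*(ln (real n))^2"
   using elim(3) by (intro mult_right_mono powr_mono exponent) auto
  finally show ?case using elim(1) by linarith
 qed
qed

theorem proposition4:
  fixes M :: "'a measure"
    and \<epsilon> \<epsilon>' :: "int \<Rightarrow> 'a \<Rightarrow> real"
    and r :: nat
    and d :: "nat \<Rightarrow> real"
    and G :: "nat \<Rightarrow> real \<Rightarrow> (nat \<Rightarrow> real) \<Rightarrow> real"
    and K :: "real \<Rightarrow> real"
    and \<theta> m :: "nat \<Rightarrow> real"
    and p :: nat
    and \<rho> C :: real
  defines "X \<equiv> pls_process \<epsilon> r d G"
    and "f \<equiv> local_spectral_density M \<epsilon> r d G"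
    and "F \<equiv> (\<lambda>n. smoothed_periodogram (pls_process \<epsilon> r d G) K n (m n) (\<theta> n))"
  assumes model: "piecewise_stationary_model M \<epsilon> \<epsilon>' r d G"
    and mean_zero: "\<And>n j. 1 \<le> j \<Longrightarrow> j \<le> n \<Longrightarrow> (\<integral>\<omega>. X n j \<omega> \<partial>M) = 0"
    and second_moment: "\<And>n j. 1 \<le> j \<Longrightarrow> j \<le> n \<Longrightarrow> Lnorm M 2 (X n j) < \<infinity>"
    and K_even: "\<And>x. K (- x) = K x"
    and K_C1: "K C1_differentiable_on UNIV"
    and K_nonneg: "\<And>x. 0 \<le> K x"
    and K_integral: "has_bochner_integral lborel K 1"
    and K_support: "closure {x. K x \<noteq> 0} = {-1..1}"
    and p_ge_1: "1 \<le> p"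
    and acov_smooth: "\<And>h k. k \<le> r \<Longrightarrow>
          Ck_on p {d k<..d (Suc k)} (\<lambda>t. local_acov M \<epsilon> r d G t h)"
    and rho: "0 \<le> \<rho>" "\<rho> < 1"
    and dep_finite: "\<And>k. dep_measure M \<epsilon> \<epsilon>' r d G k 4 < \<infinity>"
    and dep_decay: "(\<lambda>k. enn2real (dep_measure M \<epsilon> \<epsilon>' r d G k 4)) \<in> O(\<lambda>k. \<rho> ^ k)"
    and lipschitz: "\<And>k t s. k \<le> r \<Longrightarrow> t \<in> {d k..d (Suc k)} \<Longrightarrow> s \<in> {d k..d (Suc k)} \<Longrightarrow>
          Lnorm M 4 (\<lambda>\<omega>. G k t (past \<epsilon> 0 \<omega>) - G k s (past \<epsilon> 0 \<omega>)) \<le> ennreal (C * \<bar>t - s\<bar>)"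
    and f_pos: "\<And>n. 1 \<le> n \<Longrightarrow> 0 < (INF t\<in>{0..1}. f t (\<theta> n))"
    and m_infinity: "filterlim m at_top sequentially"
    and m_rate: "(\<lambda>n. m n / (real n powr (real p / (4 * (real p + 2))) * (ln (real n))\<^sup>2))
          \<longlonglongrightarrow> 0"
  shows "((\<exists>lo hi. 0 < lo \<and> hi < pi \<and> (\<forall>n\<ge>1. lo \<le> \<theta> n \<and> \<theta> n \<le> hi)) \<longrightarrow>
            weakly_merging
              (\<lambda>n. distr M borel (\<lambda>\<omega>. sqrt (m n) * (F n \<omega> - (\<integral>\<omega>'. F n \<omega>' \<partial>M))))
              (\<lambda>n. normal_law 0
                 ((LBINT t:{-1..1}. (K t)\<^sup>2) * (LBINT t:{0..1}. (f t (\<theta> n))\<^sup>2))))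
       \<and> ((\<forall>n\<ge>1. \<theta> n = 0 \<or> \<theta> n = pi) \<longrightarrow>
            weakly_merging
              (\<lambda>n. distr M borel (\<lambda>\<omega>. sqrt (m n) * (F n \<omega> - (\<integral>\<omega>'. F n \<omega>' \<partial>M))))
              (\<lambda>n. normal_law 0
                 (2 * (LBINT t:{-1..1}. (K t)\<^sup>2) * (LBINT t:{0..1}. (f t (\<theta> n))\<^sup>2))))"
proof -
  interpret piecewise_stationary_model M \<epsilon> \<epsilon>' r d G by (rule model)
  obtain c \<rho>' C' where smm: "short_memory_model M \<epsilon> \<epsilon>' r d G c \<rho>' C'"
    by (rule short_memory_modelI[OF mean_zero[unfolded X_def] second_moment[unfolded X_def] rho dep_finite dep_decay lipschitz])
  obtain B where sk: "smoothing_kernel K B"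
    by (rule smoothing_kernelI[OF K_even K_C1 K_nonneg K_integral K_support])
  interpret S: spectral_setting M \<epsilon> \<epsilon>' r d G c \<rho>' C' K B
    using smm sk by (rule spectral_setting.intro)
  have pos: "0 < (LBINT t:{0..1}. (local_spectral_density M \<epsilon> r d G t (\<theta> n))\<^sup>2)" if n: "1 \<le> n" for n
  proof -
    let ?f = "\<lambda>t. local_spectral_density M \<epsilon> r d G t (\<theta> n)"
    define lo where "lo = (INF t\<in>{0..1}. ?f t)"
    have lo: "0 < lo" using f_pos[OF n] by (simp only: lo_def f_def)
    have bdd: "bdd_below (?f ` {0..1})"
    proof (rule bdd_belowI2)
      fix t :: real assume t: "t \<in> {0..1}"
      show "min (?f 0) (- (S.gmax / (2 * pi))) \<le> ?f t"
      proof (cases "t = 0")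
        case False
        then have "\<bar>2 * pi * ?f t\<bar> \<le> S.gmax" using t by (intro S.spectral_truncation(2)) auto
        then have "- S.gmax \<le> 2 * pi * ?f t" by simp
        then have "- (S.gmax / (2 * pi)) \<le> ?f t" by (simp add: field_simps)
        then show ?thesis by simp
      qed simp
    qed
    have "lo \<le> ?f y" if "0 < y" "y \<le> 1" for y
      unfolding lo_def using bdd that by (intro cINF_lower) auto
    then have "lo\<^sup>2 \<le> (LBINT t:{0..1}. (?f t)\<^sup>2)" using lo by (intro S.spectral_power_bounds(2)) auto
    then show ?thesis using zero_less_power[OF lo, of 2] by linarith
  qed
  note limit = S.smoothed_periodogram_limit[OF m_infinity bandwidth_rate[OF m_rate] _ pos]
  have half: "2 * (1 / 2) * x = x" and one: "2 * 1 * x = 2 * x" for x :: real by simp_all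
  show ?thesis
  proof (intro conjI impI)
    assume "\<exists>lo hi. 0 < lo \<and> hi < pi \<and> (\<forall>n\<ge>1. lo \<le> \<theta> n \<and> \<theta> n \<le> hi)"
    then have "((1 / 2 :: real) = 1 / 2 \<and> (\<exists>lo hi. 0 < lo \<and> hi < pi \<and> (\<forall>n\<ge>1. lo \<le> \<theta> n \<and> \<theta> n \<le> hi)))
      \<or> ((1 / 2 :: real) = 1 \<and> (\<forall>n\<ge>1. \<theta> n = 0 \<or> \<theta> n = pi))" by (intro disjI1 conjI refl)
    from limit[OF this] show "weakly_merging
        (\<lambda>n. distr M borel (\<lambda>\<omega>. sqrt (m n) * (F n \<omega> - (\<integral>\<omega>'. F n \<omega>' \<partial>M))))
        (\<lambda>n. normal_law 0 ((LBINT t:{-1..1}. (K t)\<^sup>2) * (LBINT t:{0..1}. (f t (\<theta> n))\<^sup>2)))"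
      unfolding F_def f_def half .
  next
    assume "\<forall>n\<ge>1. \<theta> n = 0 \<or> \<theta> n = pi"
    then have "((1 :: real) = 1 / 2 \<and> (\<exists>lo hi. 0 < lo \<and> hi < pi \<and> (\<forall>n\<ge>1. lo \<le> \<theta> n \<and> \<theta> n \<le> hi)))
      \<or> ((1 :: real) = 1 \<and> (\<forall>n\<ge>1. \<theta> n = 0 \<or> \<theta> n = pi))" by (intro disjI2 conjI refl)
    from limit[OF this] show "weakly_merging
        (\<lambda>n. distr M borel (\<lambda>\<omega>. sqrt (m n) * (F n \<omega> - (\<integral>\<omega>'. F n \<omega>' \<partial>M))))
        (\<lambda>n. normal_law 0 (2 * (LBINT t:{-1..1}. (K t)\<^sup>2) * (LBINT t:{0..1}. (f t (\<theta> n))\<^sup>2)))"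
      unfolding F_def f_def one .
  qed
qed

end
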